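(* The decision problem Bounded-Static$(\mathcal{X}_d,\mathcal{U}_c(x))$ is in $\mathsf{NP}$.
   Context: An instance consists of rational data encoded in binary: a bound $R\in\mathbb{Z}_+$, vectors $a\in\mathbb{Q}^{m_x}$, $b\in\mathbb{Q}^{m_u}$, a matrix $A\in\mathbb{Q}^{m_x\times n_x}$, an $m_u\times n_u$ matrix $B(x)$ whose entries depend linearly on $x$ with rational coefficients, and matrices $H_\ell\in\mathbb{Q}^{n_u\times n_x}$ for $\ell\in[L]=\{1,\dots,L\}$. Let $\mathcal{X}_d=\{x\in[0,R]^{n_x}\cap\mathbb{Z}^{n_x}: Ax\le a\}$ and $\mathcal{U}_c(x)=\{u\in[0,R]^{n_u}: B(x)u\le b\}$. Bounded-Static$(\mathcal{X}_d,\mathcal{U}_c(x))$ is the decision problem $$\exists x\in\mathcal{X}_d\ \ \forall u\in\mathcal{U}_c(x):\ u^\top H_\ell x\le 0\ \text{ for all }\ell\in[L]\,?$$ *)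

theory Defs
  imports "Jordan_Normal_Form.Matrix" "HOL-Computational_Algebra.Polynomial"
begin

section \<open>Deterministic multitape Turing machines\<close>

datatype head_move = Move_Left | Move_Stay | Move_Right

text \<open>States and tape symbols are natural numbers below \<open>tm_states\<close> and \<open>tm_symbols\<close>; symbol 0 is the
  blank. The transition function maps the current state and the symbols under the heads to
  the new state and, for every tape, the symbol to write and the head movement. It is only
  relevant on the finite domain described by \<open>wf_tm\<close>.\<close>

record tm =
  tm_tapes :: nat
  tm_states :: nat
  tm_symbols :: nat
  tm_start :: nat
  tm_accept :: nat
  tm_reject :: nat
  tm_delta :: "nat \<Rightarrow> nat list \<Rightarrow> nat \<times> (nat \<times> head_move) list"

text \<open>Symbols 1, 2, 3 are the input symbols: the bits False and True, and a separator.\<close>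

definition wf_tm :: "tm \<Rightarrow> bool" where
  "wf_tm M \<longleftrightarrow>
     1 \<le> tm_tapes M \<and> 4 \<le> tm_symbols M \<and>
     tm_start M < tm_states M \<and> tm_accept M < tm_states M \<and> tm_reject M < tm_states M \<and>
     tm_accept M \<noteq> tm_reject M \<and>
     (\<forall>q rs. q < tm_states M \<and> length rs = tm_tapes M \<and> (\<forall>r\<in>set rs. r < tm_symbols M) \<longrightarrow>
        (case tm_delta M q rs of (q', acts) \<Rightarrow>
           q' < tm_states M \<and> length acts = tm_tapes M \<and> (\<forall>(s, d)\<in>set acts. s < tm_symbols M)))"

text \<open>A tape is infinite in both directions and comes with the position of its head.\<close>

type_synonym tape = "(int \<Rightarrow> nat) \<times> int"
type_synonym config = "nat \<times> tape list"

fun move_offset :: "head_move \<Rightarrow> int" where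
  "move_offset Move_Left = -1"
| "move_offset Move_Stay = 0"
| "move_offset Move_Right = 1"

definition tape_read :: "tape \<Rightarrow> nat" where
  "tape_read = (\<lambda>(t, h). t h)"

definition tape_act :: "nat \<times> head_move \<Rightarrow> tape \<Rightarrow> tape" where
  "tape_act = (\<lambda>(s, d) (t, h). (t(h := s), h + move_offset d))"

definition tm_step :: "tm \<Rightarrow> config \<Rightarrow> config" where
  "tm_step M = (\<lambda>(q, ts).
     if q = tm_accept M \<or> q = tm_reject M then (q, ts)
     else (case tm_delta M q (map tape_read ts) of (q', acts) \<Rightarrow> (q', map2 tape_act acts ts)))"

definition input_tape :: "nat list \<Rightarrow> tape" where
  "input_tape w = ((\<lambda>i. if 0 \<le> i \<and> i < int (length w) then w ! nat i else 0), 0)"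

definition tm_init :: "tm \<Rightarrow> nat list \<Rightarrow> config" where
  "tm_init M w = (tm_start M, map (\<lambda>k. if k = 0 then input_tape w else input_tape []) [0..<tm_tapes M])"

definition tm_state_after :: "tm \<Rightarrow> nat list \<Rightarrow> nat \<Rightarrow> nat" where
  "tm_state_after M w t = fst ((tm_step M ^^ t) (tm_init M w))"


section \<open>The class NP\<close>

definition bit_symbol :: "bool \<Rightarrow> nat" where
  "bit_symbol b = (if b then 2 else 1)"

definition pair_word :: "bool list \<Rightarrow> bool list \<Rightarrow> nat list" where
  "pair_word w c = map bit_symbol w @ [3] @ map bit_symbol c"

text \<open>As \<open>tm_step\<close> leaves halted configurations unchanged, being in the accepting or rejecting state
  after \<open>t\<close> steps means having halted with that answer within \<open>t\<close> steps.\<close>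

definition polytime_relation :: "(bool list \<Rightarrow> bool list \<Rightarrow> bool) \<Rightarrow> bool" where
  "polytime_relation V \<longleftrightarrow>
     (\<exists>M (p :: nat poly). wf_tm M \<and>
        (\<forall>w c. tm_state_after M (pair_word w c) (poly p (length w + length c)) =
                 (if V w c then tm_accept M else tm_reject M)))"

definition NP :: "bool list set set" where
  "NP = {\<L>. \<exists>V (p :: nat poly). polytime_relation V \<and>
           (\<forall>w. w \<in> \<L> \<longleftrightarrow> (\<exists>c. length c \<le> poly p (length w) \<and> V w c))}"


section \<open>The decision problem\<close>

text \<open>The matrix \<open>B(x)\<close> is given by its coefficient matrices \<open>B\<^sub>0, \<dots>, B\<^sub>n\<^sub>-\<^sub>1\<close> (with \<open>n = bs_nx\<close>), that is,
  \<open>B(x) = x\<^sub>0 B\<^sub>0 + \<dots> + x\<^sub>n\<^sub>-\<^sub>1 B\<^sub>n\<^sub>-\<^sub>1\<close>.\<close>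

record bs_instance =
  bs_R :: nat
  bs_nx :: nat
  bs_nu :: nat
  bs_mx :: nat
  bs_mu :: nat
  bs_L :: nat
  bs_a :: "rat vec"
  bs_b :: "rat vec"
  bs_A :: "rat mat"
  bs_B :: "rat mat list"
  bs_H :: "rat mat list"

definition wf_instance :: "bs_instance \<Rightarrow> bool" where
  "wf_instance I \<longleftrightarrow>
     bs_a I \<in> carrier_vec (bs_mx I) \<and>
     bs_b I \<in> carrier_vec (bs_mu I) \<and>
     bs_A I \<in> carrier_mat (bs_mx I) (bs_nx I) \<and>
     length (bs_B I) = bs_nx I \<and> set (bs_B I) \<subseteq> carrier_mat (bs_mu I) (bs_nu I) \<and>
     length (bs_H I) = bs_L I \<and> set (bs_H I) \<subseteq> carrier_mat (bs_nu I) (bs_nx I)"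

abbreviation real_vec :: "rat vec \<Rightarrow> real vec" where
  "real_vec \<equiv> map_vec real_of_rat"

abbreviation real_mat :: "rat mat \<Rightarrow> real mat" where
  "real_mat \<equiv> map_mat real_of_rat"

definition B_at :: "bs_instance \<Rightarrow> real vec \<Rightarrow> real mat" where
  "B_at I x = mat (bs_mu I) (bs_nu I) (\<lambda>(i, j). \<Sum>k<bs_nx I. real_of_rat (bs_B I ! k $$ (i, j)) * x $ k)"

text \<open>The order on vectors is the componentwise one.\<close>

definition X_d :: "bs_instance \<Rightarrow> real vec set" where
  "X_d I = {x \<in> carrier_vec (bs_nx I).
     (\<forall>k<bs_nx I. x $ k \<in> {0..real (bs_R I)} \<inter> \<int>) \<and> real_mat (bs_A I) *\<^sub>v x \<le> real_vec (bs_a I)}"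

definition U_c :: "bs_instance \<Rightarrow> real vec \<Rightarrow> real vec set" where
  "U_c I x = {u \<in> carrier_vec (bs_nu I).
     (\<forall>j<bs_nu I. u $ j \<in> {0..real (bs_R I)}) \<and> B_at I x *\<^sub>v u \<le> real_vec (bs_b I)}"

definition bounded_static :: "bs_instance \<Rightarrow> bool" where
  "bounded_static I \<longleftrightarrow>
     (\<exists>x\<in>X_d I. \<forall>u\<in>U_c I x. \<forall>l<bs_L I. u \<bullet> (real_mat (bs_H I ! l) *\<^sub>v x) \<le> 0)"


section \<open>Binary encoding of instances\<close>

text \<open>The digits of a natural number, least significant first and without leading zeros.\<close>

fun binary_digits :: "nat \<Rightarrow> bool list" where
  "binary_digits n = (if n = 0 then [] else odd n # binary_digits (n div 2))"

declare binary_digits.simps [simp del]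

text \<open>To make codes self-delimiting, every digit is preceded by True and the code ends with False.\<close>

definition enc_nat :: "nat \<Rightarrow> bool list" where
  "enc_nat n = concat (map (\<lambda>d. [True, d]) (binary_digits n)) @ [False]"

definition enc_int :: "int \<Rightarrow> bool list" where
  "enc_int k = (k < 0) # enc_nat (nat \<bar>k\<bar>)"

text \<open>Rationals are encoded in lowest terms, with positive denominator.\<close>

definition enc_rat :: "rat \<Rightarrow> bool list" where
  "enc_rat r = (case quotient_of r of (p, q) \<Rightarrow> enc_int p @ enc_nat (nat q))"

definition enc_vec :: "rat vec \<Rightarrow> bool list" where
  "enc_vec v = concat (map enc_rat (list_of_vec v))"

definition enc_mat :: "rat mat \<Rightarrow> bool list" where
  "enc_mat A = concat (map enc_vec (rows A))"

text \<open>Dimensions are written in unary, so that the size of an instance is at least the sum of its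
  dimensions, even if some of its matrices are empty.\<close>

definition enc_dim :: "nat \<Rightarrow> bool list" where
  "enc_dim n = replicate n True @ [False]"

definition enc_instance :: "bs_instance \<Rightarrow> bool list" where
  "enc_instance I =
     enc_dim (bs_nx I) @ enc_dim (bs_nu I) @ enc_dim (bs_mx I) @ enc_dim (bs_mu I) @ enc_dim (bs_L I) @
     enc_nat (bs_R I) @ enc_vec (bs_a I) @ enc_vec (bs_b I) @ enc_mat (bs_A I) @
     concat (map enc_mat (bs_B I)) @ concat (map enc_mat (bs_H I))"

definition Bounded_Static :: "bool list set" where
  "Bounded_Static = {enc_instance I | I. wf_instance I \<and> bounded_static I}"


section \<open>The encoding is injective\<close>

lemma binary_digits_inj: "binary_digits m = binary_digits n \<Longrightarrow> m = n"
proof (induction m arbitrary: n rule: less_induct)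
  case (less m)
  show ?case
  proof (cases "m = 0 \<or> n = 0")
    case True
    with less.prems show ?thesis
      by (auto simp: binary_digits.simps[of m] binary_digits.simps[of n] split: if_splits)
  next
    case False
    then have eq: "odd m = odd n" "binary_digits (m div 2) = binary_digits (n div 2)"
      using less.prems by (simp_all add: binary_digits.simps[of m] binary_digits.simps[of n])
    from False have "m div 2 < m" by simp
    from less.IH[OF this eq(2)] have "m div 2 = n div 2" .
    moreover from eq(1) have "m mod 2 = n mod 2" by presburger
    ultimately show ?thesis by (metis div_mult_mod_eq)
  qed
qed

lemma enc_digits_prefix_free:
  "concat (map (\<lambda>d. [True, d]) ds) @ False # xs = concat (map (\<lambda>d. [True, d]) es) @ False # ys \<Longrightarrow>
     ds = es \<and> xs = ys"
proof (induction ds arbitrary: es)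
  case Nil
  then show ?case by (cases es) auto
next
  case (Cons d ds)
  then show ?case by (cases es) auto
qed

lemma enc_nat_prefix_free: "enc_nat m @ xs = enc_nat n @ ys \<Longrightarrow> m = n \<and> xs = ys"
  using enc_digits_prefix_free[of "binary_digits m" xs "binary_digits n" ys] binary_digits_inj
  by (auto simp: enc_nat_def)

lemma enc_int_prefix_free: "enc_int k @ xs = enc_int l @ ys \<Longrightarrow> k = l \<and> xs = ys"
  using enc_nat_prefix_free[of "nat \<bar>k\<bar>" xs "nat \<bar>l\<bar>" ys]
  by (auto simp: enc_int_def)

lemma enc_rat_prefix_free:
  assumes "enc_rat r @ xs = enc_rat s @ ys"
  shows "r = s \<and> xs = ys"
proof -
  obtain p q where r: "quotient_of r = (p, q)" by fastforce
  obtain p' q' where s: "quotient_of s = (p', q')" by fastforce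
  have "enc_int p @ enc_nat (nat q) @ xs = enc_int p' @ enc_nat (nat q') @ ys"
    using assms r s by (simp add: enc_rat_def)
  then have "p = p'" "enc_nat (nat q) @ xs = enc_nat (nat q') @ ys"
    using enc_int_prefix_free by blast+
  moreover from this(2) have "nat q = nat q'" "xs = ys"
    using enc_nat_prefix_free by blast+
  moreover have "q > 0" "q' > 0" using r s quotient_of_denom_pos by auto
  ultimately have "quotient_of r = quotient_of s" "xs = ys" using r s by auto
  then show ?thesis using quotient_of_inject by blast
qed

lemma concat_prefix_free:
  assumes "\<And>a b xs ys. a \<in> S \<Longrightarrow> b \<in> S \<Longrightarrow> f a @ xs = f b @ ys \<Longrightarrow> a = b \<and> xs = ys"
    and "length as = length bs" and "set as \<subseteq> S" and "set bs \<subseteq> S"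
    and "concat (map f as) @ xs = concat (map f bs) @ ys"
  shows "as = bs \<and> xs = ys"
  using assms(2-5)
proof (induction as bs rule: list_induct2)
  case Nil
  then show ?case by simp
next
  case (Cons a as b bs)
  from Cons.prems have "a = b \<and> concat (map f as) @ xs = concat (map f bs) @ ys"
    by (intro assms(1)) auto
  with Cons show ?case by auto
qed

lemma enc_vec_prefix_free:
  assumes "v \<in> carrier_vec n" "w \<in> carrier_vec n" "enc_vec v @ xs = enc_vec w @ ys"
  shows "v = w \<and> xs = ys"
proof -
  have "list_of_vec v = list_of_vec w \<and> xs = ys"
    using assms by (intro concat_prefix_free[of UNIV enc_rat] enc_rat_prefix_free) (auto simp: enc_vec_def)
  then show ?thesis by (metis vec_list)
qed

lemma enc_mat_prefix_free:
  assumes A: "A \<in> carrier_mat m n" and B: "B \<in> carrier_mat m n" and eq: "enc_mat A @ xs = enc_mat B @ ys"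
  shows "A = B \<and> xs = ys"
proof -
  have "rows A = rows B \<and> xs = ys"
    using A B eq rows_carrier[of A] rows_carrier[of B]
    by (intro concat_prefix_free[of "carrier_vec n" enc_vec] enc_vec_prefix_free) (auto simp: enc_mat_def)
  then show ?thesis using A B by (metis mat_of_rows_rows carrier_matD(2))
qed

lemma enc_dim_prefix_free: "enc_dim m @ xs = enc_dim n @ ys \<Longrightarrow> m = n \<and> xs = ys"
proof (induction m arbitrary: n)
  case 0
  then show ?case by (cases n) (auto simp: enc_dim_def)
next
  case (Suc m)
  then show ?case by (cases n) (auto simp: enc_dim_def)
qed

theorem enc_instance_inj: "inj_on enc_instance (Collect wf_instance)"
proof (rule inj_onI, unfold mem_Collect_eq)
  fix I J assume I: "wf_instance I" and J: "wf_instance J" and eq: "enc_instance I = enc_instance J"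
  note eq = eq[unfolded enc_instance_def]
  note s1 = enc_dim_prefix_free[OF eq]
  note s2 = enc_dim_prefix_free[OF conjunct2[OF s1]]
  note s3 = enc_dim_prefix_free[OF conjunct2[OF s2]]
  note s4 = enc_dim_prefix_free[OF conjunct2[OF s3]]
  note s5 = enc_dim_prefix_free[OF conjunct2[OF s4]]
  note dims = s1[THEN conjunct1] s2[THEN conjunct1] s3[THEN conjunct1] s4[THEN conjunct1] s5[THEN conjunct1]
  note I = I[unfolded wf_instance_def dims]
  note J = J[unfolded wf_instance_def]
  note s6 = enc_nat_prefix_free[OF conjunct2[OF s5]]
  have s7: "bs_a I = bs_a J \<and> enc_vec (bs_b I) @ enc_mat (bs_A I) @
      concat (map enc_mat (bs_B I)) @ concat (map enc_mat (bs_H I)) =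
      enc_vec (bs_b J) @ enc_mat (bs_A J) @
      concat (map enc_mat (bs_B J)) @ concat (map enc_mat (bs_H J))"
    using I J by (intro enc_vec_prefix_free[OF _ _ conjunct2[OF s6]]) auto
  have s8: "bs_b I = bs_b J \<and> enc_mat (bs_A I) @
      concat (map enc_mat (bs_B I)) @ concat (map enc_mat (bs_H I)) =
      enc_mat (bs_A J) @ concat (map enc_mat (bs_B J)) @ concat (map enc_mat (bs_H J))"
    using I J by (intro enc_vec_prefix_free[OF _ _ conjunct2[OF s7]]) auto
  have s9: "bs_A I = bs_A J \<and>
      concat (map enc_mat (bs_B I)) @ concat (map enc_mat (bs_H I)) =
      concat (map enc_mat (bs_B J)) @ concat (map enc_mat (bs_H J))"
    using I J by (intro enc_mat_prefix_free[OF _ _ conjunct2[OF s8]]) auto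
  have s10: "bs_B I = bs_B J \<and> concat (map enc_mat (bs_H I)) = concat (map enc_mat (bs_H J))"
    by (rule concat_prefix_free[OF _ _ _ _ conjunct2[OF s9], of "carrier_mat (bs_mu J) (bs_nu J)"])
      (use I J in \<open>auto dest: enc_mat_prefix_free\<close>)
  have "concat (map enc_mat (bs_H I)) @ [] = concat (map enc_mat (bs_H J)) @ []"
    using s10 by simp
  then have s11: "bs_H I = bs_H J \<and> ([] :: bool list) = []"
    by (rule concat_prefix_free[rotated 4, where S = "carrier_mat (bs_nu J) (bs_nx J)"])
      (use I J in \<open>auto dest: enc_mat_prefix_free\<close>)
  show "I = J"
    using dims s6 s7 s8 s9 s10 s11 by (intro bs_instance.equality) auto
qed

end

theory Submission
  imports Defs "HOL-Library.Countable" "HOL-Library.FuncSet"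
begin

text \<open>For fixed \<open>x\<close>, Farkas' lemma turns each of the \<open>L\<close> implications into the existence of nonnegative
  multipliers. After clearing denominators they are a natural solution of an integer linear system, and minimal
  natural solutions of such systems have polynomially many bits. So \<open>x\<close>, the multipliers and the decoded
  input form a certificate, whose correctness is a bounded arithmetical formula over arrays of binary numbers.
  Formulas of this kind are evaluated by nondeterministic programs on finitely many stacks, and a Turing machine
  simulates such a program by taking every nondeterministic choice from the next bit of its certificate.\<close>

section \<open>Simulation of stack programs by Turing machines\<close>

text \<open>Guessing and checking shapes every layer. A program guesses a sum and verifies it, or
  guesses the number of rounds of a loop and compares a counter afterwards. Each machine step
  consumes a certificate bit, so every run ends by itself: soundness of a program can ignore time
  and divergence, and costs matter only for the one run exhibited for completeness. The data are
  rational but \<open>u\<close> is real. Farkas' lemma is therefore applied to rational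
  \<open>u\<close> only, and soundness for real \<open>u\<close> needs just weak duality. In the
  pigeonhole bound \<open>(2 * n * C + 1) ^ m\<close> the exponent is the number of equations, here
  \<open>nu + 1\<close>; this gives polynomially many bits without any determinants.
  \<open>Bounded_Static\<close> contains exact codes only. The certificate must thus also establish
  that numbers have no leading zeros and that fractions are in lowest terms, the latter by Bezout
  coefficients.\<close>

datatype com = Skip | Push nat nat | Pop nat nat | Seq com com (infixr ";;" 60) | Alt com com | Star com

instance com :: countable
  by countable_datatype

type_synonym store = "nat \<Rightarrow> nat list"

text \<open>The number is the exact count of machine steps from the state of the command to the
  state of \<open>Skip\<close>. A pop takes two steps, and each \<open>+ 3\<close> consists of one
  step that pushes the continuation and two in which \<open>Skip\<close> takes it back from the
  control stack.\<close>

inductive exec :: "com \<Rightarrow> store \<Rightarrow> nat \<Rightarrow> store \<Rightarrow> bool" where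
  Skip: "exec Skip \<sigma> 0 \<sigma>"
| Push: "exec (Push i s) \<sigma> 1 (\<sigma>(i := s # \<sigma> i))"
| Pop: "\<sigma> i = s # l \<Longrightarrow> exec (Pop i s) \<sigma> 2 (\<sigma>(i := l))"
| Seq: "exec a \<sigma> m \<tau> \<Longrightarrow> exec b \<tau> n \<rho> \<Longrightarrow> exec (a ;; b) \<sigma> (m + n + 3) \<rho>"
| AltL: "exec a \<sigma> n \<tau> \<Longrightarrow> exec (Alt a b) \<sigma> (n + 1) \<tau>"
| AltR: "exec b \<sigma> n \<tau> \<Longrightarrow> exec (Alt a b) \<sigma> (n + 1) \<tau>"
| Star0: "exec (Star a) \<sigma> 1 \<sigma>"
| StarS: "exec a \<sigma> m \<tau> \<Longrightarrow> exec (Star a) \<tau> n \<rho> \<Longrightarrow> exec (Star a) \<sigma> (m + n + 3) \<rho>"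

primrec subs :: "com \<Rightarrow> com set" where
  "subs Skip = {Skip}"
| "subs (Push i s) = {Push i s}"
| "subs (Pop i s) = {Pop i s}"
| "subs (a ;; b) = insert (a ;; b) (subs a \<union> subs b)"
| "subs (Alt a b) = insert (Alt a b) (subs a \<union> subs b)"
| "subs (Star a) = insert (Star a) (subs a)"

primrec cbound :: "com \<Rightarrow> nat" where
  "cbound Skip = 0"
| "cbound (Push i s) = Suc (max i s)"
| "cbound (Pop i s) = Suc (max i s)"
| "cbound (a ;; b) = max (cbound a) (cbound b)"
| "cbound (Alt a b) = max (cbound a) (cbound b)"
| "cbound (Star a) = cbound a"

text \<open>Symbol 0 is the blank below the bottom of every stack, so it must not be popped.\<close>

primrec pops_nonblank :: "com \<Rightarrow> bool" where
  "pops_nonblank Skip = True"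
| "pops_nonblank (Push i s) = True"
| "pops_nonblank (Pop i s) = (s \<noteq> 0)"
| "pops_nonblank (a ;; b) = (pops_nonblank a \<and> pops_nonblank b)"
| "pops_nonblank (Alt a b) = (pops_nonblank a \<and> pops_nonblank b)"
| "pops_nonblank (Star a) = pops_nonblank a"

lemma finite_subs [simp]: "finite (subs c)"
  by (induction c) auto

lemma subs_refl [simp]: "c \<in> subs c"
  by (cases c) auto

lemma subs_trans: "c \<in> subs m \<Longrightarrow> subs c \<subseteq> subs m"
  by (induction m) auto

lemma subs_comp:
  "a ;; b \<in> subs m \<Longrightarrow> a \<in> subs m \<and> b \<in> subs m"
  "Alt a b \<in> subs m \<Longrightarrow> a \<in> subs m \<and> b \<in> subs m"
  "Star a \<in> subs m \<Longrightarrow> a \<in> subs m"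
  by (auto dest!: subs_trans)

lemma cbound_subs: "c \<in> subs m \<Longrightarrow> cbound c \<le> cbound m"
  by (induction m) auto

lemma pops_nonblank_subs: "c \<in> subs m \<Longrightarrow> pops_nonblank m \<Longrightarrow> pops_nonblank c"
  by (induction m) auto

section \<open>States, tapes and transitions of the simulating machine\<close>

definition allsubs :: "com \<Rightarrow> com set" where
  "allsubs m = insert Skip (subs m)"

definition codes :: "com \<Rightarrow> nat" where
  "codes m = Suc (Max (to_nat ` allsubs m))"

text \<open>Tape 0 carries the input and the certificate, tape 1 the control stack of pending
  commands, and tape \<open>i + 2\<close> the stack \<open>i\<close>. The summand 3 guarantees tape
  2, to which the input is copied, even when \<open>cbound m = 0\<close>.\<close>

definition ntapes :: "com \<Rightarrow> nat" where
  "ntapes m = cbound m + 3"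

text \<open>States 0 and 1 copy the input to the first stack, 2 accepts and 3 rejects. The flag marks the
  second half of a pop, which first moves the head to the left and then inspects the symbol.\<close>

definition st :: "com \<Rightarrow> bool \<Rightarrow> nat" where
  "st c f = 4 + 2 * to_nat c + of_bool f"

type_synonym acts = "nat \<Rightarrow> (nat \<times> head_move) option"

text \<open>Every finished command continues with \<open>Skip\<close>, which pops the next pending
  command. Commands are pushed as \<open>Suc (to_nat c)\<close>, so that the blank 0 unambiguously
  means an empty control stack and hence acceptance. The choices of \<open>Alt\<close> and
  \<open>Star\<close> are read off the certificate symbol \<open>r 0\<close>, where 2 is the bit
  True.\<close>

fun ctl :: "com \<Rightarrow> com \<Rightarrow> bool \<Rightarrow> (nat \<Rightarrow> nat) \<Rightarrow> nat \<times> acts" where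
  "ctl m Skip f r = (if \<not> f then (st Skip True, [1 \<mapsto> (r 1, Move_Left)])
     else if r 1 = 0 then (2, Map.empty)
     else if r 1 \<in> (\<lambda>c. Suc (to_nat c)) ` allsubs m then (st (from_nat (r 1 - 1)) False, Map.empty)
     else (3, Map.empty))"
| "ctl m (Push i s) f r = (st Skip False, [i + 2 \<mapsto> (s, Move_Right)])"
| "ctl m (Pop i s) f r = (if \<not> f then (st (Pop i s) True, [i + 2 \<mapsto> (r (i + 2), Move_Left)])
     else if r (i + 2) = s then (st Skip False, Map.empty) else (3, Map.empty))"
| "ctl m (a ;; b) f r = (st a False, [1 \<mapsto> (Suc (to_nat b), Move_Right)])"
| "ctl m (Alt a b) f r = (st (if r 0 = 2 then a else b) False, Map.empty)"
| "ctl m (Star a) f r = (if r 0 = 2 then (st a False, [1 \<mapsto> (Suc (to_nat (Star a)), Move_Right)])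
     else (st Skip False, Map.empty))"

text \<open>The final update at 0 moves the certificate head to the right in every program step, and
  a symbol that is not a bit leads to rejection. The length of the certificate therefore acts as a
  clock. State 0 first puts the end mark 3 below the copied input.\<close>

definition next_acts :: "com \<Rightarrow> nat \<Rightarrow> (nat \<Rightarrow> nat) \<Rightarrow> nat \<times> acts" where
  "next_acts m q r =
    (if q = 0 then (1, [2 \<mapsto> (3, Move_Right)])
     else if q = 1 then
       (if r 0 = 1 \<or> r 0 = 2 then (1, [0 \<mapsto> (r 0, Move_Right), 2 \<mapsto> (r 0, Move_Right)])
        else if r 0 = 3 then (st m False, [0 \<mapsto> (3, Move_Right)])
        else (3, Map.empty))
     else if 4 \<le> q \<and> from_nat ((q - 4) div 2) \<in> allsubs m \<and> (r 0 = 1 \<or> r 0 = 2) then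
       (case ctl m (from_nat ((q - 4) div 2)) (odd q) r of (q', g) \<Rightarrow> (q', g(0 \<mapsto> (r 0, Move_Right))))
     else (3, Map.empty))"

definition upd :: "acts \<Rightarrow> (nat \<Rightarrow> tape) \<Rightarrow> nat \<Rightarrow> tape" where
  "upd g T k = (case g k of None \<Rightarrow> T k | Some a \<Rightarrow> tape_act a (T k))"

definition machine :: "com \<Rightarrow> tm" where
  "machine m = \<lparr> tm_tapes = ntapes m, tm_states = 2 * codes m + 4, tm_symbols = cbound m + codes m + 5,
     tm_start = 0, tm_accept = 2, tm_reject = 3,
     tm_delta = (\<lambda>q rs. case next_acts m q (\<lambda>k. if k < ntapes m then rs ! k else 0) of
       (q', g) \<Rightarrow> (q', map (\<lambda>k. case g k of None \<Rightarrow> (rs ! k, Move_Stay) | Some a \<Rightarrow> a) [0..<ntapes m])) \<rparr>"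

lemma machine_simps [simp]:
  "tm_tapes (machine m) = ntapes m" "tm_states (machine m) = 2 * codes m + 4"
  "tm_symbols (machine m) = cbound m + codes m + 5"
  "tm_start (machine m) = 0" "tm_accept (machine m) = 2" "tm_reject (machine m) = 3"
  by (simp_all add: machine_def)

lemma finite_allsubs [simp]: "finite (allsubs m)"
  by (simp add: allsubs_def)

lemma allsubs_simps [simp]: "Skip \<in> allsubs m" "m \<in> allsubs m"
  by (simp_all add: allsubs_def)

lemma allsubs_comp:
  "a ;; b \<in> allsubs m \<Longrightarrow> a \<in> allsubs m \<and> b \<in> allsubs m"
  "Alt a b \<in> allsubs m \<Longrightarrow> a \<in> allsubs m \<and> b \<in> allsubs m"
  "Star a \<in> allsubs m \<Longrightarrow> a \<in> allsubs m"
  by (auto simp: allsubs_def dest: subs_comp)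

lemma cbound_allsubs: "c \<in> allsubs m \<Longrightarrow> cbound c \<le> cbound m"
  by (auto simp: allsubs_def cbound_subs)

lemma to_nat_codes: "c \<in> allsubs m \<Longrightarrow> to_nat c < codes m"
  unfolding codes_def by (simp add: less_Suc_eq_le)

lemma st_bound: "c \<in> allsubs m \<Longrightarrow> st c f < 2 * codes m + 4"
  using to_nat_codes[of c m] by (cases f) (auto simp: st_def)

text \<open>A head moves left without changing the tape by writing back the symbol it reads; this is
  the reason for the alternative \<open>fst a \<in> range r\<close>.\<close>

lemma ctl_bounds:
  assumes "c \<in> allsubs m" "ctl m c f r = (q', g)"
  shows "q' < 2 * codes m + 4 \<and> (\<forall>k a. g k = Some a \<longrightarrow> fst a < cbound m + codes m + 5 \<or> fst a \<in> range r)"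
proof (cases c)
  case Skip
  have s: "st c f < 2 * codes m + 4" if "c \<in> allsubs m" for c f using that by (rule st_bound)
  show ?thesis using assms(2) s[OF allsubs_simps(1), of True] s[of "from_nat (r 1 - 1)" False]
    by (auto simp: Skip codes_def split: if_splits)
next
  case (Push i s)
  then show ?thesis using assms(2) st_bound[of Skip m False] cbound_allsubs[OF assms(1)]
    by (auto split: if_splits)
next
  case (Pop i s)
  then show ?thesis using assms st_bound[of c m True] st_bound[of Skip m False]
    by (cases f) (auto simp: codes_def split: if_splits)
next
  case (Seq a b)
  then have ab: "a \<in> allsubs m" "b \<in> allsubs m" using assms(1) allsubs_comp(1)[of a b m] by simp_all
  show ?thesis using Seq assms(2) st_bound[OF ab(1), of False] to_nat_codes[OF ab(2)]
    by (auto split: if_splits)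
next
  case (Alt a b)
  then have ab: "a \<in> allsubs m" "b \<in> allsubs m" using assms(1) allsubs_comp(2)[of a b m] by simp_all
  show ?thesis using Alt assms(2) st_bound[OF ab(1), of False] st_bound[OF ab(2), of False]
    by (cases "r 0 = 2") auto
next
  case (Star a)
  then have a: "a \<in> allsubs m" using assms(1) allsubs_comp(3)[of a m] by simp
  show ?thesis using Star assms(2) st_bound[OF a, of False] st_bound[of Skip m False] to_nat_codes[OF assms(1)]
    by (cases "r 0 = 2") (auto split: if_splits)
qed

lemma next_acts_bounds:
  assumes "next_acts m q r = (q', g)" "\<And>k. r k < cbound m + codes m + 5"
  shows "q' < 2 * codes m + 4 \<and> (\<forall>k a. g k = Some a \<longrightarrow> fst a < cbound m + codes m + 5)"
proof (cases "4 \<le> q \<and> from_nat ((q - 4) div 2) \<in> allsubs m \<and> (r 0 = 1 \<or> r 0 = 2)")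
  case True
  obtain q2 g2 where c: "ctl m (from_nat ((q - 4) div 2)) (odd q) r = (q2, g2)" by fastforce
  have "q' = q2" "g = g2(0 \<mapsto> (r 0, Move_Right))"
    using assms(1) True c by (auto simp: next_acts_def)
  moreover have "q2 < 2 * codes m + 4 \<and> (\<forall>k a. g2 k = Some a \<longrightarrow> fst a < cbound m + codes m + 5 \<or> fst a \<in> range r)"
    using True by (intro ctl_bounds[OF _ c]) simp
  ultimately show ?thesis using assms(2) by (metis fst_conv fun_upd_apply option.inject rangeE)
next
  case False
  then have e: "next_acts m q r = (if q = 0 then (1, [2 \<mapsto> (3, Move_Right)])
     else if q = 1 then
       (if r 0 = 1 \<or> r 0 = 2 then (1, [0 \<mapsto> (r 0, Move_Right), 2 \<mapsto> (r 0, Move_Right)])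
        else if r 0 = 3 then (st m False, [0 \<mapsto> (3, Move_Right)])
        else (3, Map.empty))
     else (3, Map.empty))"
    by (simp only: next_acts_def if_False)
  have "st m False < 2 * codes m + 4" by (rule st_bound) simp
  moreover have "r 0 < cbound m + codes m + 5" by (rule assms(2))
  ultimately show ?thesis using assms(1) unfolding e by (simp split: if_splits) (auto split: if_splits)
qed

lemma wf_machine: "wf_tm (machine m)"
  unfolding wf_tm_def
proof (intro conjI allI impI)
  fix q rs assume *: "q < tm_states (machine m) \<and> length rs = tm_tapes (machine m) \<and> (\<forall>r\<in>set rs. r < tm_symbols (machine m))"
  obtain q' g where n: "next_acts m q (\<lambda>k. if k < ntapes m then rs ! k else 0) = (q', g)" by fastforce
  have "\<And>k. (if k < ntapes m then rs ! k else 0) < cbound m + codes m + 5" using * by auto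
  from next_acts_bounds[OF n this] n *
  show "case tm_delta (machine m) q rs of (q', acts) \<Rightarrow>
          q' < tm_states (machine m) \<and> length acts = tm_tapes (machine m) \<and>
          (\<forall>(s, d)\<in>set acts. s < tm_symbols (machine m))"
    by (auto simp: machine_def split: option.splits)
qed (auto simp: ntapes_def codes_def)

section \<open>Configurations and tapes as stacks\<close>

abbreviation cfg :: "com \<Rightarrow> nat \<Rightarrow> (nat \<Rightarrow> tape) \<Rightarrow> config" where
  "cfg m q T \<equiv> (q, map T [0..<ntapes m])"

abbreviation reads :: "com \<Rightarrow> (nat \<Rightarrow> tape) \<Rightarrow> nat \<Rightarrow> nat" where
  "reads m T \<equiv> (\<lambda>k. if k < ntapes m then tape_read (T k) else 0)"

lemma tape_act_stay: "tape_act (tape_read t, Move_Stay) t = t"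
  by (cases t) (auto simp: tape_act_def tape_read_def)

lemma machine_step:
  assumes "q \<noteq> 2" "q \<noteq> 3" "next_acts m q (reads m T) = (q', g)"
  shows "tm_step (machine m) (cfg m q T) = cfg m q' (upd g T)"
proof -
  have r: "(\<lambda>k. if k < ntapes m then map tape_read (map T [0..<ntapes m]) ! k else 0) = reads m T"
    by auto
  have "tm_delta (machine m) q (map tape_read (map T [0..<ntapes m])) =
     (q', map (\<lambda>k. case g k of None \<Rightarrow> (tape_read (T k), Move_Stay) | Some a \<Rightarrow> a) [0..<ntapes m])"
    unfolding machine_def tm.simps r assms(3) by (auto split: option.splits)
  then show ?thesis using assms(1,2)
    by (auto simp: tm_step_def upd_def map2_map_map tape_act_stay intro!: map_cong split: option.splits)
qed

lemma machine_halted: "q = 2 \<or> q = 3 \<Longrightarrow> (tm_step (machine m) ^^ n) (q, ts) = (q, ts)"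
  by (induction n) (auto simp: tm_step_def)

text \<open>The stack lies to the left of the head with its top next to it and blanks below its
  bottom. Cells under and to the right of the head are unconstrained, as popped symbols remain
  there.\<close>

definition on_stack :: "tape \<Rightarrow> nat list \<Rightarrow> bool" where
  "on_stack = (\<lambda>(t, h) l. \<forall>i. t (h - 1 - int i) = (if i < length l then l ! i else 0))"

lemma on_stack_push: "on_stack t l \<Longrightarrow> on_stack (tape_act (s, Move_Right) t) (s # l)"
proof -
  assume *: "on_stack t l"
  obtain c h where t: "t = (c, h)" by fastforce
  have a: "c (h - 1 - int j) = (if j < length l then l ! j else 0)" for j
    using * t by (simp add: on_stack_def)
  have "(c(h := s)) (h + 1 - 1 - int i) = (if i < length (s # l) then (s # l) ! i else 0)" for i
  proof (cases i)
    case (Suc j)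
    have "h + 1 - 1 - int i = h - 1 - int j" using Suc by simp
    then have "(c(h := s)) (h + 1 - 1 - int i) = c (h - 1 - int j)" by (metis add_diff_cancel_right' diff_add_cancel fun_upd_other less_irrefl of_nat_0_le_iff zle_diff1_eq diff_add_eq diff_less_eq le_add_same_cancel1 not_less)
    also have "\<dots> = (if i < length (s # l) then (s # l) ! i else 0)" unfolding a using Suc by simp
    finally show ?thesis .
  qed auto
  then show ?thesis unfolding t on_stack_def tape_act_def by (simp only: prod.case move_offset.simps) blast
qed

lemma on_stack_left: "on_stack t l \<Longrightarrow> on_stack (tape_act (tape_read t, Move_Left) t) (tl l)"
proof -
  assume *: "on_stack t l"
  obtain c h where t: "t = (c, h)" by fastforce
  have a: "c (h - 1 - int j) = (if j < length l then l ! j else 0)" for j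
    using * t by (simp add: on_stack_def)
  have "c (h - 1 - 1 - int i) = (if i < length (tl l) then tl l ! i else 0)" for i
  proof -
    have e: "h - 1 - 1 - int i = h - 1 - int (Suc i)" by simp
    show ?thesis unfolding e a by (auto simp: nth_tl)
  qed
  then show ?thesis unfolding t on_stack_def tape_act_def tape_read_def by simp
qed

lemma tape_read_left:
  "on_stack t l \<Longrightarrow> tape_read (tape_act (tape_read t, Move_Left) t) = (if l = [] then 0 else hd l)"
  by (cases t) (auto simp: on_stack_def tape_act_def tape_read_def hd_conv_nth dest!: spec[of _ 0])

text \<open>Tape 0 is absent because its content and head position are tracked separately in the
  form \<open>T 0 = (u, p)\<close>.\<close>

definition good :: "com \<Rightarrow> com list \<Rightarrow> store \<Rightarrow> (nat \<Rightarrow> tape) \<Rightarrow> bool" where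
  "good m K \<sigma> T \<longleftrightarrow> on_stack (T 1) (map (\<lambda>c. Suc (to_nat c)) K) \<and> (\<forall>i. on_stack (T (i + 2)) (\<sigma> i)) \<and>
     set K \<subseteq> allsubs m"

lemma st_decode [simp]: "from_nat ((st c f - 4) div 2) = c" "odd (st c f) = f" "4 \<le> st c f"
  "st c f \<noteq> 0" "st c f \<noteq> 1" "st c f \<noteq> 2" "st c f \<noteq> 3"
  "st c f \<noteq> Suc 0"
  by (cases f; simp add: st_def)+

text \<open>Every step of the simulation consumes one bit of the certificate.\<close>

lemma st_step:
  assumes "c \<in> allsubs m" "T 0 = (u, p)" "u p = bit_symbol b" "ctl m c f (reads m T) = (q', g)"
  shows "tm_step (machine m) (cfg m (st c f) T) = cfg m q' (upd (g(0 \<mapsto> (u p, Move_Right))) T)"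
proof (rule machine_step)
  have r: "reads m T 0 = u p" using assms(2) by (simp add: ntapes_def tape_read_def)
  have u: "u p = 1 \<or> u p = 2" using assms(3) by (simp add: bit_symbol_def)
  show "next_acts m (st c f) (reads m T) = (q', g(0 \<mapsto> (u p, Move_Right)))"
    using assms(1,4) u unfolding next_acts_def r by simp
qed auto

lemma upd_0: "T 0 = (u, p) \<Longrightarrow> upd (g(0 \<mapsto> (u p, Move_Right))) T 0 = (u, p + 1)"
  by (simp add: upd_def tape_act_def)

lemma reads_simps: "reads m T 0 = tape_read (T 0)" "reads m T 1 = tape_read (T 1)"
  "reads m T (Suc 0) = tape_read (T 1)" "reads m T 2 = tape_read (T 2)"
  by (simp_all add: ntapes_def)

lemma reads_stack: "c \<in> allsubs m \<Longrightarrow> i < cbound c \<Longrightarrow> reads m T (i + 2) = tape_read (T (i + 2))"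
  using cbound_allsubs[of c m] by (simp add: ntapes_def)

lemma st_stepI:
  assumes "c \<in> allsubs m" "T 0 = (u, p)" "u p = bit_symbol b" "ctl m c f (reads m T) = (q', g)"
    and "good m K \<sigma> (upd (g(0 \<mapsto> (u p, Move_Right))) T)"
  shows "\<exists>T'. tm_step (machine m) (cfg m (st c f) T) = cfg m q' T' \<and> T' 0 = (u, p + 1) \<and> good m K \<sigma> T'"
  using st_step[where u = u and p = p and T = T, OF assms(1-4)] upd_0[where T = T, OF assms(2), of g] assms(5)
  by blast

section \<open>Single commands and whole executions on the machine\<close>

lemma step_Push:
  assumes "Push i s \<in> allsubs m" "T 0 = (u, p)" "u p = bit_symbol b" "good m K \<sigma> T"
  shows "\<exists>T'. tm_step (machine m) (cfg m (st (Push i s) False) T) = cfg m (st Skip False) T' \<and>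
    T' 0 = (u, p + 1) \<and> good m K (\<sigma>(i := s # \<sigma> i)) T'"
  by (rule st_stepI[where T = T, OF assms(1-3) ctl.simps(2)])
    (use assms(4) in \<open>auto simp: good_def upd_def on_stack_push\<close>)

lemma step_Seq:
  assumes "a ;; b \<in> allsubs m" "T 0 = (u, p)" "u p = bit_symbol x" "good m K \<sigma> T"
  shows "\<exists>T'. tm_step (machine m) (cfg m (st (a ;; b) False) T) = cfg m (st a False) T' \<and>
    T' 0 = (u, p + 1) \<and> good m (b # K) \<sigma> T'"
  by (rule st_stepI[where T = T, OF assms(1-3) ctl.simps(4)])
    (use assms(4) allsubs_comp(1)[OF assms(1)] in \<open>auto simp: good_def upd_def on_stack_push\<close>)

lemma step_Alt:
  assumes "Alt a b \<in> allsubs m" "T 0 = (u, p)" "u p = bit_symbol x" "good m K \<sigma> T"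
  shows "\<exists>T'. tm_step (machine m) (cfg m (st (Alt a b) False) T) = cfg m (st (if x then a else b) False) T' \<and>
    T' 0 = (u, p + 1) \<and> good m K \<sigma> T'"
proof (rule st_stepI[where T = T, OF assms(1-3)])
  show "ctl m (Alt a b) False (reads m T) = (st (if x then a else b) False, Map.empty)"
    using assms(2,3) by (simp add: reads_simps tape_read_def bit_symbol_def)
qed (use assms(4) in \<open>auto simp: good_def upd_def\<close>)

lemma step_Star:
  assumes "Star a \<in> allsubs m" "T 0 = (u, p)" "u p = bit_symbol x" "good m K \<sigma> T"
  shows "\<exists>T'. tm_step (machine m) (cfg m (st (Star a) False) T) = cfg m (st (if x then a else Skip) False) T' \<and>
    T' 0 = (u, p + 1) \<and> good m (if x then Star a # K else K) \<sigma> T'"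
proof (rule st_stepI[where T = T, OF assms(1-3)])
  show "ctl m (Star a) False (reads m T) = (st (if x then a else Skip) False,
      if x then [1 \<mapsto> (Suc (to_nat (Star a)), Move_Right)] else Map.empty)"
    using assms(2,3) by (simp add: reads_simps tape_read_def bit_symbol_def)
qed (use assms(1,4) in \<open>auto simp: good_def upd_def on_stack_push\<close>)

text \<open>The failing case is part of the conclusion because accepting runs have to be inverted
  later. An empty stack shows the blank, which \<open>s \<noteq> 0\<close> keeps apart from a
  successful pop.\<close>

lemma step_Pop:
  assumes "Pop i s \<in> allsubs m" "T 0 = (u, p)" "u p = bit_symbol x" "u (p + 1) = bit_symbol y" "good m K \<sigma> T" "s \<noteq> 0"
  shows "\<exists>T'. (tm_step (machine m) ^^ 2) (cfg m (st (Pop i s) False) T) =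
      cfg m (if \<sigma> i \<noteq> [] \<and> hd (\<sigma> i) = s then st Skip False else 3) T' \<and>
    T' 0 = (u, p + 2) \<and> good m K (\<sigma>(i := tl (\<sigma> i))) T'"
proof -
  have i: "i < cbound (Pop i s)" by simp
  define T1 where "T1 = upd (([i + 2 \<mapsto> (tape_read (T (i + 2)), Move_Left)])(0 \<mapsto> (u p, Move_Right))) T"
  have s1: "tm_step (machine m) (cfg m (st (Pop i s) False) T) = cfg m (st (Pop i s) True) T1"
    unfolding T1_def by (rule st_step[where T = T and u = u and p = p, OF assms(1-3)]) (use reads_stack[OF assms(1) i] in simp)
  have T10: "T1 0 = (u, p + 1)" unfolding T1_def by (rule upd_0[where T = T, OF assms(2)])
  have g1: "good m K (\<sigma>(i := tl (\<sigma> i))) T1" using assms(5) on_stack_left unfolding good_def T1_def upd_def by auto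
  have "T1 (i + 2) = tape_act (tape_read (T (i + 2)), Move_Left) (T (i + 2))" by (simp add: T1_def upd_def)
  moreover have "on_stack (T (i + 2)) (\<sigma> i)" using assms(5) by (simp add: good_def)
  ultimately have "tape_read (T1 (i + 2)) = (if \<sigma> i = [] then 0 else hd (\<sigma> i))"
    using tape_read_left by metis
  then have c: "ctl m (Pop i s) True (reads m T1) = ((if \<sigma> i \<noteq> [] \<and> hd (\<sigma> i) = s then st Skip False else 3), Map.empty)"
    using reads_stack[OF assms(1) i, of T1] assms(6) by auto
  note s2 = st_step[where T = T1 and u = u and p = "p + 1", OF assms(1) T10 assms(4) c]
  show ?thesis
  proof (intro exI conjI)
    show "(tm_step (machine m) ^^ 2) (cfg m (st (Pop i s) False) T) =
      cfg m (if \<sigma> i \<noteq> [] \<and> hd (\<sigma> i) = s then st Skip False else 3) (upd (Map.empty(0 \<mapsto> (u (p + 1), Move_Right))) T1)"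
      using s1 s2 by (simp add: numeral_2_eq_2)
    show "upd (Map.empty(0 \<mapsto> (u (p + 1), Move_Right))) T1 0 = (u, p + 2)"
      using upd_0[where T = T1, OF T10, of Map.empty] by simp
    show "good m K (\<sigma>(i := tl (\<sigma> i))) (upd (Map.empty(0 \<mapsto> (u (p + 1), Move_Right))) T1)"
      using g1 by (simp add: good_def upd_def)
  qed
qed

lemma step_Skip:
  assumes "T 0 = (u, p)" "u p = bit_symbol x" "u (p + 1) = bit_symbol y" "good m K \<sigma> T"
  shows "\<exists>T'. (tm_step (machine m) ^^ 2) (cfg m (st Skip False) T) =
      cfg m (if K = [] then 2 else st (hd K) False) T' \<and>
    T' 0 = (u, p + 2) \<and> good m (tl K) \<sigma> T'"
proof -
  define T1 where "T1 = upd (([1 \<mapsto> (tape_read (T 1), Move_Left)])(0 \<mapsto> (u p, Move_Right))) T"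
  have s1: "tm_step (machine m) (cfg m (st Skip False) T) = cfg m (st Skip True) T1"
    unfolding T1_def by (rule st_step[where T = T and u = u and p = p, OF _ assms(1-2)]) (simp_all add: ntapes_def)
  have T10: "T1 0 = (u, p + 1)" unfolding T1_def by (rule upd_0[where T = T, OF assms(1)])
  let ?k = "map (\<lambda>c. Suc (to_nat c)) K"
  have o: "on_stack (T 1) ?k" using assms(4) by (simp add: good_def)
  have T11: "T1 1 = tape_act (tape_read (T 1), Move_Left) (T 1)" by (simp add: T1_def upd_def)
  have g1: "good m (tl K) \<sigma> T1"
    using assms(4) on_stack_left[OF o] T11
    by (cases K) (auto simp: good_def T1_def upd_def)
  have r: "tape_read (T1 1) = (if K = [] then 0 else Suc (to_nat (hd K)))"
    using tape_read_left[OF o] T11 by (cases K) auto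
  have hd: "K \<noteq> [] \<Longrightarrow> hd K \<in> allsubs m" using assms(4) by (cases K) (auto simp: good_def)
  have c: "ctl m Skip True (reads m T1) = ((if K = [] then 2 else st (hd K) False), Map.empty)"
    using hd r by (auto simp: ntapes_def)
  note s2 = st_step[where T = T1 and u = u and p = "p + 1", OF allsubs_simps(1) T10 assms(3) c]
  show ?thesis
  proof (intro exI conjI)
    show "(tm_step (machine m) ^^ 2) (cfg m (st Skip False) T) =
      cfg m (if K = [] then 2 else st (hd K) False) (upd (Map.empty(0 \<mapsto> (u (p + 1), Move_Right))) T1)"
      using s1 s2 by (simp add: numeral_2_eq_2)
    show "upd (Map.empty(0 \<mapsto> (u (p + 1), Move_Right))) T1 0 = (u, p + 2)"
      using upd_0[where T = T1, OF T10, of Map.empty] by simp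
    show "good m (tl K) \<sigma> (upd (Map.empty(0 \<mapsto> (u (p + 1), Move_Right))) T1)"
      using g1 by (simp add: good_def upd_def)
  qed
qed

text \<open>The bits are chosen before the continuation \<open>K\<close>, the tapes and the
  position. This uniformity lets the bits of consecutive commands be concatenated although the
  second command starts with other tapes. Steps without a choice receive the filler True.\<close>

lemma exec_machine:
  assumes "exec c \<sigma> n \<tau>" "c \<in> allsubs m" "pops_nonblank m"
  shows "\<exists>bs. length bs = n \<and> (\<forall>K T u p. good m K \<sigma> T \<and> T 0 = (u, p) \<and> (\<forall>j<n. u (p + int j) = bit_symbol (bs ! j)) \<longrightarrow>
    (\<exists>T'. good m K \<tau> T' \<and> T' 0 = (u, p + int n) \<and>
       (tm_step (machine m) ^^ n) (cfg m (st c False) T) = cfg m (st Skip False) T'))"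
  using assms
proof (induction rule: exec.induct)
  case (Skip \<sigma>)
  then show ?case by auto
next
  case (Push i s \<sigma>)
  show ?case
  proof (intro exI[of _ "[True]"] conjI allI impI)
    fix K T u p assume *: "good m K \<sigma> T \<and> T 0 = (u, p) \<and> (\<forall>j<1. u (p + int j) = bit_symbol ([True] ! j))"
    then have u: "u p = bit_symbol True" by simp
    from step_Push[where T = T and u = u and p = p and K = K and \<sigma> = \<sigma>, OF Push(1) _ u] *
    show "\<exists>T'. good m K (\<sigma>(i := s # \<sigma> i)) T' \<and> T' 0 = (u, p + int 1) \<and>
        (tm_step (machine m) ^^ 1) (cfg m (st (Push i s) False) T) = cfg m (st Skip False) T'"
      by (simp del: upt.simps map_map) blast
  qed simp
next
  case (Pop \<sigma> i s l)
  have s: "s \<noteq> 0" using Pop pops_nonblank_subs by (fastforce simp: allsubs_def)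
  show ?case
  proof (intro exI[of _ "[True, True]"] conjI allI impI)
    fix K T u p assume *: "good m K \<sigma> T \<and> T 0 = (u, p) \<and> (\<forall>j<2. u (p + int j) = bit_symbol ([True, True] ! j))"
    then have u: "\<And>j. j < 2 \<Longrightarrow> u (p + int j) = bit_symbol ([True, True] ! j)" by blast
    have u2: "u p = bit_symbol True" "u (p + 1) = bit_symbol True" using u[of 0] u[of 1] by simp_all
    from step_Pop[where T = T and u = u and p = p and K = K and \<sigma> = \<sigma>, OF Pop(2) _ u2 _ s] * Pop(1)
    show "\<exists>T'. good m K (\<sigma>(i := l)) T' \<and> T' 0 = (u, p + int 2) \<and>
         (tm_step (machine m) ^^ 2) (cfg m (st (Pop i s) False) T) = cfg m (st Skip False) T'"
      by auto
  qed simp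
next
  case (Seq a \<sigma> k \<tau> b n \<rho>)
  note sub = allsubs_comp(1)[OF Seq(5)]
  from Seq.IH(1)[OF conjunct1[OF sub] Seq(6)] obtain bs1 where b1: "length bs1 = k"
    "\<And>K T u p. good m K \<sigma> T \<Longrightarrow> T 0 = (u, p) \<Longrightarrow> (\<forall>j<k. u (p + int j) = bit_symbol (bs1 ! j)) \<Longrightarrow>
      \<exists>T'. good m K \<tau> T' \<and> T' 0 = (u, p + int k) \<and> (tm_step (machine m) ^^ k) (cfg m (st a False) T) = cfg m (st Skip False) T'"
    by blast
  from Seq.IH(2)[OF conjunct2[OF sub] Seq(6)] obtain bs2 where b2: "length bs2 = n"
    "\<And>K T u p. good m K \<tau> T \<Longrightarrow> T 0 = (u, p) \<Longrightarrow> (\<forall>j<n. u (p + int j) = bit_symbol (bs2 ! j)) \<Longrightarrow>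
      \<exists>T'. good m K \<rho> T' \<and> T' 0 = (u, p + int n) \<and> (tm_step (machine m) ^^ n) (cfg m (st b False) T) = cfg m (st Skip False) T'"
    by blast
  \<comment> \<open>One filler for pushing the continuation \<open>b\<close>, and two for the steps
    in which \<open>Skip\<close> pops it again.\<close>
  let ?bs = "True # bs1 @ True # True # bs2"
  show ?case
  proof (intro exI[of _ ?bs] conjI allI impI)
    fix K T u p assume *: "good m K \<sigma> T \<and> T 0 = (u, p) \<and> (\<forall>j<k + n + 3. u (p + int j) = bit_symbol (?bs ! j))"
    then have u: "\<And>j. j < k + n + 3 \<Longrightarrow> u (p + int j) = bit_symbol (?bs ! j)" by blast
    from u[of 0] have u0: "u p = bit_symbol True" by simp
    have u1: "\<forall>j<k. u (p + 1 + int j) = bit_symbol (bs1 ! j)"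
    proof (intro allI impI)
      fix j assume "j < k" then show "u (p + 1 + int j) = bit_symbol (bs1 ! j)"
        using u[of "Suc j"] b1(1) by (simp add: nth_append add.assoc)
    qed
    from u[of "Suc k"] b1(1) have u2: "u (p + 1 + int k) = bit_symbol True" by (simp add: nth_append add.assoc)
    from u[of "Suc (Suc k)"] b1(1) have u3: "u (p + 1 + int k + 1) = bit_symbol True"
      by (simp add: nth_append add_ac)
    have u4: "\<forall>j<n. u (p + 1 + int k + 2 + int j) = bit_symbol (bs2 ! j)"
    proof (intro allI impI)
      fix j assume j: "j < n"
      have "p + 1 + int k + 2 + int j = p + int (k + 3 + j)" by simp
      then show "u (p + 1 + int k + 2 + int j) = bit_symbol (bs2 ! j)"
        using u[of "k + 3 + j"] j b1(1) by (simp add: nth_append Suc_diff_le numeral_3_eq_3 algebra_simps)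
    qed
    obtain T1 where T1: "tm_step (machine m) (cfg m (st (a ;; b) False) T) = cfg m (st a False) T1"
      "T1 0 = (u, p + 1)" "good m (b # K) \<sigma> T1"
      using step_Seq[where T = T and u = u and p = p and K = K and \<sigma> = \<sigma>, OF Seq(5) _ u0] * by blast
    obtain T2 where T2: "good m (b # K) \<tau> T2" "T2 0 = (u, p + 1 + int k)"
      "(tm_step (machine m) ^^ k) (cfg m (st a False) T1) = cfg m (st Skip False) T2"
      using b1(2)[OF T1(3,2) u1] by blast
    obtain T3 where T3: "(tm_step (machine m) ^^ 2) (cfg m (st Skip False) T2) = cfg m (st b False) T3"
      "T3 0 = (u, p + 1 + int k + 2)" "good m K \<tau> T3"
      using step_Skip[where T = T2, OF T2(2) u2 u3 T2(1)] by auto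
    obtain T4 where T4: "good m K \<rho> T4" "T4 0 = (u, p + 1 + int k + 2 + int n)"
      "(tm_step (machine m) ^^ n) (cfg m (st b False) T3) = cfg m (st Skip False) T4"
      using b2(2)[OF T3(3,2) u4] by blast
    have e: "k + n + 3 = n + (2 + (k + 1))" by simp
    have "(tm_step (machine m) ^^ (k + n + 3)) (cfg m (st (a ;; b) False) T) = cfg m (st Skip False) T4"
      unfolding e funpow_add using T1(1) T2(3) T3(1) T4(3) by (simp add: o_def)
    then show "\<exists>T'. good m K \<rho> T' \<and> T' 0 = (u, p + int (k + n + 3)) \<and>
        (tm_step (machine m) ^^ (k + n + 3)) (cfg m (st (a ;; b) False) T) = cfg m (st Skip False) T'"
      using T4(1,2) by (intro exI[of _ T4]) (auto simp: add_ac)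
  qed (use b1 b2 in simp)
next
  case (AltL a \<sigma> n \<tau> b)
  from AltL.IH[OF conjunct1[OF allsubs_comp(2)[OF AltL(3)]] AltL(4)] obtain bs where b: "length bs = n"
    "\<And>K T u p. good m K \<sigma> T \<Longrightarrow> T 0 = (u, p) \<Longrightarrow> (\<forall>j<n. u (p + int j) = bit_symbol (bs ! j)) \<Longrightarrow>
      \<exists>T'. good m K \<tau> T' \<and> T' 0 = (u, p + int n) \<and> (tm_step (machine m) ^^ n) (cfg m (st a False) T) = cfg m (st Skip False) T'"
    by blast
  show ?case
  proof (intro exI[of _ "True # bs"] conjI allI impI)
    fix K T u p assume *: "good m K \<sigma> T \<and> T 0 = (u, p) \<and> (\<forall>j<n + 1. u (p + int j) = bit_symbol ((True # bs) ! j))"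
    then have u0: "u p = bit_symbol True" by (auto dest!: spec[of _ 0])
    have u1: "\<forall>j<n. u (p + 1 + int j) = bit_symbol (bs ! j)"
    proof (intro allI impI)
      fix j assume "j < n"
      moreover from * have "j < n \<Longrightarrow> u (p + int (Suc j)) = bit_symbol ((True # bs) ! Suc j)"
        by (metis Suc_eq_plus1 Suc_less_eq)
      ultimately show "u (p + 1 + int j) = bit_symbol (bs ! j)" by (simp add: add.assoc)
    qed
    obtain T1 where T1: "tm_step (machine m) (cfg m (st (Alt a b) False) T) = cfg m (st a False) T1"
      "T1 0 = (u, p + 1)" "good m K \<sigma> T1"
      using step_Alt[where T = T and u = u and p = p and K = K and \<sigma> = \<sigma>, OF AltL(3) _ u0] * by auto
    from b(2)[OF T1(3,2) u1]
    show "\<exists>T'. good m K \<tau> T' \<and> T' 0 = (u, p + int (n + 1)) \<and>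
        (tm_step (machine m) ^^ (n + 1)) (cfg m (st (Alt a b) False) T) = cfg m (st Skip False) T'"
      unfolding Suc_eq_plus1[symmetric] funpow_Suc_right o_def T1(1) by (simp add: add_ac)
  qed (use b in simp)
next
  case (AltR b \<sigma> n \<tau> a)
  from AltR.IH[OF conjunct2[OF allsubs_comp(2)[OF AltR(3)]] AltR(4)] obtain bs where b: "length bs = n"
    "\<And>K T u p. good m K \<sigma> T \<Longrightarrow> T 0 = (u, p) \<Longrightarrow> (\<forall>j<n. u (p + int j) = bit_symbol (bs ! j)) \<Longrightarrow>
      \<exists>T'. good m K \<tau> T' \<and> T' 0 = (u, p + int n) \<and> (tm_step (machine m) ^^ n) (cfg m (st b False) T) = cfg m (st Skip False) T'"
    by blast
  show ?case
  proof (intro exI[of _ "False # bs"] conjI allI impI)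
    fix K T u p assume *: "good m K \<sigma> T \<and> T 0 = (u, p) \<and> (\<forall>j<n + 1. u (p + int j) = bit_symbol ((False # bs) ! j))"
    then have u0: "u p = bit_symbol False" by (auto dest!: spec[of _ 0])
    have u1: "\<forall>j<n. u (p + 1 + int j) = bit_symbol (bs ! j)"
    proof (intro allI impI)
      fix j assume "j < n"
      moreover from * have "j < n \<Longrightarrow> u (p + int (Suc j)) = bit_symbol ((False # bs) ! Suc j)"
        by (metis Suc_eq_plus1 Suc_less_eq)
      ultimately show "u (p + 1 + int j) = bit_symbol (bs ! j)" by (simp add: add.assoc)
    qed
    obtain T1 where T1: "tm_step (machine m) (cfg m (st (Alt a b) False) T) = cfg m (st b False) T1"
      "T1 0 = (u, p + 1)" "good m K \<sigma> T1"
      using step_Alt[where T = T and u = u and p = p and K = K and \<sigma> = \<sigma>, OF AltR(3) _ u0] * by auto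
    from b(2)[OF T1(3,2) u1]
    show "\<exists>T'. good m K \<tau> T' \<and> T' 0 = (u, p + int (n + 1)) \<and>
        (tm_step (machine m) ^^ (n + 1)) (cfg m (st (Alt a b) False) T) = cfg m (st Skip False) T'"
      unfolding Suc_eq_plus1[symmetric] funpow_Suc_right o_def T1(1) by (simp add: add_ac)
  qed (use b in simp)
next
  case (Star0 a \<sigma>)
  show ?case
  proof (intro exI[of _ "[False]"] conjI allI impI)
    fix K T u p assume *: "good m K \<sigma> T \<and> T 0 = (u, p) \<and> (\<forall>j<1. u (p + int j) = bit_symbol ([False] ! j))"
    then have u: "u p = bit_symbol False" by simp
    from step_Star[where T = T and u = u and p = p and K = K and \<sigma> = \<sigma>, OF Star0(1) _ u] *
    show "\<exists>T'. good m K \<sigma> T' \<and> T' 0 = (u, p + int 1) \<and>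
        (tm_step (machine m) ^^ 1) (cfg m (st (Star a) False) T) = cfg m (st Skip False) T'"
      by (simp del: upt.simps map_map) blast
  qed simp
next
  case (StarS a \<sigma> k \<tau> n \<rho>)
  from StarS.IH(1)[OF allsubs_comp(3)[OF StarS(5)] StarS(6)] obtain bs1 where b1: "length bs1 = k"
    "\<And>K T u p. good m K \<sigma> T \<Longrightarrow> T 0 = (u, p) \<Longrightarrow> (\<forall>j<k. u (p + int j) = bit_symbol (bs1 ! j)) \<Longrightarrow>
      \<exists>T'. good m K \<tau> T' \<and> T' 0 = (u, p + int k) \<and> (tm_step (machine m) ^^ k) (cfg m (st a False) T) = cfg m (st Skip False) T'"
    by blast
  from StarS.IH(2)[OF StarS(5,6)] obtain bs2 where b2: "length bs2 = n"
    "\<And>K T u p. good m K \<tau> T \<Longrightarrow> T 0 = (u, p) \<Longrightarrow> (\<forall>j<n. u (p + int j) = bit_symbol (bs2 ! j)) \<Longrightarrow>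
      \<exists>T'. good m K \<rho> T' \<and> T' 0 = (u, p + int n) \<and> (tm_step (machine m) ^^ n) (cfg m (st (Star a) False) T) = cfg m (st Skip False) T'"
    by blast
  \<comment> \<open>Here the first True is a real choice: it makes \<open>Star a\<close> enter
    another round.\<close>
  let ?bs = "True # bs1 @ True # True # bs2"
  show ?case
  proof (intro exI[of _ ?bs] conjI allI impI)
    fix K T u p assume *: "good m K \<sigma> T \<and> T 0 = (u, p) \<and> (\<forall>j<k + n + 3. u (p + int j) = bit_symbol (?bs ! j))"
    then have u: "\<And>j. j < k + n + 3 \<Longrightarrow> u (p + int j) = bit_symbol (?bs ! j)" by blast
    from u[of 0] have u0: "u p = bit_symbol True" by simp
    have u1: "\<forall>j<k. u (p + 1 + int j) = bit_symbol (bs1 ! j)"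
    proof (intro allI impI)
      fix j assume "j < k" then show "u (p + 1 + int j) = bit_symbol (bs1 ! j)"
        using u[of "Suc j"] b1(1) by (simp add: nth_append add.assoc)
    qed
    from u[of "Suc k"] b1(1) have u2: "u (p + 1 + int k) = bit_symbol True" by (simp add: nth_append add.assoc)
    from u[of "Suc (Suc k)"] b1(1) have u3: "u (p + 1 + int k + 1) = bit_symbol True"
      by (simp add: nth_append add_ac)
    have u4: "\<forall>j<n. u (p + 1 + int k + 2 + int j) = bit_symbol (bs2 ! j)"
    proof (intro allI impI)
      fix j assume j: "j < n"
      have "p + 1 + int k + 2 + int j = p + int (k + 3 + j)" by simp
      then show "u (p + 1 + int k + 2 + int j) = bit_symbol (bs2 ! j)"
        using u[of "k + 3 + j"] j b1(1) by (simp add: nth_append Suc_diff_le numeral_3_eq_3 algebra_simps)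
    qed
    obtain T1 where T1: "tm_step (machine m) (cfg m (st (Star a) False) T) = cfg m (st a False) T1"
      "T1 0 = (u, p + 1)" "good m (Star a # K) \<sigma> T1"
      using step_Star[where T = T and u = u and p = p and K = K and \<sigma> = \<sigma>, OF StarS(5) _ u0] * by auto
    obtain T2 where T2: "good m (Star a # K) \<tau> T2" "T2 0 = (u, p + 1 + int k)"
      "(tm_step (machine m) ^^ k) (cfg m (st a False) T1) = cfg m (st Skip False) T2"
      using b1(2)[OF T1(3,2) u1] by blast
    obtain T3 where T3: "(tm_step (machine m) ^^ 2) (cfg m (st Skip False) T2) = cfg m (st (Star a) False) T3"
      "T3 0 = (u, p + 1 + int k + 2)" "good m K \<tau> T3"
      using step_Skip[where T = T2, OF T2(2) u2 u3 T2(1)] by auto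
    obtain T4 where T4: "good m K \<rho> T4" "T4 0 = (u, p + 1 + int k + 2 + int n)"
      "(tm_step (machine m) ^^ n) (cfg m (st (Star a) False) T3) = cfg m (st Skip False) T4"
      using b2(2)[OF T3(3,2) u4] by blast
    have e: "k + n + 3 = n + (2 + (k + 1))" by simp
    have "(tm_step (machine m) ^^ (k + n + 3)) (cfg m (st (Star a) False) T) = cfg m (st Skip False) T4"
      unfolding e funpow_add using T1(1) T2(3) T3(1) T4(3) by (simp add: o_def)
    then show "\<exists>T'. good m K \<rho> T' \<and> T' 0 = (u, p + int (k + n + 3)) \<and>
        (tm_step (machine m) ^^ (k + n + 3)) (cfg m (st (Star a) False) T) = cfg m (st Skip False) T'"
      using T4(1,2) by (intro exI[of _ T4]) (auto simp: add_ac)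
  qed (use b1 b2 in simp)
qed

section \<open>From accepting runs back to executions\<close>

primrec runs :: "com list \<Rightarrow> store \<Rightarrow> bool" where
  "runs [] \<sigma> = True"
| "runs (c # K) \<sigma> = (\<exists>n \<tau>. exec c \<sigma> n \<tau> \<and> runs K \<tau>)"

lemma step_dead:
  assumes "T 0 = (u, p)" "\<nexists>b. u p = bit_symbol b"
  shows "(tm_step (machine m) ^^ Suc n) (cfg m (st c f) T) = cfg m 3 T"
proof -
  have "u p \<noteq> 1" "u p \<noteq> 2" using assms(2) by (auto simp: bit_symbol_def split: if_splits)
  then have "next_acts m (st c f) (reads m T) = (3, Map.empty)"
    using assms(1) by (auto simp: next_acts_def ntapes_def tape_read_def)
  from machine_step[OF _ _ this] have "tm_step (machine m) (cfg m (st c f) T) = cfg m 3 T"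
    by (simp add: upd_def)
  then show ?thesis by (simp add: funpow_swap1 machine_halted del: upt.simps)
qed

lemma ctl_state:
  assumes "c \<in> allsubs m" "ctl m c f r = (q', g)"
  shows "q' = 2 \<or> q' = 3 \<or> (\<exists>c'\<in>allsubs m. \<exists>f'. q' = st c' f')"
proof (cases c)
  case (Seq a b)
  then show ?thesis using assms(2) allsubs_comp(1)[of a b m] assms(1) by auto
next
  case (Alt a b)
  then show ?thesis using assms(2) allsubs_comp(2)[of a b m] assms(1) by auto
next
  case (Star a)
  then show ?thesis using assms(2) allsubs_comp(3)[of a m] assms(1) by (auto split: if_splits)
next
  case (Pop i s)
  then show ?thesis using assms by (auto split: if_splits)
qed (use assms in \<open>auto split: if_splits\<close>)

text \<open>The certificate head advances in each step and cannot pass a symbol that is not a bit,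
  so its distance \<open>k\<close> to such a symbol bounds the remaining time. This yields the
  deadline that \<open>polytime_relation\<close> demands for arbitrary, also useless,
  certificates.\<close>

lemma machine_halts:
  assumes "c \<in> allsubs m" "T 0 = (u, p)" "\<nexists>b. u (p + int k) = bit_symbol b"
  shows "fst ((tm_step (machine m) ^^ Suc k) (cfg m (st c f) T)) \<in> {2, 3}"
  using assms
proof (induction k arbitrary: c f T p)
  case 0
  then show ?case using step_dead[where T = T and u = u and p = p and n = 0 and m = m and c = c and f = f] by simp
next
  case (Suc k)
  show ?case
  proof (cases "\<exists>b. u p = bit_symbol b")
    case False
    then show ?thesis using step_dead[where T = T and n = "Suc k" and m = m and c = c and f = f, OF Suc.prems(2)] by simp
  next
    case True
    then obtain b where b: "u p = bit_symbol b" by blast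
    obtain q' g where c: "ctl m c f (reads m T) = (q', g)" by fastforce
    let ?T = "upd (g(0 \<mapsto> (u p, Move_Right))) T"
    note s = st_step[where T = T and u = u and p = p, OF Suc.prems(1,2) b c]
    consider "q' = 2 \<or> q' = 3" | c' f' where "c' \<in> allsubs m" "q' = st c' f'"
      using ctl_state[OF Suc.prems(1) c] by blast
    then show ?thesis
    proof cases
      case 1
      then show ?thesis
        using machine_halted[where m = m and n = "Suc k", OF 1] s by (auto simp only: funpow_Suc_right o_def fst_conv)
    next
      case 2
      have "fst ((tm_step (machine m) ^^ Suc k) (cfg m (st c' f') ?T)) \<in> {2, 3}"
        by (rule Suc.IH[where T = ?T, OF 2(1) upd_0[where T = T, OF Suc.prems(2)]]) (use Suc.prems(3) in \<open>simp add: add_ac\<close>)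
      then show ?thesis unfolding funpow_Suc_right[of "Suc k"] o_def s 2(2) .
    qed
  qed
qed

lemma step_half:
  assumes "c \<in> allsubs m" "T 0 = (u, p)" "u p = bit_symbol b" "c = Skip \<or> (\<exists>i s. c = Pop i s)"
  shows "\<exists>T1. tm_step (machine m) (cfg m (st c False) T) = cfg m (st c True) T1 \<and> T1 0 = (u, p + 1)"
proof -
  obtain g where "ctl m c False (reads m T) = (st c True, g)" using assms(4) by auto
  from st_step[where T = T and u = u and p = p, OF assms(1-3) this] upd_0[where T = T, OF assms(2)] show ?thesis by blast
qed

text \<open>The claim covers a command together with its pending continuation, which is the form
  that survives a machine step. The induction is on the remaining time with all smaller values
  available, since \<open>Skip\<close> and \<open>Pop\<close> use up two steps at once.\<close>

lemma machine_runs: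
  assumes "fst ((tm_step (machine m) ^^ n) (cfg m (st c False) T)) = 2" "good m K \<sigma> T" "T 0 = (u, p)"
    "c \<in> allsubs m" "pops_nonblank m"
  shows "runs (c # K) \<sigma>"
  using assms(1-4)
proof (induction n arbitrary: c T K \<sigma> p rule: less_induct)
  case (less n)
  obtain n' where n: "n = Suc n'" using less.prems(1) by (cases n) auto
  have "\<exists>b. u p = bit_symbol b"
    by (rule ccontr) (use step_dead[where T = T and m = m and n = n' and c = c and f = False, OF less.prems(3)]
      less.prems(1) n in \<open>auto simp del: funpow.simps\<close>)
  then obtain b where b: "u p = bit_symbol b" by blast
  have n1: "fst ((tm_step (machine m) ^^ n') (tm_step (machine m) (cfg m (st c False) T))) = 2"
    using less.prems(1) unfolding n funpow_Suc_right o_def .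
  \<comment> \<open>After its first step such a command is in a state that does not accept. A second
    step must follow, and it must find a bit.\<close>
  have half: "\<exists>b k. u (p + 1) = bit_symbol b \<and> n = k + 2 \<and>
      fst ((tm_step (machine m) ^^ k) ((tm_step (machine m) ^^ 2) (cfg m (st c False) T))) = 2"
    if c: "c = Skip \<or> (\<exists>i s. c = Pop i s)"
  proof -
    obtain T1 where T1: "tm_step (machine m) (cfg m (st c False) T) = cfg m (st c True) T1" "T1 0 = (u, p + 1)"
      using step_half[where T = T, OF less.prems(4,3) b c] by blast
    obtain k where k: "n' = Suc k" using n1 T1(1) by (cases n') auto
    have "\<exists>b. u (p + 1) = bit_symbol b"
      by (rule ccontr) (use step_dead[where T = T1 and m = m and n = k and c = c and f = True, OF T1(2)]
        n1 T1(1) k in \<open>auto simp del: funpow.simps\<close>)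
    moreover have "n = k + 2" using n k by simp
    moreover have "fst ((tm_step (machine m) ^^ k) ((tm_step (machine m) ^^ 2) (cfg m (st c False) T))) = 2"
      using less.prems(1) unfolding \<open>n = k + 2\<close> funpow_add o_def .
    ultimately show ?thesis by blast
  qed
  show ?case
  proof (cases c)
    case Skip
    then obtain y k where k: "u (p + 1) = bit_symbol y" "n = k + 2"
      "fst ((tm_step (machine m) ^^ k) ((tm_step (machine m) ^^ 2) (cfg m (st Skip False) T))) = 2"
      using half by blast
    from step_Skip[where T = T, OF less.prems(3) b k(1) less.prems(2)] obtain T' where
      T': "(tm_step (machine m) ^^ 2) (cfg m (st Skip False) T) = cfg m (if K = [] then 2 else st (hd K) False) T'"
      "T' 0 = (u, p + 2)" "good m (tl K) \<sigma> T'" by blast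
    have "runs K \<sigma>"
    proof (cases K)
      case (Cons d K')
      have "runs (d # K') \<sigma>"
        by (rule less.IH[of k d T' K' \<sigma>]) (use k T' Cons less.prems(2) in \<open>auto simp: good_def\<close>)
      then show ?thesis using Cons by simp
    qed simp
    moreover have "exec Skip \<sigma> 0 \<sigma>" by (rule exec.Skip)
    ultimately show ?thesis using Skip by auto
  next
    case (Push i s)
    from step_Push[where T = T, OF less.prems(4)[unfolded Push] less.prems(3) b less.prems(2)] obtain T' where
      T': "tm_step (machine m) (cfg m (st (Push i s) False) T) = cfg m (st Skip False) T'"
      "T' 0 = (u, p + 1)" "good m K (\<sigma>(i := s # \<sigma> i)) T'" by blast
    have "runs (Skip # K) (\<sigma>(i := s # \<sigma> i))"
      by (rule less.IH[OF _ _ T'(3,2)]) (use n n1 T'(1) Push in auto)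
    then have "runs K (\<sigma>(i := s # \<sigma> i))" by (auto elim: exec.cases)
    then show ?thesis using exec.Push[of i s \<sigma>] Push by auto
  next
    case (Pop i s)
    then obtain y k where k: "u (p + 1) = bit_symbol y" "n = k + 2"
      "fst ((tm_step (machine m) ^^ k) ((tm_step (machine m) ^^ 2) (cfg m (st (Pop i s) False) T))) = 2"
      using half by blast
    have s: "s \<noteq> 0" using less.prems(4) Pop assms(5) pops_nonblank_subs by (fastforce simp: allsubs_def)
    from step_Pop[where T = T, OF less.prems(4)[unfolded Pop] less.prems(3) b k(1) less.prems(2) s] obtain T' where
      T': "(tm_step (machine m) ^^ 2) (cfg m (st (Pop i s) False) T) =
        cfg m (if \<sigma> i \<noteq> [] \<and> hd (\<sigma> i) = s then st Skip False else 3) T'"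
      "T' 0 = (u, p + 2)" "good m K (\<sigma>(i := tl (\<sigma> i))) T'" by blast
    have top: "\<sigma> i \<noteq> [] \<and> hd (\<sigma> i) = s"
      using k(3) T'(1) machine_halted[where m = m and n = k and q = 3] by (auto split: if_splits)
    have "runs (Skip # K) (\<sigma>(i := tl (\<sigma> i)))"
      by (rule less.IH[OF _ _ T'(3,2), of k]) (use k T'(1) top in auto)
    then have "runs K (\<sigma>(i := tl (\<sigma> i)))" by (auto elim: exec.cases)
    moreover have "exec (Pop i s) \<sigma> 2 (\<sigma>(i := tl (\<sigma> i)))" using top by (intro exec.Pop) auto
    ultimately show ?thesis using Pop by auto
  next
    case (Seq c1 c2)
    from step_Seq[where T = T, OF less.prems(4)[unfolded Seq] less.prems(3) b less.prems(2)] obtain T' where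
      T': "tm_step (machine m) (cfg m (st (c1 ;; c2) False) T) = cfg m (st c1 False) T'"
      "T' 0 = (u, p + 1)" "good m (c2 # K) \<sigma> T'" by blast
    have "runs (c1 # c2 # K) \<sigma>"
      by (rule less.IH[of n' c1 T']) (use n n1 T' Seq less.prems(4) allsubs_comp(1)[of c1 c2 m] in auto)
    then show ?thesis using Seq by (auto intro: exec.Seq)
  next
    case (Alt c1 c2)
    from step_Alt[where T = T, OF less.prems(4)[unfolded Alt] less.prems(3) b less.prems(2)] obtain T' where
      T': "tm_step (machine m) (cfg m (st (Alt c1 c2) False) T) = cfg m (st (if b then c1 else c2) False) T'"
      "T' 0 = (u, p + 1)" "good m K \<sigma> T'" by blast
    have "runs ((if b then c1 else c2) # K) \<sigma>"
      by (rule less.IH[of n' _ T']) (use n n1 T' Alt less.prems(4) allsubs_comp(2)[of c1 c2 m] in auto)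
    then show ?thesis using Alt by (cases b) (auto intro: exec.AltL exec.AltR)
  next
    case (Star a)
    from step_Star[where T = T, OF less.prems(4)[unfolded Star] less.prems(3) b less.prems(2)] obtain T' where
      T': "tm_step (machine m) (cfg m (st (Star a) False) T) = cfg m (st (if b then a else Skip) False) T'"
      "T' 0 = (u, p + 1)" "good m (if b then Star a # K else K) \<sigma> T'" by blast
    have "runs ((if b then a else Skip) # (if b then Star a # K else K)) \<sigma>"
      by (rule less.IH[of n' _ T']) (use n n1 T' Star less.prems(4) allsubs_comp(3)[of a m] in auto)
    then show ?thesis using Star by (cases b) (auto intro: exec.Star0 exec.StarS elim: exec.cases[of Skip])
  qed
qed

section \<open>Copying the input, and membership in NP from a program\<close>

definition init_store :: "bool list \<Rightarrow> store" where
  "init_store w = (\<lambda>i. if i = 0 then map bit_symbol (rev w) @ [3] else [])"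

lemma good_empty: "(\<And>k. k \<noteq> 0 \<Longrightarrow> T k = input_tape []) \<Longrightarrow> good m [] (\<lambda>_. []) T"
  by (simp add: good_def on_stack_def input_tape_def)

lemma machine_copy:
  fixes w c :: "bool list"
  defines "u \<equiv> fst (input_tape (pair_word w c))"
  shows "j \<le> length w \<Longrightarrow> \<exists>T. (tm_step (machine m) ^^ Suc j) (tm_init (machine m) (pair_word w c)) = cfg m 1 T \<and>
     T 0 = (u, int j) \<and> good m [] (init_store (take j w)) T"
proof (induction j)
  case 0
  define T :: "nat \<Rightarrow> tape" where "T = (\<lambda>k. if k = 0 then input_tape (pair_word w c) else input_tape [])"
  have T0: "T 0 = (u, 0)" by (simp add: T_def u_def input_tape_def)
  have i: "tm_init (machine m) (pair_word w c) = cfg m 0 T" by (simp add: tm_init_def T_def)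
  have g: "good m [] (\<lambda>_. []) T" by (rule good_empty) (simp add: T_def)
  have "next_acts m 0 (reads m T) = (1, [2 \<mapsto> (3, Move_Right)])" by (simp add: next_acts_def)
  from machine_step[OF _ _ this]
  have s: "tm_step (machine m) (cfg m 0 T) = cfg m 1 (upd [2 \<mapsto> (3, Move_Right)] T)" by simp
  have "good m [] (init_store (take 0 w)) (upd [2 \<mapsto> (3, Move_Right)] T)"
    using g by (auto simp: good_def init_store_def upd_def on_stack_push)
  moreover have "upd [2 \<mapsto> (3, Move_Right)] T 0 = (u, int 0)" using T0 by (simp add: upd_def)
  ultimately show ?case using s i by auto
next
  case (Suc j)
  then obtain T where T: "(tm_step (machine m) ^^ Suc j) (tm_init (machine m) (pair_word w c)) = cfg m 1 T"
     "T 0 = (u, int j)" "good m [] (init_store (take j w)) T" by auto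
  have u: "u (int j) = bit_symbol (w ! j)"
    using Suc.prems by (simp add: u_def input_tape_def pair_word_def nth_append)
  then have r: "reads m T 0 = bit_symbol (w ! j)" "bit_symbol (w ! j) = 1 \<or> bit_symbol (w ! j) = 2"
    using T(2) by (auto simp: ntapes_def tape_read_def bit_symbol_def)
  let ?g = "[0 \<mapsto> (bit_symbol (w ! j), Move_Right), 2 \<mapsto> (bit_symbol (w ! j), Move_Right)]"
  have "next_acts m 1 (reads m T) = (1, ?g)" using r(2) unfolding next_acts_def r(1) by auto
  from machine_step[OF _ _ this]
  have s: "tm_step (machine m) (cfg m 1 T) = cfg m 1 (upd ?g T)" by simp
  have "init_store (take (Suc j) w) = (init_store (take j w))(0 := bit_symbol (w ! j) # init_store (take j w) 0)"
    using Suc.prems by (auto simp: init_store_def take_Suc_conv_app_nth)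
  then have "good m [] (init_store (take (Suc j) w)) (upd ?g T)"
    using T(3) by (auto simp: good_def upd_def on_stack_push)
  moreover have "upd ?g T 0 = (u, int (Suc j))" using T(2) u by (auto simp: upd_def tape_act_def)
  ultimately show ?case using s T(1) by auto
qed

lemma machine_start:
  fixes w c :: "bool list"
  defines "u \<equiv> fst (input_tape (pair_word w c))"
  shows "\<exists>T. (tm_step (machine m) ^^ (length w + 2)) (tm_init (machine m) (pair_word w c)) = cfg m (st m False) T \<and>
     T 0 = (u, int (length w) + 1) \<and> good m [] (init_store w) T"
proof -
  obtain T where T: "(tm_step (machine m) ^^ Suc (length w)) (tm_init (machine m) (pair_word w c)) = cfg m 1 T"
     "T 0 = (u, int (length w))" "good m [] (init_store w) T"
    using machine_copy[of "length w" w m c] by (auto simp: u_def)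
  have u: "u (int (length w)) = 3" by (simp add: u_def input_tape_def pair_word_def nth_append)
  then have r: "reads m T 0 = 3" using T(2) by (simp add: ntapes_def tape_read_def)
  have "next_acts m 1 (reads m T) = (st m False, [0 \<mapsto> (3, Move_Right)])" unfolding next_acts_def r by simp
  from machine_step[OF _ _ this]
  have s: "tm_step (machine m) (cfg m 1 T) = cfg m (st m False) (upd [0 \<mapsto> (3, Move_Right)] T)" by simp
  have "good m [] (init_store w) (upd [0 \<mapsto> (3, Move_Right)] T)" using T(3) by (simp add: good_def upd_def)
  moreover have "upd [0 \<mapsto> (3, Move_Right)] T 0 = (u, int (length w) + 1)"
    using T(2) u by (auto simp: upd_def tape_act_def)
  moreover have "(tm_step (machine m) ^^ (length w + 2)) (tm_init (machine m) (pair_word w c)) =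
      cfg m (st m False) (upd [0 \<mapsto> (3, Move_Right)] T)"
    using s T(1) by simp
  ultimately show ?thesis by blast
qed

text \<open>The deadline \<open>length w + length c + 3\<close> is made of
  \<open>length w + 2\<close> steps for copying and \<open>length c + 1\<close> steps after which
  the certificate is exhausted. An accepting run is an execution whatever its length, hence
  \<open>sound\<close> has no time bound; only \<open>complete\<close> has to provide a short
  one.\<close>

theorem NP_of_com:
  assumes nonblank: "pops_nonblank m"
    and sound: "\<And>w n \<tau>. exec m (init_store w) n \<tau> \<Longrightarrow> w \<in> L"
    and complete: "\<And>w. w \<in> L \<Longrightarrow> \<exists>n \<tau>. exec m (init_store w) n \<tau> \<and> n \<le> poly q (length w)"
  shows "L \<in> NP"
proof -
  define V where "V w c \<longleftrightarrow> tm_state_after (machine m) (pair_word w c) (length w + length c + 3) = 2" for w c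
  have split: "tm_state_after (machine m) (pair_word w c) (length w + length c + 3) =
      fst ((tm_step (machine m) ^^ Suc (length c)) (cfg m (st m False) T))"
    if "(tm_step (machine m) ^^ (length w + 2)) (tm_init (machine m) (pair_word w c)) = cfg m (st m False) T" for w c T
  proof -
    have e: "length w + length c + 3 = Suc (length c) + (length w + 2)" by simp
    show ?thesis unfolding tm_state_after_def e funpow_add[of "Suc (length c)"] o_def that ..
  qed
  have "tm_state_after (machine m) (pair_word w c) (length w + length c + 3) \<in> {2, 3}" for w c
  proof -
    obtain T where T: "(tm_step (machine m) ^^ (length w + 2)) (tm_init (machine m) (pair_word w c)) = cfg m (st m False) T"
      "T 0 = (fst (input_tape (pair_word w c)), int (length w) + 1)"
      using machine_start[of w m c] by blast
    have "fst (input_tape (pair_word w c)) (int (length w) + 1 + int (length c)) = 0"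
      by (simp add: input_tape_def pair_word_def)
    then have "\<nexists>b. fst (input_tape (pair_word w c)) (int (length w) + 1 + int (length c)) = bit_symbol b"
      by (simp add: bit_symbol_def)
    from machine_halts[where T = T, OF _ T(2) this, of m m False] show ?thesis
      unfolding split[OF T(1)] by simp
  qed
  then have "polytime_relation V"
    unfolding polytime_relation_def
    by (intro exI[of _ "machine m"] exI[of _ "[:3, 1:]"] conjI wf_machine) (auto simp: V_def add_ac)
  moreover have "w \<in> L \<longleftrightarrow> (\<exists>c. length c \<le> poly (q + 2) (length w) \<and> V w c)" for w
  proof
    assume "w \<in> L"
    then obtain n \<tau> where n: "exec m (init_store w) n \<tau>" "n \<le> poly q (length w)" using complete by blast
    obtain bs where bs: "length bs = n" "\<And>K T u p. good m K (init_store w) T \<Longrightarrow> T 0 = (u, p) \<Longrightarrow>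
        (\<forall>j<n. u (p + int j) = bit_symbol (bs ! j)) \<Longrightarrow> \<exists>T'. good m K \<tau> T' \<and> T' 0 = (u, p + int n) \<and>
        (tm_step (machine m) ^^ n) (cfg m (st m False) T) = cfg m (st Skip False) T'"
      using exec_machine[OF n(1) _ nonblank] by auto
    \<comment> \<open>The two further bits serve the last \<open>Skip\<close>, which finds the
      control stack empty and accepts.\<close>
    define c where "c = bs @ [True, True]"
    let ?u = "fst (input_tape (pair_word w c))"
    obtain T where T: "(tm_step (machine m) ^^ (length w + 2)) (tm_init (machine m) (pair_word w c)) = cfg m (st m False) T"
      "T 0 = (?u, int (length w) + 1)" "good m [] (init_store w) T"
      using machine_start[of w m c] by blast
    have u: "?u (int (length w) + 1 + int j) = bit_symbol (c ! j)" if "j < length c" for j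
    proof -
      have e: "int (length w) + 1 + int j = int (length w + 1 + j)" by simp
      show ?thesis unfolding e input_tape_def pair_word_def fst_conv nat_int using that
        by (simp add: nth_append del: of_nat_add)
    qed
    have "\<forall>j<n. ?u (int (length w) + 1 + int j) = bit_symbol (bs ! j)"
      using bs(1) u by (auto simp: c_def nth_append)
    from bs(2)[OF T(3,2) this] obtain T' where T': "good m [] \<tau> T'" "T' 0 = (?u, int (length w) + 1 + int n)"
        "(tm_step (machine m) ^^ n) (cfg m (st m False) T) = cfg m (st Skip False) T'" by blast
    have u2: "?u (int (length w) + 1 + int n) = bit_symbol True" "?u (int (length w) + 1 + int n + 1) = bit_symbol True"
      using u[of n] u[of "Suc n"] bs(1) by (auto simp: c_def nth_append add_ac)
    obtain T'' where "(tm_step (machine m) ^^ 2) (cfg m (st Skip False) T') = cfg m 2 T''"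
      using step_Skip[where T = T', OF T'(2) u2 T'(1)] by auto
    then have "(tm_step (machine m) ^^ (1 + (2 + n))) (cfg m (st m False) T) = cfg m 2 T''"
      unfolding funpow_add o_def T'(3) using machine_halted[where m = m and n = 1 and q = 2] by simp
    then have "V w c" unfolding V_def split[OF T(1)] using bs(1) by (simp add: c_def)
    moreover have "length c \<le> poly (q + 2) (length w)" using n(2) bs(1) by (simp add: c_def)
    ultimately show "\<exists>c. length c \<le> poly (q + 2) (length w) \<and> V w c" by blast
  next
    assume "\<exists>c. length c \<le> poly (q + 2) (length w) \<and> V w c"
    then obtain c where c: "V w c" by blast
    obtain T where T: "(tm_step (machine m) ^^ (length w + 2)) (tm_init (machine m) (pair_word w c)) = cfg m (st m False) T"
      "T 0 = (fst (input_tape (pair_word w c)), int (length w) + 1)" "good m [] (init_store w) T"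
      using machine_start[of w m c] by blast
    have "runs [m] (init_store w)"
      by (rule machine_runs[where T = T, OF _ T(3,2) _ nonblank])
        (use c in \<open>auto simp: V_def split[OF T(1)] simp del: funpow.simps\<close>)
    then show "w \<in> L" using sound by auto
  qed
  ultimately show ?thesis unfolding NP_def by blast
qed

section \<open>Stacks of binary numbers\<close>

text \<open>Programs are analysed twice: \<open>runs_to\<close> inverts arbitrary executions for
  soundness and forgets time, while \<open>reach\<close> exhibits one execution together with an
  upper bound on its cost for completeness.\<close>

definition runs_to :: "com \<Rightarrow> store \<Rightarrow> store \<Rightarrow> bool" where
  "runs_to c \<sigma> \<tau> \<longleftrightarrow> (\<exists>n. exec c \<sigma> n \<tau>)"

definition reach :: "com \<Rightarrow> store \<Rightarrow> store \<Rightarrow> nat \<Rightarrow> bool" where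
  "reach c \<sigma> \<tau> k \<longleftrightarrow> (\<exists>n\<le>k. exec c \<sigma> n \<tau>)"

lemma reach_mono: "reach c \<sigma> \<tau> k \<Longrightarrow> k \<le> k' \<Longrightarrow> reach c \<sigma> \<tau> k'"
  by (meson reach_def le_trans)

lemma runs_Skip [simp]: "runs_to Skip \<sigma> \<tau> \<longleftrightarrow> \<tau> = \<sigma>"
  unfolding runs_to_def by (subst exec.simps) auto

lemma runs_Push [simp]: "runs_to (Push i s) \<sigma> \<tau> \<longleftrightarrow> \<tau> = \<sigma>(i := s # \<sigma> i)"
  unfolding runs_to_def by (subst exec.simps) auto

lemma runs_Pop [simp]: "runs_to (Pop i s) \<sigma> \<tau> \<longleftrightarrow> (\<exists>l. \<sigma> i = s # l \<and> \<tau> = \<sigma>(i := l))"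
  unfolding runs_to_def by (subst exec.simps) auto

lemma runs_Seq [simp]: "runs_to (a ;; b) \<sigma> \<tau> \<longleftrightarrow> (\<exists>\<rho>. runs_to a \<sigma> \<rho> \<and> runs_to b \<rho> \<tau>)"
  unfolding runs_to_def by (subst exec.simps) auto

lemma runs_Alt [simp]: "runs_to (Alt a b) \<sigma> \<tau> \<longleftrightarrow> runs_to a \<sigma> \<tau> \<or> runs_to b \<sigma> \<tau>"
  unfolding runs_to_def by (subst exec.simps) auto

lemma runs_Star_induct [consumes 1, case_names Nil Cons]:
  assumes "runs_to (Star a) \<sigma> \<tau>" "\<And>\<sigma>. P \<sigma> \<sigma>"
    "\<And>\<sigma> \<rho> \<tau>. runs_to a \<sigma> \<rho> \<Longrightarrow> runs_to (Star a) \<rho> \<tau> \<Longrightarrow> P \<rho> \<tau> \<Longrightarrow> P \<sigma> \<tau>"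
  shows "P \<sigma> \<tau>"
proof -
  obtain n where "exec (Star a) \<sigma> n \<tau>" using assms(1) by (auto simp: runs_to_def)
  then show ?thesis
  proof (induction "Star a" \<sigma> n \<tau>)
    case (StarS \<sigma> m \<tau> n \<rho>)
    then show ?case using assms(3) unfolding runs_to_def by blast
  qed (rule assms(2))
qed

lemma reach_Skip: "reach Skip \<sigma> \<sigma> k"
  unfolding reach_def by (intro exI[of _ 0]) (auto intro: exec.Skip)

lemma reach_Push: "1 \<le> k \<Longrightarrow> \<tau> = \<sigma>(i := s # \<sigma> i) \<Longrightarrow> reach (Push i s) \<sigma> \<tau> k"
  unfolding reach_def by (intro exI[of _ 1]) (auto intro: exec.Push[simplified])

lemma reach_Pop: "2 \<le> k \<Longrightarrow> \<sigma> i = s # l \<Longrightarrow> \<tau> = \<sigma>(i := l) \<Longrightarrow> reach (Pop i s) \<sigma> \<tau> k"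
  unfolding reach_def by (intro exI[of _ 2]) (auto intro: exec.Pop)

lemma reach_Seq: "reach a \<sigma> \<rho> k \<Longrightarrow> reach b \<rho> \<tau> l \<Longrightarrow> k + l + 3 \<le> q \<Longrightarrow> reach (a ;; b) \<sigma> \<tau> q"
  unfolding reach_def by (meson exec.Seq add_le_mono le_trans order_refl)

lemma reach_AltL: "reach a \<sigma> \<tau> k \<Longrightarrow> k + 1 \<le> q \<Longrightarrow> reach (Alt a b) \<sigma> \<tau> q"
  unfolding reach_def by (meson exec.AltL add_le_mono le_trans order_refl)

lemma reach_AltR: "reach b \<sigma> \<tau> k \<Longrightarrow> k + 1 \<le> q \<Longrightarrow> reach (Alt a b) \<sigma> \<tau> q"
  unfolding reach_def by (meson exec.AltR add_le_mono le_trans order_refl)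

lemma reach_Star0: "1 \<le> k \<Longrightarrow> reach (Star a) \<sigma> \<sigma> k"
  unfolding reach_def by (meson exec.Star0)

lemma reach_StarS: "reach a \<sigma> \<rho> k \<Longrightarrow> reach (Star a) \<rho> \<tau> l \<Longrightarrow> k + l + 3 \<le> q \<Longrightarrow> reach (Star a) \<sigma> \<tau> q"
  unfolding reach_def by (meson exec.StarS add_le_mono le_trans order_refl)

text \<open>The sequence \<open>f\<close> lists the stores between the rounds. Since
  \<open>StarS\<close> adds a round at the front, the induction proceeds from the last round
  backwards.\<close>

lemma reach_Star:
  assumes "\<And>i. i < m \<Longrightarrow> reach a (f i) (f (Suc i)) k" "m * (k + 3) + 1 \<le> q"
  shows "reach (Star a) (f 0) (f m) q"
proof -
  have "reach (Star a) (f (m - j)) (f m) (j * (k + 3) + 1)" if "j \<le> m" for j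
    using that
  proof (induction j)
    case (Suc j)
    have "reach a (f (m - Suc j)) (f (Suc (m - Suc j))) k" using Suc.prems by (intro assms(1)) auto
    moreover have "Suc (m - Suc j) = m - j" using Suc.prems by simp
    ultimately have "reach a (f (m - Suc j)) (f (m - j)) k" by simp
    from reach_StarS[OF this Suc.IH] Suc.prems show ?case by simp
  qed (auto intro: reach_Star0)
  from this[of m] show ?thesis using assms(2) reach_mono by auto
qed

section \<open>Digit strings on stacks and their transfer\<close>

definition enc :: "bool list \<Rightarrow> nat list" where
  "enc ds = map bit_symbol ds @ [3]"

type_synonym dstore = "nat \<Rightarrow> bool list list"

definition E :: "dstore \<Rightarrow> store" where
  "E d = (\<lambda>i. concat (map enc (d i)))"

lemma bit_symbol_simps [simp]: "bit_symbol b \<noteq> 3" "bit_symbol b \<noteq> 0" "bit_symbol b = bit_symbol c \<longleftrightarrow> b = c"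
  "3 \<noteq> bit_symbol b"
  by (auto simp: bit_symbol_def)

text \<open>The end mark is not a bit, so a stack of terminated digit strings can be parsed in only
  one way.\<close>

lemma enc_prefix: "map bit_symbol ds @ 3 # l = map bit_symbol es @ 3 # r \<longleftrightarrow> ds = es \<and> l = r"
proof (induction ds arbitrary: es)
  case Nil
  then show ?case by (cases es) auto
next
  case (Cons a ds)
  then show ?case by (cases es) auto
qed

lemma E_top: "E d i = map bit_symbol ds @ 3 # l \<longleftrightarrow> (\<exists>r. d i = ds # r \<and> l = concat (map enc r))"
  by (cases "d i") (auto simp: E_def enc_def enc_prefix)

primrec pushes :: "nat list \<Rightarrow> nat \<Rightarrow> com" where
  "pushes [] s = Skip"
| "pushes (q # qs) s = Push q s ;; pushes qs s"

primrec pops :: "nat list \<Rightarrow> nat \<Rightarrow> com" where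
  "pops [] s = Skip"
| "pops (q # qs) s = Pop q s ;; pops qs s"

lemma runs_pushes: "distinct qs \<Longrightarrow>
    runs_to (pushes qs s) \<sigma> \<tau> \<longleftrightarrow> \<tau> = (\<lambda>i. if i \<in> set qs then s # \<sigma> i else \<sigma> i)"
proof (induction qs arbitrary: \<sigma>)
  case (Cons q qs)
  have e: "(\<lambda>i. if i \<in> set qs then s # (\<sigma>(q := s # \<sigma> q)) i else (\<sigma>(q := s # \<sigma> q)) i) =
      (\<lambda>i. if i \<in> set (q # qs) then s # \<sigma> i else \<sigma> i)"
    using Cons.prems by auto
  have "runs_to (pushes (q # qs) s) \<sigma> \<tau> \<longleftrightarrow> runs_to (pushes qs s) (\<sigma>(q := s # \<sigma> q)) \<tau>" by simp
  then show ?case using Cons e by simp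
qed auto

lemma runs_pops: "distinct qs \<Longrightarrow>
    runs_to (pops qs s) \<sigma> \<tau> \<longleftrightarrow> (\<forall>q\<in>set qs. \<exists>l. \<sigma> q = s # l) \<and> \<tau> = (\<lambda>i. if i \<in> set qs then tl (\<sigma> i) else \<sigma> i)"
proof (induction qs arbitrary: \<sigma>)
  case (Cons q qs)
  have e: "(\<lambda>i. if i \<in> set qs then tl ((\<sigma>(q := l)) i) else (\<sigma>(q := l)) i) =
      (\<lambda>i. if i \<in> set (q # qs) then tl (\<sigma> i) else \<sigma> i)" if "\<sigma> q = s # l" for l
    using that Cons.prems by auto
  have "runs_to (pops (q # qs) s) \<sigma> \<tau> \<longleftrightarrow> (\<exists>l. \<sigma> q = s # l \<and> runs_to (pops qs s) (\<sigma>(q := l)) \<tau>)"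
    by (simp del: fun_upd_apply) blast
  also have "\<dots> \<longleftrightarrow> (\<exists>l. \<sigma> q = s # l \<and> (\<forall>p\<in>set qs. \<exists>l'. (\<sigma>(q := l)) p = s # l') \<and>
      \<tau> = (\<lambda>i. if i \<in> set qs then tl ((\<sigma>(q := l)) i) else (\<sigma>(q := l)) i))"
    using Cons.IH Cons.prems by (simp del: fun_upd_apply)
  also have "\<dots> \<longleftrightarrow> (\<exists>l. \<sigma> q = s # l \<and> (\<forall>p\<in>set qs. \<exists>l'. \<sigma> p = s # l') \<and>
      \<tau> = (\<lambda>i. if i \<in> set (q # qs) then tl (\<sigma> i) else \<sigma> i))"
    using e Cons.prems by (intro ex_cong conj_cong refl arg_cong2[of _ _ _ _ "(=)"] ball_cong) auto
  also have "\<dots> \<longleftrightarrow> (\<forall>p\<in>set (q # qs). \<exists>l. \<sigma> p = s # l) \<and> \<tau> = (\<lambda>i. if i \<in> set (q # qs) then tl (\<sigma> i) else \<sigma> i)"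
    by auto
  finally show ?case .
qed auto

lemma reach_pushes: "distinct qs \<Longrightarrow> \<tau> = (\<lambda>i. if i \<in> set qs then s # \<sigma> i else \<sigma> i) \<Longrightarrow>
    4 * length qs \<le> k \<Longrightarrow> reach (pushes qs s) \<sigma> \<tau> k"
proof (induction qs arbitrary: \<sigma> k)
  case (Cons q qs)
  show ?case
    by (simp, rule reach_Seq[OF reach_Push[OF order_refl refl] Cons.IH[OF _ _ order_refl]]) (use Cons.prems in auto)
qed (auto intro: reach_Skip)

lemma reach_pops: "distinct qs \<Longrightarrow> (\<And>q. q \<in> set qs \<Longrightarrow> \<exists>l. \<sigma> q = s # l) \<Longrightarrow>
    \<tau> = (\<lambda>i. if i \<in> set qs then tl (\<sigma> i) else \<sigma> i) \<Longrightarrow> 5 * length qs \<le> k \<Longrightarrow> reach (pops qs s) \<sigma> \<tau> k"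
proof (induction qs arbitrary: \<sigma> k)
  case (Cons q qs)
  have q: "\<sigma> q = s # tl (\<sigma> q)" using Cons.prems(2)[of q] by auto
  show ?case
    by (simp, rule reach_Seq[OF reach_Pop[where i = q and \<sigma> = \<sigma>, OF order_refl q refl] Cons.IH[OF _ _ _ order_refl]]) (use Cons.prems in auto)
qed (auto intro: reach_Skip)

definition branch :: "(bool \<Rightarrow> com) \<Rightarrow> com" where
  "branch f = Alt (f False) (f True)"

lemma runs_branch [simp]: "runs_to (branch f) \<sigma> \<tau> \<longleftrightarrow> (\<exists>b. runs_to (f b) \<sigma> \<tau>)"
  by (simp add: branch_def ex_bool_eq disj_commute)

lemma reach_branch: "reach (f b) \<sigma> \<tau> k \<Longrightarrow> k + 1 \<le> q \<Longrightarrow> reach (branch f) \<sigma> \<tau> q"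
  unfolding branch_def by (cases b) (auto intro: reach_AltL reach_AltR)

text \<open>Transferring reverses the digits. With no sources it pushes a guessed number, with no targets
  it checks that the sources agree.\<close>

definition xfer_loop :: "nat list \<Rightarrow> nat list \<Rightarrow> com" where
  "xfer_loop ps qs = Star (branch (\<lambda>b. pops ps (bit_symbol b) ;; pushes qs (bit_symbol b)))"

definition Xfer :: "nat list \<Rightarrow> nat list \<Rightarrow> com" where
  "Xfer ps qs = pushes qs 3 ;; xfer_loop ps qs ;; pops ps 3"

definition moved :: "nat list \<Rightarrow> nat list \<Rightarrow> bool list \<Rightarrow> dstore \<Rightarrow> dstore" where
  "moved ps qs ds d = (\<lambda>i. if i \<in> set ps then tl (d i) else if i \<in> set qs then rev ds # d i else d i)"

definition loop_moved :: "nat list \<Rightarrow> nat list \<Rightarrow> bool list \<Rightarrow> store \<Rightarrow> store" where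
  "loop_moved ps qs bs \<sigma> = (\<lambda>i. if i \<in> set ps then drop (length bs) (\<sigma> i)
     else if i \<in> set qs then map bit_symbol (rev bs) @ \<sigma> i else \<sigma> i)"

lemma runs_xfer_loop:
  assumes "distinct ps" "distinct qs" "set ps \<inter> set qs = {}" "runs_to (xfer_loop ps qs) \<sigma> \<tau>"
  shows "\<exists>bs. (\<forall>p\<in>set ps. \<exists>l. \<sigma> p = map bit_symbol bs @ l) \<and> \<tau> = loop_moved ps qs bs \<sigma>"
  using assms(4) unfolding xfer_loop_def
proof (induction rule: runs_Star_induct)
  case (Nil \<sigma>)
  then show ?case by (intro exI[of _ "[]"]) (auto simp: loop_moved_def)
next
  case (Cons \<sigma> \<rho> \<tau>)
  obtain bs where bs: "\<forall>p\<in>set ps. \<exists>l. \<rho> p = map bit_symbol bs @ l" "\<tau> = loop_moved ps qs bs \<rho>"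
    using Cons(3) by blast
  obtain b where b: "\<forall>p\<in>set ps. \<exists>l. \<sigma> p = bit_symbol b # l"
    "\<rho> = (\<lambda>i. if i \<in> set qs then bit_symbol b # (if i \<in> set ps then tl (\<sigma> i) else \<sigma> i)
      else if i \<in> set ps then tl (\<sigma> i) else \<sigma> i)"
    using Cons(1) assms(1,2) by (auto simp: runs_pushes runs_pops)
  have "\<exists>l. \<sigma> p = map bit_symbol (b # bs) @ l" if p: "p \<in> set ps" for p
  proof -
    obtain l where "\<sigma> p = bit_symbol b # l" using b(1) p by blast
    moreover have "\<rho> p = tl (\<sigma> p)" using b(2) p assms(3) by auto
    moreover obtain l' where "\<rho> p = map bit_symbol bs @ l'" using bs(1) p by blast
    ultimately show ?thesis by auto
  qed
  moreover have "\<tau> = loop_moved ps qs (b # bs) \<sigma>"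
  proof
    fix i
    consider "i \<in> set ps" "i \<notin> set qs" | "i \<in> set qs" "i \<notin> set ps" | "i \<notin> set ps" "i \<notin> set qs"
      using assms(3) by blast
    then show "\<tau> i = loop_moved ps qs (b # bs) \<sigma> i"
      by cases (simp_all add: b(2) bs(2) loop_moved_def drop_Suc)
  qed
  ultimately show ?case by blast
qed

lemma reach_xfer_loop:
  assumes "distinct ps" "distinct qs" "set ps \<inter> set qs = {}" "\<And>p. p \<in> set ps \<Longrightarrow> \<exists>l. \<sigma> p = map bit_symbol bs @ l"
    "length bs * (5 * length ps + 4 * length qs + 7) + 1 \<le> k"
  shows "reach (xfer_loop ps qs) \<sigma> (loop_moved ps qs bs \<sigma>) k"
proof -
  define f where "f j = loop_moved ps qs (take j bs) \<sigma>" for j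
  have f0: "f 0 = \<sigma>" by (auto simp: f_def loop_moved_def)
  have fl: "f (length bs) = loop_moved ps qs bs \<sigma>" by (simp add: f_def)
  have "reach (xfer_loop ps qs) (f 0) (f (length bs)) k"
    unfolding xfer_loop_def
  proof (rule reach_Star[where k = "5 * length ps + 4 * length qs + 4"])
    fix j assume j: "j < length bs"
    define \<rho> where "\<rho> = (\<lambda>i. if i \<in> set ps then tl (f j i) else f j i)"
    have fp: "f j p = bit_symbol (bs ! j) # drop (Suc j) (\<sigma> p)" if that_p: "p \<in> set ps" for p
    proof -
      obtain l where l: "\<sigma> p = map bit_symbol bs @ l" using assms(4)[OF that_p] by blast
      have "f j p = drop j (\<sigma> p)" using that_p j by (simp add: f_def loop_moved_def)
      moreover have "\<sigma> p ! j = bit_symbol (bs ! j)" "j < length (\<sigma> p)" using l j by (simp_all add: nth_append)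
      ultimately show ?thesis by (metis Cons_nth_drop_Suc)
    qed
    have "f (Suc j) = (\<lambda>i. if i \<in> set qs then bit_symbol (bs ! j) # \<rho> i else \<rho> i)"
    proof
      fix i show "f (Suc j) i = (if i \<in> set qs then bit_symbol (bs ! j) # \<rho> i else \<rho> i)"
      proof (cases "i \<in> set ps")
        case True
        then have "i \<notin> set qs" using assms(3) by auto
        then show ?thesis using True fp[OF True] j by (simp add: \<rho>_def f_def loop_moved_def)
      next
        case False
        then show ?thesis using j by (auto simp: \<rho>_def f_def loop_moved_def take_Suc_conv_app_nth)
      qed
    qed
    then show "reach (branch (\<lambda>b. pops ps (bit_symbol b) ;; pushes qs (bit_symbol b))) (f j) (f (Suc j))
        (5 * length ps + 4 * length qs + 4)"
      by (intro reach_branch[where b = "bs ! j" and k = "5 * length ps + 4 * length qs + 3"]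
          reach_Seq[OF reach_pops[OF assms(1) _ \<rho>_def order_refl] reach_pushes[OF assms(2) _ order_refl]]) (use fp in auto)
  qed (use assms(5) in \<open>simp add: add_ac\<close>)
  then show ?thesis by (simp add: f0 fl)
qed

text \<open>The loop may stop after any number of digits, but the final pops of the mark 3 succeed
  only if every source has been moved completely. With several sources all of them then hold the
  same digits, which is how equality gets tested.\<close>

lemma runs_Xfer:
  assumes "distinct ps" "distinct qs" "set ps \<inter> set qs = {}" "runs_to (Xfer ps qs) (E d) \<tau>"
  shows "\<exists>ds. (\<forall>p\<in>set ps. d p \<noteq> [] \<and> hd (d p) = ds) \<and> \<tau> = E (moved ps qs ds d)"
proof -
  define \<sigma> where "\<sigma> = (\<lambda>i. if i \<in> set qs then 3 # E d i else E d i)"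
  from assms(4) obtain \<rho> where r: "runs_to (xfer_loop ps qs) \<sigma> \<rho>" "runs_to (pops ps 3) \<rho> \<tau>"
    by (auto simp: Xfer_def runs_pushes[OF assms(2)] \<sigma>_def)
  from runs_xfer_loop[OF assms(1-3) r(1)] obtain bs where
    bs: "\<forall>p\<in>set ps. \<exists>l. \<sigma> p = map bit_symbol bs @ l" "\<rho> = loop_moved ps qs bs \<sigma>" by blast
  have t: "\<forall>p\<in>set ps. \<exists>l. \<rho> p = 3 # l" "\<tau> = (\<lambda>i. if i \<in> set ps then tl (\<rho> i) else \<rho> i)"
    using r(2) by (auto simp: runs_pops[OF assms(1)])
  have p: "\<exists>r. d p = bs # r \<and> \<tau> p = concat (map enc r)" if p: "p \<in> set ps" for p
  proof -
    have "\<sigma> p = E d p" using p assms(3) by (auto simp: \<sigma>_def)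
    then obtain l where "E d p = map bit_symbol bs @ l" using bs(1) p by metis
    moreover obtain l' where l': "\<rho> p = 3 # l'" using t(1) p by blast
    moreover have "\<rho> p = drop (length bs) (\<sigma> p)" using bs(2) p by (simp add: loop_moved_def)
    ultimately have "E d p = map bit_symbol bs @ 3 # l'" using \<open>\<sigma> p = E d p\<close> by simp
    moreover have "\<tau> p = l'" using t(2) p l' by simp
    ultimately show ?thesis by (simp add: E_top)
  qed
  have "\<tau> = E (moved ps qs bs d)"
  proof
    fix i show "\<tau> i = E (moved ps qs bs d) i"
    proof (cases "i \<in> set ps")
      case True
      then show ?thesis using p[OF True] by (auto simp: E_def moved_def)
    next
      case False
      then show ?thesis using t(2) bs(2) by (auto simp: \<sigma>_def loop_moved_def moved_def E_def enc_def)
    qed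
  qed
  then show ?thesis using p by fastforce
qed

lemma reach_Xfer:
  assumes "distinct ps" "distinct qs" "set ps \<inter> set qs = {}" "\<And>p. p \<in> set ps \<Longrightarrow> \<exists>r. d p = ds # r"
    "(length ds + 1) * (5 * length ps + 4 * length qs + 7) \<le> k"
  shows "reach (Xfer ps qs) (E d) (E (moved ps qs ds d)) k"
proof -
  define \<sigma> where "\<sigma> = (\<lambda>i. if i \<in> set qs then 3 # E d i else E d i)"
  have s: "\<exists>l. \<sigma> p = map bit_symbol ds @ 3 # l" if p: "p \<in> set ps" for p
  proof -
    have "\<sigma> p = E d p" using p assms(3) by (auto simp: \<sigma>_def)
    moreover obtain r where "d p = ds # r" using assms(4)[OF p] by blast
    ultimately show ?thesis by (simp add: E_def enc_def)
  qed
  have "E (moved ps qs ds d) = (\<lambda>i. if i \<in> set ps then tl (loop_moved ps qs ds \<sigma> i) else loop_moved ps qs ds \<sigma> i)"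
  proof
    fix i show "E (moved ps qs ds d) i = (if i \<in> set ps then tl (loop_moved ps qs ds \<sigma> i) else loop_moved ps qs ds \<sigma> i)"
    proof (cases "i \<in> set ps")
      case True
      then have "i \<notin> set qs" using assms(3) by auto
      then show ?thesis using True assms(4)[OF True]
        by (auto simp: E_def moved_def loop_moved_def \<sigma>_def enc_def)
    next
      case False
      then show ?thesis by (auto simp: \<sigma>_def loop_moved_def moved_def E_def enc_def)
    qed
  qed
  then show ?thesis
    unfolding Xfer_def
    by (intro reach_Seq[OF reach_pushes[OF assms(2) \<sigma>_def order_refl] reach_Seq[OF reach_xfer_loop[OF assms(1-3) _ order_refl]
          reach_pops[OF assms(1) _ _ order_refl] order_refl]])
      (use s assms(5) in \<open>auto simp: loop_moved_def algebra_simps dest!: s\<close>)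
qed

section \<open>Binary numerals and elementary operations on them\<close>

primrec bval :: "bool list \<Rightarrow> nat" where
  "bval [] = 0"
| "bval (b # bs) = of_bool b + 2 * bval bs"

text \<open>The least significant digit comes first, and the width is fixed. Adding and comparing
  run through several numbers in parallel and so require equal lengths; in the runs built for
  completeness all numbers on the stacks have the same width, filled with leading zeros.\<close>

primrec dg :: "nat \<Rightarrow> nat \<Rightarrow> bool list" where
  "dg 0 n = []"
| "dg (Suc W) n = odd n # dg W (n div 2)"

lemma length_dg [simp]: "length (dg W n) = W"
  by (induction W arbitrary: n) auto

lemma bval_dg [simp]: "n < 2 ^ W \<Longrightarrow> bval (dg W n) = n"
proof (induction W arbitrary: n)
  case (Suc W)
  then have "n div 2 < 2 ^ W" by auto
  then have "bval (dg W (n div 2)) = n div 2" by (rule Suc.IH)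
  then show ?case by simp
qed auto

lemma bval_append: "bval (xs @ ys) = bval xs + 2 ^ length xs * bval ys"
  by (induction xs) auto

lemma bval_zeros [simp]: "bval (replicate n False) = 0"
  by (induction n) auto

lemma dg_bval: "dg (length ds) (bval ds) = ds"
  by (induction ds) auto

lemma bval_less: "bval ds < 2 ^ length ds"
  by (induction ds) auto

lemma dg_small: "dg (Suc W) (of_bool b) = b # replicate W False"
proof -
  have "dg W 0 = replicate W False" by (induction W) auto
  then show ?thesis by (cases b) auto
qed

lemma reach_conv: "reach c \<sigma> (E d) k \<Longrightarrow> d = d' \<Longrightarrow> k \<le> k' \<Longrightarrow> reach c \<sigma> (E d') k'"
  using reach_mono by blast

lemma Cons_hd: "xs \<noteq> [] \<Longrightarrow> \<exists>r. xs = hd xs # r"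
  by (cases xs) auto

text \<open>\<open>Xfer\<close> reverses the digits, so a detour over stack 1 restores their
  order.\<close>

definition Move :: "nat \<Rightarrow> nat \<Rightarrow> com" where
  "Move i j = Xfer [i] [1] ;; Xfer [1] [j]"

definition Copy :: "nat \<Rightarrow> nat \<Rightarrow> com" where
  "Copy i j = Xfer [i] [1] ;; Xfer [1] [i, j]"

text \<open>The number of leading zeros is guessed, so that the width of the new constant can be
  adapted to the other numbers.\<close>

definition Dig :: "nat \<Rightarrow> bool \<Rightarrow> com" where
  "Dig i b = Push i 3 ;; Star (Push i (bit_symbol False)) ;; Push i (bit_symbol b)"

lemma runs_Xfer1:
  assumes "runs_to (Xfer [i] [j]) (E d) \<tau>" "i \<noteq> j"
  shows "d i \<noteq> [] \<and> \<tau> = E (d(i := tl (d i), j := rev (hd (d i)) # d j))"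
proof -
  obtain ds where "d i \<noteq> []" "hd (d i) = ds" "\<tau> = E (moved [i] [j] ds d)"
    using runs_Xfer[of "[i]" "[j]" d \<tau>] assms by auto
  moreover from this have "moved [i] [j] ds d = d(i := tl (d i), j := rev (hd (d i)) # d j)"
    using assms(2) by (auto simp: moved_def fun_eq_iff)
  ultimately show ?thesis by simp
qed

lemma reach_Xfer1:
  assumes "d i \<noteq> []" "i \<noteq> j" "length (hd (d i)) \<le> W"
  shows "reach (Xfer [i] [j]) (E d) (E (d(i := tl (d i), j := rev (hd (d i)) # d j))) (16 * (W + 1))"
  by (rule reach_conv[OF reach_Xfer[where ds = "hd (d i)"]])
    (use assms in \<open>auto simp: moved_def fun_eq_iff Cons_hd\<close>)

lemma runs_Xfer2:
  assumes "runs_to (Xfer [i] [j, k]) (E d) \<tau>" "i \<noteq> j" "i \<noteq> k" "j \<noteq> k"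
  shows "d i \<noteq> [] \<and> \<tau> = E (d(i := tl (d i), j := rev (hd (d i)) # d j, k := rev (hd (d i)) # d k))"
proof -
  obtain ds where "d i \<noteq> []" "hd (d i) = ds" "\<tau> = E (moved [i] [j, k] ds d)"
    using runs_Xfer[of "[i]" "[j, k]" d \<tau>] assms by auto
  moreover from this have "moved [i] [j, k] ds d =
      d(i := tl (d i), j := rev (hd (d i)) # d j, k := rev (hd (d i)) # d k)"
    using assms(2-) by (auto simp: moved_def fun_eq_iff)
  ultimately show ?thesis by simp
qed

lemma reach_Xfer2:
  assumes "d i \<noteq> []" "i \<noteq> j" "i \<noteq> k" "j \<noteq> k" "length (hd (d i)) \<le> W"
  shows "reach (Xfer [i] [j, k]) (E d)
    (E (d(i := tl (d i), j := rev (hd (d i)) # d j, k := rev (hd (d i)) # d k))) (20 * (W + 1))"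
  by (rule reach_conv[OF reach_Xfer[where ds = "hd (d i)"]])
    (use assms in \<open>auto simp: moved_def fun_eq_iff Cons_hd\<close>)

lemma runs_Move:
  assumes "runs_to (Move i j) (E d) \<tau>" "i \<noteq> j" "i \<noteq> 1" "j \<noteq> 1"
  shows "d i \<noteq> [] \<and> \<tau> = E (d(i := tl (d i), j := hd (d i) # d j))"
proof -
  obtain \<rho> where r: "runs_to (Xfer [i] [1]) (E d) \<rho>" "runs_to (Xfer [1] [j]) \<rho> \<tau>"
    using assms(1) by (auto simp: Move_def)
  from runs_Xfer1[OF r(1) assms(3)] have 1: "d i \<noteq> []" "\<rho> = E (d(i := tl (d i), 1 := rev (hd (d i)) # d 1))" by auto
  from runs_Xfer1[OF r(2)[unfolded 1(2)]] assms(4)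
  have "\<tau> = E ((d(i := tl (d i), 1 := rev (hd (d i)) # d 1))(1 := d 1, j := hd (d i) # d j))"
    using assms(2) by simp
  also have "(d(i := tl (d i), 1 := rev (hd (d i)) # d 1))(1 := d 1, j := hd (d i) # d j) =
      d(i := tl (d i), j := hd (d i) # d j)"
    using assms by (auto simp: fun_eq_iff)
  finally show ?thesis using 1(1) by blast
qed

lemma reach_Move:
  assumes "d i \<noteq> []" "i \<noteq> j" "i \<noteq> 1" "j \<noteq> 1" "length (hd (d i)) \<le> W"
  shows "reach (Move i j) (E d) (E (d(i := tl (d i), j := hd (d i) # d j))) (40 * (W + 1))"
  unfolding Move_def
  by (rule reach_conv[OF reach_Seq[OF reach_Xfer1[where W = W] reach_Xfer1[where W = W] order_refl]])
    (use assms in \<open>auto simp: fun_eq_iff\<close>)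

lemma runs_Copy:
  assumes "runs_to (Copy i j) (E d) \<tau>" "i \<noteq> j" "i \<noteq> 1" "j \<noteq> 1"
  shows "d i \<noteq> [] \<and> \<tau> = E (d(j := hd (d i) # d j))"
proof -
  obtain \<rho> where r: "runs_to (Xfer [i] [1]) (E d) \<rho>" "runs_to (Xfer [1] [i, j]) \<rho> \<tau>"
    using assms(1) by (auto simp: Copy_def)
  from runs_Xfer1[OF r(1) assms(3)] have 1: "d i \<noteq> []" "\<rho> = E (d(i := tl (d i), 1 := rev (hd (d i)) # d 1))" by auto
  from runs_Xfer2[OF r(2)[unfolded 1(2)]] assms(2-)
  have "\<tau> = E ((d(i := tl (d i), 1 := rev (hd (d i)) # d 1))(1 := d 1, i := hd (d i) # tl (d i), j := hd (d i) # d j))"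
    by simp
  also have "(d(i := tl (d i), 1 := rev (hd (d i)) # d 1))(1 := d 1, i := hd (d i) # tl (d i), j := hd (d i) # d j) =
      d(j := hd (d i) # d j)"
    using assms 1(1) by (auto simp: fun_eq_iff)
  finally show ?thesis using 1(1) by blast
qed

lemma reach_Copy:
  assumes "d i \<noteq> []" "i \<noteq> j" "i \<noteq> 1" "j \<noteq> 1" "length (hd (d i)) \<le> W"
  shows "reach (Copy i j) (E d) (E (d(j := hd (d i) # d j))) (40 * (W + 1))"
  unfolding Copy_def
  by (rule reach_conv[OF reach_Seq[OF reach_Xfer1[where W = W] reach_Xfer2[where W = W] order_refl]])
    (use assms in \<open>auto simp: fun_eq_iff\<close>)

lemma runs_Guess: "runs_to (Xfer [] [j]) (E d) \<tau> \<Longrightarrow> \<exists>ds. \<tau> = E (d(j := ds # d j))"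
proof -
  assume "runs_to (Xfer [] [j]) (E d) \<tau>"
  then obtain ds where "\<tau> = E (moved [] [j] ds d)" using runs_Xfer[of "[]" "[j]" d \<tau>] by auto
  moreover have "moved [] [j] ds d = d(j := rev ds # d j)" by (auto simp: moved_def)
  ultimately show ?thesis by auto
qed

lemma reach_Guess: "length ds \<le> W \<Longrightarrow> reach (Xfer [] [j]) (E d) (E (d(j := ds # d j))) (40 * (W + 1))"
  by (rule reach_conv[OF reach_Xfer[where ds = "rev ds"]]) (auto simp: moved_def fun_eq_iff)

lemma runs_Drop: "runs_to (Xfer [i] []) (E d) \<tau> \<Longrightarrow> d i \<noteq> [] \<and> \<tau> = E (d(i := tl (d i)))"
proof -
  assume "runs_to (Xfer [i] []) (E d) \<tau>"
  then obtain ds where "d i \<noteq> []" "\<tau> = E (moved [i] [] ds d)" using runs_Xfer[of "[i]" "[]" d \<tau>] by auto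
  moreover have "moved [i] [] ds d = d(i := tl (d i))" by (auto simp: moved_def)
  ultimately show ?thesis by auto
qed

lemma reach_Drop:
  "d i \<noteq> [] \<Longrightarrow> length (hd (d i)) \<le> W \<Longrightarrow> reach (Xfer [i] []) (E d) (E (d(i := tl (d i)))) (40 * (W + 1))"
  by (rule reach_conv[OF reach_Xfer[where ds = "hd (d i)"]]) (auto simp: moved_def fun_eq_iff Cons_hd)

lemma runs_Same:
  assumes "runs_to (Xfer [i, j] []) (E d) \<tau>" "i \<noteq> j"
  shows "d i \<noteq> [] \<and> d j \<noteq> [] \<and> hd (d i) = hd (d j) \<and> \<tau> = E (d(i := tl (d i), j := tl (d j)))"
proof -
  obtain ds where "d i \<noteq> []" "d j \<noteq> []" "hd (d i) = hd (d j)" "\<tau> = E (moved [i, j] [] ds d)"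
    using runs_Xfer[of "[i, j]" "[]" d \<tau>] assms by auto
  moreover have "moved [i, j] [] ds d = d(i := tl (d i), j := tl (d j))"
    using assms(2) by (auto simp: moved_def)
  ultimately show ?thesis by auto
qed

lemma reach_Same:
  assumes "d i \<noteq> []" "d j \<noteq> []" "hd (d i) = hd (d j)" "i \<noteq> j" "length (hd (d i)) \<le> W"
  shows "reach (Xfer [i, j] []) (E d) (E (d(i := tl (d i), j := tl (d j)))) (40 * (W + 1))"
proof (rule reach_conv[OF reach_Xfer[where ds = "hd (d i)"]])
  fix p assume "p \<in> set [i, j]"
  then show "\<exists>r. d p = hd (d i) # r" using assms by (metis list.collapse list.set_cases set_ConsD empty_iff list.set(1))
qed (use assms in \<open>auto simp: moved_def fun_eq_iff Cons_hd\<close>)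

lemma runs_Dig:
  assumes "runs_to (Dig i b) (E d) \<tau>"
  shows "\<exists>ds. bval ds = of_bool b \<and> \<tau> = E (d(i := ds # d i))"
proof -
  have star: "runs_to (Star (Push i (bit_symbol False))) \<sigma> \<rho> \<Longrightarrow>
      \<exists>m. \<rho> = \<sigma>(i := replicate m (bit_symbol False) @ \<sigma> i)" for \<sigma> \<rho>
  proof (induction rule: runs_Star_induct)
    case (Nil \<sigma>)
    then show ?case by (intro exI[of _ 0]) simp
  next
    case (Cons \<sigma> \<rho> \<tau>)
    then obtain m where "\<tau> = \<rho>(i := replicate m (bit_symbol False) @ \<rho> i)" by blast
    moreover have "\<rho> = \<sigma>(i := bit_symbol False # \<sigma> i)" using Cons(1) by simp
    ultimately show ?case by (intro exI[of _ "Suc m"]) (simp add: replicate_app_Cons_same)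
  qed
  obtain \<rho> where "runs_to (Star (Push i (bit_symbol False))) ((E d)(i := 3 # E d i)) \<rho>"
    "\<tau> = \<rho>(i := bit_symbol b # \<rho> i)" using assms by (auto simp: Dig_def)
  with star[of "(E d)(i := 3 # E d i)" \<rho>] obtain m where
    "\<tau> = (E d)(i := bit_symbol b # replicate m (bit_symbol False) @ 3 # E d i)" by auto
  moreover have "(E d)(i := bit_symbol b # replicate m (bit_symbol False) @ 3 # E d i) =
      E (d(i := (b # replicate m False) # d i))"
    by (auto simp: E_def enc_def fun_eq_iff)
  ultimately show ?thesis by (intro exI[of _ "b # replicate m False"]) simp
qed

lemma reach_Dig:
  assumes "0 < W"
  shows "reach (Dig i b) (E d) (E (d(i := dg W (of_bool b) # d i))) (40 * (W + 1))"
proof -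
  obtain m where m: "W = Suc m" using assms by (cases W) auto
  define f where "f j = (E d)(i := replicate j (bit_symbol False) @ 3 # E d i)" for j
  have "reach (Star (Push i (bit_symbol False))) (f 0) (f m) (4 * m + 1)"
  proof (rule reach_Star[where k = 1])
    fix j show "reach (Push i (bit_symbol False)) (f j) (f (Suc j)) 1"
      by (rule reach_Push) (auto simp: f_def)
  qed simp
  then have s: "reach (Star (Push i (bit_symbol False))) ((E d)(i := 3 # E d i)) (f m) (4 * m + 1)"
    by (simp add: f_def)
  have e: "(f m)(i := bit_symbol b # f m i) = E (d(i := dg W (of_bool b) # d i))"
    unfolding m dg_small by (auto simp: f_def E_def enc_def fun_eq_iff)
  show ?thesis
    unfolding Dig_def
    by (rule reach_Seq[OF reach_Push[OF order_refl refl] reach_Seq[OF s reach_Push[OF order_refl e[symmetric]] order_refl]])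
      (simp add: m)
qed

section \<open>Reading single digits and checking additions\<close>

lemma runs_PopBit:
  assumes "runs_to (Pop i (bit_symbol b)) (E d) \<tau>"
  shows "\<exists>ds r. d i = (b # ds) # r \<and> \<tau> = E (d(i := ds # r))"
proof -
  obtain l where l: "E d i = bit_symbol b # l" "\<tau> = (E d)(i := l)" using assms by auto
  obtain x r where x: "d i = x # r" using l(1) by (cases "d i") (auto simp: E_def)
  obtain ds where ds: "x = b # ds" using l(1) x by (cases x) (auto simp: E_def enc_def)
  have "\<tau> = E (d(i := ds # r))" using l x ds by (auto simp: E_def enc_def fun_eq_iff)
  then show ?thesis using x ds by blast
qed

lemma runs_PopEnd:
  assumes "runs_to (Pop i 3) (E d) \<tau>"
  shows "\<exists>r. d i = [] # r \<and> \<tau> = E (d(i := r))"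
proof -
  obtain l where l: "E d i = 3 # l" "\<tau> = (E d)(i := l)" using assms by auto
  then obtain r where "d i = [] # r" "l = concat (map enc r)" using E_top[of d i "[]" l] by auto
  then show ?thesis using l(2) by (auto simp: E_def fun_eq_iff)
qed

lemma reach_PopBit: "d i = (b # ds) # r \<Longrightarrow> 2 \<le> k \<Longrightarrow> reach (Pop i (bit_symbol b)) (E d) (E (d(i := ds # r))) k"
  by (rule reach_Pop[where l = "enc ds @ concat (map enc r)"]) (auto simp: E_def enc_def fun_eq_iff)

lemma reach_PopEnd: "d i = [] # r \<Longrightarrow> 2 \<le> k \<Longrightarrow> reach (Pop i 3) (E d) (E (d(i := r))) k"
  by (rule reach_Pop[where l = "concat (map enc r)"]) (auto simp: E_def enc_def fun_eq_iff)

text \<open>The carry is kept on the auxiliary stack 1.\<close>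

definition adder :: "nat \<Rightarrow> nat \<Rightarrow> nat \<Rightarrow> com" where
  "adder i j k = branch (\<lambda>a. branch (\<lambda>b. branch (\<lambda>c. Pop i (bit_symbol a) ;; Pop j (bit_symbol b) ;;
     Pop 1 (bit_symbol c) ;; Pop k (bit_symbol (odd (of_bool a + of_bool b + of_bool c :: nat))) ;;
     Push 1 (bit_symbol (2 \<le> (of_bool a + of_bool b + of_bool c :: nat))))))"

text \<open>The program verifies a claimed sum instead of computing one. The three end marks have to
  be reached in the same round and the last carry must be False; this excludes operands of different
  lengths and an overflow.\<close>

definition AddChk :: "nat \<Rightarrow> nat \<Rightarrow> nat \<Rightarrow> com" where
  "AddChk i j k = Push 1 (bit_symbol False) ;; Star (adder i j k) ;; Pop 1 (bit_symbol False) ;; pops [i, j, k] 3"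

text \<open>One column of addition: the parity of \<open>a + b + c\<close> is the digit of the sum
  and cancels, and half of the rest is the carry into the remaining columns.\<close>

lemma adder_digit:
  fixes a b c :: bool and A B C :: nat
  shows "of_bool a + 2 * A + (of_bool b + 2 * B) + of_bool c =
      of_bool (odd (of_bool a + of_bool b + of_bool c :: nat)) + 2 * C \<longleftrightarrow>
    A + B + of_bool (2 \<le> (of_bool a + of_bool b + of_bool c :: nat)) = C"
  by (cases a; cases b; cases c) auto

lemma adder_digit':
  fixes a b c z :: bool and A B C :: nat
  assumes "of_bool a + 2 * A + (of_bool b + 2 * B) + of_bool c = of_bool z + 2 * C"
  shows "z = odd (of_bool a + of_bool b + of_bool c :: nat)"
  using arg_cong[OF assms, of odd] by (cases a; cases b; cases c; cases z) auto

text \<open>Invariant of ripple-carry addition over a guessed number of columns, with incoming carry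
  \<open>x\<close> and outgoing carry \<open>y\<close>. The carry is found on top of whatever stack
  1 already contained.\<close>

lemma runs_adder_star:
  assumes "distinct [1, i, j, k]" "runs_to (Star (adder i j k)) \<sigma> \<tau>" "\<sigma> 1 = bit_symbol x # l"
  shows "\<exists>as bs cs y. \<sigma> i = map bit_symbol as @ \<tau> i \<and> \<sigma> j = map bit_symbol bs @ \<tau> j \<and>
     \<sigma> k = map bit_symbol cs @ \<tau> k \<and> \<tau> 1 = bit_symbol y # l \<and> length as = length cs \<and> length bs = length cs \<and>
     (\<forall>q. q \<notin> {1, i, j, k} \<longrightarrow> \<tau> q = \<sigma> q) \<and>
     bval as + bval bs + of_bool x = bval cs + 2 ^ length cs * of_bool y"
  using assms(2,3)
proof (induction arbitrary: x rule: runs_Star_induct)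
  case (Nil \<sigma>)
  then show ?case by (intro exI[of _ "[]"] exI[of _ x]) auto
next
  case (Cons \<sigma> \<rho> \<tau>)
  obtain a b c li lj lk l1 where s: "\<sigma> i = bit_symbol a # li" "\<sigma> j = bit_symbol b # lj" "\<sigma> 1 = bit_symbol c # l1"
    "\<sigma> k = bit_symbol (odd (of_bool a + of_bool b + of_bool c :: nat)) # lk"
    "\<rho> = \<sigma>(i := li, j := lj, k := lk, 1 := bit_symbol (2 \<le> (of_bool a + of_bool b + of_bool c :: nat)) # l1)"
  proof -
    from Cons(1) obtain a b c li lj lk l1 where "\<sigma> i = bit_symbol a # li" "\<sigma> j = bit_symbol b # lj"
      "\<sigma> 1 = bit_symbol c # l1" "\<sigma> k = bit_symbol (odd (of_bool a + of_bool b + of_bool c :: nat)) # lk"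
      "\<rho> = \<sigma>(i := li, j := lj, 1 := l1, k := lk, 1 := bit_symbol (2 \<le> (of_bool a + of_bool b + of_bool c :: nat)) # l1)"
      unfolding adder_def using assms(1) by (fastforce simp del: fun_upd_apply bit_symbol_simps simp: fun_upd_same fun_upd_other)
    then show thesis by (intro that) (auto simp: fun_eq_iff)
  qed
  have x: "c = x" "l1 = l" using s(3) Cons.prems by auto
  let ?y = "2 \<le> (of_bool a + of_bool b + of_bool c :: nat)"
  have "\<rho> 1 = bit_symbol ?y # l" using s(5) x by simp
  from Cons.IH[OF this] obtain as bs cs y where IH: "\<rho> i = map bit_symbol as @ \<tau> i" "\<rho> j = map bit_symbol bs @ \<tau> j"
    "\<rho> k = map bit_symbol cs @ \<tau> k" "\<tau> 1 = bit_symbol y # l" "length as = length cs" "length bs = length cs"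
    "\<forall>q. q \<notin> {1, i, j, k} \<longrightarrow> \<tau> q = \<rho> q"
    "bval as + bval bs + of_bool ?y = bval cs + 2 ^ length cs * of_bool y" by blast
  have r: "\<rho> i = li" "\<rho> j = lj" "\<rho> k = lk" using assms(1) by (auto simp: s(5))
  let ?z = "odd (of_bool a + of_bool b + of_bool c :: nat)"
  have "bval (a # as) + bval (b # bs) + of_bool x = bval (?z # cs) + 2 ^ length (?z # cs) * of_bool y"
    using IH(8) adder_digit[of a "bval as" b "bval bs" c "bval cs + 2 ^ length cs * of_bool y"] x(1) by simp
  moreover have "\<forall>q. q \<notin> {1, i, j, k} \<longrightarrow> \<tau> q = \<sigma> q" using IH(7) by (simp add: s(5))
  moreover have "\<sigma> i = map bit_symbol (a # as) @ \<tau> i" "\<sigma> j = map bit_symbol (b # bs) @ \<tau> j"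
    "\<sigma> k = map bit_symbol (?z # cs) @ \<tau> k" using s IH(1-3) r by auto
  ultimately show ?case using IH(4-6)
    by (intro exI[of _ "a # as"] exI[of _ "b # bs"] exI[of _ "?z # cs"] exI[of _ y]) simp
qed

lemma runs_AddChk:
  assumes "distinct [1, i, j, k]" "runs_to (AddChk i j k) (E d) \<tau>"
  shows "d i \<noteq> [] \<and> d j \<noteq> [] \<and> d k \<noteq> [] \<and> bval (hd (d k)) = bval (hd (d i)) + bval (hd (d j)) \<and>
    \<tau> = E (d(i := tl (d i), j := tl (d j), k := tl (d k)))"
proof -
  define \<sigma> where "\<sigma> = (E d)(1 := bit_symbol False # E d 1)"
  obtain \<rho> l where r: "runs_to (Star (adder i j k)) \<sigma> \<rho>" "\<rho> 1 = bit_symbol False # l"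
    "runs_to (pops [i, j, k] 3) (\<rho>(1 := l)) \<tau>"
    using assms(2) by (auto simp: AddChk_def \<sigma>_def simp del: pops.simps)
  have s1: "\<sigma> 1 = bit_symbol False # E d 1" by (simp add: \<sigma>_def)
  from runs_adder_star[OF assms(1) r(1) s1] r(2) obtain as bs cs where
    a: "\<sigma> i = map bit_symbol as @ \<rho> i" "\<sigma> j = map bit_symbol bs @ \<rho> j" "\<sigma> k = map bit_symbol cs @ \<rho> k" "l = E d 1"
     "\<forall>q. q \<notin> {1, i, j, k} \<longrightarrow> \<rho> q = \<sigma> q" "bval as + bval bs = bval cs" by auto
  have d: "distinct [i, j, k]" using assms(1) by simp
  have p: "\<exists>l'. \<rho> q = 3 # l'" if "q \<in> {i, j, k}" for q
    using r(3) that assms(1) unfolding runs_pops[OF d] by (auto split: if_splits)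
  obtain li lj lk where li: "\<rho> i = 3 # li" "\<rho> j = 3 # lj" "\<rho> k = 3 # lk"
    using p[of i] p[of j] p[of k] by auto
  have "E d i = map bit_symbol as @ 3 # li" "E d j = map bit_symbol bs @ 3 # lj" "E d k = map bit_symbol cs @ 3 # lk"
    using a(1-3) li assms(1) by (auto simp: \<sigma>_def)
  then obtain ri rj rk where e: "d i = as # ri" "li = concat (map enc ri)" "d j = bs # rj" "lj = concat (map enc rj)"
    "d k = cs # rk" "lk = concat (map enc rk)" unfolding E_top by blast
  have "\<tau> = E (d(i := ri, j := rj, k := rk))"
  proof
    fix q show "\<tau> q = E (d(i := ri, j := rj, k := rk)) q"
      using r(3) a(4,5) assms(1) li e unfolding runs_pops[OF d] by (auto simp: E_def \<sigma>_def)
  qed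
  then show ?thesis using e a(6) by simp
qed

lemma reach_adder:
  assumes "distinct [1, i, j, k]" "\<sigma> i = bit_symbol a # li" "\<sigma> j = bit_symbol b # lj" "\<sigma> 1 = bit_symbol c # l"
    "\<sigma> k = bit_symbol (odd (of_bool a + of_bool b + of_bool c :: nat)) # lk"
  shows "reach (adder i j k) \<sigma>
    (\<sigma>(i := li, j := lj, k := lk, 1 := bit_symbol (2 \<le> (of_bool a + of_bool b + of_bool c :: nat)) # l)) 30"
  unfolding adder_def
  apply (rule reach_branch[where b = a and k = 29], rule reach_branch[where b = b and k = 28],
      rule reach_branch[where b = c and k = 27])
     apply (rule reach_Seq[OF reach_Pop[where i = i and \<sigma> = \<sigma>, OF order_refl assms(2) refl] reach_Seq[OF reach_Pop[OF order_refl _ refl, where l = lj]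
          reach_Seq[OF reach_Pop[OF order_refl _ refl, where l = l] reach_Seq[OF reach_Pop[OF order_refl _ refl, where l = lk]
          reach_Push[OF order_refl] order_refl] order_refl] order_refl]])
  using assms by (auto simp: fun_eq_iff)

lemma reach_adder_star:
  assumes "distinct [1, i, j, k]" "length as = length bs" "length bs = length cs"
    "bval as + bval bs + of_bool x = bval cs + 2 ^ length cs * of_bool y"
    "\<sigma> i = map bit_symbol as @ li" "\<sigma> j = map bit_symbol bs @ lj" "\<sigma> k = map bit_symbol cs @ lk"
    "\<sigma> 1 = bit_symbol x # l"
  shows "reach (Star (adder i j k)) \<sigma> (\<sigma>(i := li, j := lj, k := lk, 1 := bit_symbol y # l)) (33 * length cs + 1)"
  using assms(2-)
proof (induction as bs cs arbitrary: x \<sigma> rule: list_induct3)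
  case Nil
  then have "x = y" by (cases x; cases y) auto
  with Nil have e: "\<sigma>(i := li, j := lj, k := lk, 1 := bit_symbol y # l) = \<sigma>" by (auto simp: fun_eq_iff)
  show ?case unfolding e by (rule reach_Star0) simp
next
  case (Cons a as b bs z cs)
  let ?y = "2 \<le> (of_bool a + of_bool b + of_bool x :: nat)"
  have eq: "of_bool a + 2 * bval as + (of_bool b + 2 * bval bs) + of_bool x =
      of_bool z + 2 * (bval cs + 2 ^ length cs * of_bool y)" using Cons.prems(1) by simp
  note z = adder_digit'[OF eq]
  from eq[unfolded z adder_digit] have eq': "bval as + bval bs + of_bool ?y = bval cs + 2 ^ length cs * of_bool y" .
  define \<rho> where "\<rho> = \<sigma>(i := map bit_symbol as @ li, j := map bit_symbol bs @ lj, k := map bit_symbol cs @ lk,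
      1 := bit_symbol ?y # l)"
  have 1: "reach (adder i j k) \<sigma> \<rho> 30"
    unfolding \<rho>_def by (rule reach_adder[OF assms(1)]) (use Cons.prems z in auto)
  have 2: "reach (Star (adder i j k)) \<rho> (\<rho>(i := li, j := lj, k := lk, 1 := bit_symbol y # l)) (33 * length cs + 1)"
    by (rule Cons.IH[OF eq']) (use assms(1) in \<open>auto simp: \<rho>_def\<close>)
  have e: "\<rho>(i := li, j := lj, k := lk, 1 := bit_symbol y # l) = \<sigma>(i := li, j := lj, k := lk, 1 := bit_symbol y # l)"
    by (auto simp: \<rho>_def fun_eq_iff)
  show ?case by (rule reach_StarS[OF 1 2[unfolded e]]) simp
qed

lemma reach_AddChk:
  assumes "distinct [1, i, j, k]" "d i \<noteq> []" "d j \<noteq> []" "d k \<noteq> []"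
    "bval (hd (d k)) = bval (hd (d i)) + bval (hd (d j))"
    "length (hd (d i)) = W" "length (hd (d j)) = W" "length (hd (d k)) = W"
  shows "reach (AddChk i j k) (E d) (E (d(i := tl (d i), j := tl (d j), k := tl (d k)))) (60 * (W + 1))"
proof -
  obtain as ri bs rj cs rk where d: "d i = as # ri" "d j = bs # rj" "d k = cs # rk"
    using assms(2-4) by (meson list.exhaust)
  let ?\<sigma> = "(E d)(1 := bit_symbol False # E d 1)"
  have dist: "distinct [i, j, k]" using assms(1) by simp
  have star: "reach (Star (adder i j k)) ?\<sigma> (?\<sigma>(i := 3 # concat (map enc ri), j := 3 # concat (map enc rj),
      k := 3 # concat (map enc rk), 1 := bit_symbol False # E d 1)) (33 * length cs + 1)"
    by (rule reach_adder_star[where as = as and bs = bs and cs = cs and x = False, OF assms(1)])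
      (use assms d in \<open>auto simp: E_def enc_def\<close>)
  show ?thesis
    unfolding AddChk_def
    by (rule reach_Seq[OF reach_Push[OF order_refl refl] reach_Seq[OF star reach_Seq[OF
        reach_Pop[OF order_refl _ refl, where l = "E d 1"] reach_pops[OF dist _ _ order_refl] order_refl] order_refl]])
      (use assms d in \<open>auto simp: fun_eq_iff E_def enc_def\<close>)
qed

section \<open>Arithmetic on the evaluation stack\<close>

definition Dup :: com where
  "Dup = Copy 5 7 ;; Move 7 5"

text \<open>Conventions: stack 5 is the evaluation stack, 2 to 4 are the operands of the adder, 1 is
  used for transit and carries, 6 keeps values aside, 7 is scratch space, and from 8 on come the
  arrays. The sum is guessed directly on stack 5 and a copy of it is checked.\<close>

definition AddOp :: com where
  "AddOp = Move 5 2 ;; Move 5 3 ;; Xfer [] [5] ;; Copy 5 4 ;; AddChk 2 3 4"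

text \<open>Digit strings are compared, not values. Strings of different width with the same value
  are rejected, which is harmless for soundness and cannot occur in a run with uniform
  width.\<close>

definition EqOp :: com where
  "EqOp = Move 5 2 ;; Xfer [5, 2] []"

text \<open>The inequality is witnessed by a guessed difference on stack 3.\<close>

definition LeOp :: com where
  "LeOp = Move 5 4 ;; Move 5 2 ;; Xfer [] [3] ;; AddChk 2 3 4"

text \<open>One step of Horner's scheme: the accumulator on stack 5 is doubled, and the multiplicand
  on stack 6 is added if the next digit is set. The multiplier was reversed onto stack 1, so its
  most significant digit is read first; carries and transits use stack 1 only above its unread
  digits.\<close>

definition mul_loop :: com where
  "mul_loop = branch (\<lambda>b. Pop 1 (bit_symbol b) ;; Dup ;; AddOp ;; (if b then Copy 6 5 ;; AddOp else Skip))"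

definition MulOp :: com where
  "MulOp = Xfer [5] [1] ;; Move 5 6 ;; Dig 5 False ;; Star mul_loop ;; Pop 1 3 ;; Xfer [6] []"

definition Inc :: "nat \<Rightarrow> com" where
  "Inc i = Move i 5 ;; Dig 5 True ;; AddOp ;; Move 5 i"

lemma runs_Dup:
  assumes "runs_to Dup (E d) \<tau>"
  shows "d 5 \<noteq> [] \<and> \<tau> = E (d(5 := hd (d 5) # d 5))"
proof -
  obtain \<rho> where r: "runs_to (Copy 5 7) (E d) \<rho>" "runs_to (Move 7 5) \<rho> \<tau>"
    using assms by (auto simp: Dup_def)
  have 1: "d 5 \<noteq> []" "\<rho> = E (d(7 := hd (d 5) # d 7))" using runs_Copy[OF r(1)] by auto
  have "\<tau> = E ((d(7 := hd (d 5) # d 7))(7 := d 7, 5 := hd (d 5) # d 5))"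
    using runs_Move[OF r(2)[unfolded 1(2)]] by simp
  also have "(d(7 := hd (d 5) # d 7))(7 := d 7, 5 := hd (d 5) # d 5) = d(5 := hd (d 5) # d 5)"
    by (auto simp: fun_eq_iff)
  finally show ?thesis using 1(1) by blast
qed

lemma reach_Dup:
  assumes "d 5 \<noteq> []" "length (hd (d 5)) \<le> W"
  shows "reach Dup (E d) (E (d(5 := hd (d 5) # d 5))) (100 * (W + 1))"
  unfolding Dup_def
  by (rule reach_conv[OF reach_Seq[OF reach_Copy[where W = W] reach_Move[where W = W] order_refl]])
    (use assms in \<open>auto simp: fun_eq_iff\<close>)

lemma runs_AddOp:
  assumes "runs_to AddOp (E d) \<tau>"
  shows "\<exists>x y z r. d 5 = x # y # r \<and> bval z = bval x + bval y \<and> \<tau> = E (d(5 := z # r))"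
proof -
  obtain \<rho>1 \<rho>2 \<rho>3 \<rho>4 where r: "runs_to (Move 5 2) (E d) \<rho>1" "runs_to (Move 5 3) \<rho>1 \<rho>2" "runs_to (Xfer [] [5]) \<rho>2 \<rho>3"
    "runs_to (Copy 5 4) \<rho>3 \<rho>4" "runs_to (AddChk 2 3 4) \<rho>4 \<tau>"
    using assms by (auto simp: AddOp_def)
  obtain x l where 1: "d 5 = x # l" "\<rho>1 = E (d(5 := l, 2 := x # d 2))"
    using runs_Move[OF r(1)] by (cases "d 5") auto
  obtain y r' where 2: "l = y # r'" "\<rho>2 = E (d(5 := r', 2 := x # d 2, 3 := y # d 3))"
    using runs_Move[OF r(2)[unfolded 1(2)]] by (cases l) (auto simp: fun_upd_twist)
  obtain z where 3: "\<rho>3 = E (d(5 := z # r', 2 := x # d 2, 3 := y # d 3))"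
    using runs_Guess[OF r(3)[unfolded 2(2)]] by (auto simp: fun_upd_twist)
  have 4: "\<rho>4 = E (d(5 := z # r', 2 := x # d 2, 3 := y # d 3, 4 := z # d 4))"
    using runs_Copy[OF r(4)[unfolded 3]] by auto
  have "bval z = bval x + bval y" "\<tau> = E (d(5 := z # r', 2 := x # d 2, 3 := y # d 3, 4 := z # d 4, 2 := d 2, 3 := d 3, 4 := d 4))"
    using runs_AddChk[OF _ r(5)[unfolded 4]] by auto
  moreover have "d(5 := z # r', 2 := x # d 2, 3 := y # d 3, 4 := z # d 4, 2 := d 2, 3 := d 3, 4 := d 4) = d(5 := z # r')"
    by (auto simp: fun_eq_iff)
  ultimately show ?thesis using 1(1) 2(1) by metis
qed

lemma reach_AddOp:
  assumes "d 5 = x # y # r" "length x = W" "length y = W" "bval x + bval y < 2 ^ W"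
  shows "reach AddOp (E d) (E (d(5 := dg W (bval x + bval y) # r))) (300 * (W + 1))"
  unfolding AddOp_def
  by (rule reach_conv[OF reach_Seq[OF reach_Move[where W = W] reach_Seq[OF reach_Move[where W = W]
        reach_Seq[OF reach_Guess[where W = W and ds = "dg W (bval x + bval y)"] reach_Seq[OF reach_Copy[where W = W]
        reach_AddChk[where W = W] order_refl] order_refl] order_refl] order_refl]])
    (use assms in \<open>auto simp: fun_eq_iff\<close>)

lemma runs_EqOp:
  assumes "runs_to EqOp (E d) \<tau>"
  shows "\<exists>x r. d 5 = x # x # r \<and> \<tau> = E (d(5 := r))"
proof -
  obtain \<rho>1 where r: "runs_to (Move 5 2) (E d) \<rho>1" "runs_to (Xfer [5, 2] []) \<rho>1 \<tau>"
    using assms by (auto simp: EqOp_def)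
  obtain x l where 1: "d 5 = x # l" "\<rho>1 = E (d(5 := l, 2 := x # d 2))"
    using runs_Move[OF r(1)] by (cases "d 5") auto
  have "l \<noteq> []" "hd l = x" "\<tau> = E (d(5 := l, 2 := x # d 2, 5 := tl l, 2 := d 2))"
    using runs_Same[OF r(2)[unfolded 1(2)]] by auto
  moreover have "d(5 := l, 2 := x # d 2, 5 := tl l, 2 := d 2) = d(5 := tl l)" by (auto simp: fun_eq_iff)
  ultimately show ?thesis using 1(1) by (intro exI[of _ x] exI[of _ "tl l"]) auto
qed

lemma reach_EqOp:
  assumes "d 5 = x # x # r" "length x \<le> W"
  shows "reach EqOp (E d) (E (d(5 := r))) (100 * (W + 1))"
  unfolding EqOp_def
  by (rule reach_conv[OF reach_Seq[OF reach_Move[where W = W] reach_Same[where W = W] order_refl]])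
    (use assms in \<open>auto simp: fun_eq_iff\<close>)

lemma runs_LeOp:
  assumes "runs_to LeOp (E d) \<tau>"
  shows "\<exists>x y r. d 5 = y # x # r \<and> bval x \<le> bval y \<and> \<tau> = E (d(5 := r))"
proof -
  obtain \<rho>1 \<rho>2 \<rho>3 where r: "runs_to (Move 5 4) (E d) \<rho>1" "runs_to (Move 5 2) \<rho>1 \<rho>2" "runs_to (Xfer [] [3]) \<rho>2 \<rho>3"
    "runs_to (AddChk 2 3 4) \<rho>3 \<tau>"
    using assms by (auto simp: LeOp_def)
  obtain y l where 1: "d 5 = y # l" "\<rho>1 = E (d(5 := l, 4 := y # d 4))"
    using runs_Move[OF r(1)] by (cases "d 5") auto
  obtain x r' where 2: "l = x # r'" "\<rho>2 = E (d(5 := r', 4 := y # d 4, 2 := x # d 2))"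
    using runs_Move[OF r(2)[unfolded 1(2)]] by (cases l) (auto simp: fun_upd_twist)
  obtain z where 3: "\<rho>3 = E (d(5 := r', 4 := y # d 4, 2 := x # d 2, 3 := z # d 3))"
    using runs_Guess[OF r(3)[unfolded 2(2)]] by (auto simp: fun_upd_twist)
  have "bval y = bval x + bval z" "\<tau> = E (d(5 := r', 4 := y # d 4, 2 := x # d 2, 3 := z # d 3, 2 := d 2, 3 := d 3, 4 := d 4))"
    using runs_AddChk[OF _ r(4)[unfolded 3]] by auto
  moreover have "d(5 := r', 4 := y # d 4, 2 := x # d 2, 3 := z # d 3, 2 := d 2, 3 := d 3, 4 := d 4) = d(5 := r')"
    by (auto simp: fun_eq_iff)
  ultimately show ?thesis using 1(1) 2(1) by (intro exI[of _ x] exI[of _ y] exI[of _ r']) auto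
qed

lemma reach_LeOp:
  assumes "d 5 = y # x # r" "length x = W" "length y = W" "bval x \<le> bval y"
  shows "reach LeOp (E d) (E (d(5 := r))) (300 * (W + 1))"
proof -
  have "bval y < 2 ^ W" using bval_less[of y] assms(3) by simp
  then have "bval y - bval x < 2 ^ W" by simp
  then show ?thesis
    unfolding LeOp_def
    by (intro reach_conv[OF reach_Seq[OF reach_Move[where W = W] reach_Seq[OF reach_Move[where W = W]
        reach_Seq[OF reach_Guess[where W = W and ds = "dg W (bval y - bval x)"]
        reach_AddChk[where W = W] order_refl] order_refl] order_refl]])
      (use assms in \<open>auto simp: fun_eq_iff\<close>)
qed

lemma runs_Inc:
  assumes "runs_to (Inc i) (E d) \<tau>" "7 \<le> i"
  shows "\<exists>x y r. d i = x # r \<and> bval y = Suc (bval x) \<and> \<tau> = E (d(i := y # r))"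
proof -
  obtain \<rho>1 \<rho>2 \<rho>3 where r: "runs_to (Move i 5) (E d) \<rho>1" "runs_to (Dig 5 True) \<rho>1 \<rho>2" "runs_to AddOp \<rho>2 \<rho>3"
    "runs_to (Move 5 i) \<rho>3 \<tau>"
    using assms(1) by (auto simp: Inc_def)
  obtain x r' where 1: "d i = x # r'" "\<rho>1 = E (d(i := r', 5 := x # d 5))"
    using runs_Move[OF r(1)] assms(2) by (cases "d i") auto
  obtain z where 2: "bval z = 1" "\<rho>2 = E (d(i := r', 5 := z # x # d 5))"
    using runs_Dig[OF r(2)[unfolded 1(2)]] by auto
  obtain y where 3: "bval y = 1 + bval x" "\<rho>3 = E (d(i := r', 5 := y # d 5))"
    using runs_AddOp[OF r(3)[unfolded 2(2)]] 2(1) by auto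
  have "\<tau> = E (d(i := r', 5 := y # d 5, 5 := d 5, i := y # r'))"
    using runs_Move[OF r(4)[unfolded 3(2)]] assms(2) by auto
  moreover have "d(i := r', 5 := y # d 5, 5 := d 5, i := y # r') = d(i := y # r')"
    by (auto simp: fun_eq_iff)
  ultimately show ?thesis using 1(1) 3(1) by auto
qed

lemma reach_Inc:
  assumes "7 \<le> i" "d i = x # r" "length x = W" "Suc (bval x) < 2 ^ W"
  shows "reach (Inc i) (E d) (E (d(i := dg W (Suc (bval x)) # r))) (500 * (W + 1))"
proof -
  have W: "0 < W" using assms(4) by (cases W) auto
  have "(1::nat) < 2 ^ W" using assms(4) by linarith
  then have b: "bval (dg W (of_bool True)) = 1" by simp
  show ?thesis
    unfolding Inc_def
    by (rule reach_conv[OF reach_Seq[OF reach_Move[where W = W] reach_Seq[OF reach_Dig[where W = W]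
        reach_Seq[OF reach_AddOp[where W = W and x = "dg W (of_bool True)" and y = x and r = "d 5"] reach_Move[where W = W] order_refl] order_refl] order_refl]])
      (use assms W b in \<open>auto simp: fun_eq_iff\<close>)
qed

lemma runs_mul_loop:
  assumes "runs_to mul_loop (E d) \<tau>" "d 5 = c # r" "d 6 = a # r6"
  shows "\<exists>b ds r1 c'. d 1 = (b # ds) # r1 \<and> bval c' = 2 * bval c + of_bool b * bval a \<and> \<tau> = E (d(1 := ds # r1, 5 := c' # r))"
proof -
  obtain b \<rho>1 \<rho>2 \<rho>3 where r: "runs_to (Pop 1 (bit_symbol b)) (E d) \<rho>1" "runs_to Dup \<rho>1 \<rho>2" "runs_to AddOp \<rho>2 \<rho>3"
    "runs_to (if b then Copy 6 5 ;; AddOp else Skip) \<rho>3 \<tau>"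
    using assms(1) unfolding mul_loop_def runs_branch runs_Seq by blast
  obtain ds r1 where 1: "d 1 = (b # ds) # r1" "\<rho>1 = E (d(1 := ds # r1))" using runs_PopBit[OF r(1)] by blast
  have 2: "\<rho>2 = E (d(1 := ds # r1, 5 := c # c # r))" using runs_Dup[OF r(2)[unfolded 1(2)]] assms(2) by auto
  obtain z where 3: "bval z = bval c + bval c" "\<rho>3 = E (d(1 := ds # r1, 5 := z # r))"
    using runs_AddOp[OF r(3)[unfolded 2]] by auto
  show ?thesis
  proof (cases b)
    case True
    then obtain \<rho>4 where r4: "runs_to (Copy 6 5) \<rho>3 \<rho>4" "runs_to AddOp \<rho>4 \<tau>" using r(4) by auto
    have 4: "\<rho>4 = E (d(1 := ds # r1, 5 := a # z # r))" using runs_Copy[OF r4(1)[unfolded 3(2)]] assms(3) by auto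
    obtain z' where "bval z' = bval a + bval z" "\<tau> = E (d(1 := ds # r1, 5 := z' # r))"
      using runs_AddOp[OF r4(2)[unfolded 4]] by auto
    then show ?thesis using 1(1) 3(1) True by (intro exI[of _ b] exI[of _ ds] exI[of _ r1] exI[of _ z']) simp
  next
    case False
    then show ?thesis using 1(1) 3 r(4) by (intro exI[of _ b] exI[of _ ds] exI[of _ r1] exI[of _ z]) simp
  qed
qed

lemma reach_mul_loop:
  assumes "d 1 = (b # ds) # r1" "d 5 = c # r" "d 6 = a # r6" "length a = W" "length c = W"
    "2 * bval c + of_bool b * bval a < 2 ^ W"
  shows "reach mul_loop (E d) (E (d(1 := ds # r1, 5 := dg W (2 * bval c + of_bool b * bval a) # r))) (1000 * (W + 1))"
proof -
  have c2: "2 * bval c < 2 ^ W" using assms(6) by simp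
  have 1: "reach (Pop 1 (bit_symbol b)) (E d) (E (d(1 := ds # r1))) 2"
    by (rule reach_PopBit[where i = 1 and d = d, OF assms(1)]) simp
  have 2: "reach Dup (E (d(1 := ds # r1))) (E (d(1 := ds # r1, 5 := c # c # r))) (100 * (W + 1))"
    by (rule reach_conv[OF reach_Dup[where W = W]]) (use assms in auto)
  have 3: "reach AddOp (E (d(1 := ds # r1, 5 := c # c # r))) (E (d(1 := ds # r1, 5 := dg W (2 * bval c) # r))) (300 * (W + 1))"
    by (rule reach_conv[OF reach_AddOp[where W = W and x = c and y = c and r = r]]) (use assms c2 in \<open>auto simp: mult_2\<close>)
  have 4: "reach (if b then Copy 6 5 ;; AddOp else Skip) (E (d(1 := ds # r1, 5 := dg W (2 * bval c) # r)))
      (E (d(1 := ds # r1, 5 := dg W (2 * bval c + of_bool b * bval a) # r))) (400 * (W + 1))"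
  proof (cases b)
    case True
    have 5: "reach (Copy 6 5) (E (d(1 := ds # r1, 5 := dg W (2 * bval c) # r)))
        (E (d(1 := ds # r1, 5 := a # dg W (2 * bval c) # r))) (40 * (W + 1))"
      by (rule reach_conv[OF reach_Copy[where W = W]]) (use assms in auto)
    have 6: "reach AddOp (E (d(1 := ds # r1, 5 := a # dg W (2 * bval c) # r)))
        (E (d(1 := ds # r1, 5 := dg W (2 * bval c + bval a) # r))) (300 * (W + 1))"
      by (rule reach_conv[OF reach_AddOp[where W = W and x = a and y = "dg W (2 * bval c)" and r = r]])
        (use assms c2 True in \<open>auto simp: add_ac\<close>)
    show ?thesis using reach_Seq[OF 5 6, of "400 * (W + 1)"] True by simp
  next
    case False
    then show ?thesis by (simp add: reach_Skip)
  qed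
  show ?thesis
    unfolding mul_loop_def
    by (rule reach_branch[where b = b and k = "900 * (W + 1)"],
        rule reach_Seq[OF 1 reach_Seq[OF 2 reach_Seq[OF 3 4 order_refl] order_refl]]) simp_all
qed

lemma runs_mul_star:
  assumes "runs_to (Star mul_loop) \<sigma> \<tau>"
  shows "\<sigma> = E d \<Longrightarrow> d 1 = xs # r1 \<Longrightarrow> d 5 = c # r \<Longrightarrow> d 6 = a # r6 \<Longrightarrow>
    \<exists>bs ds c'. xs = bs @ ds \<and> bval c' = bval c * 2 ^ length bs + bval a * bval (rev bs) \<and> \<tau> = E (d(1 := ds # r1, 5 := c' # r))"
  using assms
proof (induction arbitrary: d xs c rule: runs_Star_induct)
  case (Nil \<sigma>)
  have e: "d(1 := xs # r1, 5 := c # r) = d" using Nil by (auto simp: fun_eq_iff)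
  show ?case
    by (rule exI[of _ "[]"], rule exI[of _ xs], rule exI[of _ c], unfold e) (use Nil(1) in simp)
next
  case (Cons \<sigma> \<rho> \<tau>)
  obtain b ds c1 where 1: "xs = b # ds" "bval c1 = 2 * bval c + of_bool b * bval a" "\<rho> = E (d(1 := ds # r1, 5 := c1 # r))"
    using runs_mul_loop[OF Cons(1)[unfolded Cons(4)] Cons(6,7)] Cons(5) by auto
  obtain bs es c' where 2: "ds = bs @ es" "bval c' = bval c1 * 2 ^ length bs + bval a * bval (rev bs)"
    "\<tau> = E (d(1 := ds # r1, 5 := c1 # r, 1 := es # r1, 5 := c' # r))"
  proof -
    have "(d(1 := ds # r1, 5 := c1 # r)) 1 = ds # r1" "(d(1 := ds # r1, 5 := c1 # r)) 5 = c1 # r"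
      "(d(1 := ds # r1, 5 := c1 # r)) 6 = a # r6" using Cons(7) by auto
    from Cons(3)[OF 1(3) this] show thesis using that by blast
  qed
  have "d(1 := ds # r1, 5 := c1 # r, 1 := es # r1, 5 := c' # r) = d(1 := es # r1, 5 := c' # r)" by (auto simp: fun_eq_iff)
  with 2(3) have "\<tau> = E (d(1 := es # r1, 5 := c' # r))" by (simp only:)
  moreover have "bval c' = bval c * 2 ^ length (b # bs) + bval a * bval (rev (b # bs))"
    using 1(2) 2(2) by (simp add: bval_append algebra_simps)
  moreover have "xs = (b # bs) @ es" using 1(1) 2(1) by simp
  ultimately show ?case by blast
qed

lemma runs_MulOp:
  assumes "runs_to MulOp (E d) \<tau>"
  shows "\<exists>x y z r. d 5 = x # y # r \<and> bval z = bval y * bval x \<and> \<tau> = E (d(5 := z # r))"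
proof -
  obtain \<rho>1 \<rho>2 \<rho>3 \<rho>4 \<rho>5 where r: "runs_to (Xfer [5] [1]) (E d) \<rho>1" "runs_to (Move 5 6) \<rho>1 \<rho>2" "runs_to (Dig 5 False) \<rho>2 \<rho>3"
    "runs_to (Star mul_loop) \<rho>3 \<rho>4" "runs_to (Pop 1 3) \<rho>4 \<rho>5" "runs_to (Xfer [6] []) \<rho>5 \<tau>"
    using assms unfolding MulOp_def runs_Seq by blast
  obtain x l where 1: "d 5 = x # l" "\<rho>1 = E (d(5 := l, 1 := rev x # d 1))"
    using runs_Xfer1[OF r(1)] by (cases "d 5") auto
  obtain y r' where 2: "l = y # r'" "\<rho>2 = E (d(5 := r', 1 := rev x # d 1, 6 := y # d 6))"
    using runs_Move[OF r(2)[unfolded 1(2)]] by (cases l) (auto simp: fun_upd_twist)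
  obtain z where 3: "bval z = 0" "\<rho>3 = E (d(1 := rev x # d 1, 6 := y # d 6, 5 := z # r'))"
    using runs_Dig[OF r(3)[unfolded 2(2)]] by (auto simp: fun_upd_twist)
  obtain bs ds c' where 4: "rev x = bs @ ds" "bval c' = bval z * 2 ^ length bs + bval y * bval (rev bs)"
    "\<rho>4 = E (d(1 := rev x # d 1, 6 := y # d 6, 5 := z # r', 1 := ds # d 1, 5 := c' # r'))"
    using runs_mul_star[OF r(4) 3(2), of "rev x" "d 1" z r' y "d 6"] by (auto simp: fun_upd_twist)
  have 5: "ds = []" "\<rho>5 = E (d(1 := rev x # d 1, 6 := y # d 6, 5 := z # r', 1 := ds # d 1, 5 := c' # r', 1 := d 1))"
    using runs_PopEnd[OF r(5)[unfolded 4(3)]] by auto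
  have "\<tau> = E (d(1 := rev x # d 1, 6 := y # d 6, 5 := z # r', 1 := ds # d 1, 5 := c' # r', 1 := d 1, 6 := d 6))"
    using runs_Drop[OF r(6)[unfolded 5(2)]] by auto
  also have "d(1 := rev x # d 1, 6 := y # d 6, 5 := z # r', 1 := ds # d 1, 5 := c' # r', 1 := d 1, 6 := d 6) = d(5 := c' # r')"
    by (auto simp: fun_eq_iff)
  finally have "\<tau> = E (d(5 := c' # r'))" .
  moreover have "bval c' = bval y * bval x" using 4(1,2) 3(1) 5(1) by (metis add_0 append_Nil2 mult_0 rev_rev_ident)
  ultimately show ?thesis using 1(1) 2(1) by blast
qed

lemma reach_MulOp:
  assumes "d 5 = x # y # r" "length x = W" "length y = W" "bval y * bval x < 2 ^ W" "0 < W"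
  shows "reach MulOp (E d) (E (d(5 := dg W (bval y * bval x) # r))) (2000 * ((W + 1) * (W + 1)))"
proof -
  \<comment> \<open>\<open>p j\<close> is the value of the \<open>j\<close> leading digits of the
    multiplier. The accumulator \<open>bval y * p j\<close> never exceeds the product, so no
    intermediate result overflows the width.\<close>
  define p where "p j = bval (rev (take j (rev x)))" for j
  have p_Suc: "p (Suc j) = 2 * p j + of_bool (rev x ! j)" if "j < W" for j
    using that assms(2) by (simp add: p_def take_Suc_conv_app_nth)
  have p_le: "p j \<le> bval x" for j
  proof -
    have "x = rev (drop j (rev x)) @ rev (take j (rev x))" by (metis append_take_drop_id rev_append rev_rev_ident)
    then have "bval x = bval (rev (drop j (rev x))) + 2 ^ length (rev (drop j (rev x))) * p j"
      unfolding p_def using bval_append by metis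
    then show ?thesis by (metis le_add2 le_trans mult_le_mono1 nat_mult_1 one_le_numeral one_le_power)
  qed
  have small: "bval y * p j < 2 ^ W" for j
    using p_le[of j] assms(4) by (meson le_less_trans mult_le_mono2)
  define f where "f j = d(5 := dg W (bval y * p j) # r, 1 := drop j (rev x) # d 1, 6 := y # d 6)" for j
  have 1: "reach (Xfer [5] [1]) (E d) (E (d(5 := y # r, 1 := rev x # d 1))) (16 * (W + 1))"
    by (rule reach_conv[OF reach_Xfer1[where W = W]]) (use assms in auto)
  have 2: "reach (Move 5 6) (E (d(5 := y # r, 1 := rev x # d 1))) (E (d(5 := r, 1 := rev x # d 1, 6 := y # d 6))) (40 * (W + 1))"
    by (rule reach_conv[OF reach_Move[where W = W]]) (use assms in \<open>auto simp: fun_eq_iff\<close>)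
  have 3: "reach (Dig 5 False) (E (d(5 := r, 1 := rev x # d 1, 6 := y # d 6))) (E (f 0)) (40 * (W + 1))"
    by (rule reach_conv[OF reach_Dig[where W = W]]) (use assms in \<open>auto simp: fun_eq_iff f_def p_def\<close>)
  have 4: "reach (Star mul_loop) (E (f 0)) (E (f W)) (W * (1000 * (W + 1) + 3) + 1)"
  proof (rule reach_Star[where f = "\<lambda>j. E (f j)", OF _ order_refl])
    fix j assume j: "j < W"
    have d: "drop j (rev x) = rev x ! j # drop (Suc j) (rev x)" using j assms(2) by (simp add: Cons_nth_drop_Suc)
    have e: "2 * (bval y * p j) + of_bool (rev x ! j) * bval y = bval y * p (Suc j)"
      using p_Suc[OF j] by (simp add: algebra_simps)
    show "reach mul_loop (E (f j)) (E (f (Suc j))) (1000 * (W + 1))"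
      by (rule reach_conv[OF reach_mul_loop[where W = W and b = "rev x ! j" and ds = "drop (Suc j) (rev x)" and ?r1.0 = "d 1"
              and c = "dg W (bval y * p j)" and r = r and a = y and ?r6.0 = "d 6"]])
        (use assms(3) d e small small[of "Suc j"] in \<open>auto simp: f_def fun_eq_iff\<close>)
  qed
  have pW: "p W = bval x" "drop W (rev x) = []" using assms(2) by (auto simp: p_def)
  have 5: "reach (Pop 1 3) (E (f W)) (E (d(5 := dg W (bval y * bval x) # r, 1 := d 1, 6 := y # d 6))) 2"
    by (rule reach_conv[OF reach_PopEnd[where r = "d 1", OF _ order_refl]]) (auto simp: f_def pW fun_eq_iff)
  have 6: "reach (Xfer [6] []) (E (d(5 := dg W (bval y * bval x) # r, 1 := d 1, 6 := y # d 6)))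
      (E (d(5 := dg W (bval y * bval x) # r))) (40 * (W + 1))"
    by (rule reach_conv[OF reach_Drop[where W = W]]) (use assms in \<open>auto simp: fun_eq_iff\<close>)
  show ?thesis
    unfolding MulOp_def
    by (rule reach_Seq[OF 1 reach_Seq[OF 2 reach_Seq[OF 3 reach_Seq[OF 4 reach_Seq[OF 5 6 order_refl] order_refl] order_refl] order_refl]])
      (simp add: algebra_simps)
qed

text \<open>Stacks have no random access, so an entry is reached by shifting those above it to
  another stack, and walking back restores the array. The number of shifts is guessed while a
  counter runs along; \<open>EqOp\<close> finally compares the counter with the wanted
  index.\<close>

definition Walk :: "nat \<Rightarrow> nat \<Rightarrow> com" where
  "Walk i j = Dig 5 False ;; Star (Move i j ;; Dig 5 True ;; AddOp) ;; EqOp"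

definition walked :: "nat \<Rightarrow> nat \<Rightarrow> nat \<Rightarrow> dstore \<Rightarrow> dstore" where
  "walked i j m d = d(i := drop m (d i), j := rev (take m (d i)) @ d j)"

lemma walked_Suc:
  assumes "i \<noteq> j" "m < length (d i)"
  shows "walked i j (Suc m) d = (walked i j m d)(i := tl (walked i j m d i), j := hd (walked i j m d i) # walked i j m d j)"
  using assms by (auto simp: walked_def fun_eq_iff take_Suc_conv_app_nth drop_Suc hd_drop_conv_nth tl_drop)

lemma runs_walk_star:
  assumes "runs_to (Star (Move i j ;; Dig 5 True ;; AddOp)) \<sigma> \<tau>" "7 \<le> i" "7 \<le> j" "i \<noteq> j"
  shows "\<sigma> = E ((walked i j m d)(5 := c # r)) \<Longrightarrow> m \<le> length (d i) \<Longrightarrow> bval c = m \<Longrightarrow>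
    \<exists>m' c'. m' \<le> length (d i) \<and> bval c' = m' \<and> \<tau> = E ((walked i j m' d)(5 := c' # r))"
  using assms(1)
proof (induction arbitrary: m c rule: runs_Star_induct)
  case (Nil \<sigma>)
  then show ?case by blast
next
  case (Cons \<sigma> \<rho> \<tau>)
  obtain \<rho>1 \<rho>2 where r: "runs_to (Move i j) \<sigma> \<rho>1" "runs_to (Dig 5 True) \<rho>1 \<rho>2" "runs_to AddOp \<rho>2 \<rho>" using Cons(1) by auto
  let ?d = "(walked i j m d)(5 := c # r)"
  have i5: "?d i = walked i j m d i" using assms by auto
  have 1: "walked i j m d i \<noteq> []" "\<rho>1 = E (?d(i := tl (?d i), j := hd (?d i) # ?d j))"
    using runs_Move[OF r(1)[unfolded Cons(4)]] assms i5 by auto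
  have m: "m < length (d i)" using 1(1) assms(4) by (auto simp: walked_def)
  have "?d(i := tl (?d i), j := hd (?d i) # ?d j) = (walked i j (Suc m) d)(5 := c # r)"
    unfolding walked_Suc[where d = d, OF assms(4) m] using assms by (auto simp: fun_eq_iff)
  with 1(2) have 2: "\<rho>1 = E ((walked i j (Suc m) d)(5 := c # r))" by simp
  obtain z where 4: "bval z = 1" "\<rho>2 = E ((walked i j (Suc m) d)(5 := z # c # r))"
    using runs_Dig[OF r(2)[unfolded 2]] by auto
  obtain y where 5: "bval y = Suc m" "\<rho> = E ((walked i j (Suc m) d)(5 := y # r))"
    using runs_AddOp[OF r(3)[unfolded 4(2)]] 4(1) Cons(6) by auto
  show ?case using Cons(3)[OF 5(2) _ 5(1)] m by simp
qed

lemma runs_Walk: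
  assumes "runs_to (Walk i j) (E d) \<tau>" "7 \<le> i" "7 \<le> j" "i \<noteq> j"
  shows "\<exists>x r. d 5 = x # r \<and> bval x \<le> length (d i) \<and> \<tau> = E ((walked i j (bval x) d)(5 := r))"
proof -
  obtain \<rho>1 \<rho>2 where r: "runs_to (Dig 5 False) (E d) \<rho>1" "runs_to (Star (Move i j ;; Dig 5 True ;; AddOp)) \<rho>1 \<rho>2" "runs_to EqOp \<rho>2 \<tau>"
    using assms(1) unfolding Walk_def runs_Seq by blast
  obtain z where 1: "bval z = 0" "\<rho>1 = E (d(5 := z # d 5))" using runs_Dig[OF r(1)] by auto
  have w0: "(walked i j 0 d)(5 := z # d 5) = d(5 := z # d 5)" by (auto simp: walked_def fun_eq_iff)
  obtain m c where 2: "m \<le> length (d i)" "bval c = m" "\<rho>2 = E ((walked i j m d)(5 := c # d 5))"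
    using runs_walk_star[OF r(2) assms(2-4), of 0 d z "d 5"] 1 w0 by auto
  obtain x r' where 3: "c # d 5 = x # x # r'" "\<tau> = E ((walked i j m d)(5 := c # d 5, 5 := r'))"
    using runs_EqOp[OF r(3)[unfolded 2(3)]] by auto
  then show ?thesis using 2 by auto
qed

lemma reach_Walk:
  assumes "d 5 = x # r" "length x = W" "bval x \<le> length (d i)" "7 \<le> i" "7 \<le> j" "i \<noteq> j" "0 < W"
    "\<forall>y\<in>set (take (bval x) (d i)). length y = W"
  shows "reach (Walk i j) (E d) (E ((walked i j (bval x) d)(5 := r))) ((bval x + 1) * (1000 * (W + 1)))"
proof -
  have bx: "bval x < 2 ^ W" using bval_less[of x] assms(2) by simp
  have one: "bval (dg W (of_bool True)) = 1"
  proof -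
    have "(1::nat) < 2 ^ W" using assms(7) by (metis one_less_numeral_iff one_less_power semiring_norm(76))
    then show ?thesis by simp
  qed
  define f where "f m = (walked i j m d)(5 := dg W m # x # r)" for m
  have f0: "d(5 := dg W (of_bool False) # d 5) = f 0" using assms(1) by (auto simp: f_def walked_def fun_eq_iff)
  have 1: "reach (Dig 5 False) (E d) (E (f 0)) (40 * (W + 1))"
    using reach_Dig[OF assms(7), of 5 False d] unfolding f0 .
  have 2: "reach (Star (Move i j ;; Dig 5 True ;; AddOp)) (E (f 0)) (E (f (bval x))) (bval x * (500 * (W + 1) + 3) + 1)"
  proof (rule reach_Star[where f = "\<lambda>m. E (f m)", OF _ order_refl])
    fix m assume m: "m < bval x"
    then have m': "m < length (d i)" using assms(3) by simp
    have "d i ! m \<in> set (take (bval x) (d i))"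
      using m m' by (metis in_set_conv_nth length_take min_less_iff_conj nth_take)
    then have w: "walked i j m d i \<noteq> []" "length (hd (walked i j m d i)) = W"
      using m' assms(6,8) by (auto simp: walked_def hd_drop_conv_nth)
    have fi: "f m i = walked i j m d i" "f m j = walked i j m d j" using assms(4,5) by (auto simp: f_def)
    have a: "reach (Move i j) (E (f m)) (E ((walked i j (Suc m) d)(5 := dg W m # x # r))) (40 * (W + 1))"
    proof (rule reach_conv[OF reach_Move[where W = W]])
      show "(f m)(i := tl (f m i), j := hd (f m i) # f m j) = (walked i j (Suc m) d)(5 := dg W m # x # r)"
        unfolding fi walked_Suc[where d = d, OF assms(6) m'] using assms(4,5) by (auto simp: f_def fun_eq_iff)
    qed (use assms w fi in auto)
    have b: "reach (Dig 5 True) (E ((walked i j (Suc m) d)(5 := dg W m # x # r)))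
        (E ((walked i j (Suc m) d)(5 := dg W (of_bool True) # dg W m # x # r))) (40 * (W + 1))"
      by (rule reach_conv[OF reach_Dig[OF assms(7)]]) auto
    have c: "reach AddOp (E ((walked i j (Suc m) d)(5 := dg W (of_bool True) # dg W m # x # r))) (E (f (Suc m))) (300 * (W + 1))"
      by (rule reach_conv[OF reach_AddOp[where W = W and x = "dg W (of_bool True)" and y = "dg W m" and r = "x # r"]])
        (use one m bx in \<open>auto simp: f_def\<close>)
    show "reach (Move i j ;; Dig 5 True ;; AddOp) (E (f m)) (E (f (Suc m))) (500 * (W + 1))"
      by (rule reach_Seq[OF a reach_Seq[OF b c order_refl]]) simp
  qed
  have 3: "reach EqOp (E (f (bval x))) (E ((walked i j (bval x) d)(5 := r))) (100 * (W + 1))"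
    by (rule reach_conv[OF reach_EqOp[where W = W and x = x and r = r]])
      (use assms(2) dg_bval[of x] in \<open>auto simp: f_def\<close>)
  show ?thesis
    unfolding Walk_def
    by (rule reach_Seq[OF 1 reach_Seq[OF 2 3 order_refl]]) (simp add: algebra_simps)
qed

section \<open>A logic for verifiers\<close>

type_synonym env = "nat \<Rightarrow> nat list"

datatype trm = TBit bool | TGet nat trm | TAdd trm trm | TMul trm trm | TSum nat trm trm

datatype fml = FLe trm trm | FAnd fml fml | FOr fml fml | FAll nat trm fml

text \<open>The default 3 is neither a bit nor the end mark 2 of the input array. Looking up a
  position beyond the input can therefore not be mistaken for reading a symbol of it.\<close>

definition get :: "nat list \<Rightarrow> nat \<Rightarrow> nat" where
  "get xs i = (if i < length xs then xs ! i else 3)"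

text \<open>A bound variable is the head of the array of the same index.\<close>

primrec tval :: "trm \<Rightarrow> env \<Rightarrow> nat" where
  "tval (TBit b) e = of_bool b"
| "tval (TGet k t) e = get (e k) (tval t e)"
| "tval (TAdd s t) e = tval s e + tval t e"
| "tval (TMul s t) e = tval s e * tval t e"
| "tval (TSum k s t) e = (\<Sum>i<tval s e. tval t (e(k := i # e k)))"

primrec fsat :: "fml \<Rightarrow> env \<Rightarrow> bool" where
  "fsat (FLe s t) e = (tval s e \<le> tval t e)"
| "fsat (FAnd f g) e = (fsat f e \<and> fsat g e)"
| "fsat (FOr f g) e = (fsat f e \<or> fsat g e)"
| "fsat (FAll k s f) e = (\<forall>i<tval s e. fsat f (e(k := i # e k)))"

text \<open>Satisfaction by a computation in which all loops have length at most \<open>Y\<close> and all numbers have at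
  most \<open>Y\<close> bits.\<close>

primrec tok :: "nat \<Rightarrow> trm \<Rightarrow> env \<Rightarrow> bool" where
  "tok Y (TBit b) e = True"
| "tok Y (TGet k t) e = (tok Y t e \<and> tval t e < length (e k) \<and> tval t e \<le> Y)"
| "tok Y (TAdd s t) e = (tok Y s e \<and> tok Y t e \<and> tval s e + tval t e < 2 ^ Y)"
| "tok Y (TMul s t) e = (tok Y s e \<and> tok Y t e \<and> tval s e * tval t e < 2 ^ Y)"
| "tok Y (TSum k s t) e = (tok Y s e \<and> tval s e \<le> Y \<and> (\<forall>i<tval s e. tok Y t (e(k := i # e k))) \<and>
     (\<Sum>i<tval s e. tval t (e(k := i # e k))) < 2 ^ Y)"

primrec fok :: "nat \<Rightarrow> fml \<Rightarrow> env \<Rightarrow> bool" where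
  "fok Y (FLe s t) e = (tok Y s e \<and> tok Y t e \<and> tval s e \<le> tval t e)"
| "fok Y (FAnd f g) e = (fok Y f e \<and> fok Y g e)"
| "fok Y (FOr f g) e = (fok Y f e \<or> fok Y g e)"
| "fok Y (FAll k s f) e = (tok Y s e \<and> tval s e \<le> Y \<and> (\<forall>i<tval s e. fok Y f (e(k := i # e k))))"

text \<open>For an array access the index is saved on stack 6, as the first walk consumes it and the
  walk back needs it again. In a sum the bound waits on stack 6, and after a guessed number of
  rounds \<open>EqOp\<close> accepts only if the counter equals it.\<close>

primrec ct :: "trm \<Rightarrow> com" where
  "ct (TBit b) = Dig 5 b"
| "ct (TGet k t) = ct t ;; Copy 5 6 ;; Walk (k + 8) 7 ;; Copy (k + 8) 5 ;; Move 6 5 ;; Walk 7 (k + 8)"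
| "ct (TAdd s t) = ct s ;; ct t ;; AddOp"
| "ct (TMul s t) = ct s ;; ct t ;; MulOp"
| "ct (TSum k s t) = ct s ;; Move 5 6 ;; Dig 5 False ;; Dig (k + 8) False ;;
     Star (ct t ;; AddOp ;; Inc (k + 8)) ;; Move (k + 8) 5 ;; Move 6 5 ;; EqOp"

primrec cf :: "fml \<Rightarrow> com" where
  "cf (FLe s t) = ct s ;; ct t ;; LeOp"
| "cf (FAnd f g) = cf f ;; cf g"
| "cf (FOr f g) = Alt (cf f) (cf g)"
| "cf (FAll k s f) = ct s ;; Move 5 6 ;; Dig (k + 8) False ;;
     Star (cf f ;; Inc (k + 8)) ;; Move (k + 8) 5 ;; Move 6 5 ;; EqOp"

section \<open>Soundness of compiled terms and formulas\<close>

definition envof :: "dstore \<Rightarrow> env" where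
  "envof d = (\<lambda>k. map bval (d (k + 8)))"

lemma envof_upd:
  "i < 8 \<Longrightarrow> envof (d(i := x)) = envof d"
  "envof (d(k + 8 := xs)) = (envof d)(k := map bval xs)"
  by (auto simp: envof_def fun_eq_iff)

text \<open>The loop counter on top of stack \<open>k + 8\<close> is at the same time the bound
  variable seen by the body. The body is assumed correct for all stores because every round runs
  with another head of this array.\<close>

lemma runs_sum_star:
  assumes body: "\<And>d \<tau>. runs_to c (E d) \<tau> \<Longrightarrow> \<exists>z. bval z = F (envof d) \<and> \<tau> = E (d(5 := z # d 5))"
    and run: "runs_to (Star (c ;; AddOp ;; Inc (k + 8))) \<sigma> \<tau>"
  shows "\<sigma> = E (d(5 := acc # r, k + 8 := i # q)) \<Longrightarrow>
    \<exists>acc' i'. \<tau> = E (d(5 := acc' # r, k + 8 := i' # q)) \<and> bval i \<le> bval i' \<and>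
      bval acc' = bval acc + (\<Sum>v=bval i..<bval i'. F ((envof d)(k := v # map bval q)))"
  using run
proof (induction arbitrary: acc i rule: runs_Star_induct)
  case (Nil \<sigma>)
  moreover have "bval acc = bval acc + (\<Sum>v=bval i..<bval i. F ((envof d)(k := v # map bval q)))" by simp
  ultimately show ?case by blast
next
  case (Cons \<sigma> \<rho> \<tau>)
  let ?d = "d(5 := acc # r, k + 8 := i # q)"
  obtain \<rho>1 \<rho>2 where r: "runs_to c (E ?d) \<rho>1" "runs_to AddOp \<rho>1 \<rho>2" "runs_to (Inc (k + 8)) \<rho>2 \<rho>"
    using Cons(1) unfolding Cons(4) runs_Seq by blast
  have e: "envof ?d = (envof d)(k := bval i # map bval q)" by (simp add: envof_upd)
  obtain z where z: "bval z = F ((envof d)(k := bval i # map bval q))" "\<rho>1 = E (?d(5 := z # ?d 5))"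
    using body[OF r(1)] unfolding e by blast
  obtain a where a: "bval a = bval z + bval acc" "\<rho>2 = E (?d(5 := a # r))"
    using runs_AddOp[OF r(2)[unfolded z(2)]] by auto
  obtain j where j: "bval j = Suc (bval i)" "\<rho> = E (?d(5 := a # r, k + 8 := j # q))"
    using runs_Inc[OF r(3)[unfolded a(2)]] by auto
  have "?d(5 := a # r, k + 8 := j # q) = d(5 := a # r, k + 8 := j # q)" by (auto simp: fun_eq_iff)
  with j(2) have "\<rho> = E (d(5 := a # r, k + 8 := j # q))" by (simp only:)
  from Cons(3)[OF this] obtain acc' i' where *: "\<tau> = E (d(5 := acc' # r, k + 8 := i' # q))" "bval j \<le> bval i'"
     "bval acc' = bval a + (\<Sum>v=bval j..<bval i'. F ((envof d)(k := v # map bval q)))" by blast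
  have "bval acc' = bval acc + (\<Sum>v=bval i..<bval i'. F ((envof d)(k := v # map bval q)))"
    using * a(1) z(1) j(1) by (subst sum.atLeast_Suc_lessThan) auto
  moreover have "bval i \<le> bval i'" using * j(1) by simp
  ultimately show ?case using *(1) by blast
qed

lemma runs_all_star:
  assumes body: "\<And>d \<tau>. runs_to c (E d) \<tau> \<Longrightarrow> \<tau> = E d \<and> P (envof d)"
    and run: "runs_to (Star (c ;; Inc (k + 8))) \<sigma> \<tau>"
  shows "\<sigma> = E (d(k + 8 := i # q)) \<Longrightarrow>
    \<exists>i'. \<tau> = E (d(k + 8 := i' # q)) \<and> bval i \<le> bval i' \<and>
      (\<forall>v. bval i \<le> v \<and> v < bval i' \<longrightarrow> P ((envof d)(k := v # map bval q)))"
  using run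
proof (induction arbitrary: i rule: runs_Star_induct)
  case (Nil \<sigma>)
  then show ?case using not_le by blast
next
  case (Cons \<sigma> \<rho> \<tau>)
  let ?d = "d(k + 8 := i # q)"
  obtain \<rho>1 where r: "runs_to c (E ?d) \<rho>1" "runs_to (Inc (k + 8)) \<rho>1 \<rho>"
    using Cons(1) unfolding Cons(4) runs_Seq by blast
  have e: "envof ?d = (envof d)(k := bval i # map bval q)" by (simp add: envof_upd)
  have z: "P ((envof d)(k := bval i # map bval q))" "\<rho>1 = E ?d"
    using body[OF r(1)] unfolding e by blast+
  obtain j where j: "bval j = Suc (bval i)" "\<rho> = E (d(k + 8 := j # q))"
    using runs_Inc[OF r(2)[unfolded z(2)]] by auto
  from Cons(3)[OF j(2)] obtain i' where *: "\<tau> = E (d(k + 8 := i' # q))" "bval j \<le> bval i'"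
     "\<forall>v. bval j \<le> v \<and> v < bval i' \<longrightarrow> P ((envof d)(k := v # map bval q))" by blast
  have "P ((envof d)(k := v # map bval q))" if "bval i \<le> v" "v < bval i'" for v
    using that *(3) z(1) j(1) by (cases "v = bval i") auto
  moreover have "bval i \<le> bval i'" using * j(1) by simp
  ultimately show ?case using *(1) by blast
qed

lemma runs_ct:
  "runs_to (ct t) (E d) \<tau> \<Longrightarrow> \<exists>z. bval z = tval t (envof d) \<and> \<tau> = E (d(5 := z # d 5))"
proof (induction t arbitrary: d \<tau>)
  case (TBit b)
  then show ?case using runs_Dig[of 5 b d \<tau>] unfolding ct.simps tval.simps by blast
next
  case (TGet k t)
  then obtain \<rho>1 \<rho>2 \<rho>3 \<rho>4 \<rho>5 where r: "runs_to (ct t) (E d) \<rho>1" "runs_to (Copy 5 6) \<rho>1 \<rho>2" "runs_to (Walk (k + 8) 7) \<rho>2 \<rho>3"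
    "runs_to (Copy (k + 8) 5) \<rho>3 \<rho>4" "runs_to (Move 6 5) \<rho>4 \<rho>5" "runs_to (Walk 7 (k + 8)) \<rho>5 \<tau>" unfolding ct.simps cf.simps runs_Seq by blast
  obtain z where z: "bval z = tval t (envof d)" "\<rho>1 = E (d(5 := z # d 5))" using TGet.IH[OF r(1)] by blast
  let ?m = "bval z"
  have 2: "\<rho>2 = E (d(5 := z # d 5, 6 := z # d 6))" using runs_Copy[OF r(2)[unfolded z(2)]] by auto
  have 3: "?m \<le> length (d (k + 8))" "\<rho>3 = E ((walked (k + 8) 7 ?m (d(5 := z # d 5, 6 := z # d 6)))(5 := d 5))"
    using runs_Walk[OF r(3)[unfolded 2]] by auto
  let ?d3 = "d(6 := z # d 6, k + 8 := drop ?m (d (k + 8)), 7 := rev (take ?m (d (k + 8))) @ d 7)"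
  have "(walked (k + 8) 7 ?m (d(5 := z # d 5, 6 := z # d 6)))(5 := d 5) = ?d3" by (auto simp: walked_def fun_eq_iff)
  with 3(2) have w3: "\<rho>3 = E ?d3" by simp
  have c: "drop ?m (d (k + 8)) \<noteq> []" "\<rho>4 = E (?d3(5 := hd (drop ?m (d (k + 8))) # d 5))"
    using runs_Copy[OF r(4)[unfolded w3]] by auto
  define y where "y = hd (drop ?m (d (k + 8)))"
  let ?d5 = "d(k + 8 := drop ?m (d (k + 8)), 7 := rev (take ?m (d (k + 8))) @ d 7, 5 := z # y # d 5)"
  have "\<rho>5 = E ((?d3(5 := y # d 5))(6 := d 6, 5 := z # y # d 5))"
    using runs_Move[OF r(5)[unfolded c(2)]] by (auto simp: y_def)
  also have "(?d3(5 := y # d 5))(6 := d 6, 5 := z # y # d 5) = ?d5" by (auto simp: fun_eq_iff)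
  finally have 5: "\<rho>5 = E ?d5" .
  have "\<tau> = E ((walked 7 (k + 8) ?m ?d5)(5 := y # d 5))" using runs_Walk[OF r(6)[unfolded 5]] by auto
  also have "(walked 7 (k + 8) ?m ?d5)(5 := y # d 5) = d(5 := y # d 5)"
    using 3(1) by (auto simp: walked_def fun_eq_iff)
  finally have t: "\<tau> = E (d(5 := y # d 5))" .
  have "bval y = tval (TGet k t) (envof d)"
    using c(1) z(1) by (auto simp: y_def get_def envof_def hd_drop_conv_nth)
  with t show ?case by blast
next
  case (TAdd s t)
  then obtain \<rho>1 \<rho>2 where r: "runs_to (ct s) (E d) \<rho>1" "runs_to (ct t) \<rho>1 \<rho>2" "runs_to AddOp \<rho>2 \<tau>" unfolding ct.simps cf.simps runs_Seq by blast
  obtain y where y: "bval y = tval s (envof d)" "\<rho>1 = E (d(5 := y # d 5))" using TAdd.IH(1)[OF r(1)] by blast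
  obtain x where x0: "bval x = tval t (envof (d(5 := y # d 5)))"
    "\<rho>2 = E (d(5 := y # d 5, 5 := x # (d(5 := y # d 5)) 5))"
    using TAdd.IH(2)[OF r(2)[unfolded y(2)]] by blast
  have x: "bval x = tval t (envof d)" "\<rho>2 = E (d(5 := x # y # d 5))"
    using x0 by (simp_all add: envof_upd)
  from runs_AddOp[OF r(3)[unfolded x(2)]] obtain z where
    z: "bval z = bval x + bval y" "\<tau> = E (d(5 := z # d 5))" by auto
  have "bval z = tval (TAdd s t) (envof d)" using z(1) x(1) y(1) by simp
  with z(2) show ?case by blast
next
  case (TMul s t)
  then obtain \<rho>1 \<rho>2 where r: "runs_to (ct s) (E d) \<rho>1" "runs_to (ct t) \<rho>1 \<rho>2" "runs_to MulOp \<rho>2 \<tau>" unfolding ct.simps cf.simps runs_Seq by blast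
  obtain y where y: "bval y = tval s (envof d)" "\<rho>1 = E (d(5 := y # d 5))" using TMul.IH(1)[OF r(1)] by blast
  obtain x where x0: "bval x = tval t (envof (d(5 := y # d 5)))"
    "\<rho>2 = E (d(5 := y # d 5, 5 := x # (d(5 := y # d 5)) 5))"
    using TMul.IH(2)[OF r(2)[unfolded y(2)]] by blast
  have x: "bval x = tval t (envof d)" "\<rho>2 = E (d(5 := x # y # d 5))"
    using x0 by (simp_all add: envof_upd)
  from runs_MulOp[OF r(3)[unfolded x(2)]] obtain z where
    z: "bval z = bval y * bval x" "\<tau> = E (d(5 := z # d 5))" by auto
  have "bval z = tval (TMul s t) (envof d)" using z(1) x(1) y(1) by simp
  with z(2) show ?case by blast
next
  case (TSum k s t)
  then obtain \<rho>1 \<rho>2 \<rho>3 \<rho>4 \<rho>5 \<rho>6 \<rho>7 where r: "runs_to (ct s) (E d) \<rho>1" "runs_to (Move 5 6) \<rho>1 \<rho>2" "runs_to (Dig 5 False) \<rho>2 \<rho>3"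
    "runs_to (Dig (k + 8) False) \<rho>3 \<rho>4" "runs_to (Star (ct t ;; AddOp ;; Inc (k + 8))) \<rho>4 \<rho>5" "runs_to (Move (k + 8) 5) \<rho>5 \<rho>6"
    "runs_to (Move 6 5) \<rho>6 \<rho>7" "runs_to EqOp \<rho>7 \<tau>" unfolding ct.simps cf.simps runs_Seq by blast
  obtain b where b: "bval b = tval s (envof d)" "\<rho>1 = E (d(5 := b # d 5))" using TSum.IH(1)[OF r(1)] by blast
  have "\<rho>2 = E (d(5 := b # d 5, 5 := d 5, 6 := b # d 6))" using runs_Move[OF r(2)[unfolded b(2)]] by auto
  then have 2: "\<rho>2 = E (d(6 := b # d 6))" by (simp add: fun_upd_triv)
  obtain acc where acc: "bval acc = 0" "\<rho>3 = E (d(6 := b # d 6, 5 := acc # d 5))" using runs_Dig[OF r(3)[unfolded 2]] by auto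
  obtain i where i: "bval i = 0" "\<rho>4 = E (d(6 := b # d 6, 5 := acc # d 5, k + 8 := i # d (k + 8)))"
    using runs_Dig[OF r(4)[unfolded acc(2)]] by auto
  from runs_sum_star[where d = "d(6 := b # d 6)", OF TSum.IH(2) r(5) i(2)]
  obtain acc' i' where l: "\<rho>5 = E (d(6 := b # d 6, 5 := acc' # d 5, k + 8 := i' # d (k + 8)))"
    "bval acc' = bval acc + (\<Sum>v=bval i..<bval i'. tval t ((envof (d(6 := b # d 6)))(k := v # map bval (d (k + 8)))))"
    by blast
  have e: "envof (d(6 := b # d 6)) = envof d" "map bval (d (k + 8)) = envof d k" by (simp_all add: envof_upd envof_def)
  note l2 = l(2)[unfolded acc(1) i(1) e add_0 atLeast0LessThan]
  have "\<rho>6 = E (d(6 := b # d 6, 5 := acc' # d 5, k + 8 := i' # d (k + 8), k + 8 := d (k + 8), 5 := i' # acc' # d 5))"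
    using runs_Move[OF r(6)[unfolded l(1)]] by auto
  also have "d(6 := b # d 6, 5 := acc' # d 5, k + 8 := i' # d (k + 8), k + 8 := d (k + 8), 5 := i' # acc' # d 5) =
     d(6 := b # d 6, 5 := i' # acc' # d 5)" by (auto simp: fun_eq_iff)
  finally have 6: "\<rho>6 = E (d(6 := b # d 6, 5 := i' # acc' # d 5))" .
  have 7: "\<rho>7 = E (d(6 := b # d 6, 5 := i' # acc' # d 5, 6 := d 6, 5 := b # i' # acc' # d 5))"
    using runs_Move[OF r(7)[unfolded 6]] by auto
  have 8: "b = i'" "\<tau> = E (d(6 := b # d 6, 5 := i' # acc' # d 5, 6 := d 6, 5 := b # i' # acc' # d 5, 5 := acc' # d 5))"
    using runs_EqOp[OF r(8)[unfolded 7]] by auto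
  have "d(6 := b # d 6, 5 := i' # acc' # d 5, 6 := d 6, 5 := b # i' # acc' # d 5, 5 := acc' # d 5) = d(5 := acc' # d 5)"
    by (auto simp: fun_eq_iff)
  with 8(2) have "\<tau> = E (d(5 := acc' # d 5))" by (simp only:)
  moreover have "bval acc' = tval (TSum k s t) (envof d)" using l2 8(1) b(1) by simp
  ultimately show ?case by blast
qed

lemma runs_cf:
  "runs_to (cf f) (E d) \<tau> \<Longrightarrow> \<tau> = E d \<and> fsat f (envof d)"
proof (induction f arbitrary: d \<tau>)
  case (FLe s t)
  then obtain \<rho>1 \<rho>2 where r: "runs_to (ct s) (E d) \<rho>1" "runs_to (ct t) \<rho>1 \<rho>2" "runs_to LeOp \<rho>2 \<tau>" unfolding ct.simps cf.simps runs_Seq by blast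
  obtain y where y: "bval y = tval s (envof d)" "\<rho>1 = E (d(5 := y # d 5))" using runs_ct[OF r(1)] by blast
  obtain x where x: "bval x = tval t (envof d)" "\<rho>2 = E (d(5 := x # y # d 5))"
    using runs_ct[OF r(2)[unfolded y(2)]] by (auto simp: envof_upd)
  show ?case using runs_LeOp[OF r(3)[unfolded x(2)]] x(1) y(1) by (auto simp: fun_upd_triv)
next
  case (FAnd f g)
  then obtain \<rho> where r: "runs_to (cf f) (E d) \<rho>" "runs_to (cf g) \<rho> \<tau>" unfolding ct.simps cf.simps runs_Seq by blast
  then show ?case using FAnd.IH(1)[OF r(1)] FAnd.IH(2)[of d \<tau>] by auto
next
  case (FOr f g)
  then show ?case by auto
next
  case (FAll k s f)
  then obtain \<rho>1 \<rho>2 \<rho>4 \<rho>5 \<rho>6 \<rho>7 where r: "runs_to (ct s) (E d) \<rho>1" "runs_to (Move 5 6) \<rho>1 \<rho>2"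
    "runs_to (Dig (k + 8) False) \<rho>2 \<rho>4" "runs_to (Star (cf f ;; Inc (k + 8))) \<rho>4 \<rho>5" "runs_to (Move (k + 8) 5) \<rho>5 \<rho>6"
    "runs_to (Move 6 5) \<rho>6 \<rho>7" "runs_to EqOp \<rho>7 \<tau>" unfolding ct.simps cf.simps runs_Seq by blast
  obtain b where b: "bval b = tval s (envof d)" "\<rho>1 = E (d(5 := b # d 5))" using runs_ct[OF r(1)] by blast
  have "\<rho>2 = E (d(5 := b # d 5, 5 := d 5, 6 := b # d 6))" using runs_Move[OF r(2)[unfolded b(2)]] by auto
  then have 2: "\<rho>2 = E (d(6 := b # d 6))" by (simp add: fun_upd_triv)
  obtain i where i: "bval i = 0" "\<rho>4 = E (d(6 := b # d 6, k + 8 := i # d (k + 8)))"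
    using runs_Dig[OF r(3)[unfolded 2]] by auto
  from runs_all_star[where d = "d(6 := b # d 6)", OF FAll.IH r(4) i(2)]
  obtain i' where l: "\<rho>5 = E (d(6 := b # d 6, k + 8 := i' # d (k + 8)))"
    "\<forall>v. bval i \<le> v \<and> v < bval i' \<longrightarrow> fsat f ((envof (d(6 := b # d 6)))(k := v # map bval (d (k + 8))))"
    by blast
  have e: "envof (d(6 := b # d 6)) = envof d" "map bval (d (k + 8)) = envof d k" by (simp_all add: envof_upd envof_def)
  note l2 = l(2)[unfolded i(1) e]
  have "\<rho>6 = E (d(6 := b # d 6, k + 8 := i' # d (k + 8), k + 8 := d (k + 8), 5 := i' # d 5))"
    using runs_Move[OF r(5)[unfolded l(1)]] by auto
  also have "d(6 := b # d 6, k + 8 := i' # d (k + 8), k + 8 := d (k + 8), 5 := i' # d 5) =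
     d(6 := b # d 6, 5 := i' # d 5)" by (auto simp: fun_eq_iff)
  finally have 6: "\<rho>6 = E (d(6 := b # d 6, 5 := i' # d 5))" .
  have 7: "\<rho>7 = E (d(6 := b # d 6, 5 := i' # d 5, 6 := d 6, 5 := b # i' # d 5))"
    using runs_Move[OF r(6)[unfolded 6]] by auto
  have 8: "b = i'" "\<tau> = E (d(6 := b # d 6, 5 := i' # d 5, 6 := d 6, 5 := b # i' # d 5, 5 := d 5))"
    using runs_EqOp[OF r(7)[unfolded 7]] by auto
  have "d(6 := b # d 6, 5 := i' # d 5, 6 := d 6, 5 := b # i' # d 5, 5 := d 5) = d"
    by (auto simp: fun_eq_iff)
  with 8(2) have "\<tau> = E d" by (simp only:)
  then show ?case using l2 8(1) b(1) by simp
qed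

section \<open>Running time of compiled terms and formulas\<close>

definition wd :: "nat \<Rightarrow> dstore \<Rightarrow> bool" where
  "wd Y d \<longleftrightarrow> (\<forall>k. \<forall>ds\<in>set (d (k + 8)). length ds = Y)"

lemma wd_upd:
  "i < 8 \<Longrightarrow> wd Y d \<Longrightarrow> wd Y (d(i := x))"
  "wd Y d \<Longrightarrow> length ds = Y \<Longrightarrow> wd Y (d(k + 8 := ds # d (k + 8)))"
  by (auto simp: wd_def)

abbreviation lin :: "nat poly" where
  "lin \<equiv> [:1, 1:]"

primrec tcost :: "trm \<Rightarrow> nat poly" where
  "tcost (TBit b) = 40 * lin"
| "tcost (TGet k t) = tcost t + 5000 * (lin * lin)"
| "tcost (TAdd s t) = tcost s + tcost t + 400 * lin"
| "tcost (TMul s t) = tcost s + tcost t + 3000 * (lin * lin)"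
| "tcost (TSum k s t) = tcost s + lin * (tcost t + 1000 * lin) + 1000 * lin"

primrec fcost :: "fml \<Rightarrow> nat poly" where
  "fcost (FLe s t) = tcost s + tcost t + 400 * lin"
| "fcost (FAnd f g) = fcost f + fcost g + 3"
| "fcost (FOr f g) = fcost f + fcost g + 1"
| "fcost (FAll k s f) = tcost s + lin * (fcost f + 1000 * lin) + 1000 * lin"

lemma get_less: "i < length xs \<Longrightarrow> get xs i = xs ! i"
  by (simp add: get_def)

lemma tval_less:
  assumes "tok Y t (envof d)" "wd Y d" "0 < Y"
  shows "tval t (envof d) < 2 ^ Y"
proof (cases t)
  case (TBit b)
  have "(1::nat) < 2 ^ Y" using assms(3) by (metis one_less_numeral_iff one_less_power semiring_norm(76))
  then show ?thesis using TBit by simp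
next
  case (TGet k s)
  then have "tval t (envof d) \<in> bval ` set (d (k + 8))"
    using assms(1) by (simp add: get_less) (simp add: envof_def)
  then show ?thesis using assms(2) bval_less unfolding wd_def by fastforce
qed (use assms in auto)

text \<open>All numbers of this run have width exactly \<open>Y\<close>. The conditions collected in
  \<open>tok\<close> say that intermediate values fit into this width and that indices and loops are
  at most \<open>Y\<close>, which turns the cost into a polynomial in \<open>Y\<close>.\<close>

lemma reach_ct:
  "tok Y t (envof d) \<Longrightarrow> wd Y d \<Longrightarrow> 0 < Y \<Longrightarrow>
    reach (ct t) (E d) (E (d(5 := dg Y (tval t (envof d)) # d 5))) (poly (tcost t) Y)"
proof (induction t arbitrary: d)
  case (TBit b)
  from reach_Dig[OF TBit(3), of 5 b d] show ?case
    unfolding ct.simps tval.simps tcost.simps by (simp del: fun_upd_apply add: mult.commute)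
next
  case (TGet k t)
  let ?m = "tval t (envof d)" and ?A = "d (k + 8)"
  have t: "tok Y t (envof d)" and m: "?m < length ?A" and mY: "?m \<le> Y"
    using TGet.prems(1) by (auto simp: envof_def)
  have mb: "bval (dg Y ?m) = ?m" using tval_less[OF t TGet.prems(2,3)] by simp
  let ?z = "dg Y ?m" and ?y = "?A ! ?m"
  have y: "length ?y = Y" using nth_mem[OF m] TGet.prems(2) unfolding wd_def by blast
  have 1: "reach (ct t) (E d) (E (d(5 := ?z # d 5))) (poly (tcost t) Y)"
    by (rule TGet.IH[OF t TGet.prems(2,3)])
  have 2: "reach (Copy 5 6) (E (d(5 := ?z # d 5))) (E (d(5 := ?z # d 5, 6 := ?z # d 6))) (40 * (Y + 1))"
    by (rule reach_conv[OF reach_Copy[where W = Y]]) auto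
  let ?d3 = "d(6 := ?z # d 6, k + 8 := drop ?m ?A, 7 := rev (take ?m ?A) @ d 7)"
  have 3: "reach (Walk (k + 8) 7) (E (d(5 := ?z # d 5, 6 := ?z # d 6))) (E ?d3) ((Y + 1) * (1000 * (Y + 1)))"
  proof (rule reach_conv[OF reach_Walk[where W = Y and x = ?z and r = "d 5"]])
    show "\<forall>y\<in>set (take (bval ?z) ((d(5 := ?z # d 5, 6 := ?z # d 6)) (k + 8))). length y = Y"
      using TGet.prems(2) by (auto simp: wd_def dest: in_set_takeD)
    show "(bval ?z + 1) * (1000 * (Y + 1)) \<le> (Y + 1) * (1000 * (Y + 1))" using mY mb by (intro mult_le_mono1) simp
  qed (use m mb TGet.prems(3) in \<open>auto simp: walked_def fun_eq_iff\<close>)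
  have d3: "?d3 (k + 8) \<noteq> []" "hd (?d3 (k + 8)) = ?y" using m by (auto simp: hd_drop_conv_nth)
  have 4: "reach (Copy (k + 8) 5) (E ?d3) (E (?d3(5 := ?y # d 5))) (40 * (Y + 1))"
    by (rule reach_conv[OF reach_Copy[where W = Y]]) (use d3 y in auto)
  let ?d5 = "d(k + 8 := drop ?m ?A, 7 := rev (take ?m ?A) @ d 7, 5 := ?z # ?y # d 5)"
  have 5: "reach (Move 6 5) (E (?d3(5 := ?y # d 5))) (E ?d5) (40 * (Y + 1))"
    by (rule reach_conv[OF reach_Move[where W = Y]]) (auto simp: fun_eq_iff)
  have 6: "reach (Walk 7 (k + 8)) (E ?d5) (E (d(5 := ?y # d 5))) ((Y + 1) * (1000 * (Y + 1)))"
  proof (rule reach_conv[OF reach_Walk[where W = Y and x = ?z and r = "?y # d 5"]])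
    show "\<forall>y\<in>set (take (bval ?z) (?d5 7)). length y = Y"
      using TGet.prems(2) m mb by (auto simp: wd_def dest: in_set_takeD)
    show "(bval ?z + 1) * (1000 * (Y + 1)) \<le> (Y + 1) * (1000 * (Y + 1))" using mY mb by (intro mult_le_mono1) simp
  qed (use m mb TGet.prems(3) in \<open>auto simp: walked_def fun_eq_iff\<close>)
  have v: "tval (TGet k t) (envof d) = bval ?y" using m by (simp add: get_def envof_def)
  have e: "dg Y (tval (TGet k t) (envof d)) = ?y" unfolding v using dg_bval[of ?y] y by simp
  show ?case
    unfolding e ct.simps
    by (rule reach_Seq[OF 1 reach_Seq[OF 2 reach_Seq[OF 3 reach_Seq[OF 4 reach_Seq[OF 5 6 order_refl] order_refl] order_refl] order_refl]])
      (simp add: algebra_simps)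
next
  case (TAdd s t)
  let ?a = "tval s (envof d)" and ?b = "tval t (envof d)"
  have ok: "tok Y s (envof d)" "tok Y t (envof d)" "?a + ?b < 2 ^ Y" using TAdd.prems(1) by auto
  have e: "envof (d(5 := x)) = envof d" for x by (rule envof_upd) simp
  have 1: "reach (ct s) (E d) (E (d(5 := dg Y ?a # d 5))) (poly (tcost s) Y)"
    by (rule TAdd.IH(1)[OF ok(1) TAdd.prems(2,3)])
  have 2: "reach (ct t) (E (d(5 := dg Y ?a # d 5))) (E (d(5 := dg Y ?b # dg Y ?a # d 5))) (poly (tcost t) Y)"
    using TAdd.IH(2)[of "d(5 := dg Y ?a # d 5)", unfolded e, OF ok(2) wd_upd(1)[OF _ TAdd.prems(2)] TAdd.prems(3)]
    by (simp del: fun_upd_apply add: fun_upd_same)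
  have 3: "reach AddOp (E (d(5 := dg Y ?b # dg Y ?a # d 5))) (E (d(5 := dg Y (?a + ?b) # d 5))) (300 * (Y + 1))"
    by (rule reach_conv[OF reach_AddOp[where W = Y and x = "dg Y ?b" and y = "dg Y ?a" and r = "d 5"]])
      (use ok tval_less[OF ok(1) TAdd.prems(2,3)] tval_less[OF ok(2) TAdd.prems(2,3)] in \<open>auto simp: add_ac\<close>)
  show ?case
    unfolding ct.simps tval.simps
    by (rule reach_Seq[OF 1 reach_Seq[OF 2 3 order_refl]]) simp
next
  case (TMul s t)
  let ?a = "tval s (envof d)" and ?b = "tval t (envof d)"
  have ok: "tok Y s (envof d)" "tok Y t (envof d)" "?a * ?b < 2 ^ Y" using TMul.prems(1) by auto
  have e: "envof (d(5 := x)) = envof d" for x by (rule envof_upd) simp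
  have 1: "reach (ct s) (E d) (E (d(5 := dg Y ?a # d 5))) (poly (tcost s) Y)"
    by (rule TMul.IH(1)[OF ok(1) TMul.prems(2,3)])
  have 2: "reach (ct t) (E (d(5 := dg Y ?a # d 5))) (E (d(5 := dg Y ?b # dg Y ?a # d 5))) (poly (tcost t) Y)"
    using TMul.IH(2)[of "d(5 := dg Y ?a # d 5)", unfolded e, OF ok(2) wd_upd(1)[OF _ TMul.prems(2)] TMul.prems(3)]
    by (simp del: fun_upd_apply add: fun_upd_same)
  have 3: "reach MulOp (E (d(5 := dg Y ?b # dg Y ?a # d 5))) (E (d(5 := dg Y (?a * ?b) # d 5))) (2000 * ((Y + 1) * (Y + 1)))"
    by (rule reach_conv[OF reach_MulOp[where W = Y and x = "dg Y ?b" and y = "dg Y ?a" and r = "d 5"]])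
      (use ok tval_less[OF ok(1) TMul.prems(2,3)] tval_less[OF ok(2) TMul.prems(2,3)] TMul.prems(3) in auto)
  show ?case
    unfolding ct.simps tval.simps
    by (rule reach_Seq[OF 1 reach_Seq[OF 2 3 order_refl]]) (simp add: algebra_simps)
next
  case (TSum k s t)
  let ?n = "tval s (envof d)" and ?q = "d (k + 8)"
  define F where "F v = tval t ((envof d)(k := v # envof d k))" for v
  define S where "S j = (\<Sum>v<j. F v)" for j
  have ok: "tok Y s (envof d)" "?n \<le> Y" "\<And>v. v < ?n \<Longrightarrow> tok Y t ((envof d)(k := v # envof d k))" "S ?n < 2 ^ Y"
    using TSum.prems(1) by (auto simp: S_def F_def)
  have nb: "?n < 2 ^ Y" by (rule tval_less[OF ok(1) TSum.prems(2,3)])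
  have Sb: "S j < 2 ^ Y" if "j \<le> ?n" for j
  proof -
    have "S j \<le> S ?n" unfolding S_def using that by (intro sum_mono2) auto
    then show ?thesis using ok(4) by simp
  qed
  let ?z = "dg Y ?n"
  define f where "f j = d(6 := ?z # d 6, 5 := dg Y (S j) # d 5, k + 8 := dg Y j # ?q)" for j
  have 1: "reach (ct s) (E d) (E (d(5 := ?z # d 5))) (poly (tcost s) Y)"
    by (rule TSum.IH(1)[OF ok(1) TSum.prems(2,3)])
  have 2: "reach (Move 5 6) (E (d(5 := ?z # d 5))) (E (d(6 := ?z # d 6))) (40 * (Y + 1))"
    by (rule reach_conv[OF reach_Move[where W = Y]]) (auto simp: fun_eq_iff)
  have 3: "reach (Dig 5 False) (E (d(6 := ?z # d 6))) (E (d(6 := ?z # d 6, 5 := dg Y 0 # d 5))) (40 * (Y + 1))"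
    by (rule reach_conv[OF reach_Dig[where W = Y]]) (use TSum.prems in auto)
  have 4: "reach (Dig (k + 8) False) (E (d(6 := ?z # d 6, 5 := dg Y 0 # d 5))) (E (f 0)) (40 * (Y + 1))"
    by (rule reach_conv[OF reach_Dig[where W = Y]]) (use TSum.prems in \<open>auto simp: f_def S_def\<close>)
  have 5: "reach (Star (ct t ;; AddOp ;; Inc (k + 8))) (E (f 0)) (E (f ?n))
      (?n * (poly (tcost t) Y + 900 * (Y + 1) + 3) + 1)"
  proof (rule reach_Star[where f = "\<lambda>j. E (f j)", OF _ order_refl])
    fix j assume j: "j < ?n"
    have jb: "bval (dg Y j) = j" using j nb by simp
    have ef: "envof (f j) = (envof d)(k := j # envof d k)"
      using jb by (auto simp: f_def envof_upd) (simp add: envof_def)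
    have wf: "wd Y (f j)" unfolding f_def using TSum.prems(2) by (auto simp: wd_def)
    have okj: "tok Y t (envof (f j))" unfolding ef by (rule ok(3)[OF j])
    have fj: "f j 5 = dg Y (S j) # d 5" "tval t (envof (f j)) = F j" unfolding ef F_def by (simp_all add: f_def)
    have a: "reach (ct t) (E (f j)) (E ((f j)(5 := dg Y (F j) # dg Y (S j) # d 5))) (poly (tcost t) Y)"
      using TSum.IH(2)[OF okj wf TSum.prems(3)] unfolding fj .
    have FS: "F j + S j = S (Suc j)" by (simp add: S_def)
    then have Fb: "F j < 2 ^ Y" "S j < 2 ^ Y" "F j + S j < 2 ^ Y" using Sb[of "Suc j"] j by auto
    have b: "reach AddOp (E ((f j)(5 := dg Y (F j) # dg Y (S j) # d 5))) (E ((f j)(5 := dg Y (S (Suc j)) # d 5))) (300 * (Y + 1))"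
      by (rule reach_conv[OF reach_AddOp[where W = Y and x = "dg Y (F j)" and y = "dg Y (S j)" and r = "d 5"]])
        (use Fb FS in auto)
    have c: "reach (Inc (k + 8)) (E ((f j)(5 := dg Y (S (Suc j)) # d 5))) (E (f (Suc j))) (500 * (Y + 1))"
      by (rule reach_conv[OF reach_Inc[where W = Y and x = "dg Y j" and r = ?q]])
        (use jb j nb in \<open>auto simp: f_def fun_eq_iff\<close>)
    show "reach (ct t ;; AddOp ;; Inc (k + 8)) (E (f j)) (E (f (Suc j))) (poly (tcost t) Y + 900 * (Y + 1))"
      by (rule reach_Seq[OF a reach_Seq[OF b c order_refl]]) simp
  qed
  have 6: "reach (Move (k + 8) 5) (E (f ?n)) (E (d(6 := ?z # d 6, 5 := ?z # dg Y (S ?n) # d 5))) (40 * (Y + 1))"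
    by (rule reach_conv[OF reach_Move[where W = Y]]) (auto simp: f_def fun_eq_iff)
  have 7: "reach (Move 6 5) (E (d(6 := ?z # d 6, 5 := ?z # dg Y (S ?n) # d 5))) (E (d(5 := ?z # ?z # dg Y (S ?n) # d 5))) (40 * (Y + 1))"
    by (rule reach_conv[OF reach_Move[where W = Y]]) (auto simp: fun_eq_iff)
  have 8: "reach EqOp (E (d(5 := ?z # ?z # dg Y (S ?n) # d 5))) (E (d(5 := dg Y (S ?n) # d 5))) (100 * (Y + 1))"
    by (rule reach_conv[OF reach_EqOp[where W = Y and x = ?z and r = "dg Y (S ?n) # d 5"]]) auto
  have v: "tval (TSum k s t) (envof d) = S ?n" by (simp add: S_def F_def)
  have n: "?n * (poly (tcost t) Y + 900 * (Y + 1) + 3) \<le> Y * (poly (tcost t) Y + 900 * (Y + 1) + 3)"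
    using ok(2) by (rule mult_le_mono1)
  show ?case
    unfolding v ct.simps
    by (rule reach_Seq[OF 1 reach_Seq[OF 2 reach_Seq[OF 3 reach_Seq[OF 4 reach_Seq[OF 5 reach_Seq[OF 6 reach_Seq[OF 7 8
      order_refl] order_refl] order_refl] order_refl] order_refl] order_refl]])
      (use n in \<open>simp add: algebra_simps\<close>)
qed

lemma reach_cf:
  "fok Y f (envof d) \<Longrightarrow> wd Y d \<Longrightarrow> 0 < Y \<Longrightarrow> reach (cf f) (E d) (E d) (poly (fcost f) Y)"
proof (induction f arbitrary: d)
  case (FLe s t)
  let ?a = "tval s (envof d)" and ?b = "tval t (envof d)"
  have ok: "tok Y s (envof d)" "tok Y t (envof d)" "?a \<le> ?b" using FLe.prems(1) by auto
  have e: "envof (d(5 := x)) = envof d" for x by (rule envof_upd) simp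
  have 1: "reach (ct s) (E d) (E (d(5 := dg Y ?a # d 5))) (poly (tcost s) Y)"
    by (rule reach_ct[OF ok(1) FLe.prems(2,3)])
  have 2: "reach (ct t) (E (d(5 := dg Y ?a # d 5))) (E (d(5 := dg Y ?b # dg Y ?a # d 5))) (poly (tcost t) Y)"
    by (rule reach_conv[OF reach_ct]) (use ok FLe.prems e in \<open>auto intro: wd_upd\<close>)
  have 3: "reach LeOp (E (d(5 := dg Y ?b # dg Y ?a # d 5))) (E d) (300 * (Y + 1))"
    by (rule reach_conv[OF reach_LeOp[where W = Y and y = "dg Y ?b" and x = "dg Y ?a" and r = "d 5"]])
      (use ok tval_less[OF ok(1) FLe.prems(2,3)] tval_less[OF ok(2) FLe.prems(2,3)] in auto)
  show ?case
    unfolding cf.simps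
    by (rule reach_Seq[OF 1 reach_Seq[OF 2 3 order_refl]]) simp
next
  case (FAnd f g)
  then show ?case
    unfolding cf.simps by (intro reach_Seq[OF FAnd.IH(1) FAnd.IH(2)]) auto
next
  case (FOr f g)
  then consider "fok Y f (envof d)" | "fok Y g (envof d)" by auto
  then show ?case
  proof cases
    case 1
    show ?thesis unfolding cf.simps by (rule reach_AltL[OF FOr.IH(1)[OF 1 FOr.prems(2,3)]]) simp
  next
    case 2
    show ?thesis unfolding cf.simps by (rule reach_AltR[OF FOr.IH(2)[OF 2 FOr.prems(2,3)]]) simp
  qed
next
  case (FAll k s g)
  let ?n = "tval s (envof d)" and ?q = "d (k + 8)"
  have ok: "tok Y s (envof d)" "?n \<le> Y" "\<And>v. v < ?n \<Longrightarrow> fok Y g ((envof d)(k := v # envof d k))"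
    using FAll.prems(1) by auto
  have nb: "?n < 2 ^ Y" by (rule tval_less[OF ok(1) FAll.prems(2,3)])
  let ?z = "dg Y ?n"
  define f where "f j = d(6 := ?z # d 6, k + 8 := dg Y j # ?q)" for j
  have 1: "reach (ct s) (E d) (E (d(5 := ?z # d 5))) (poly (tcost s) Y)"
    by (rule reach_ct[OF ok(1) FAll.prems(2,3)])
  have 2: "reach (Move 5 6) (E (d(5 := ?z # d 5))) (E (d(6 := ?z # d 6))) (40 * (Y + 1))"
    by (rule reach_conv[OF reach_Move[where W = Y]]) (auto simp: fun_eq_iff)
  have 4: "reach (Dig (k + 8) False) (E (d(6 := ?z # d 6))) (E (f 0)) (40 * (Y + 1))"
    by (rule reach_conv[OF reach_Dig[where W = Y]]) (use FAll.prems in \<open>auto simp: f_def\<close>)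
  have 5: "reach (Star (cf g ;; Inc (k + 8))) (E (f 0)) (E (f ?n))
      (?n * (poly (fcost g) Y + 600 * (Y + 1) + 3) + 1)"
  proof (rule reach_Star[where f = "\<lambda>j. E (f j)", OF _ order_refl])
    fix j assume j: "j < ?n"
    have jb: "bval (dg Y j) = j" using j nb by simp
    have ef: "envof (f j) = (envof d)(k := j # envof d k)"
      using jb by (auto simp: f_def envof_upd) (simp add: envof_def)
    have wf: "wd Y (f j)" unfolding f_def using FAll.prems(2) by (auto simp: wd_def)
    have a: "reach (cf g) (E (f j)) (E (f j)) (poly (fcost g) Y)"
      by (rule FAll.IH[OF _ wf FAll.prems(3)], unfold ef, rule ok(3)[OF j])
    have c: "reach (Inc (k + 8)) (E (f j)) (E (f (Suc j))) (500 * (Y + 1))"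
      by (rule reach_conv[OF reach_Inc[where W = Y and x = "dg Y j" and r = ?q]])
        (use jb j nb in \<open>auto simp: f_def fun_eq_iff\<close>)
    show "reach (cf g ;; Inc (k + 8)) (E (f j)) (E (f (Suc j))) (poly (fcost g) Y + 600 * (Y + 1))"
      by (rule reach_Seq[OF a c]) simp
  qed
  have 6: "reach (Move (k + 8) 5) (E (f ?n)) (E (d(6 := ?z # d 6, 5 := ?z # d 5))) (40 * (Y + 1))"
    by (rule reach_conv[OF reach_Move[where W = Y]]) (auto simp: f_def fun_eq_iff)
  have 7: "reach (Move 6 5) (E (d(6 := ?z # d 6, 5 := ?z # d 5))) (E (d(5 := ?z # ?z # d 5))) (40 * (Y + 1))"
    by (rule reach_conv[OF reach_Move[where W = Y]]) (auto simp: fun_eq_iff)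
  have 8: "reach EqOp (E (d(5 := ?z # ?z # d 5))) (E d) (100 * (Y + 1))"
    by (rule reach_conv[OF reach_EqOp[where W = Y and x = ?z and r = "d 5"]]) auto
  have n: "?n * (poly (fcost g) Y + 600 * (Y + 1) + 3) \<le> Y * (poly (fcost g) Y + 600 * (Y + 1) + 3)"
    using ok(2) by (rule mult_le_mono1)
  show ?case
    unfolding cf.simps
    by (rule reach_Seq[OF 1 reach_Seq[OF 2 reach_Seq[OF 4 reach_Seq[OF 5 reach_Seq[OF 6 reach_Seq[OF 7 8
      order_refl] order_refl] order_refl] order_refl] order_refl]])
      (use n in \<open>simp add: algebra_simps\<close>)
qed

section \<open>Loading the input and guessing the certificate\<close>

definition load :: com where
  "load = Dig 5 True ;; Dig 5 True ;; AddOp ;; Move 5 8 ;;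
     Star (branch (\<lambda>b. Pop 0 (bit_symbol b) ;; Dig 8 b)) ;; Pop 0 3"

primrec guess_arrays :: "nat \<Rightarrow> com" where
  "guess_arrays 0 = Skip"
| "guess_arrays (Suc m) = guess_arrays m ;; Star (Xfer [] [m + 9])"

definition verifier :: "nat \<Rightarrow> fml \<Rightarrow> com" where
  "verifier m f = load ;; guess_arrays m ;; cf f"

lemma init_store_E: "init_store w = E (\<lambda>i. if i = 0 then [rev w] else [])"
  by (auto simp: init_store_def E_def enc_def fun_eq_iff)

lemma runs_load_star:
  assumes "runs_to (Star (branch (\<lambda>b. Pop 0 (bit_symbol b) ;; Dig 8 b))) \<sigma> \<tau>"
  shows "\<sigma> = E d \<Longrightarrow> d 0 = [ds] \<Longrightarrow>
    \<exists>bs es xs. ds = bs @ es \<and> map bval xs = map of_bool (rev bs) \<and> \<tau> = E (d(0 := [es], 8 := xs @ d 8))"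
  using assms
proof (induction arbitrary: d ds rule: runs_Star_induct)
  case (Nil \<sigma>)
  have "d(0 := [ds], 8 := [] @ d 8) = d" using Nil(2) by (auto simp: fun_eq_iff)
  then have "\<sigma> = E (d(0 := [ds], 8 := [] @ d 8))" using Nil(1) by (simp only:)
  moreover have "ds = [] @ ds" "map bval [] = map of_bool (rev [])" by simp_all
  ultimately show ?case by blast
next
  case (Cons \<sigma> \<rho> \<tau>)
  obtain b \<rho>1 where r: "runs_to (Pop 0 (bit_symbol b)) (E d) \<rho>1" "runs_to (Dig 8 b) \<rho>1 \<rho>"
    using Cons(1) unfolding Cons(4) runs_branch runs_Seq by blast
  obtain es' r' where "d 0 = (b # es') # r'" "\<rho>1 = E (d(0 := es' # r'))" using runs_PopBit[OF r(1)] by blast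
  then have 1: "ds = b # es'" "\<rho>1 = E (d(0 := [es']))" using Cons(5) by auto
  obtain x where x: "bval x = of_bool b" "\<rho> = E (d(0 := [es'], 8 := x # d 8))"
    using runs_Dig[OF r(2)[unfolded 1(2)]] by auto
  have "(d(0 := [es'], 8 := x # d 8)) 0 = [es']" by simp
  from Cons(3)[OF x(2) this] obtain bs es xs where
    *: "es' = bs @ es" "map bval xs = map of_bool (rev bs)"
    "\<tau> = E (d(0 := [es'], 8 := x # d 8, 0 := [es], 8 := xs @ (d(0 := [es'], 8 := x # d 8)) 8))" by blast
  have "d(0 := [es'], 8 := x # d 8, 0 := [es], 8 := xs @ (d(0 := [es'], 8 := x # d 8)) 8) =
      d(0 := [es], 8 := (xs @ [x]) @ d 8)" by (auto simp: fun_eq_iff)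
  with *(3) have "\<tau> = E (d(0 := [es], 8 := (xs @ [x]) @ d 8))" by (simp only:)
  moreover have "ds = (b # bs) @ es" "map bval (xs @ [x]) = map of_bool (rev (b # bs))" using *(1,2) 1(1) x(1) by simp_all
  ultimately show ?case by blast
qed

text \<open>Stack 0 starts with the last input bit on top, so moving its bits one by one onto array
  0 restores their order. The end mark \<open>2\<close>, obtained as \<open>1 + 1\<close>, is placed
  there beforehand and ends up behind the input.\<close>

lemma runs_load:
  assumes "runs_to load (init_store w) \<tau>"
  shows "\<exists>d. \<tau> = E d \<and> envof d 0 = map of_bool w @ [2]"
proof -
  let ?d = "\<lambda>i::nat. if i = 0 then [rev w] else []"
  obtain \<rho>1 \<rho>2 \<rho>3 \<rho>4 \<rho>5 where r: "runs_to (Dig 5 True) (E ?d) \<rho>1" "runs_to (Dig 5 True) \<rho>1 \<rho>2" "runs_to AddOp \<rho>2 \<rho>3"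
    "runs_to (Move 5 8) \<rho>3 \<rho>4" "runs_to (Star (branch (\<lambda>b. Pop 0 (bit_symbol b) ;; Dig 8 b))) \<rho>4 \<rho>5" "runs_to (Pop 0 3) \<rho>5 \<tau>"
    using assms unfolding load_def runs_Seq init_store_E by blast
  obtain x where x: "bval x = 1" "\<rho>1 = E (?d(5 := [x]))" using runs_Dig[OF r(1)] by auto
  obtain y where y: "bval y = 1" "\<rho>2 = E (?d(5 := [y, x]))" using runs_Dig[OF r(2)[unfolded x(2)]] by auto
  obtain z where z0: "bval z = bval y + bval x" "\<rho>3 = E (?d(5 := [z]))" using runs_AddOp[OF r(3)[unfolded y(2)]] by auto
  have z: "bval z = 2" "\<rho>3 = E (?d(5 := [z]))" using z0 x(1) y(1) by simp_all
  have "\<rho>4 = E (?d(5 := [z], 5 := [], 8 := [z]))" using runs_Move[OF r(4)[unfolded z(2)]] by auto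
  also have "?d(5 := [z], 5 := [], 8 := [z]) = ?d(8 := [z])" by (auto simp: fun_eq_iff)
  finally have 4: "\<rho>4 = E (?d(8 := [z]))" .
  obtain bs es xs where 5: "rev w = bs @ es" "map bval xs = map of_bool (rev bs)" "\<rho>5 = E (?d(8 := [z], 0 := [es], 8 := xs @ [z]))"
    using runs_load_star[OF r(5) 4, of "rev w"] by auto
  have 6: "es = []" "\<tau> = E (?d(8 := [z], 0 := [es], 8 := xs @ [z], 0 := []))"
    using runs_PopEnd[OF r(6)[unfolded 5(3)]] by auto
  have "rev bs = w" using 5(1) 6(1) by (metis append_Nil2 rev_rev_ident)
  then have "envof (?d(8 := [z], 0 := [es], 8 := xs @ [z], 0 := [])) 0 = map of_bool w @ [2]"
    using 5(2) z(1) by (simp add: envof_def)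
  then show ?thesis using 6(2) by blast
qed

lemma runs_guess_arrays:
  "runs_to (guess_arrays m) (E d) \<tau> \<Longrightarrow> \<exists>d'. \<tau> = E d' \<and> d' 8 = d 8"
proof (induction m arbitrary: \<tau>)
  case (Suc m)
  then obtain \<rho> where r: "runs_to (guess_arrays m) (E d) \<rho>" "runs_to (Star (Xfer [] [m + 9])) \<rho> \<tau>"
    unfolding guess_arrays.simps runs_Seq by blast
  obtain d1 where 1: "d1 8 = d 8" "runs_to (Star (Xfer [] [m + 9])) (E d1) \<tau>" using Suc.IH[OF r(1)] r(2) by blast
  have "runs_to (Star (Xfer [] [m + 9])) \<sigma> \<rho> \<Longrightarrow> \<sigma> = E c \<Longrightarrow> \<exists>d'. \<rho> = E d' \<and> d' 8 = c 8" for \<sigma> \<rho> c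
  proof (induction arbitrary: c rule: runs_Star_induct)
    case (Cons \<sigma> \<rho> \<tau>)
    obtain ds where "\<rho> = E (c(m + 9 := ds # c (m + 9)))" using runs_Guess[OF Cons(1)[unfolded Cons(4)]] by blast
    moreover have "(c(m + 9 := ds # c (m + 9))) 8 = c 8" by simp
    ultimately show ?case using Cons(3) by metis
  qed blast
  from this[OF 1(2) refl] show ?case using 1(1) by simp
qed auto

lemma reach_load:
  assumes "2 \<le> Y" "length w \<le> Y"
  shows "reach load (init_store w) (E (\<lambda>i. if i = 8 then map (dg Y) (map of_bool w @ [2]) else [])) (1000 * ((Y + 1) * (Y + 1)))"
proof -
  let ?d = "\<lambda>i::nat. if i = 0 then [rev w] else []"
  have Y: "0 < Y" using assms(1) by simp
  have p: "(4::nat) \<le> 2 ^ Y" using power_increasing[OF assms(1), of "2::nat"] by simp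
  have two: "bval (dg Y (of_bool True)) + bval (dg Y (of_bool True)) = 2" using p by simp
  have 1: "reach (Dig 5 True) (E ?d) (E (?d(5 := [dg Y (of_bool True)]))) (40 * (Y + 1))"
    by (rule reach_conv[OF reach_Dig[OF Y]]) auto
  have 2: "reach (Dig 5 True) (E (?d(5 := [dg Y (of_bool True)]))) (E (?d(5 := [dg Y (of_bool True), dg Y (of_bool True)]))) (40 * (Y + 1))"
    by (rule reach_conv[OF reach_Dig[OF Y]]) (auto simp: fun_eq_iff)
  have 3: "reach AddOp (E (?d(5 := [dg Y (of_bool True), dg Y (of_bool True)]))) (E (?d(5 := [dg Y 2]))) (300 * (Y + 1))"
  proof (rule reach_conv[OF reach_AddOp[where W = Y and x = "dg Y (of_bool True)" and y = "dg Y (of_bool True)" and r = "[]"]])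
    show "bval (dg Y (of_bool True)) + bval (dg Y (of_bool True)) < 2 ^ Y" unfolding two using p by simp
    show "(?d(5 := [dg Y (of_bool True), dg Y (of_bool True)]))
        (5 := dg Y (bval (dg Y (of_bool True)) + bval (dg Y (of_bool True))) # []) = ?d(5 := [dg Y 2])"
      unfolding two by (auto simp: fun_eq_iff)
  qed auto
  define f where "f j = ?d(8 := map (dg Y) (map of_bool (rev (take j (rev w))) @ [2]), 0 := [drop j (rev w)])" for j
  have 4: "reach (Move 5 8) (E (?d(5 := [dg Y 2]))) (E (f 0)) (40 * (Y + 1))"
    by (rule reach_conv[OF reach_Move[where W = Y]]) (auto simp: fun_eq_iff f_def)
  have 5: "reach (Star (branch (\<lambda>b. Pop 0 (bit_symbol b) ;; Dig 8 b))) (E (f 0)) (E (f (length w))) (length w * (50 * (Y + 1) + 3) + 1)"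
  proof (rule reach_Star[where f = "\<lambda>j. E (f j)", OF _ order_refl])
    fix j assume j: "j < length w"
    define b where "b = rev w ! j"
    have d: "drop j (rev w) = b # drop (Suc j) (rev w)" using j by (simp add: Cons_nth_drop_Suc b_def)
    have t: "rev (take (Suc j) (rev w)) = b # rev (take j (rev w))" using j by (simp add: take_Suc_conv_app_nth b_def)
    have a: "reach (Pop 0 (bit_symbol b)) (E (f j)) (E ((f j)(0 := [drop (Suc j) (rev w)]))) 2"
      by (rule reach_PopBit) (use d in \<open>auto simp: f_def\<close>)
    have c: "reach (Dig 8 b) (E ((f j)(0 := [drop (Suc j) (rev w)]))) (E (f (Suc j))) (40 * (Y + 1))"
      by (rule reach_conv[OF reach_Dig[OF Y]]) (auto simp: f_def fun_eq_iff t)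
    show "reach (branch (\<lambda>b. Pop 0 (bit_symbol b) ;; Dig 8 b)) (E (f j)) (E (f (Suc j))) (50 * (Y + 1))"
      by (rule reach_branch[where b = b and f = "\<lambda>b. Pop 0 (bit_symbol b) ;; Dig 8 b", OF reach_Seq[OF a c order_refl]]) simp
  qed
  have 6: "reach (Pop 0 3) (E (f (length w))) (E (\<lambda>i. if i = 8 then map (dg Y) (map of_bool w @ [2]) else [])) 2"
    by (rule reach_conv[OF reach_PopEnd[where r = "[]", OF _ order_refl]]) (auto simp: f_def fun_eq_iff)
  have n: "length w * (50 * (Y + 1) + 3) \<le> Y * (50 * (Y + 1) + 3)" using assms(2) by (rule mult_le_mono1)
  show ?thesis
    unfolding load_def init_store_E
    by (rule reach_Seq[OF 1 reach_Seq[OF 2 reach_Seq[OF 3 reach_Seq[OF 4 reach_Seq[OF 5 6 order_refl] order_refl] order_refl] order_refl]])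
      (use n in \<open>simp add: algebra_simps\<close>)
qed

lemma reach_guess_arrays:
  assumes "\<And>k. length (e k) \<le> Y" "d 8 = map (dg Y) (e 0)" "\<And>i. i \<noteq> 8 \<Longrightarrow> d i = []"
  shows "reach (guess_arrays m) (E d) (E (\<lambda>i. if i \<in> {8..m + 8} then map (dg Y) (e (i - 8)) else [])) (m * (100 * ((Y + 1) * (Y + 1))))"
proof (induction m)
  case 0
  have "(\<lambda>i. if i \<in> {8..0 + 8} then map (dg Y) (e (i - 8)) else []) = d" using assms(2,3) by (auto simp: fun_eq_iff)
  then show ?case by (simp add: reach_Skip)
next
  case (Suc m)
  let ?g = "\<lambda>m i. if i \<in> {8..m + 8} then map (dg Y) (e (i - 8)) else []"
  let ?xs = "map (dg Y) (e (Suc m))"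
  define f where "f j = (?g m)(m + 9 := drop (length ?xs - j) ?xs)" for j
  have f0: "f 0 = ?g m" by (auto simp: f_def fun_eq_iff)
  have fl: "f (length ?xs) = ?g (Suc m)" by (auto simp: f_def fun_eq_iff Suc_diff_le)
  have "reach (Star (Xfer [] [m + 9])) (E (f 0)) (E (f (length ?xs))) (length ?xs * (40 * (Y + 1) + 3) + 1)"
  proof (rule reach_Star[where f = "\<lambda>j. E (f j)", OF _ order_refl])
    fix j assume j: "j < length ?xs"
    have l: "length (?xs ! (length ?xs - Suc j)) \<le> Y" using j by simp
    have "drop (length ?xs - Suc j) ?xs = ?xs ! (length ?xs - Suc j) # drop (length ?xs - j) ?xs"
      using j by (metis Cons_nth_drop_Suc Suc_diff_Suc diff_less length_pos_if_in_set nth_mem zero_less_Suc)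
    then have "(f j)(m + 9 := ?xs ! (length ?xs - Suc j) # f j (m + 9)) = f (Suc j)" by (simp add: f_def)
    with reach_Guess[OF l, of "m + 9" "f j"]
    show "reach (Xfer [] [m + 9]) (E (f j)) (E (f (Suc j))) (40 * (Y + 1))" by (simp only:)
  qed
  note 2 = this[unfolded f0 fl]
  have "length ?xs * (40 * (Y + 1) + 3) \<le> Y * (40 * (Y + 1) + 3)" using assms(1)[of "Suc m"] by (intro mult_le_mono1) simp
  then show ?case
    unfolding guess_arrays.simps
    by (intro reach_Seq[OF Suc.IH 2]) (simp add: algebra_simps)
qed

lemma pops_nonblank_pushes [simp]: "pops_nonblank (pushes qs s)"
  by (induction qs) auto

lemma pops_nonblank_pops [simp]: "s \<noteq> 0 \<Longrightarrow> pops_nonblank (pops qs s)"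
  by (induction qs) auto

lemma pops_nonblank_branch [simp]: "pops_nonblank (branch f) \<longleftrightarrow> (\<forall>b. pops_nonblank (f b))"
  by (auto simp: branch_def all_bool_eq)

lemma pops_nonblank_Xfer [simp]: "pops_nonblank (Xfer ps qs)"
  by (simp add: Xfer_def xfer_loop_def)

lemma pops_nonblank_ops [simp]:
  "pops_nonblank (Move i j)" "pops_nonblank (Copy i j)" "pops_nonblank (Dig i b)" "pops_nonblank (AddChk i j k)"
  by (simp_all add: Move_def Copy_def Dig_def AddChk_def adder_def)

lemma pops_nonblank_ops2 [simp]:
  "pops_nonblank AddOp" "pops_nonblank EqOp" "pops_nonblank LeOp" "pops_nonblank MulOp" "pops_nonblank (Inc i)"
  "pops_nonblank (Walk i j)"
  by (simp_all add: AddOp_def EqOp_def LeOp_def MulOp_def mul_loop_def Dup_def Inc_def Walk_def)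

lemma pops_nonblank_ct [simp]: "pops_nonblank (ct t)"
  by (induction t) auto

lemma pops_nonblank_cf [simp]: "pops_nonblank (cf f)"
  by (induction f) auto

lemma pops_nonblank_verifier: "pops_nonblank (verifier m f)"
proof -
  have "pops_nonblank (guess_arrays m)" by (induction m) auto
  then show ?thesis by (simp add: verifier_def load_def)
qed

text \<open>Soundness faces arbitrary guessed arrays, whereas completeness may choose arrays of
  bounded length and bit size. The width is \<open>Y = poly q (length w)\<close>, so the running
  time is a polynomial composed with \<open>q\<close>. The lower bound 2 on the width makes room for
  the end mark 2.\<close>

theorem NP_of_formula:
  fixes f :: fml and q :: "nat poly"
  assumes sound: "\<And>w e. e 0 = map of_bool w @ [2] \<Longrightarrow> fsat f e \<Longrightarrow> w \<in> L"
    and complete: "\<And>w. w \<in> L \<Longrightarrow> \<exists>e. e 0 = map of_bool w @ [2] \<and> (\<forall>k>m. e k = []) \<and>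
      (\<forall>k. length (e k) \<le> poly q (length w) \<and> (\<forall>v\<in>set (e k). v < 2 ^ poly q (length w))) \<and>
      fok (poly q (length w)) f e"
    and q: "\<And>n. 2 \<le> poly q n"
  shows "L \<in> NP"
proof (rule NP_of_com[where m = "verifier m f" and
      q = "pcompose (1000 * (lin * lin) + of_nat m * (100 * (lin * lin)) + fcost f + 6) q"])
  show "pops_nonblank (verifier m f)" by (rule pops_nonblank_verifier)
next
  fix w n \<tau> assume "exec (verifier m f) (init_store w) n \<tau>"
  then have "runs_to (verifier m f) (init_store w) \<tau>" by (auto simp: runs_to_def)
  then obtain \<rho>1 \<rho>2 where r: "runs_to load (init_store w) \<rho>1" "runs_to (guess_arrays m) \<rho>1 \<rho>2" "runs_to (cf f) \<rho>2 \<tau>"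
    unfolding verifier_def runs_Seq by blast
  obtain d where d: "\<rho>1 = E d" "envof d 0 = map of_bool w @ [2]" using runs_load[OF r(1)] by blast
  obtain d' where d': "\<rho>2 = E d'" "d' 8 = d 8" using runs_guess_arrays[OF r(2)[unfolded d(1)]] by blast
  have "envof d' 0 = map of_bool w @ [2]" using d(2) d'(2) by (simp add: envof_def)
  moreover have "fsat f (envof d')" using runs_cf[OF r(3)[unfolded d'(1)]] by blast
  ultimately show "w \<in> L" by (rule sound)
next
  fix w assume "w \<in> L"
  then obtain e where e: "e 0 = map of_bool w @ [2]" "\<forall>k>m. e k = []"
    "\<forall>k. length (e k) \<le> poly q (length w) \<and> (\<forall>v\<in>set (e k). v < 2 ^ poly q (length w))"
    "fok (poly q (length w)) f e" using complete by blast
  define Y where "Y = poly q (length w)"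
  note e = e[folded Y_def]
  have Y: "2 \<le> Y" using q by (simp add: Y_def)
  have "length w \<le> Y" using e(1) e(3)[rule_format, of 0] by simp
  note 1 = reach_load[OF Y this, folded e(1)]
  let ?d = "\<lambda>i. if i \<in> {8..m + 8} then map (dg Y) (e (i - 8)) else []"
  have 2: "reach (guess_arrays m) (E (\<lambda>i. if i = 8 then map (dg Y) (e 0) else [])) (E ?d) (m * (100 * ((Y + 1) * (Y + 1))))"
    by (rule reach_guess_arrays) (use e(3) in auto)
  have "envof ?d = e"
  proof
    fix k
    have "map bval (map (dg Y) (e k)) = e k" using e(3) by (intro map_idI[THEN trans[OF map_map]]) auto
    then show "envof ?d k = e k" using e(2) by (cases "k \<le> m") (auto simp: envof_def)
  qed
  then have "fok Y f (envof ?d)" using e(4) by simp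
  moreover have "wd Y ?d" by (auto simp: wd_def)
  ultimately have 3: "reach (cf f) (E ?d) (E ?d) (poly (fcost f) Y)" using Y by (intro reach_cf) auto
  have "reach (verifier m f) (init_store w) (E ?d)
      (1000 * ((Y + 1) * (Y + 1)) + m * (100 * ((Y + 1) * (Y + 1))) + poly (fcost f) Y + 6)"
    unfolding verifier_def by (rule reach_Seq[OF 1 reach_Seq[OF 2 3 order_refl]]) simp
  moreover have "1000 * ((Y + 1) * (Y + 1)) + m * (100 * ((Y + 1) * (Y + 1))) + poly (fcost f) Y + 6 =
      poly (pcompose (1000 * (lin * lin) + of_nat m * (100 * (lin * lin)) + fcost f + 6) q) (length w)"
    unfolding poly_pcompose Y_def[symmetric] by (simp add: poly_of_nat algebra_simps)
  ultimately show "\<exists>n \<tau>. exec (verifier m f) (init_store w) n \<tau> \<and>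
      n \<le> poly (pcompose (1000 * (lin * lin) + of_nat m * (100 * (lin * lin)) + fcost f + 6) q) (length w)"
    unfolding reach_def by metis
qed

section \<open>Small certificates for linear inequalities\<close>

text \<open>Bartl's proof: if some \<open>u\<close> violates the implication for the first \<open>m\<close> functionals, project along
  \<open>u\<close> onto the kernel of the last one.\<close>

lemma farkas:
  fixes a :: "nat \<Rightarrow> 'j \<Rightarrow> 'a::linordered_field"
  assumes "finite J" "\<And>u. (\<forall>i<m. (\<Sum>j\<in>J. a i j * u j) \<le> 0) \<Longrightarrow> (\<Sum>j\<in>J. g j * u j) \<le> 0"
  shows "\<exists>l. (\<forall>i<m. 0 \<le> l i) \<and> (\<forall>j\<in>J. g j = (\<Sum>i<m. l i * a i j))"
  using assms(2)
proof (induction m arbitrary: a g)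
  \<comment> \<open>Without functionals the hypothesis holds at \<open>u = g\<close>, and a sum of
    squares that is at most 0 vanishes termwise.\<close>
  case 0
  have "(\<Sum>j\<in>J. g j * g j) \<le> 0" using 0[of g] by simp
  moreover have "(\<Sum>j\<in>J. g j * g j) \<ge> 0" by (intro sum_nonneg) simp
  ultimately have "(\<Sum>j\<in>J. g j * g j) = 0" by simp
  then have "\<forall>j\<in>J. g j * g j = 0" using assms(1) by (subst (asm) sum_nonneg_eq_0_iff) auto
  then show ?case by simp
next
  case (Suc m)
  define D where "D x u = (\<Sum>j\<in>J. x j * u j)" for x u :: "'j \<Rightarrow> 'a"
  have D_lin: "D (\<lambda>j. x j - c * y j) u = D x u - c * D y u" "D x (\<lambda>j. v j - c * w j) = D x v - c * D x w"
    "D x (\<lambda>j. c * v j) = c * D x v" for x y u v w c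
    by (simp_all add: D_def algebra_simps sum_subtractf sum_distrib_left)
  have prem: "D g u \<le> 0" if "\<forall>i<Suc m. D (a i) u \<le> 0" for u
    using Suc.prems that unfolding D_def by blast
  show ?case
  proof (cases "\<forall>u. (\<forall>i<m. D (a i) u \<le> 0) \<longrightarrow> D g u \<le> 0")
    case True
    then obtain l where l: "\<forall>i<m. 0 \<le> l i" "\<forall>j\<in>J. g j = (\<Sum>i<m. l i * a i j)"
      using Suc.IH[of a g] unfolding D_def by blast
    have "(\<Sum>i<m. (l(m := 0)) i * a i j) = (\<Sum>i<m. l i * a i j)" for j by (intro sum.cong) auto
    with l show ?thesis by (intro exI[of _ "l(m := 0)"]) (auto simp: less_Suc_eq)
  next
    case False
    then obtain u where u: "\<forall>i<m. D (a i) u \<le> 0" "D g u > 0" by force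
    have au: "D (a m) u > 0"
    proof (rule ccontr)
      assume "\<not> D (a m) u > 0"
      then have "\<forall>i<Suc m. D (a i) u \<le> 0" using u(1) by (auto simp: less_Suc_eq)
      with prem u(2) show False by fastforce
    qed
    define w where "w j = inverse (D (a m) u) * u j" for j
    have w: "D (a m) w = 1" "\<forall>i<m. D (a i) w \<le> 0" "D g w > 0"
    proof -
      have "D x w = inverse (D (a m) u) * D x u" for x unfolding w_def[abs_def] by (rule D_lin(3))
      then show "D (a m) w = 1" "\<forall>i<m. D (a i) w \<le> 0" "D g w > 0"
        using au u by (auto simp: mult_nonneg_nonpos)
    qed
    \<comment> \<open>These are the functionals composed with the projection
      \<open>x \<mapsto> x - D (a m) x * w\<close> onto the kernel of \<open>a m\<close>; the
      normalisation \<open>D (a m) w = 1\<close> makes it a projection.\<close>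
    define a' where "a' i j = a i j - D (a i) w * a m j" for i j
    define g' where "g' j = g j - D g w * a m j" for j
    have "\<exists>l. (\<forall>i<m. 0 \<le> l i) \<and> (\<forall>j\<in>J. g' j = (\<Sum>i<m. l i * a' i j))"
    proof (rule Suc.IH)
      fix x assume x: "\<forall>i<m. (\<Sum>j\<in>J. a' i j * x j) \<le> 0"
      let ?y = "\<lambda>j. x j - D (a m) x * w j"
      have "D (a i) ?y = D (a' i) x" for i
        unfolding D_lin(2) a'_def[abs_def] D_lin(1) by (simp add: mult.commute)
      then have "\<forall>i<m. D (a i) ?y \<le> 0" using x unfolding D_def by simp
      moreover have "D (a m) ?y = 0" unfolding D_lin(2) using w(1) by simp
      ultimately have "D g ?y \<le> 0" by (intro prem) (auto simp: less_Suc_eq)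
      moreover have "D g ?y = D g' x"
        unfolding D_lin(2) g'_def[abs_def] D_lin(1) by (simp add: mult.commute)
      ultimately show "(\<Sum>j\<in>J. g' j * x j) \<le> 0" by (simp add: D_def)
    qed
    then obtain l where l: "\<forall>i<m. 0 \<le> l i" "\<forall>j\<in>J. g' j = (\<Sum>i<m. l i * a' i j)" by blast
    \<comment> \<open>Undoing the projection leaves this coefficient for the last functional. It is
      nonnegative because \<open>g\<close> is positive at \<open>w\<close> while the first
      \<open>m\<close> functionals are not.\<close>
    define c where "c = D g w - (\<Sum>i<m. l i * D (a i) w)"
    have "(\<Sum>i<m. l i * D (a i) w) \<le> 0" using l(1) w(2) by (intro sum_nonpos) (auto simp: mult_nonneg_nonpos)
    then have c: "0 \<le> c" using w(3) by (simp add: c_def)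
    have "g j = (\<Sum>i<Suc m. (l(m := c)) i * a i j)" if "j \<in> J" for j
    proof -
      have "(\<Sum>i<m. (l(m := c)) i * a i j) = (\<Sum>i<m. l i * a i j)" by (intro sum.cong) auto
      moreover have "g j = (\<Sum>i<m. l i * a i j) + c * a m j"
        using l(2) that
        by (simp add: g'_def a'_def c_def algebra_simps sum_subtractf sum_distrib_left sum_distrib_right)
      ultimately show ?thesis by simp
    qed
    then show ?thesis using l(1) c by (intro exI[of _ "l(m := c)"]) (auto simp: less_Suc_eq)
  qed
qed

section \<open>Small solutions of integer linear systems\<close>

lemma sum_lessThan_add: "(\<Sum>i<m + n :: nat. f i) = (\<Sum>i<m. f i) + (\<Sum>i<n. f (m + i) :: 'a::comm_monoid_add)"
  by (induction n) (auto simp: add_ac)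

text \<open>A minimal solution \<open>v\<close> is small: along the rounded segment from \<open>0\<close> to \<open>v\<close> the residues stay bounded, so
  if \<open>v\<close> is large two points on it have the same residue, and \<open>v\<close> splits into two solutions.\<close>

lemma small_solution:
  fixes A :: "nat \<Rightarrow> nat \<Rightarrow> int" and v :: "nat \<Rightarrow> nat"
  assumes sol: "\<forall>i<m. (\<Sum>j<n. A i j * int (v j)) = 0" "1 \<le> v 0" and n: "0 < n"
    and bound: "\<And>i j. i < m \<Longrightarrow> j < n \<Longrightarrow> \<bar>A i j\<bar> \<le> int C"
  shows "\<exists>v. (\<forall>i<m. (\<Sum>j<n. A i j * int (v j)) = 0) \<and> 1 \<le> v 0 \<and> (\<forall>j<n. v j \<le> (2 * n * C + 1) ^ m)"
proof -
  define P where "P v \<longleftrightarrow> (\<forall>i<m. (\<Sum>j<n. A i j * int (v j)) = 0) \<and> 1 \<le> v 0" for v :: "nat \<Rightarrow> nat"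
  define N where "N v = (\<Sum>j<n. v j)" for v :: "nat \<Rightarrow> nat"
  have "P v" using sol by (simp add: P_def)
  then obtain v where v: "P v" and min: "\<And>v'. P v' \<Longrightarrow> N v \<le> N v'"
    using ex_has_least_nat[of P v N] by blast
  have "v j0 \<le> (2 * n * C + 1) ^ m" if j0: "j0 < n" for j0
  proof (rule ccontr)
    define V where "V = v j0"
    assume "\<not> v j0 \<le> (2 * n * C + 1) ^ m"
    then have V: "(2 * n * C + 1) ^ m < V" by (simp add: V_def)
    then have V0: "0 < V" by simp
    \<comment> \<open>The rounded points of the segment, for \<open>k / V\<close>. As
      \<open>V\<close> is the coordinate \<open>j0\<close> of \<open>v\<close>, this coordinate of
      \<open>p k\<close> is exactly \<open>k\<close>, so different indices give different
      points.\<close>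
    define p where "p k j = k * v j div V" for k j
    have p0: "p k j0 = k" for k using V0 by (simp add: p_def V_def)
    have p_mono: "p k j \<le> p k' j" if "k \<le> k'" for k k' j using that by (simp add: p_def div_le_mono)
    have p_le: "p k j \<le> v j" if "k \<le> V" for k j
    proof -
      have "k * v j div V \<le> V * v j div V" using that by (intro div_le_mono mult_le_mono1)
      then show ?thesis using V0 by (simp add: p_def)
    qed
    define e where "e k i = (\<Sum>j<n. A i j * int (p k j))" for k i
    \<comment> \<open>Multiplied by \<open>V\<close>, the residue consists of a multiple of the
      vanishing row product with \<open>v\<close> minus a combination of \<open>n\<close> remainders
      modulo \<open>V\<close>. Each remainder is less than \<open>V\<close>, so the bound does not
      depend on \<open>v\<close>.\<close>
    have e_bound: "\<bar>e k i\<bar> \<le> int (n * C)" if i: "i < m" for k i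
    proof -
      have "int V * e k i = (\<Sum>j<n. A i j * int (k * v j)) - (\<Sum>j<n. A i j * int (k * v j mod V))"
      proof -
        have "int V * int (p k j) = int (k * v j) - int (k * v j mod V)" for j
          unfolding p_def of_nat_mult[symmetric] by (simp add: minus_mod_eq_mult_div[symmetric] of_nat_diff)
        then have "int V * e k i = (\<Sum>j<n. A i j * (int (k * v j) - int (k * v j mod V)))"
          unfolding e_def sum_distrib_left by (intro sum.cong refl) (metis mult.left_commute)
        then show ?thesis by (simp only: right_diff_distrib sum_subtractf)
      qed
      also have "(\<Sum>j<n. A i j * int (k * v j)) = int k * (\<Sum>j<n. A i j * int (v j))"
        by (simp add: sum_distrib_left mult_ac)
      also have "\<dots> = 0" using v i by (simp add: P_def)
      finally have *: "int V * e k i = - (\<Sum>j<n. A i j * int (k * v j mod V))" by simp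
      have "int V * \<bar>e k i\<bar> = \<bar>int V * e k i\<bar>" by (simp add: abs_mult)
      also have "\<dots> \<le> (\<Sum>j<n. \<bar>A i j * int (k * v j mod V)\<bar>)" unfolding * abs_minus_cancel by (rule sum_abs)
      also have "\<dots> \<le> (\<Sum>j<n. int C * int V)"
      proof (rule sum_mono)
        fix j assume "j \<in> {..<n}"
        then show "\<bar>A i j * int (k * v j mod V)\<bar> \<le> int C * int V"
          unfolding abs_mult using bound[OF i, of j] V0 by (intro mult_mono) auto
      qed
      also have "\<dots> = int V * int (n * C)" by (simp add: mult_ac)
      finally show ?thesis using V0 by simp
    qed
    \<comment> \<open>The vectors of residues, shifted by \<open>n * C\<close> into the naturals.
      There are at most \<open>(2 * n * C + 1) ^ m\<close> of them, which is less than the number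
      \<open>V\<close> of indices.\<close>
    define F where "F k = (\<lambda>i\<in>{..<m}. nat (e k i + int (n * C)))" for k
    have "F ` {..<V} \<subseteq> {..<m} \<rightarrow>\<^sub>E {..2 * n * C}"
    proof
      fix h assume "h \<in> F ` {..<V}"
      then obtain k where h: "h = F k" by blast
      have "nat (e k i + int (n * C)) \<le> 2 * n * C" if "i < m" for i using e_bound[OF that, of k] by linarith
      then show "h \<in> {..<m} \<rightarrow>\<^sub>E {..2 * n * C}" by (auto simp: h F_def)
    qed
    then have "card (F ` {..<V}) \<le> card ({..<m} \<rightarrow>\<^sub>E {..2 * n * C})" by (intro card_mono finite_PiE) auto
    also have "\<dots> = (2 * n * C + 1) ^ m" by (simp add: card_funcsetE)
    finally have "card (F ` {..<V}) < card {..<V}" using V by simp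
    then have "\<not> inj_on F {..<V}" by (rule pigeonhole)
    then obtain k k' where k: "k < k'" "k' < V" "F k = F k'"
      by (auto simp: inj_on_def) (metis linorder_neqE_nat)
    have ee: "e k i = e k' i" if i: "i < m" for i
    proof -
      have "nat (e k i + int (n * C)) = nat (e k' i + int (n * C))"
        using fun_cong[OF k(3), of i] i by (simp add: F_def)
      then show ?thesis using e_bound[OF i, of k] e_bound[OF i, of k'] by linarith
    qed
    define d where "d j = p k' j - p k j" for j
    have d_le: "d j \<le> v j" for j using p_le[of k' j] k by (simp add: d_def)
    have d0: "d j0 = k' - k" by (simp add: d_def p0)
    have d_sol: "(\<Sum>j<n. A i j * int (d j)) = 0" if "i < m" for i
    proof -
      have "int (d j) = int (p k' j) - int (p k j)" for j using p_mono[of k k' j] k(1) by (simp add: d_def of_nat_diff)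
      then have "(\<Sum>j<n. A i j * int (d j)) = e k' i - e k i"
        by (simp add: e_def right_diff_distrib sum_subtractf)
      then show ?thesis using ee[OF that] by simp
    qed
    \<comment> \<open>Both \<open>d\<close> and its complement \<open>v - d\<close> solve the system
      and have a smaller coordinate sum than \<open>v\<close>, because \<open>d j0 = k' - k\<close>
      lies strictly between 0 and \<open>V\<close>. One of them is positive at coordinate 0:
      \<open>d\<close> itself, or else its complement.\<close>
    show False
    proof (cases "1 \<le> d 0")
      case True
      then have "P d" using d_sol by (simp add: P_def)
      moreover have "N d < N v"
        unfolding N_def by (rule sum_strict_mono_ex1) (use d_le j0 d0 k V_def in \<open>auto intro!: bexI[of _ j0]\<close>)
      ultimately show False using min by fastforce
    next
      case False
      have "P (\<lambda>j. v j - d j)"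
        unfolding P_def
      proof (intro conjI allI impI)
        fix i assume i: "i < m"
        have "(\<Sum>j<n. A i j * int (v j - d j)) = (\<Sum>j<n. A i j * int (v j)) - (\<Sum>j<n. A i j * int (d j))"
          using d_le by (simp add: of_nat_diff right_diff_distrib sum_subtractf)
        then show "(\<Sum>j<n. A i j * int (v j - d j)) = 0" using d_sol[OF i] v i by (simp add: P_def)
      next
        have "d 0 = 0" using False by simp
        then show "1 \<le> v 0 - d 0" using v by (simp add: P_def)
      qed
      moreover have "N (\<lambda>j. v j - d j) < N v"
        unfolding N_def by (rule sum_strict_mono_ex1) (use d_le[of j0] j0 d0 k in \<open>auto intro!: bexI[of _ j0]\<close>)
      ultimately show False using min by fastforce
    qed
  qed
  then show ?thesis using v by (intro exI[of _ v]) (simp add: P_def)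
qed

section \<open>Small multipliers from Farkas' lemma\<close>

lemma common_denominator:
  fixes l :: "nat \<Rightarrow> rat"
  assumes "\<forall>i<m. 0 \<le> l i"
  shows "\<exists>q v. 1 \<le> q \<and> (\<forall>i<m. l i * of_nat q = of_nat (v i :: nat))"
  using assms
proof (induction m)
  case 0
  show ?case by (intro exI[of _ 1]) simp
next
  case (Suc m)
  then obtain q v where IH: "1 \<le> q" "\<forall>i<m. l i * of_nat q = of_nat (v i :: nat)" by auto
  obtain a b where ab: "quotient_of (l m) = (a, b)" by fastforce
  have b: "b > 0" using quotient_of_denom_pos[OF ab] .
  have lm: "l m = of_int a / of_int b" using quotient_of_div[OF ab] .
  have "0 \<le> l m" using Suc.prems by simp
  then have a: "0 \<le> a" using b lm by (simp add: zero_le_divide_iff)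
  let ?q = "q * nat b" and ?v = "\<lambda>i. if i < m then v i * nat b else nat a * q"
  have "l i * of_nat ?q = of_nat (?v i)" if "i < Suc m" for i
  proof (cases "i < m")
    case True
    then show ?thesis using IH(2)[rule_format, OF True] by (simp add: mult.assoc[symmetric])
  next
    case False
    then have "i = m" using that by simp
    have "l m * of_int b = of_int a" using b lm by simp
    then have "l m * of_nat (nat b) = of_nat (nat a)" using a b by simp
    then show ?thesis using \<open>i = m\<close> by (simp add: mult_ac)
  qed
  moreover have "1 \<le> ?q" using IH(1) b by simp
  ultimately show ?case by (intro exI[of _ ?q] exI[of _ ?v] conjI allI impI)
qed

text \<open>The affine implication is homogenised by one more coordinate. The equations for the
  multipliers then number \<open>nu + 1\<close>, one per coordinate, in
  \<open>mu + 2 * nu + 2\<close> unknowns: the scale \<open>s\<close>, one multiplier for each row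
  of \<open>M\<close>, for each upper bound and for each lower bound, and one for the sign of the
  new coordinate. \<open>K\<close> is the bound of \<open>small_solution\<close> for this
  system.\<close>

lemma small_dual:
  fixes M :: "nat \<Rightarrow> nat \<Rightarrow> int" and b h :: "nat \<Rightarrow> int" and R mu nu C :: nat
  assumes primal: "\<And>u :: nat \<Rightarrow> rat. \<lbrakk>\<forall>j<nu. 0 \<le> u j \<and> u j \<le> of_nat R;
      \<forall>i<mu. (\<Sum>j<nu. of_int (M i j) * u j) \<le> of_int (b i)\<rbrakk> \<Longrightarrow> (\<Sum>j<nu. of_int (h j) * u j) \<le> 0"
    and bM: "\<And>i j. i < mu \<Longrightarrow> j < nu \<Longrightarrow> \<bar>M i j\<bar> \<le> int C" and bb: "\<And>i. i < mu \<Longrightarrow> \<bar>b i\<bar> \<le> int C"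
    and bh: "\<And>j. j < nu \<Longrightarrow> \<bar>h j\<bar> \<le> int C" and bR: "R \<le> C" "1 \<le> C"
  defines "K \<equiv> (2 * (mu + 2 * nu + 2) * C + 1) ^ (nu + 1)"
  shows "\<exists>s y z. 1 \<le> s \<and> s \<le> K \<and> (\<forall>i<mu. y i \<le> K) \<and> (\<forall>j<nu. z j \<le> K) \<and>
    (\<forall>j<nu. int s * h j \<le> (\<Sum>i<mu. int (y i) * M i j) + int (z j)) \<and>
    (\<Sum>i<mu. int (y i) * b i) + int R * (\<Sum>j<nu. int (z j)) \<le> 0"
proof -
  \<comment> \<open>Coordinate \<open>nu\<close> is minus the homogenising scale. The four blocks
    express the rows of \<open>M\<close>, the upper bounds \<open>R\<close>, nonnegativity of
    \<open>u\<close>, and nonnegativity of the scale.\<close>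
  define a :: "nat \<Rightarrow> nat \<Rightarrow> int" where "a i j =
     (if i < mu then (if j < nu then M i j else b i)
      else if i < mu + nu then (if j = i - mu then 1 else if j = nu then int R else 0)
      else if i < mu + nu + nu then (if j = i - (mu + nu) then -1 else 0)
      else (if j = nu then 1 else 0))" for i j
  define g :: "nat \<Rightarrow> int" where "g j = (if j < nu then h j else 0)" for j
  let ?m = "mu + nu + nu + 1"
  have split: "(\<Sum>i<?m. f i) = (\<Sum>i<mu. f i) + (\<Sum>k<nu. f (mu + k)) + (\<Sum>k<nu. f (mu + nu + k)) + f (mu + nu + nu)"
    for f :: "nat \<Rightarrow> 'a::comm_monoid_add"
    by (simp add: sum_lessThan_add add_ac)
  have a1: "a i j = (if j < nu then M i j else b i)" if "i < mu" for i j using that by (simp add: a_def)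
  have a2: "a (mu + k) j = (if j = k then 1 else if j = nu then int R else 0)" if "k < nu" for k j using that by (simp add: a_def)
  have a3: "a (mu + nu + k) j = (if j = k then -1 else 0)" if "k < nu" for k j using that by (simp add: a_def)
  have a4: "a (mu + nu + nu) j = (if j = nu then 1 else 0)" for j by (simp add: a_def)
  have "\<exists>l. (\<forall>i<?m. 0 \<le> l i) \<and> (\<forall>j\<in>{..<Suc nu}. (of_int (g j) :: rat) = (\<Sum>i<?m. l i * of_int (a i j)))"
  proof (rule farkas)
    fix u :: "nat \<Rightarrow> rat" assume u: "\<forall>i<?m. (\<Sum>j\<in>{..<Suc nu}. of_int (a i j) * u j) \<le> 0"
    have w: "u nu \<le> 0" using u[rule_format, of "mu + nu + nu"] by (simp add: a4)
    have up: "0 \<le> u k" if "k < nu" for k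
    proof -
      have "(\<Sum>j\<in>{..<Suc nu}. of_int (a (mu + nu + k) j) * u j) = (\<Sum>j\<in>{..<Suc nu}. if j = k then - u j else 0)"
        using that by (intro sum.cong) (auto simp: a3)
      also have "\<dots> = - u k" using that by simp
      finally show ?thesis using u[rule_format, of "mu + nu + k"] that by simp
    qed
    have uR: "u k + of_nat R * u nu \<le> 0" if "k < nu" for k
    proof -
      have "(\<Sum>j<nu. of_int (a (mu + k) j) * u j) = (\<Sum>j<nu. if j = k then u j else 0)"
        using that by (intro sum.cong) (auto simp: a2)
      moreover have "a (mu + k) nu = int R" using that by (simp add: a2)
      ultimately have "(\<Sum>j\<in>{..<Suc nu}. of_int (a (mu + k) j) * u j) = (\<Sum>j<nu. if j = k then u j else 0) + of_nat R * u nu"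
        by simp
      also have "(\<Sum>j<nu. if j = k then u j else 0) = u k" using that by simp
      finally show ?thesis using u[rule_format, of "mu + k"] that by simp
    qed
    have uM: "(\<Sum>j<nu. of_int (M i j) * u j) + of_int (b i) * u nu \<le> 0" if "i < mu" for i
      using u[rule_format, of i] that by (simp add: a1)
    have "(\<Sum>j<nu. of_int (h j) * u j) \<le> 0"
    proof (cases "u nu = 0")
      \<comment> \<open>At scale 0 the box collapses to the origin. The boundedness of
        \<open>u\<close> thus rules out nontrivial recession directions, and no separate treatment
        of an infeasible system arises.\<close>
      case True
      then have "u k = 0" if "k < nu" for k using up[OF that] uR[OF that] by simp
      then show ?thesis by simp
    next
      case False
      define c where "c = - u nu"
      have c: "0 < c" using False w by (simp add: c_def)
      have "(\<Sum>j<nu. of_int (h j) * (u j / c)) \<le> 0"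
      proof (rule primal)
        show "\<forall>j<nu. 0 \<le> u j / c \<and> u j / c \<le> of_nat R"
        proof (intro allI impI conjI)
          fix j assume j: "j < nu"
          show "0 \<le> u j / c" using up[OF j] c by simp
          have "u j \<le> of_nat R * c" using uR[OF j] by (simp add: c_def)
          then show "u j / c \<le> of_nat R" using c by (simp add: pos_divide_le_eq)
        qed
        show "\<forall>i<mu. (\<Sum>j<nu. of_int (M i j) * (u j / c)) \<le> of_int (b i)"
        proof (intro allI impI)
          fix i assume i: "i < mu"
          have "(\<Sum>j<nu. of_int (M i j) * u j) \<le> - (of_int (b i) * u nu)" using uM[OF i] by linarith
          then have "(\<Sum>j<nu. of_int (M i j) * u j) \<le> of_int (b i) * c" by (simp add: c_def)
          then show "(\<Sum>j<nu. of_int (M i j) * (u j / c)) \<le> of_int (b i)"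
            using c by (simp add: sum_divide_distrib[symmetric] pos_divide_le_eq)
        qed
      qed
      then show ?thesis using c by (simp add: sum_divide_distrib[symmetric] divide_le_0_iff)
    qed
    then show "(\<Sum>j\<in>{..<Suc nu}. of_int (g j) * u j) \<le> 0" by (simp add: g_def)
  qed simp
  then obtain l where l: "\<forall>i<?m. 0 \<le> l i" "\<And>j. j < Suc nu \<Longrightarrow> (of_int (g j) :: rat) = (\<Sum>i<?m. l i * of_int (a i j))" by blast
  obtain q v where q: "1 \<le> q" "\<forall>i<?m. l i * of_nat q = of_nat (v i :: nat)" using common_denominator[OF l(1)] by blast
  \<comment> \<open>Unknown 0 multiplies the target functional. Requiring it to be at least 1
    excludes the trivial solution and replaces the normalisation to 1 that is lost when denominators
    are cleared.\<close>
  define A where "A j i = (case i of 0 \<Rightarrow> - g j | Suc i \<Rightarrow> a i j)" for j i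
  define x where "x i = (case i of 0 \<Rightarrow> q | Suc i \<Rightarrow> v i)" for i
  have Ax: "(\<Sum>i<Suc ?m. A j i * int (x i)) = (\<Sum>i<?m. a i j * int (x (Suc i))) - g j * int (x 0)" for j x
    by (subst sum.lessThan_Suc_shift) (simp add: A_def)
  have "(\<Sum>i<Suc ?m. A j i * int (x i)) = 0" if j: "j < Suc nu" for j
  proof -
    have "(of_int (\<Sum>i<?m. a i j * int (v i)) :: rat) = (\<Sum>i<?m. of_int (a i j) * (l i * of_nat q))"
      using q(2) by simp
    also have "\<dots> = of_int (g j) * of_nat q"
      unfolding l(2)[OF j] sum_distrib_right by (intro sum.cong) (auto simp: mult_ac)
    also have "\<dots> = of_int (g j * int q)" by simp
    finally have "(\<Sum>i<?m. a i j * int (v i)) = g j * int q" by (simp only: of_int_eq_iff)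
    then show ?thesis unfolding Ax by (simp add: x_def)
  qed
  moreover have "1 \<le> x 0" using q(1) by (simp add: x_def)
  moreover have "\<bar>A j i\<bar> \<le> int C" if "j < Suc nu" "i < Suc ?m" for i j
    using that bM bb bh bR by (auto simp: A_def a_def g_def split: nat.split)
  ultimately have ex: "\<exists>v. (\<forall>j<Suc nu. (\<Sum>i<Suc ?m. A j i * int (v i)) = 0) \<and> 1 \<le> v 0 \<and>
      (\<forall>i<Suc ?m. v i \<le> (2 * Suc ?m * C + 1) ^ Suc nu)"
    by (intro small_solution[where m = "Suc nu" and n = "Suc ?m" and A = A and v = x and C = C]) auto
  obtain v where v: "\<And>j. j < Suc nu \<Longrightarrow> (\<Sum>i<?m. a i j * int (v (Suc i))) = g j * int (v 0)" "1 \<le> v 0"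
    "\<And>i. i < Suc ?m \<Longrightarrow> v i \<le> (2 * Suc ?m * C + 1) ^ Suc nu"
    using ex unfolding Ax by auto
  have K: "(2 * Suc ?m * C + 1) ^ Suc nu = K"
  proof -
    have "Suc ?m = mu + 2 * nu + 2" by simp
    then show ?thesis unfolding K_def by (simp only: Suc_eq_plus1)
  qed
  \<comment> \<open>The remaining \<open>nu + 1\<close> unknowns belong to the sign constraints.
    They are nonnegative slacks, and dropping them turns the equations into the claimed
    inequalities.\<close>
  let ?y = "\<lambda>i. v (Suc i)" and ?z = "\<lambda>j. v (Suc (mu + j))"
  have "int (v 0) * h j \<le> (\<Sum>i<mu. int (?y i) * M i j) + int (?z j)" if j: "j < nu" for j
  proof -
    have "(\<Sum>k<nu. a (mu + k) j * int (v (Suc (mu + k)))) = (\<Sum>k<nu. if j = k then int (v (Suc (mu + k))) else 0)"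
      using j by (intro sum.cong) (auto simp: a2)
    then have 1: "(\<Sum>k<nu. a (mu + k) j * int (v (Suc (mu + k)))) = int (?z j)" using j by simp
    have "(\<Sum>k<nu. a (mu + nu + k) j * int (v (Suc (mu + nu + k)))) = (\<Sum>k<nu. if j = k then - int (v (Suc (mu + nu + k))) else 0)"
      using j by (intro sum.cong) (auto simp: a3)
    then have 2: "(\<Sum>k<nu. a (mu + nu + k) j * int (v (Suc (mu + nu + k)))) = - int (v (Suc (mu + nu + j)))" using j by simp
    have 3: "(\<Sum>i<mu. a i j * int (v (Suc i))) = (\<Sum>i<mu. int (?y i) * M i j)"
      using j by (intro sum.cong) (auto simp: a1)
    have "h j * int (v 0) = (\<Sum>i<mu. int (?y i) * M i j) + int (?z j) - int (v (Suc (mu + nu + j)))"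
      using v(1)[of j] j unfolding split 1 2 3 a4 by (simp add: g_def)
    then show ?thesis by (simp add: mult.commute)
  qed
  moreover have "(\<Sum>i<mu. int (?y i) * b i) + int R * (\<Sum>j<nu. int (?z j)) \<le> 0"
  proof -
    have 1: "(\<Sum>k<nu. a (mu + k) nu * int (v (Suc (mu + k)))) = int R * (\<Sum>j<nu. int (?z j))"
      unfolding sum_distrib_left by (intro sum.cong) (auto simp: a2)
    have 2: "(\<Sum>k<nu. a (mu + nu + k) nu * int (v (Suc (mu + nu + k)))) = 0"
      by (intro sum.neutral) (auto simp: a3)
    have 3: "(\<Sum>i<mu. a i nu * int (v (Suc i))) = (\<Sum>i<mu. int (?y i) * b i)"
      by (intro sum.cong) (auto simp: a1)
    show ?thesis using v(1)[of nu] unfolding split 1 2 3 a4 by (simp add: g_def)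
  qed
  ultimately show ?thesis
    using v(2,3) unfolding K by (intro exI[of _ "v 0"] exI[of _ ?y] exI[of _ ?z]) auto
qed

section \<open>Codes of instances\<close>

definition occ :: "bool list \<Rightarrow> nat \<Rightarrow> bool list \<Rightarrow> bool" where
  "occ w p xs \<longleftrightarrow> (\<exists>v. drop p w = xs @ v)"

abbreviation inp :: "bool list \<Rightarrow> nat \<Rightarrow> nat" where
  "inp w \<equiv> get (map of_bool w @ [2])"

lemma inp_of_bool: "inp w p = of_bool b \<longleftrightarrow> p < length w \<and> w ! p = b"
  by (auto simp: get_def nth_append)

lemma inp_simps:
  "inp w p = 1 \<longleftrightarrow> p < length w \<and> w ! p" "inp w p = Suc 0 \<longleftrightarrow> p < length w \<and> w ! p"
  "inp w p = 0 \<longleftrightarrow> p < length w \<and> \<not> w ! p"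
  "inp w p \<le> 1 \<longleftrightarrow> p < length w" "inp w p = 2 \<longleftrightarrow> p = length w"
  by (auto simp: get_def nth_append)

lemma occ_Nil [simp]: "occ w p []"
  by (simp add: occ_def)

lemma occ_Cons: "occ w p (b # xs) \<longleftrightarrow> inp w p = of_bool b \<and> occ w (Suc p) xs"
proof -
  have "(\<exists>v. drop p w = b # xs @ v) \<longleftrightarrow> p < length w \<and> w ! p = b \<and> (\<exists>v. drop (Suc p) w = xs @ v)"
  proof (cases "p < length w")
    case True
    have "drop p w = w ! p # drop (Suc p) w" using Cons_nth_drop_Suc[OF True] by simp
    then show ?thesis using True by simp
  qed simp
  then show ?thesis unfolding occ_def inp_of_bool append_Cons by blast
qed

lemma occ_append: "occ w p (xs @ ys) \<longleftrightarrow> occ w p xs \<and> occ w (p + length xs) ys"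
  by (induction xs arbitrary: p) (auto simp: occ_Cons)

lemma occ_end: "occ w 0 xs \<Longrightarrow> length xs = length w \<Longrightarrow> w = xs"
  by (auto simp: occ_def)

lemma occ_self: "occ w 0 w"
  by (simp add: occ_def)

section \<open>Codes of dimensions and of natural numbers\<close>

definition dim_code :: "(nat \<Rightarrow> nat) \<Rightarrow> nat \<Rightarrow> nat \<Rightarrow> bool" where
  "dim_code g p n \<longleftrightarrow> (\<forall>i<n. g (p + i) = 1) \<and> g (p + n) = 0"

lemma dim_code_occ: "dim_code (inp w) p n \<longleftrightarrow> occ w p (enc_dim n)"
proof (induction n arbitrary: p)
  case 0
  then show ?case by (simp add: dim_code_def enc_dim_def occ_Cons)
next
  case (Suc n)
  have "dim_code (inp w) p (Suc n) \<longleftrightarrow> inp w p = 1 \<and> dim_code (inp w) (Suc p) n"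
    unfolding dim_code_def by (auto simp: All_less_Suc2)
  also have "\<dots> \<longleftrightarrow> occ w p (enc_dim (Suc n))"
    unfolding Suc.IH by (simp add: enc_dim_def occ_Cons)
  finally show ?case .
qed

text \<open>For \<open>i < l\<close> the condition \<open>i + 2 \<le> l\<close> fails only at the
  last, most significant digit. That digit has to be 1, so the code has no leading zeros. Powers of
  two come from a table \<open>pw\<close> because terms have no exponentiation.\<close>

definition nat_code :: "(nat \<Rightarrow> nat) \<Rightarrow> (nat \<Rightarrow> nat) \<Rightarrow> nat \<Rightarrow> nat \<Rightarrow> nat \<Rightarrow> bool" where
  "nat_code g pw p l v \<longleftrightarrow>
     (\<forall>i<l. g (p + (i + i)) = 1 \<and> g (p + (i + i) + 1) \<le> 1 \<and> (i + 2 \<le> l \<or> g (p + (i + i) + 1) = 1)) \<and>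
     g (p + (l + l)) = 0 \<and> v = (\<Sum>i<l. g (p + (i + i) + 1) * pw i)"

lemma binary_digits_0: "binary_digits 0 = []"
  by (simp add: binary_digits.simps)

lemma bval_binary_digits: "bval (binary_digits v) = v"
proof (induction v rule: less_induct)
  case (less v)
  show ?case
  proof (cases "v = 0")
    case False
    then have "bval (binary_digits v) = of_bool (odd v) + 2 * bval (binary_digits (v div 2))"
      by (subst binary_digits.simps) simp
    also have "\<dots> = v" using less[of "v div 2"] False by simp
    finally show ?thesis .
  qed (simp add: binary_digits.simps)
qed

lemma last_binary_digits: "binary_digits v \<noteq> [] \<Longrightarrow> last (binary_digits v)"
proof (induction v rule: less_induct)
  case (less v)
  have v: "v \<noteq> 0" using less.prems binary_digits_0 by metis
  then have d: "binary_digits v = odd v # binary_digits (v div 2)" by (subst binary_digits.simps) simp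
  show ?case
  proof (cases "v div 2 = 0")
    case True
    then have "v = 1" using v by auto
    then show ?thesis unfolding d by (simp add: binary_digits.simps)
  next
    case False
    then have "binary_digits (v div 2) \<noteq> []" by (simp add: binary_digits.simps[of "v div 2"])
    then show ?thesis unfolding d using less.IH[of "v div 2"] v by simp
  qed
qed

lemma binary_digits_bval: "ds = [] \<or> last ds \<Longrightarrow> binary_digits (bval ds) = ds"
proof (induction ds)
  case Nil
  then show ?case by (simp add: binary_digits.simps)
next
  case (Cons d ds)
  have IH: "binary_digits (bval ds) = ds" using Cons by (cases "ds = []") auto
  have "bval (d # ds) \<noteq> 0"
  proof (cases "ds = []")
    case True
    then show ?thesis using Cons.prems by simp
  next
    case False
    then have "bval ds \<noteq> 0" using IH binary_digits_0 by metis
    then show ?thesis by simp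
  qed
  then have "binary_digits (bval (d # ds)) = odd (bval (d # ds)) # binary_digits (bval (d # ds) div 2)"
    by (subst binary_digits.simps) simp
  also have "\<dots> = d # ds" using IH by (cases d) auto
  finally show ?case .
qed

lemma bval_sum: "bval ds = (\<Sum>i<length ds. of_bool (ds ! i) * 2 ^ i)"
proof (induction ds)
  case (Cons d ds)
  show ?case
    unfolding length_Cons
    by (subst sum.lessThan_Suc_shift)
      (simp add: Cons.IH sum_distrib_left mult_ac del: sum_of_bool_mult_eq sum_mult_of_bool_eq)
qed simp

lemma occ_digits: "occ w p (concat (map (\<lambda>d. [True, d]) ds)) \<longleftrightarrow>
    (\<forall>i<length ds. inp w (p + (i + i)) = 1 \<and> inp w (p + (i + i) + 1) = of_bool (ds ! i))"
proof (induction ds arbitrary: p)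
  case (Cons d ds)
  have "occ w p (concat (map (\<lambda>d. [True, d]) (d # ds))) \<longleftrightarrow>
      inp w p = 1 \<and> inp w (Suc p) = of_bool d \<and> occ w (Suc (Suc p)) (concat (map (\<lambda>d. [True, d]) ds))"
    by (simp add: occ_Cons)
  also have "\<dots> \<longleftrightarrow> (\<forall>i<length (d # ds). inp w (p + (i + i)) = 1 \<and> inp w (p + (i + i) + 1) = of_bool ((d # ds) ! i))"
    unfolding Cons.IH by (auto simp: All_less_Suc2)
  finally show ?case .
qed simp

lemma length_digits_code: "length (concat (map (\<lambda>d. [True, d]) ds)) = length ds + length ds"
  by (induction ds) auto

lemma length_enc_nat: "length (enc_nat v) = 2 * length (binary_digits v) + 1"
  by (simp add: enc_nat_def length_digits_code)

text \<open>A digit string that is empty or ends with True is the list of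
  \<open>binary_digits\<close> of its value. Hence the arithmetic condition determines not just the
  value but the very bits of its code.\<close>

lemma nat_code_occ:
  assumes pw: "\<And>i. i < l \<Longrightarrow> pw i = 2 ^ i"
  shows "nat_code (inp w) pw p l v \<longleftrightarrow> l = length (binary_digits v) \<and> occ w p (enc_nat v)"
proof
  assume *: "nat_code (inp w) pw p l v"
  define ds where "ds = map (\<lambda>i. inp w (p + (i + i) + 1) = 1) [0..<l]"
  have len: "length ds = l" by (simp add: ds_def)
  have i1: "inp w (p + (i + i) + 1) = of_bool (ds ! i)" if "i < l" for i
  proof -
    have "inp w (p + (i + i) + 1) \<le> 1" using * that unfolding nat_code_def by blast
    moreover have "ds ! i = (inp w (p + (i + i) + 1) = 1)" using that by (simp add: ds_def)
    ultimately show ?thesis by (cases "inp w (p + (i + i) + 1) = 1") auto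
  qed
  have i2: "inp w (p + (i + i)) = 1" if "i < l" for i using * that unfolding nat_code_def by blast
  have "v = (\<Sum>i<l. inp w (p + (i + i) + 1) * pw i)" using * unfolding nat_code_def by blast
  also have "\<dots> = (\<Sum>i<l. of_bool (ds ! i) * 2 ^ i)" using i1 pw by (intro sum.cong refl) simp
  finally have v: "v = bval ds" by (simp add: bval_sum len)
  have "ds = [] \<or> last ds"
  proof (cases "l = 0")
    case False
    then have l: "l - 1 < l" by simp
    have "\<not> (l - 1 + 2 \<le> l)" using False by simp
    then have "inp w (p + (l - 1 + (l - 1)) + 1) = 1" using * l unfolding nat_code_def by blast
    then show ?thesis using l by (simp add: ds_def last_conv_nth)
  qed (simp add: ds_def)
  then have d: "binary_digits v = ds" unfolding v by (rule binary_digits_bval)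
  have "inp w (p + (l + l)) = 0" using * unfolding nat_code_def by blast
  then have "occ w p (enc_nat v)"
    unfolding enc_nat_def d occ_append length_digits_code len occ_digits using i1 i2 by (simp add: occ_Cons)
  then show "l = length (binary_digits v) \<and> occ w p (enc_nat v)" using d len by simp
next
  assume *: "l = length (binary_digits v) \<and> occ w p (enc_nat v)"
  define ds where "ds = binary_digits v"
  have len: "length ds = l" using * by (simp add: ds_def)
  have "occ w p (concat (map (\<lambda>d. [True, d]) ds))" and fin: "inp w (p + (l + l)) = 0"
    using * unfolding enc_nat_def occ_append length_digits_code by (auto simp: ds_def occ_Cons)
  then have i: "inp w (p + (i + i)) = 1" "inp w (p + (i + i) + 1) = of_bool (ds ! i)" if "i < l" for i
    using that unfolding occ_digits len by blast+
  have last: "ds ! i" if "i < l" "\<not> i + 2 \<le> l" for i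
  proof -
    have "i = length ds - 1" "ds \<noteq> []" using that len by auto
    then show ?thesis using last_binary_digits[of v] by (simp add: ds_def last_conv_nth)
  qed
  have "v = bval ds" by (simp add: ds_def bval_binary_digits)
  also have "\<dots> = (\<Sum>i<l. inp w (p + (i + i) + 1) * pw i)"
    unfolding bval_sum len using i pw by (intro sum.cong refl) simp
  finally show "nat_code (inp w) pw p l v"
    unfolding nat_code_def using i fin last by (auto simp: inp_of_bool of_bool_def)
qed

text \<open>\<open>r\<close> lists the rationals of the instance in the order in which they are encoded.\<close>

definition mkI :: "nat \<Rightarrow> nat \<Rightarrow> nat \<Rightarrow> nat \<Rightarrow> nat \<Rightarrow> nat \<Rightarrow> (nat \<Rightarrow> rat) \<Rightarrow> bs_instance" where
  "mkI nx nu mx mu L R r = \<lparr> bs_R = R, bs_nx = nx, bs_nu = nu, bs_mx = mx, bs_mu = mu, bs_L = L,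
     bs_a = vec mx r, bs_b = vec mu (\<lambda>i. r (mx + i)),
     bs_A = mat mx nx (\<lambda>(i, k). r (mx + mu + (i * nx + k))),
     bs_B = map (\<lambda>k. mat mu nu (\<lambda>(i, j). r (mx + mu + mx * nx + ((k * mu + i) * nu + j)))) [0..<nx],
     bs_H = map (\<lambda>l. mat nu nx (\<lambda>(j, k). r (mx + mu + mx * nx + nx * mu * nu + ((l * nu + j) * nx + k)))) [0..<L] \<rparr>"

abbreviation ntok :: "nat \<Rightarrow> nat \<Rightarrow> nat \<Rightarrow> nat \<Rightarrow> nat \<Rightarrow> nat" where
  "ntok nx nu mx mu L \<equiv> mx + mu + mx * nx + nx * mu * nu + L * nu * nx"

section \<open>Instances as sequences of rationals\<close>

lemma concat_shift: "concat (map (\<lambda>j. f (o' + j)) [0..<n]) = concat (map f [o'..<o' + n])"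
proof -
  have "map (\<lambda>j. f (o' + j)) [0..<n] = map f (map (\<lambda>j. j + o') [0..<n])" by (simp add: add.commute)
  then show ?thesis unfolding map_add_upt by (simp add: add.commute)
qed

lemma concat_upt_add: "concat (map f [o'..<o' + m]) @ concat (map f [o' + m..<o' + m + n]) = concat (map f [o'..<o' + m + n])"
  by (simp add: upt_add_eq_append[of o' "o' + m" n] flip: concat_append map_append)

lemma concat_seg: "concat (map (\<lambda>i. concat (map (\<lambda>j. f (o' + (i * n + j))) [0..<n])) [0..<m]) = concat (map f [o'..<o' + m * n])"
proof (induction m)
  case (Suc m)
  have "concat (map (\<lambda>j. f (o' + (m * n + j))) [0..<n]) = concat (map f [o' + m * n..<o' + m * n + n])"
    using concat_shift[of f "o' + m * n" n] by (simp add: add.assoc)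
  then have "concat (map (\<lambda>i. concat (map (\<lambda>j. f (o' + (i * n + j))) [0..<n])) [0..<Suc m]) =
      concat (map f [o'..<o' + m * n]) @ concat (map f [o' + m * n..<o' + m * n + n])"
    using Suc.IH by simp
  then show ?case unfolding concat_upt_add by (simp add: add_ac)
qed simp

lemma enc_vec_vec: "enc_vec (vec n f) = concat (map (\<lambda>i. enc_rat (f i)) [0..<n])"
  by (simp add: enc_vec_def comp_def)

lemma enc_mat_mat: "enc_mat (mat m n f) = concat (map (\<lambda>i. concat (map (\<lambda>j. enc_rat (f (i, j))) [0..<n])) [0..<m])"
proof -
  have "rows (mat m n f) = map (\<lambda>i. vec n (\<lambda>j. f (i, j))) [0..<m]"
    by (auto simp: rows_def intro!: map_cong)
  then show ?thesis by (simp add: enc_mat_def enc_vec_vec comp_def)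
qed

lemma enc_mkI: "enc_instance (mkI nx nu mx mu L R r) =
    enc_dim nx @ enc_dim nu @ enc_dim mx @ enc_dim mu @ enc_dim L @ enc_nat R @
    concat (map (\<lambda>t. enc_rat (r t)) [0..<ntok nx nu mx mu L])"
proof -
  let ?e = "\<lambda>t. enc_rat (r t)"
  let ?b = "mx + mu + mx * nx" and ?h = "mx + mu + mx * nx + nx * mu * nu"
  have 1: "enc_vec (vec mx r) = concat (map ?e [0..<0 + mx])" by (simp add: enc_vec_vec)
  have 2: "enc_vec (vec mu (\<lambda>i. r (mx + i))) = concat (map ?e [0 + mx..<0 + mx + mu])"
    using concat_shift[of ?e mx mu] by (simp add: enc_vec_vec)
  have 3: "enc_mat (mat mx nx (\<lambda>(i, k). r (mx + mu + (i * nx + k)))) = concat (map ?e [0 + mx + mu..<0 + mx + mu + mx * nx])"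
    using concat_seg[of ?e "mx + mu" nx mx] by (simp add: enc_mat_mat)
  have b: "enc_mat (mat mu nu (\<lambda>(i, j). r (?b + ((k * mu + i) * nu + j)))) =
      concat (map (\<lambda>j. ?e (?b + (k * (mu * nu) + j))) [0..<mu * nu])" for k
    using concat_seg[of ?e "?b + k * (mu * nu)" nu mu] concat_shift[of ?e "?b + k * (mu * nu)" "mu * nu"]
    by (simp add: enc_mat_mat algebra_simps)
  have 4: "concat (map enc_mat (map (\<lambda>k. mat mu nu (\<lambda>(i, j). r (?b + ((k * mu + i) * nu + j)))) [0..<nx])) =
      concat (map ?e [0 + mx + mu + mx * nx..<0 + mx + mu + mx * nx + nx * mu * nu])"
    unfolding map_map comp_def b using concat_seg[of ?e ?b "mu * nu" nx] by (simp add: mult.assoc)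
  have h: "enc_mat (mat nu nx (\<lambda>(j, k). r (?h + ((l * nu + j) * nx + k)))) =
      concat (map (\<lambda>j. ?e (?h + (l * (nu * nx) + j))) [0..<nu * nx])" for l
    using concat_seg[of ?e "?h + l * (nu * nx)" nx nu] concat_shift[of ?e "?h + l * (nu * nx)" "nu * nx"]
    by (simp add: enc_mat_mat algebra_simps)
  have 5: "concat (map enc_mat (map (\<lambda>l. mat nu nx (\<lambda>(j, k). r (?h + ((l * nu + j) * nx + k)))) [0..<L])) =
      concat (map ?e [0 + mx + mu + mx * nx + nx * mu * nu..<0 + mx + mu + mx * nx + nx * mu * nu + L * nu * nx])"
    unfolding map_map comp_def h using concat_seg[of ?e ?h "nu * nx" L] by (simp add: mult.assoc)
  show ?thesis
    unfolding enc_instance_def mkI_def bs_instance.simps 1 2 3 4 5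
    using concat_upt_add[of ?e 0 mx mu] concat_upt_add[of ?e 0 "mx + mu" "mx * nx"] concat_upt_add[of ?e 0 ?b "nx * mu * nu"]
      concat_upt_add[of ?e 0 ?h "L * nu * nx"]
    by (simp add: append_assoc[symmetric] del: append_assoc)
qed

lemma wf_mkI: "wf_instance (mkI nx nu mx mu L R r)"
  by (auto simp: wf_instance_def mkI_def)

lemma mkI_surj:
  assumes "wf_instance I"
  shows "\<exists>r. I = mkI (bs_nx I) (bs_nu I) (bs_mx I) (bs_mu I) (bs_L I) (bs_R I) r"
proof -
  let ?nx = "bs_nx I" and ?nu = "bs_nu I" and ?mx = "bs_mx I" and ?mu = "bs_mu I" and ?L = "bs_L I"
  let ?b = "?mx + ?mu + ?mx * ?nx" and ?h = "?mx + ?mu + ?mx * ?nx + ?nx * ?mu * ?nu"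
  \<comment> \<open>Quotients and remainders invert the row-major numbering used by
    \<open>mkI\<close>.\<close>
  define r where "r t = (if t < ?mx then bs_a I $ t else if t < ?mx + ?mu then bs_b I $ (t - ?mx)
     else if t < ?b then bs_A I $$ ((t - (?mx + ?mu)) div ?nx, (t - (?mx + ?mu)) mod ?nx)
     else if t < ?h then bs_B I ! ((t - ?b) div ?nu div ?mu) $$ ((t - ?b) div ?nu mod ?mu, (t - ?b) mod ?nu)
     else bs_H I ! ((t - ?h) div ?nx div ?nu) $$ ((t - ?h) div ?nx mod ?nu, (t - ?h) mod ?nx))" for t
  have lt: "i * n + j < m * n" if "i < m" "j < n" for i j m n :: nat
  proof -
    have "i * n + j < Suc i * n" using that by simp
    also have "\<dots> \<le> m * n" using that by (intro mult_le_mono1) simp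
    finally show ?thesis .
  qed
  note wf = assms[unfolded wf_instance_def]
  have a: "bs_a I = vec ?mx r" using wf by (intro eq_vecI) (auto simp: r_def)
  have b: "bs_b I = vec ?mu (\<lambda>i. r (?mx + i))" using wf by (intro eq_vecI) (auto simp: r_def)
  have A: "bs_A I = mat ?mx ?nx (\<lambda>(i, k). r (?mx + ?mu + (i * ?nx + k)))"
  proof (rule eq_matI)
    fix i k assume "i < dim_row (mat ?mx ?nx (\<lambda>(i, k). r (?mx + ?mu + (i * ?nx + k))))"
      "k < dim_col (mat ?mx ?nx (\<lambda>(i, k). r (?mx + ?mu + (i * ?nx + k))))"
    then have ik: "i < ?mx" "k < ?nx" by auto
    then show "bs_A I $$ (i, k) = mat ?mx ?nx (\<lambda>(i, k). r (?mx + ?mu + (i * ?nx + k))) $$ (i, k)"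
      using lt[OF ik] by (simp add: r_def)
  qed (use wf in auto)
  have B: "bs_B I = map (\<lambda>k. mat ?mu ?nu (\<lambda>(i, j). r (?b + ((k * ?mu + i) * ?nu + j)))) [0..<?nx]"
  proof (rule nth_equalityI)
    fix k assume "k < length (bs_B I)"
    then have k: "k < ?nx" using wf by simp
    have c: "bs_B I ! k \<in> carrier_mat ?mu ?nu" using wf k nth_mem[of k "bs_B I"] by auto
    have "bs_B I ! k = mat ?mu ?nu (\<lambda>(i, j). r (?b + ((k * ?mu + i) * ?nu + j)))"
    proof (rule eq_matI)
      fix i j assume "i < dim_row (mat ?mu ?nu (\<lambda>(i, j). r (?b + ((k * ?mu + i) * ?nu + j))))"
        "j < dim_col (mat ?mu ?nu (\<lambda>(i, j). r (?b + ((k * ?mu + i) * ?nu + j))))"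
      then have ij: "i < ?mu" "j < ?nu" by auto
      have "(k * ?mu + i) * ?nu + j < ?nx * ?mu * ?nu" using lt[OF lt[OF k ij(1)] ij(2)] .
      then show "bs_B I ! k $$ (i, j) = mat ?mu ?nu (\<lambda>(i, j). r (?b + ((k * ?mu + i) * ?nu + j))) $$ (i, j)"
        using ij by (simp add: r_def)
    qed (use c in auto)
    then show "bs_B I ! k = map (\<lambda>k. mat ?mu ?nu (\<lambda>(i, j). r (?b + ((k * ?mu + i) * ?nu + j)))) [0..<?nx] ! k"
      using k by simp
  qed (use wf in auto)
  have H: "bs_H I = map (\<lambda>l. mat ?nu ?nx (\<lambda>(j, k). r (?h + ((l * ?nu + j) * ?nx + k)))) [0..<?L]"
  proof (rule nth_equalityI)
    fix l assume "l < length (bs_H I)"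
    then have l: "l < ?L" using wf by simp
    have c: "bs_H I ! l \<in> carrier_mat ?nu ?nx" using wf l nth_mem[of l "bs_H I"] by auto
    have "bs_H I ! l = mat ?nu ?nx (\<lambda>(j, k). r (?h + ((l * ?nu + j) * ?nx + k)))"
    proof (rule eq_matI)
      fix j k assume "j < dim_row (mat ?nu ?nx (\<lambda>(j, k). r (?h + ((l * ?nu + j) * ?nx + k))))"
        "k < dim_col (mat ?nu ?nx (\<lambda>(j, k). r (?h + ((l * ?nu + j) * ?nx + k))))"
      then have jk: "j < ?nu" "k < ?nx" by auto
      then show "bs_H I ! l $$ (j, k) = mat ?nu ?nx (\<lambda>(j, k). r (?h + ((l * ?nu + j) * ?nx + k))) $$ (j, k)"
        by (simp add: r_def)
    qed (use c in auto)
    then show "bs_H I ! l = map (\<lambda>l. mat ?nu ?nx (\<lambda>(j, k). r (?h + ((l * ?nu + j) * ?nx + k)))) [0..<?L] ! l"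
      using l by simp
  qed (use wf in auto)
  have "I = mkI ?nx ?nu ?mx ?mu ?L (bs_R I) r"
    using a b A B H by (intro bs_instance.equality) (simp_all add: mkI_def)
  then show ?thesis by blast
qed

lemma bounded_mkI:
  "bounded_static (mkI nx nu mx mu L R r) \<longleftrightarrow>
    (\<exists>x :: nat \<Rightarrow> nat. (\<forall>k<nx. x k \<le> R) \<and>
       (\<forall>i<mx. (\<Sum>k<nx. r (mx + mu + (i * nx + k)) * of_nat (x k)) \<le> r i) \<and>
       (\<forall>u :: nat \<Rightarrow> real. (\<forall>j<nu. 0 \<le> u j \<and> u j \<le> real R) \<longrightarrow>
          (\<forall>i<mu. (\<Sum>j<nu. real_of_rat (\<Sum>k<nx. r (mx + mu + mx * nx + ((k * mu + i) * nu + j)) * of_nat (x k)) * u j)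
             \<le> real_of_rat (r (mx + i))) \<longrightarrow>
          (\<forall>l<L. (\<Sum>j<nu. real_of_rat (\<Sum>k<nx. r (mx + mu + mx * nx + nx * mu * nu + ((l * nu + j) * nx + k)) * of_nat (x k)) * u j) \<le> 0)))"
    (is "_ \<longleftrightarrow> (\<exists>x. ?P x)")
proof -
  let ?I = "mkI nx nu mx mu L R r"
  have fields: "bs_nx ?I = nx" "bs_nu ?I = nu" "bs_mx ?I = mx" "bs_mu ?I = mu" "bs_L ?I = L" "bs_R ?I = R"
    by (simp_all add: mkI_def)
  have rr: "real_of_rat (\<Sum>k<nx. f k * of_nat (x k)) = (\<Sum>k<nx. real_of_rat (f k) * real (x k))" for f :: "nat \<Rightarrow> rat" and x
    by (simp add: of_rat_sum of_rat_mult)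
  have X: "vec nx (\<lambda>k. real (x k)) \<in> X_d ?I \<longleftrightarrow> (\<forall>k<nx. x k \<le> R) \<and>
      (\<forall>i<mx. (\<Sum>k<nx. r (mx + mu + (i * nx + k)) * of_nat (x k)) \<le> r i)" for x :: "nat \<Rightarrow> nat"
  proof -
    have "(real_mat (bs_A ?I) *\<^sub>v vec nx (\<lambda>k. real (x k))) \<le> real_vec (bs_a ?I) \<longleftrightarrow>
        (\<forall>i<mx. (\<Sum>k<nx. real_of_rat (r (mx + mu + (i * nx + k))) * real (x k)) \<le> real_of_rat (r i))"
      unfolding less_eq_vec_def by (simp add: mkI_def scalar_prod_def atLeast0LessThan)
    then show ?thesis unfolding rr[symmetric] of_rat_less_eq by (simp add: X_d_def fields)
  qed
  have U: "vec nu u \<in> U_c ?I (vec nx (\<lambda>k. real (x k))) \<longleftrightarrow> (\<forall>j<nu. 0 \<le> u j \<and> u j \<le> real R) \<and>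
      (\<forall>i<mu. (\<Sum>j<nu. real_of_rat (\<Sum>k<nx. r (mx + mu + mx * nx + ((k * mu + i) * nu + j)) * of_nat (x k)) * u j)
             \<le> real_of_rat (r (mx + i)))" for u and x :: "nat \<Rightarrow> nat"
  proof -
    have "B_at ?I (vec nx (\<lambda>k. real (x k))) *\<^sub>v vec nu u \<le> real_vec (bs_b ?I) \<longleftrightarrow>
      (\<forall>i<mu. (\<Sum>j<nu. (\<Sum>k<nx. real_of_rat (r (mx + mu + mx * nx + ((k * mu + i) * nu + j))) * real (x k)) * u j)
             \<le> real_of_rat (r (mx + i)))"
      unfolding less_eq_vec_def B_at_def fields by (simp add: mkI_def scalar_prod_def atLeast0LessThan)
    then show ?thesis unfolding rr by (simp add: U_c_def fields)
  qed
  have H: "vec nu u \<bullet> (real_mat (bs_H ?I ! l) *\<^sub>v vec nx (\<lambda>k. real (x k))) =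
      (\<Sum>j<nu. real_of_rat (\<Sum>k<nx. r (mx + mu + mx * nx + nx * mu * nu + ((l * nu + j) * nx + k)) * of_nat (x k)) * u j)"
    if "l < L" for u l and x :: "nat \<Rightarrow> nat"
    unfolding rr using that by (simp add: mkI_def scalar_prod_def atLeast0LessThan mult.commute)
  show ?thesis
  proof
    assume "bounded_static ?I"
    then obtain x where x: "x \<in> X_d ?I" "\<And>u l. u \<in> U_c ?I x \<Longrightarrow> l < L \<Longrightarrow> u \<bullet> (real_mat (bs_H ?I ! l) *\<^sub>v x) \<le> 0"
      unfolding bounded_static_def fields by blast
    \<comment> \<open>The entries of \<open>x\<close> are nonnegative integers, so nothing is lost
      by passing to naturals; \<open>u\<close> stays real.\<close>
    define x' where "x' k = nat \<lfloor>x $ k\<rfloor>" for k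
    have xe: "x = vec nx (\<lambda>k. real (x' k))"
    proof (rule eq_vecI)
      fix k assume "k < dim_vec (vec nx (\<lambda>k. real (x' k)))"
      then have k: "k < nx" by simp
      then have "x $ k \<in> \<int>" "0 \<le> x $ k" using x(1) by (auto simp: X_d_def fields)
      then have "real (nat \<lfloor>x $ k\<rfloor>) = x $ k" by (auto elim!: Ints_cases)
      then show "x $ k = vec nx (\<lambda>k. real (x' k)) $ k" using k by (simp add: x'_def)
    qed (use x(1) in \<open>simp add: X_d_def fields\<close>)
    note x1 = x(1)[unfolded xe X]
    have "?P x'"
    proof (intro conjI conjunct1[OF x1] conjunct2[OF x1] allI impI)
      fix u :: "nat \<Rightarrow> real" and l
      assume u: "\<forall>j<nu. 0 \<le> u j \<and> u j \<le> real R"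
        "\<forall>i<mu. (\<Sum>j<nu. real_of_rat (\<Sum>k<nx. r (mx + mu + mx * nx + ((k * mu + i) * nu + j)) * of_nat (x' k)) * u j)
             \<le> real_of_rat (r (mx + i))" and l: "l < L"
      have "vec nu u \<in> U_c ?I x" unfolding xe U using u by blast
      from x(2)[OF this l]
      show "(\<Sum>j<nu. real_of_rat (\<Sum>k<nx. r (mx + mu + mx * nx + nx * mu * nu + ((l * nu + j) * nx + k)) * of_nat (x' k)) * u j) \<le> 0"
        unfolding xe H[OF l] .
    qed
    then show "\<exists>x. ?P x" by blast
  next
    assume "\<exists>x. ?P x"
    then obtain x where x: "?P x" by blast
    have "u \<bullet> (real_mat (bs_H ?I ! l) *\<^sub>v vec nx (\<lambda>k. real (x k))) \<le> 0"
      if u: "u \<in> U_c ?I (vec nx (\<lambda>k. real (x k)))" and l: "l < L" for u l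
    proof -
      have e: "u = vec nu (\<lambda>j. u $ j)" using u by (intro eq_vecI) (auto simp: U_c_def fields)
      have "vec nu (\<lambda>j. u $ j) \<in> U_c ?I (vec nx (\<lambda>k. real (x k)))" using u e by simp
      then have "(\<Sum>j<nu. real_of_rat (\<Sum>k<nx. r (mx + mu + mx * nx + nx * mu * nu + ((l * nu + j) * nx + k)) * of_nat (x k)) * u $ j) \<le> 0"
        unfolding U using x l by blast
      then show ?thesis unfolding H[OF l, symmetric] using e by simp
    qed
    moreover have "vec nx (\<lambda>k. real (x k)) \<in> X_d ?I" using x X by blast
    ultimately show "bounded_static ?I" unfolding bounded_static_def fields by blast
  qed
qed

section \<open>Index ranges and bit lengths\<close>

primrec trange :: "nat \<Rightarrow> trm \<Rightarrow> env \<Rightarrow> bool" where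
  "trange N (TBit b) e = True"
| "trange N (TGet k t) e = (trange N t e \<and> tval t e < length (e k) \<and> tval t e < N)"
| "trange N (TAdd s t) e = (trange N s e \<and> trange N t e)"
| "trange N (TMul s t) e = (trange N s e \<and> trange N t e)"
| "trange N (TSum k s t) e = (trange N s e \<and> tval s e \<le> N \<and> (\<forall>i<tval s e. trange N t (e(k := i # e k))))"

primrec frange :: "nat \<Rightarrow> fml \<Rightarrow> env \<Rightarrow> bool" where
  "frange N (FLe s t) e = (trange N s e \<and> trange N t e)"
| "frange N (FAnd f g) e = (frange N f e \<and> frange N g e)"
| "frange N (FOr f g) e = (frange N f e \<and> frange N g e)"
| "frange N (FAll k s f) e = (trange N s e \<and> tval s e \<le> N \<and> (\<forall>i<tval s e. frange N f (e(k := i # e k))))"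

text \<open>A bound for the bit length in units of \<open>G\<close>. A sum over an index costs one
  additional unit, since it has at most \<open>N \<le> 2 ^ G\<close> terms.\<close>

primrec texp :: "trm \<Rightarrow> nat" where
  "texp (TBit b) = 1"
| "texp (TGet k t) = texp t + 1"
| "texp (TAdd s t) = texp s + texp t"
| "texp (TMul s t) = texp s + texp t"
| "texp (TSum k s t) = texp s + texp t + 1"

primrec fexp :: "fml \<Rightarrow> nat" where
  "fexp (FLe s t) = texp s + texp t"
| "fexp (FAnd f g) = fexp f + fexp g"
| "fexp (FOr f g) = fexp f + fexp g"
| "fexp (FAll k s f) = texp s + fexp f"

lemma texp_pos: "1 \<le> texp t"
  by (induction t) auto

text \<open>Addition can be treated like multiplication because \<open>x + y < a * b\<close>
  whenever \<open>x < a\<close>, \<open>y < b\<close> and both bounds are at least 2. The assumption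
  \<open>N \<le> 2 ^ G\<close> also keeps the values of bound variables, which are pushed onto
  arrays, within \<open>G\<close> bits.\<close>

lemma tval_bound:
  assumes "1 \<le> G" "N \<le> 2 ^ G"
  shows "trange N t e \<Longrightarrow> \<forall>k. \<forall>v\<in>set (e k). v < 2 ^ G \<Longrightarrow> tval t e < 2 ^ (G * texp t)"
proof (induction t arbitrary: e)
  case (TBit b)
  have "(2::nat) ^ 1 \<le> 2 ^ G" using assms(1) by (intro power_increasing) auto
  then have "(1::nat) < 2 ^ G" by simp
  then show ?case by simp
next
  case (TGet k t)
  have m: "tval t e < length (e k)" using TGet.prems(1) by simp
  have "e k ! tval t e < 2 ^ G" using TGet.prems(2) nth_mem[OF m] by blast
  then have "tval (TGet k t) e < 2 ^ G" using m by (simp add: get_def)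
  also have "(2::nat) ^ G \<le> 2 ^ (G * texp (TGet k t))" by (intro power_increasing) auto
  finally show ?case .
next
  case (TAdd s t)
  have "tval s e < 2 ^ (G * texp s)" "tval t e < 2 ^ (G * texp t)" using TAdd by auto
  moreover have sq: "x + y < a * b" if "x < a" "y < b" and ab: "2 \<le> a" "2 \<le> b" for x y a b :: nat
  proof -
    have "x + y + 2 \<le> a + b" using that ab by simp
    also have "a + b \<le> a * b"
    proof -
      obtain a' where "a = 2 + a'" using ab(1) le_Suc_ex by blast
      moreover obtain b' where "b = 2 + b'" using ab(2) le_Suc_ex by blast
      ultimately show ?thesis by (simp add: algebra_simps)
    qed
    finally show ?thesis by simp
  qed
  moreover have "(2::nat) \<le> 2 ^ (G * texp s)" "(2::nat) \<le> 2 ^ (G * texp t)"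
    using assms(1) texp_pos[of s] texp_pos[of t] by (simp_all add: self_le_power)
  ultimately show ?case by (simp add: distrib_left power_add)
next
  case (TMul s t)
  have "tval s e < 2 ^ (G * texp s)" "tval t e < 2 ^ (G * texp t)" using TMul by auto
  then have "tval s e * tval t e < 2 ^ (G * texp s) * 2 ^ (G * texp t)" by (intro mult_strict_mono) auto
  then show ?case by (simp add: distrib_left power_add)
next
  case (TSum k s t)
  have n: "tval s e \<le> N" using TSum.prems(1) by simp
  have "tval t (e(k := i # e k)) < 2 ^ (G * texp t)" if i: "i < tval s e" for i
  proof (rule TSum.IH(2))
    show "trange N t (e(k := i # e k))" using TSum.prems(1) i by simp
    show "\<forall>k'. \<forall>v\<in>set ((e(k := i # e k)) k'). v < 2 ^ G" using TSum.prems(2) i n assms(2) by auto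
  qed
  then have "(\<Sum>i<tval s e. tval t (e(k := i # e k))) \<le> (\<Sum>i<tval s e. 2 ^ (G * texp t))"
    by (intro sum_mono less_imp_le) auto
  also have "\<dots> \<le> 2 ^ G * 2 ^ (G * texp t)" using n assms(2) by simp
  also have "\<dots> = 2 ^ (G * texp t + G)" by (simp add: power_add)
  also have "\<dots> < 2 ^ (G * texp s + (G * texp t + G))" using assms(1) texp_pos[of s] by (intro power_strict_increasing) auto
  finally show ?case by (simp add: algebra_simps)
qed

text \<open>Only positions and loop lengths have to be inspected for a concrete certificate; the bit
  lengths demanded by \<open>tok\<close> follow from the shape of the term through
  \<open>tval_bound\<close>.\<close>

lemma tok_of_trange:
  assumes "1 \<le> G" "N \<le> 2 ^ G" "N \<le> Y"
  shows "trange N t e \<Longrightarrow> \<forall>k. \<forall>v\<in>set (e k). v < 2 ^ G \<Longrightarrow> G * texp t \<le> Y \<Longrightarrow> tok Y t e"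
proof (induction t arbitrary: e)
  case (TGet k t)
  then show ?case using assms(3) by (auto simp: algebra_simps)
next
  case (TAdd s t)
  have "tval (TAdd s t) e < 2 ^ (G * texp (TAdd s t))" by (rule tval_bound[OF assms(1,2) TAdd.prems(1,2)])
  also have "\<dots> \<le> 2 ^ Y" using TAdd.prems(3) by (intro power_increasing) auto
  finally show ?case using TAdd by (auto simp: algebra_simps)
next
  case (TMul s t)
  have "tval (TMul s t) e < 2 ^ (G * texp (TMul s t))" by (rule tval_bound[OF assms(1,2) TMul.prems(1,2)])
  also have "\<dots> \<le> 2 ^ Y" using TMul.prems(3) by (intro power_increasing) auto
  finally show ?case using TMul by (auto simp: algebra_simps)
next
  case (TSum k s t)
  have "tval (TSum k s t) e < 2 ^ (G * texp (TSum k s t))" by (rule tval_bound[OF assms(1,2) TSum.prems(1,2)])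
  also have "\<dots> \<le> 2 ^ Y" using TSum.prems(3) by (intro power_increasing) auto
  finally have 1: "tval (TSum k s t) e < 2 ^ Y" .
  have 2: "tok Y s e" using TSum by (auto simp: algebra_simps)
  have 3: "tok Y t (e(k := i # e k))" if i: "i < tval s e" for i
  proof (rule TSum.IH(2))
    show "trange N t (e(k := i # e k))" using TSum.prems(1) i by simp
    show "\<forall>k'. \<forall>v\<in>set ((e(k := i # e k)) k'). v < 2 ^ G" using TSum.prems(1,2) i assms(2) by auto
    show "G * texp t \<le> Y" using TSum.prems(3) by (simp add: algebra_simps)
  qed
  show ?case using 1 2 3 TSum.prems(1) assms(3) by simp
qed auto

lemma fok_of_frange:
  assumes "1 \<le> G" "N \<le> 2 ^ G" "N \<le> Y"
  shows "frange N f e \<Longrightarrow> fsat f e \<Longrightarrow> \<forall>k. \<forall>v\<in>set (e k). v < 2 ^ G \<Longrightarrow> G * fexp f \<le> Y \<Longrightarrow> fok Y f e"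
proof (induction f arbitrary: e)
  case (FLe s t)
  have "G * texp s \<le> Y" "G * texp t \<le> Y" using FLe.prems(4) by (auto simp: algebra_simps)
  then show ?case using FLe.prems tok_of_trange[OF assms] by simp
next
  case (FAll k s f)
  have "G * texp s \<le> Y" "G * fexp f \<le> Y" using FAll.prems(4) by (auto simp: algebra_simps)
  moreover have "fok Y f (e(k := i # e k))" if i: "i < tval s e" for i
  proof (rule FAll.IH)
    show "frange N f (e(k := i # e k))" "fsat f (e(k := i # e k))" using FAll.prems(1,2) i by simp_all
    show "\<forall>k'. \<forall>v\<in>set ((e(k := i # e k)) k'). v < 2 ^ G" using FAll.prems(1,3) i assms(2) by auto
    show "G * fexp f \<le> Y" using calculation(2) .
  qed
  ultimately show ?case using FAll.prems(1,3) tok_of_trange[OF assms, of s e] assms(3) by simp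
qed (auto simp: algebra_simps)

section \<open>The verification condition\<close>

abbreviation one :: trm where "one \<equiv> TBit True"
abbreviation zero :: trm where "zero \<equiv> TBit False"
abbreviation sc :: "nat \<Rightarrow> trm" where "sc k \<equiv> TGet k zero"

definition FEq :: "trm \<Rightarrow> trm \<Rightarrow> fml" where
  "FEq s t = FAnd (FLe s t) (FLe t s)"

primrec conjs :: "fml list \<Rightarrow> fml" where
  "conjs [] = FLe zero zero"
| "conjs (f # fs) = FAnd f (conjs fs)"

lemma fsat_FEq [simp]: "fsat (FEq s t) e \<longleftrightarrow> tval s e = tval t e"
  by (auto simp: FEq_def)

lemma frange_FEq [simp]: "frange N (FEq s t) e \<longleftrightarrow> trange N s e \<and> trange N t e"
  by (auto simp: FEq_def)

text \<open>A binder pushes onto array \<open>k\<close>. Terms from outside that are placed under it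
  must keep their value, and this semantic condition is decided by the simplifier for each concrete
  term.\<close>

definition fresh :: "nat \<Rightarrow> trm \<Rightarrow> bool" where
  "fresh k t \<longleftrightarrow> (\<forall>e i. tval t (e(k := i # e k)) = tval t e)"

text \<open>Bound variables live in the arrays 30 to 34, away from the input array 0 and the
  certificate arrays 1 to 24, so that binding never shifts an entry of those.\<close>

definition dim_fml :: "trm \<Rightarrow> trm \<Rightarrow> fml" where
  "dim_fml p n = FAnd (FAll 30 n (FEq (TGet 0 (TAdd p (sc 30))) one)) (FEq (TGet 0 (TAdd p n)) zero)"

definition nat_fml :: "trm \<Rightarrow> trm \<Rightarrow> trm \<Rightarrow> fml" where
  "nat_fml p l v = (let i = sc 30; d = TGet 0 (TAdd (TAdd p (TAdd i i)) one) in
     conjs [FAll 30 l (conjs [FEq (TGet 0 (TAdd p (TAdd i i))) one, FLe d one,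
                              FOr (FLe (TAdd i (TAdd one one)) l) (FEq d one)]),
            FEq (TGet 0 (TAdd p (TAdd l l))) zero,
            FEq v (TSum 30 l (TMul d (TGet 14 i)))])"

lemma get_Cons_0 [simp]: "get (x # xs) 0 = x"
  by (simp add: get_def)

lemma fsat_dim_fml: "fresh 30 p \<Longrightarrow> fsat (dim_fml p n) e \<longleftrightarrow> dim_code (get (e 0)) (tval p e) (tval n e)"
  by (simp add: dim_fml_def dim_code_def fresh_def)

lemma fsat_nat_fml: "fresh 30 p \<Longrightarrow> fresh 30 l \<Longrightarrow>
    fsat (nat_fml p l v) e \<longleftrightarrow> nat_code (get (e 0)) (get (e 14)) (tval p e) (tval l e) (tval v e)"
  by (simp add: nat_fml_def nat_code_def fresh_def Let_def add.assoc)

text \<open>Array 0 is the input. The scalars in the arrays 1 to 10 are the dimensions, the bound R, the number of its digits,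
  a common denominator D, the number T of rationals, and the position of R. Rational number t starts at
  position P t; NU, LA and DE, LB are its numerator and denominator with their numbers of digits, U and V
  witness their coprimality, and it equals (VP - VN) / D. PW are the powers of two, X is the solution, and S, Y, Z
  are the dual multipliers.\<close>

definition token :: "(nat \<Rightarrow> nat \<Rightarrow> nat) \<Rightarrow> nat \<Rightarrow> bool" where
  "token F t = (let g = F 0; D = F 8 0; T = F 9 0; P = F 11; LA = F 12; LB = F 13; PW = F 14; NU = F 15; DE = F 16;
      VP = F 17; VN = F 18; U = F 23; V = F 24 in
     nat_code g PW (P t + 1) (LA t) (NU t) \<and>
     nat_code g PW (P t + (LA t + LA t) + 2) (LB t) (DE t) \<and>
     P (t + 1) = P t + (LA t + LA t) + (LB t + LB t) + 3 \<and>
     1 \<le> DE t \<and> LA t \<le> P T \<and> LB t \<le> P T \<and>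
     (U t * NU t = V t * DE t + 1 \<or> U t * NU t + 1 = V t * DE t) \<and>
     (g (P t) = 0 \<and> VN t = 0 \<and> VP t * DE t = NU t * D \<or>
      g (P t) = 1 \<and> 1 \<le> NU t \<and> VP t = 0 \<and> VN t * DE t = NU t * D))"

text \<open>The end mark 2 at position \<open>P T\<close> forces the last token to end exactly with
  the input. The power table is certified up to \<open>P T\<close> only, hence the condition
  \<open>RL \<le> P T\<close> on the number of digits of \<open>R\<close>.\<close>

definition header :: "(nat \<Rightarrow> nat \<Rightarrow> nat) \<Rightarrow> bool" where
  "header F = (let g = F 0; nx = F 1 0; nu = F 2 0; mx = F 3 0; mu = F 4 0; L = F 5 0; R = F 6 0; RL = F 7 0;
      D = F 8 0; T = F 9 0; p5 = F 10 0; P = F 11; PW = F 14 in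
     dim_code g 0 nx \<and> dim_code g (nx + 1) nu \<and> dim_code g (nx + 1 + (nu + 1)) mx \<and>
     dim_code g (nx + 1 + (nu + 1) + (mx + 1)) mu \<and> dim_code g (nx + 1 + (nu + 1) + (mx + 1) + (mu + 1)) L \<and>
     p5 = nx + 1 + (nu + 1) + (mx + 1) + (mu + 1) + (L + 1) \<and>
     1 \<le> D \<and> T = ntok nx nu mx mu L \<and> RL \<le> P T \<and>
     PW 0 = 1 \<and> (\<forall>i<P T. PW (i + 1) = PW i + PW i) \<and>
     nat_code g PW p5 RL R \<and> P 0 = p5 + (RL + RL) + 1 \<and> g (P T) = 2)"

text \<open>The inequalities are multiplied by \<open>D\<close>, and the negative parts
  \<open>VN\<close> are moved to the other side, because the terms denote natural numbers and there
  is no subtraction.\<close>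

definition primal :: "(nat \<Rightarrow> nat \<Rightarrow> nat) \<Rightarrow> bool" where
  "primal F = (let nx = F 1 0; mx = F 3 0; mu = F 4 0; R = F 6 0; VP = F 17; VN = F 18; X = F 19 in
     (\<forall>k<nx. X k \<le> R) \<and>
     (\<forall>i<mx. (\<Sum>k<nx. VP (mx + mu + (i * nx + k)) * X k) + VN i \<le> (\<Sum>k<nx. VN (mx + mu + (i * nx + k)) * X k) + VP i))"

text \<open>For each \<open>l\<close> these are the conditions \<open>s * h \<le> y * M + z\<close>
  and \<open>y * b + R * sum z \<le> 0\<close>, again without subtraction. All rational data carry
  the factor \<open>D\<close>; the multipliers \<open>z\<close> are taken relative to the scaled
  data, so \<open>R\<close> needs no factor. Row \<open>l\<close> of the multipliers is flattened to
  the indices \<open>l * mu + i\<close> and \<open>l * nu + j\<close>.\<close>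

definition dual :: "(nat \<Rightarrow> nat \<Rightarrow> nat) \<Rightarrow> bool" where
  "dual F = (let nx = F 1 0; nu = F 2 0; mx = F 3 0; mu = F 4 0; L = F 5 0; R = F 6 0;
      VP = F 17; VN = F 18; X = F 19; Y = F 20; Z = F 21; S = F 22;
      b = mx + mu + mx * nx; h = mx + mu + mx * nx + nx * mu * nu in
     \<forall>l<L. 1 \<le> S l \<and>
       (\<Sum>i<mu. Y (l * mu + i) * VP (mx + i)) + R * (\<Sum>j<nu. Z (l * nu + j)) \<le> (\<Sum>i<mu. Y (l * mu + i) * VN (mx + i)) \<and>
       (\<forall>j<nu. S l * (\<Sum>k<nx. VP (h + ((l * nu + j) * nx + k)) * X k) +
            (\<Sum>i<mu. Y (l * mu + i) * (\<Sum>k<nx. VN (b + ((k * mu + i) * nu + j)) * X k))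
          \<le> S l * (\<Sum>k<nx. VN (h + ((l * nu + j) * nx + k)) * X k) +
            (\<Sum>i<mu. Y (l * mu + i) * (\<Sum>k<nx. VP (b + ((k * mu + i) * nu + j)) * X k)) + Z (l * nu + j)))"

definition token_fml :: fml where
  "token_fml = (let t = sc 31; p = TGet 11 t; la = TGet 12 t; lb = TGet 13 t; n = TGet 15 t; d = TGet 16 t;
      un = TMul (TGet 23 t) n; vd = TMul (TGet 24 t) d; nD = TMul n (sc 8); end = TGet 11 (sc 9) in
     conjs [nat_fml (TAdd p one) la n,
       nat_fml (TAdd (TAdd p (TAdd la la)) (TAdd one one)) lb d,
       FEq (TGet 11 (TAdd t one)) (TAdd (TAdd (TAdd p (TAdd la la)) (TAdd lb lb)) (TAdd one (TAdd one one))),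
       FLe one d, FLe la end, FLe lb end,
       FOr (FEq un (TAdd vd one)) (FEq (TAdd un one) vd),
       FOr (conjs [FEq (TGet 0 p) zero, FEq (TGet 18 t) zero, FEq (TMul (TGet 17 t) d) nD])
           (conjs [FEq (TGet 0 p) one, FLe one n, FEq (TGet 17 t) zero, FEq (TMul (TGet 18 t) d) nD])])"

definition header_fml :: fml where
  "header_fml = (let nx = sc 1; nu = sc 2; mx = sc 3; mu = sc 4; L = sc 5; R = sc 6; RL = sc 7; T = sc 9; p5 = sc 10;
      p1 = TAdd nx one; p2 = TAdd p1 (TAdd nu one); p3 = TAdd p2 (TAdd mx one); p4 = TAdd p3 (TAdd mu one);
      end = TGet 11 T; i = sc 31 in
     conjs [dim_fml zero nx, dim_fml p1 nu, dim_fml p2 mx, dim_fml p3 mu, dim_fml p4 L,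
       FEq p5 (TAdd p4 (TAdd L one)), FLe one (sc 8),
       FEq T (TAdd (TAdd (TAdd (TAdd mx mu) (TMul mx nx)) (TMul (TMul nx mu) nu)) (TMul (TMul L nu) nx)),
       FLe RL end, FEq (TGet 14 zero) one,
       FAll 31 end (FEq (TGet 14 (TAdd i one)) (TAdd (TGet 14 i) (TGet 14 i))),
       nat_fml p5 RL R, FEq (TGet 11 zero) (TAdd (TAdd p5 (TAdd RL RL)) one), FEq (TGet 0 end) (TAdd one one)])"

definition primal_fml :: fml where
  "primal_fml = (let nx = sc 1; mx = sc 3; mu = sc 4; i = sc 31; k = sc 33;
      a = (\<lambda>v. TSum 33 nx (TMul (TGet v (TAdd (TAdd mx mu) (TAdd (TMul i nx) k))) (TGet 19 k))) in
     FAnd (FAll 33 nx (FLe (TGet 19 k) (sc 6)))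
       (FAll 31 mx (FLe (TAdd (a 17) (TGet 18 i)) (TAdd (a 18) (TGet 17 i)))))"

definition dual_fml :: fml where
  "dual_fml = (let nx = sc 1; nu = sc 2; mx = sc 3; mu = sc 4; l = sc 34; j = sc 32; i = sc 31; k = sc 33; s = TGet 22 l;
      bo = TAdd (TAdd mx mu) (TMul mx nx); ho = TAdd bo (TMul (TMul nx mu) nu);
      y = TGet 20 (TAdd (TMul l mu) i); z = TGet 21 (TAdd (TMul l nu) j);
      yb = (\<lambda>v. TSum 31 mu (TMul y (TGet v (TAdd mx i))));
      h = (\<lambda>v. TMul s (TSum 33 nx (TMul (TGet v (TAdd ho (TAdd (TMul (TAdd (TMul l nu) j) nx) k))) (TGet 19 k))));
      yB = (\<lambda>v. TSum 31 mu (TMul y (TSum 33 nx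
         (TMul (TGet v (TAdd bo (TAdd (TMul (TAdd (TMul k mu) i) nu) j))) (TGet 19 k))))) in
     FAll 34 (sc 5) (conjs [FLe one s, FLe (TAdd (yb 17) (TMul (sc 6) (TSum 32 nu z))) (yb 18),
       FAll 32 nu (FLe (TAdd (h 17) (yB 18)) (TAdd (TAdd (h 18) (yB 17)) z))]))"

definition cert_fml :: fml where
  "cert_fml = conjs [header_fml, FAll 31 (sc 9) token_fml, primal_fml, dual_fml]"

definition cert :: "(nat \<Rightarrow> nat \<Rightarrow> nat) \<Rightarrow> bool" where
  "cert F \<longleftrightarrow> header F \<and> (\<forall>t<F 9 0. token F t) \<and> primal F \<and> dual F"

lemma fsat_token: "fsat token_fml (e(31 := t # e 31)) \<longleftrightarrow> token (\<lambda>k. get (e k)) t"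
  by (simp add: token_fml_def token_def fsat_nat_fml fresh_def Let_def numeral_3_eq_3)

lemma fsat_header: "fsat header_fml e \<longleftrightarrow> header (\<lambda>k. get (e k))"
  by (simp add: header_fml_def header_def fsat_nat_fml fsat_dim_fml fresh_def Let_def numeral_2_eq_2)

lemma fsat_primal: "fsat primal_fml e \<longleftrightarrow> primal (\<lambda>k. get (e k))"
  by (simp add: primal_fml_def primal_def Let_def)

lemma fsat_dual: "fsat dual_fml e \<longleftrightarrow> dual (\<lambda>k. get (e k))"
  by (simp add: dual_fml_def dual_def Let_def)

lemma fsat_cert: "fsat cert_fml e \<longleftrightarrow> cert (\<lambda>k. get (e k))"
  by (simp add: cert_fml_def cert_def fsat_token fsat_header fsat_primal fsat_dual)

section \<open>Soundness of certificates\<close>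

lemma enc_rat_quotient:
  assumes "0 < d" "coprime n d"
  shows "enc_rat (of_nat n / of_nat d) = False # enc_nat n @ enc_nat d"
    and "0 < n \<Longrightarrow> enc_rat (- (of_nat n / of_nat d)) = True # enc_nat n @ enc_nat d"
proof -
  have q: "quotient_of (of_int p / of_int (int d)) = (p, int d)" if "coprime p (int d)" for p
    unfolding Fract_of_int_quotient[symmetric] quotient_of_Fract
    using that assms(1) by (simp add: normalize_stable)
  have c: "coprime (int n) (int d)" "coprime (- int n) (int d)" using assms(2) by simp_all
  show "enc_rat (of_nat n / of_nat d) = False # enc_nat n @ enc_nat d"
    using q[OF c(1)] by (simp add: enc_rat_def enc_int_def)
  show "enc_rat (- (of_nat n / of_nat d)) = True # enc_nat n @ enc_nat d" if "0 < n"
    using q[OF c(2)] that by (simp add: enc_rat_def enc_int_def)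
qed

text \<open>A Bezout identity makes coprimality checkable by two products. Over the naturals the
  difference 1 can appear on either side.\<close>

lemma coprime_bezout_nat:
  fixes u v n d :: nat
  assumes "u * n = v * d + 1 \<or> u * n + 1 = v * d"
  shows "coprime n d"
proof (rule coprimeI)
  fix c assume c: "c dvd n" "c dvd d"
  then have d: "c dvd u * n" "c dvd v * d" by simp_all
  show "is_unit c"
    using assms
  proof
    assume "u * n = v * d + 1"
    then show ?thesis using d dvd_add_right_iff[OF d(2), of 1] by simp
  next
    assume "u * n + 1 = v * d"
    then show ?thesis using d dvd_add_right_iff[OF d(1), of 1] by simp
  qed
qed

definition val :: "(nat \<Rightarrow> nat \<Rightarrow> nat) \<Rightarrow> nat \<Rightarrow> rat" where
  "val F t = (of_nat (F 17 t) - of_nat (F 18 t)) / of_nat (F 8 0)"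

text \<open>The bounds by \<open>P T\<close> keep both digit counts inside the certified part of the
  power table. Coprimality makes numerator and denominator those of the encoding, and a negative
  sign demands a positive numerator because zero is encoded with sign bit False.\<close>

lemma token_occ:
  assumes tok: "token F t" and F0: "F 0 = inp w" and D: "1 \<le> F 8 0"
    and pw: "\<And>i. i \<le> F 11 (F 9 0) \<Longrightarrow> F 14 i = 2 ^ i"
  shows "occ w (F 11 t) (enc_rat (val F t)) \<and> F 11 (t + 1) = F 11 t + length (enc_rat (val F t))"
proof -
  let ?n = "F 15 t" and ?d = "F 16 t" and ?p = "F 11 t" and ?la = "F 12 t" and ?lb = "F 13 t"
  note tk = tok[unfolded token_def Let_def F0]
  have la: "?la \<le> F 11 (F 9 0)" and lb: "?lb \<le> F 11 (F 9 0)" and d: "0 < ?d"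
    and step: "F 11 (t + 1) = ?p + (?la + ?la) + (?lb + ?lb) + 3"
    using tk by auto
  have c1: "nat_code (inp w) (F 14) (?p + 1) ?la ?n" using tk by blast
  have c2: "nat_code (inp w) (F 14) (?p + (?la + ?la) + 2) ?lb ?d" using tk by blast
  have n1: "?la = length (binary_digits ?n)" "occ w (?p + 1) (enc_nat ?n)"
    using c1 nat_code_occ[of ?la "F 14" w "?p + 1" ?n] pw la by auto
  have n2: "?lb = length (binary_digits ?d)" "occ w (?p + (?la + ?la) + 2) (enc_nat ?d)"
    using c2 nat_code_occ[of ?lb "F 14" w "?p + (?la + ?la) + 2" ?d] pw lb by auto
  have cop: "coprime ?n ?d" by (rule coprime_bezout_nat[of "F 23 t" _ "F 24 t"]) (use tk in blast)
  have o: "occ w ?p (b # enc_nat ?n @ enc_nat ?d)" if "inp w ?p = of_bool b" for b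
    using that n1 n2(2) by (simp add: occ_Cons occ_append length_enc_nat mult_2)
  have l: "length (b # enc_nat ?n @ enc_nat ?d) = (?la + ?la) + (?lb + ?lb) + 3" for b
    using n1(1) n2(1) by (simp add: length_enc_nat)
  have quot: "(of_nat v :: rat) / of_nat (F 8 0) = of_nat ?n / of_nat ?d" if e: "v * ?d = ?n * F 8 0" for v
  proof -
    have "(of_nat v :: rat) * of_nat ?d = of_nat ?n * of_nat (F 8 0)" using e by (metis of_nat_mult)
    then show ?thesis using d D by (simp add: field_simps)
  qed
  from tk consider "inp w ?p = 0 \<and> F 18 t = 0 \<and> F 17 t * ?d = ?n * F 8 0"
    | "inp w ?p = 1 \<and> 1 \<le> ?n \<and> F 17 t = 0 \<and> F 18 t * ?d = ?n * F 8 0" by blast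
  then show ?thesis
  proof cases
    case 1
    then have "val F t = of_nat ?n / of_nat ?d" using quot by (simp add: val_def)
    then have "enc_rat (val F t) = False # enc_nat ?n @ enc_nat ?d" using enc_rat_quotient(1)[OF d cop] by simp
    then show ?thesis using o[of False] l[of False] step 1 by simp
  next
    case 2
    then have "val F t = - (of_nat ?n / of_nat ?d)" using quot[of "F 18 t"] by (simp add: val_def)
    then have "enc_rat (val F t) = True # enc_nat ?n @ enc_nat ?d" using enc_rat_quotient(2)[OF d cop] 2 by simp
    then show ?thesis using o[of True] l[of True] step 2 by simp
  qed
qed

lemma header_powers:
  assumes "header F" "i \<le> F 11 (F 9 0)"
  shows "F 14 i = 2 ^ i"
  using assms(2)
proof (induction i)
  case 0
  then show ?case using assms(1) by (simp add: header_def Let_def)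
next
  case (Suc i)
  have "F 14 (i + 1) = F 14 i + F 14 i" using assms(1) Suc.prems by (simp add: header_def Let_def)
  then show ?case using Suc by simp
qed

lemma cert_instance:
  assumes F0: "F 0 = inp w" and hd: "header F" and tok: "\<forall>t<F 9 0. token F t"
  shows "w = enc_instance (mkI (F 1 0) (F 2 0) (F 3 0) (F 4 0) (F 5 0) (F 6 0) (val F))"
proof -
  let ?nx = "F 1 0" and ?nu = "F 2 0" and ?mx = "F 3 0" and ?mu = "F 4 0" and ?L = "F 5 0" and ?T = "F 9 0"
  let ?c = "\<lambda>t. concat (map (\<lambda>t. enc_rat (val F t)) [0..<t])"
  note h = hd[unfolded header_def Let_def F0]
  note pw = header_powers[OF hd]
  have D: "1 \<le> F 8 0" using h by blast
  have T: "?T = ntok ?nx ?nu ?mx ?mu ?L" using h by blast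
  \<comment> \<open>Each token starts where the previous one ends, so the codes of the rationals are
    contiguous.\<close>
  have c: "occ w (F 11 0) (?c t) \<and> F 11 t = F 11 0 + length (?c t)" if "t \<le> ?T" for t
    using that
  proof (induction t)
    case (Suc t)
    then have "t < ?T" by simp
    then have "token F t" using tok by blast
    from token_occ[OF this F0 D pw] show ?case using Suc by (simp add: occ_append)
  qed simp
  have dims: "occ w 0 (enc_dim ?nx)" "occ w (?nx + 1) (enc_dim ?nu)" "occ w (?nx + 1 + (?nu + 1)) (enc_dim ?mx)"
    "occ w (?nx + 1 + (?nu + 1) + (?mx + 1)) (enc_dim ?mu)"
    "occ w (?nx + 1 + (?nu + 1) + (?mx + 1) + (?mu + 1)) (enc_dim ?L)"
    using h unfolding dim_code_occ by blast+
  have p5: "F 10 0 = ?nx + 1 + (?nu + 1) + (?mx + 1) + (?mu + 1) + (?L + 1)" using h by blast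
  have RL: "F 7 0 \<le> F 11 ?T" using h by blast
  have "nat_code (inp w) (F 14) (F 10 0) (F 7 0) (F 6 0)" using h by blast
  then have R: "F 7 0 = length (binary_digits (F 6 0))" "occ w (F 10 0) (enc_nat (F 6 0))"
    using nat_code_occ[of "F 7 0" "F 14" w "F 10 0" "F 6 0"] pw RL by auto
  have p0: "F 11 0 = F 10 0 + (F 7 0 + F 7 0) + 1" using h by blast
  \<comment> \<open>Only the position right behind the input carries a 2, so the end mark determines
    the length of \<open>w\<close>.\<close>
  have len: "length w = F 11 ?T"
  proof -
    have "inp w (F 11 ?T) = 2" using h by blast
    then show ?thesis unfolding inp_simps by simp
  qed
  have ld: "length (enc_dim n) = n + 1" for n by (simp add: enc_dim_def)
  let ?e = "enc_dim ?nx @ enc_dim ?nu @ enc_dim ?mx @ enc_dim ?mu @ enc_dim ?L @ enc_nat (F 6 0) @ ?c ?T"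
  have "occ w 0 ?e"
    using dims R c[of ?T] p5 p0
    by (simp add: occ_append ld length_enc_nat add.assoc mult_2 del: map_eq_conv)
  moreover have "length ?e = length w"
    using c[of ?T] p5 p0 len R(1) by (simp add: ld length_enc_nat del: length_concat)
  ultimately have "w = ?e" by (rule occ_end)
  then show ?thesis unfolding enc_mkI using T by simp
qed

text \<open>Multiply the constraints by \<open>y\<close> and the upper bounds by \<open>z\<close>,
  add up and exchange the two sums. Since \<open>s > 0\<close> is arbitrary, multipliers scaled to
  integers can be used as they are, with real \<open>u\<close>.\<close>

lemma weak_duality:
  fixes s R :: real
  assumes s: "0 < s" and y: "\<And>i. i < m \<Longrightarrow> 0 \<le> y i" and z: "\<And>j. j < n \<Longrightarrow> 0 \<le> z j"
    and u: "\<And>j. j < n \<Longrightarrow> 0 \<le> u j \<and> u j \<le> R" and Mu: "\<And>i. i < m \<Longrightarrow> (\<Sum>j<n. M i j * u j) \<le> b i"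
    and h: "\<And>j. j < n \<Longrightarrow> s * h j \<le> (\<Sum>i<m. y i * M i j) + z j"
    and b: "(\<Sum>i<m. y i * b i) + R * (\<Sum>j<n. z j) \<le> 0"
  shows "(\<Sum>j<n. h j * u j) \<le> 0"
proof -
  have "s * (\<Sum>j<n. h j * u j) = (\<Sum>j<n. s * h j * u j)" by (simp add: sum_distrib_left mult.assoc)
  also have "\<dots> \<le> (\<Sum>j<n. ((\<Sum>i<m. y i * M i j) + z j) * u j)"
    using h u by (intro sum_mono mult_right_mono) auto
  also have "\<dots> = (\<Sum>j<n. \<Sum>i<m. y i * M i j * u j) + (\<Sum>j<n. z j * u j)"
    by (simp add: distrib_right sum.distrib sum_distrib_right)
  also have "(\<Sum>j<n. \<Sum>i<m. y i * M i j * u j) = (\<Sum>i<m. y i * (\<Sum>j<n. M i j * u j))"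
    by (subst sum.swap) (simp add: sum_distrib_left mult.assoc)
  also have "\<dots> \<le> (\<Sum>i<m. y i * b i)" using y Mu by (intro sum_mono mult_left_mono) auto
  also have "(\<Sum>j<n. z j * u j) \<le> (\<Sum>j<n. z j * R)" using z u by (intro sum_mono mult_left_mono) auto
  also have "(\<Sum>j<n. z j * R) = R * (\<Sum>j<n. z j)" by (simp add: sum_distrib_left mult.commute)
  finally have "s * (\<Sum>j<n. h j * u j) \<le> 0" using b by linarith
  then show ?thesis using s by (simp add: mult_le_0_iff)
qed

lemma val_sum:
  "(\<Sum>k<n. val F (f k) * of_nat (x k)) =
    (of_nat (\<Sum>k<n. F 17 (f k) * x k) - of_nat (\<Sum>k<n. F 18 (f k) * x k)) / of_nat (F 8 0)"
  by (simp add: val_def sum_divide_distrib diff_divide_distrib left_diff_distrib sum_subtractf)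

lemma cert_bounded:
  assumes D: "1 \<le> F 8 0" and primal: "primal F" and dual: "dual F"
  shows "bounded_static (mkI (F 1 0) (F 2 0) (F 3 0) (F 4 0) (F 5 0) (F 6 0) (val F))"
  unfolding bounded_mkI
proof (intro exI conjI allI impI)
  let ?nx = "F 1 0" and ?nu = "F 2 0" and ?mx = "F 3 0" and ?mu = "F 4 0" and ?X = "F 19"
  let ?b = "?mx + ?mu + ?mx * ?nx"
  let ?h = "?b + ?nx * ?mu * ?nu"
  note p = primal[unfolded primal_def Let_def]
  fix k assume "k < ?nx"
  then show "?X k \<le> F 6 0" using p by blast
next
  let ?nx = "F 1 0" and ?nu = "F 2 0" and ?mx = "F 3 0" and ?mu = "F 4 0" and ?X = "F 19"
  note p = primal[unfolded primal_def Let_def]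
  fix i assume i: "i < ?mx"
  let ?f = "\<lambda>k. ?mx + ?mu + (i * ?nx + k)"
  have "(\<Sum>k<?nx. F 17 (?f k) * ?X k) + F 18 i \<le> (\<Sum>k<?nx. F 18 (?f k) * ?X k) + F 17 i"
    using p i by blast
  then have "rat_of_nat ((\<Sum>k<?nx. F 17 (?f k) * ?X k) + F 18 i) \<le> of_nat ((\<Sum>k<?nx. F 18 (?f k) * ?X k) + F 17 i)"
    using of_nat_le_iff by blast
  then have "rat_of_nat (\<Sum>k<?nx. F 17 (?f k) * ?X k) - of_nat (\<Sum>k<?nx. F 18 (?f k) * ?X k) \<le> of_nat (F 17 i) - of_nat (F 18 i)"
    unfolding of_nat_add by linarith
  then show "(\<Sum>k<?nx. val F (?f k) * of_nat (?X k)) \<le> val F i"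
    unfolding val_sum unfolding val_def by (rule divide_right_mono) simp
next
  let ?nx = "F 1 0" and ?nu = "F 2 0" and ?mx = "F 3 0" and ?mu = "F 4 0" and ?X = "F 19"
  let ?b = "?mx + ?mu + ?mx * ?nx"
  let ?h = "?b + ?nx * ?mu * ?nu"
  let ?fM = "\<lambda>i j k. ?b + ((k * ?mu + i) * ?nu + j)"
  let ?fh = "\<lambda>l j k. ?h + ((l * ?nu + j) * ?nx + k)"
  \<comment> \<open>\<open>V f\<close> is \<open>D\<close> times the corresponding rational sum. The
    positive factor \<open>D\<close> cancels from all inequalities, which leaves the integer data of
    the certificate.\<close>
  define V where "V f = real (\<Sum>k<?nx. F 17 (f k) * ?X k) - real (\<Sum>k<?nx. F 18 (f k) * ?X k)" for f
  have V: "real_of_rat (\<Sum>k<?nx. val F (f k) * of_nat (?X k)) = V f / real (F 8 0)" for f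
    unfolding val_sum V_def of_rat_divide of_rat_diff of_rat_of_nat_eq ..
  have Dp: "0 < real (F 8 0)" using D by simp
  fix u :: "nat \<Rightarrow> real" and l
  assume u: "\<forall>j<?nu. 0 \<le> u j \<and> u j \<le> real (F 6 0)"
    and Mu: "\<forall>i<?mu. (\<Sum>j<?nu. real_of_rat (\<Sum>k<?nx. val F (?fM i j k) * of_nat (?X k)) * u j) \<le> real_of_rat (val F (?mx + i))"
    and l: "l < F 5 0"
  note d0 = dual[unfolded dual_def Let_def, rule_format, OF l]
  let ?Y = "\<lambda>i. F 20 (l * ?mu + i)" and ?Z = "\<lambda>j. F 21 (l * ?nu + j)"
  have "(\<Sum>j<?nu. V (?fh l j) * u j) \<le> 0"
  proof (rule weak_duality[where s = "real (F 22 l)" and R = "real (F 6 0)" and m = ?mu and y = "\<lambda>i. real (?Y i)"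
        and z = "\<lambda>j. real (?Z j)" and M = "\<lambda>i j. V (?fM i j)" and b = "\<lambda>i. real (F 17 (?mx + i)) - real (F 18 (?mx + i))"])
    show "0 < real (F 22 l)" using d0 by simp
    show "0 \<le> u j \<and> u j \<le> real (F 6 0)" if "j < ?nu" for j using u that by blast
    show "(\<Sum>j<?nu. V (?fM i j) * u j) \<le> real (F 17 (?mx + i)) - real (F 18 (?mx + i))" if i: "i < ?mu" for i
    proof -
      have "(\<Sum>j<?nu. V (?fM i j) / real (F 8 0) * u j) \<le> real_of_rat (val F (?mx + i))"
        using Mu i unfolding V by blast
      then have "(\<Sum>j<?nu. V (?fM i j) * u j) / real (F 8 0) \<le> (real (F 17 (?mx + i)) - real (F 18 (?mx + i))) / real (F 8 0)"
        by (simp add: sum_divide_distrib val_def of_rat_divide of_rat_diff)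
      then show ?thesis using Dp by (simp add: divide_le_cancel)
    qed
    show "real (F 22 l) * V (?fh l j) \<le> (\<Sum>i<?mu. real (?Y i) * V (?fM i j)) + real (?Z j)" if j: "j < ?nu" for j
    proof -
      let ?S = "\<lambda>v f. \<Sum>k<?nx. F v (f k) * ?X k"
      have "F 22 l * ?S 17 (?fh l j) + (\<Sum>i<?mu. ?Y i * ?S 18 (?fM i j)) \<le>
          F 22 l * ?S 18 (?fh l j) + (\<Sum>i<?mu. ?Y i * ?S 17 (?fM i j)) + ?Z j"
        using d0 j by blast
      then have "real (F 22 l * ?S 17 (?fh l j) + (\<Sum>i<?mu. ?Y i * ?S 18 (?fM i j))) \<le>
          real (F 22 l * ?S 18 (?fh l j) + (\<Sum>i<?mu. ?Y i * ?S 17 (?fM i j)) + ?Z j)"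
        using of_nat_le_iff by blast
      then have "real (F 22 l) * real (?S 17 (?fh l j)) + (\<Sum>i<?mu. real (?Y i) * real (?S 18 (?fM i j))) \<le>
          real (F 22 l) * real (?S 18 (?fh l j)) + (\<Sum>i<?mu. real (?Y i) * real (?S 17 (?fM i j))) + real (?Z j)"
        unfolding of_nat_add of_nat_mult of_nat_sum[of _ "{..<?mu}"] .
      then show ?thesis unfolding V_def right_diff_distrib sum_subtractf by linarith
    qed
    show "(\<Sum>i<?mu. real (?Y i) * (real (F 17 (?mx + i)) - real (F 18 (?mx + i)))) + real (F 6 0) * (\<Sum>j<?nu. real (?Z j)) \<le> 0"
    proof -
      have "(\<Sum>i<?mu. ?Y i * F 17 (?mx + i)) + F 6 0 * (\<Sum>j<?nu. ?Z j) \<le> (\<Sum>i<?mu. ?Y i * F 18 (?mx + i))"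
        using d0 by blast
      then have "real ((\<Sum>i<?mu. ?Y i * F 17 (?mx + i)) + F 6 0 * (\<Sum>j<?nu. ?Z j)) \<le> real (\<Sum>i<?mu. ?Y i * F 18 (?mx + i))"
        using of_nat_le_iff by blast
      then show ?thesis unfolding of_nat_add of_nat_mult of_nat_sum right_diff_distrib sum_subtractf by linarith
    qed
  qed simp_all
  then have "(\<Sum>j<?nu. V (?fh l j) * u j) / real (F 8 0) \<le> 0" using Dp by (simp add: divide_le_0_iff)
  then show "(\<Sum>j<?nu. real_of_rat (\<Sum>k<?nx. val F (?fh l j k) * of_nat (?X k)) * u j) \<le> 0"
    unfolding V by (simp add: sum_divide_distrib)
qed

lemma cert_sound:
  assumes F0: "F 0 = inp w" and cert: "cert F"
  shows "w \<in> Bounded_Static"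
proof -
  have hd: "header F" and tok: "\<forall>t<F 9 0. token F t" and p: "primal F" and d: "dual F"
    using cert by (auto simp: cert_def)
  have D: "1 \<le> F 8 0" using hd by (simp add: header_def Let_def)
  show ?thesis
    unfolding Bounded_Static_def
    using cert_instance[OF F0 hd tok] cert_bounded[OF D p d] wf_mkI by blast
qed

section \<open>Bezout coefficients and index ranges of certificates\<close>

lemma mult_add_less: "i < m \<Longrightarrow> j < n \<Longrightarrow> i * n + j < m * (n::nat)"
proof -
  assume "i < m" "j < n"
  then have "i * n + j < Suc i * n" by simp
  also have "\<dots> \<le> m * n" using \<open>i < m\<close> by (intro mult_le_mono1) simp
  finally show ?thesis .
qed

text \<open>Reducing a coefficient modulo \<open>d\<close> keeps the witnesses as small as the
  fraction itself, up to one. The cases \<open>n = 0\<close> and \<open>d = 1\<close> are separate: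
  the first lies outside \<open>bezout_nat\<close>, and modulo 1 the residue 1 does not
  exist.\<close>

lemma bezout_bounded:
  fixes n d :: nat
  assumes "coprime n d" "1 \<le> d"
  shows "\<exists>u v. u \<le> d \<and> v \<le> n + 1 \<and> (u * n = v * d + 1 \<or> u * n + 1 = v * d)"
proof (cases "n = 0")
  case True
  then have "d = 1" using assms by simp
  then have "0 \<le> d \<and> 1 \<le> n + 1 \<and> (0 * n = 1 * d + 1 \<or> 0 * n + 1 = 1 * d)" by simp
  then show ?thesis by blast
next
  case n: False
  show ?thesis
  proof (cases "d = 1")
    case True
    then have "1 \<le> d \<and> n - 1 \<le> n + 1 \<and> (1 * n = (n - 1) * d + 1 \<or> 1 * n + 1 = (n - 1) * d)" using n by simp
    then show ?thesis by blast
  next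
    case False
    then have d: "1 < d" using assms(2) by simp
    obtain x y where "n * x = d * y + 1" using bezout_nat[OF n, of d] assms(1) by auto
    then have "(n * (x mod d)) mod d = 1" using d by (simp add: mod_mult_right_eq mod_Suc)
    then have eq: "(x mod d) * n = ((x mod d) * n div d) * d + 1"
      by (metis div_mult_mod_eq mult.commute)
    have "(x mod d) * n \<le> d * n" using d by (intro mult_le_mono1) simp
    then have "(x mod d) * n div d \<le> n" using d by (metis div_le_mono nonzero_mult_div_cancel_left not_one_less_zero)
    then have "x mod d \<le> d \<and> (x mod d) * n div d \<le> n + 1" using d by simp
    then show ?thesis using eq by blast
  qed
qed

context
  fixes n N :: nat and e :: env and F :: "nat \<Rightarrow> nat \<Rightarrow> nat"
  assumes len0: "length (e 0) = Suc n" and len: "\<And>k. 1 \<le> k \<Longrightarrow> k \<le> 24 \<Longrightarrow> length (e k) = N"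
    and F: "\<And>k. F k = get (e k)" and nN: "n + 1 < N"
begin

lemma frange_header:
  assumes "F 10 0 = F 1 0 + 1 + (F 2 0 + 1) + (F 3 0 + 1) + (F 4 0 + 1) + (F 5 0 + 1)"
    and "F 10 0 + F 7 0 + F 7 0 \<le> n" "F 9 0 \<le> n" "F 11 (F 9 0) \<le> n"
  shows "frange N header_fml e"
  using assms nN by (auto simp: header_fml_def nat_fml_def dim_fml_def Let_def len0 len F)

lemma frange_token:
  assumes "F 9 0 \<le> n" "t < F 9 0" "F 11 (F 9 0) \<le> n" "F 11 t + (F 12 t + F 12 t) + (F 13 t + F 13 t) + 3 \<le> n"
  shows "frange N token_fml (e(31 := t # e 31))"
  using assms nN by (auto simp: token_fml_def nat_fml_def Let_def len0 len F)

lemma frange_primal: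
  assumes T: "F 9 0 = ntok (F 1 0) (F 2 0) (F 3 0) (F 4 0) (F 5 0)" "F 9 0 \<le> n" and "F 1 0 \<le> n" "F 3 0 \<le> n"
  shows "frange N primal_fml e"
proof -
  have i: "F 3 0 + F 4 0 + (i * F 1 0 + k) < N" if "i < F 3 0" "k < F 1 0" for i k
    using mult_add_less[OF that] T nN by linarith
  have j: "i < N" if "i < F 3 0" for i using that assms(4) nN by linarith
  show ?thesis
    using assms nN i j by (simp add: primal_fml_def Let_def len0 len F)
qed

text \<open>The multiplier arrays have up to \<open>L * mu\<close> and \<open>L * nu\<close>
  entries, which the number of rationals does not bound, for instance when \<open>nx = 0\<close>.
  This is why the array length has to reach \<open>n * n\<close>.\<close>

lemma frange_dual:
  assumes T: "F 9 0 = ntok (F 1 0) (F 2 0) (F 3 0) (F 4 0) (F 5 0)" "F 9 0 \<le> n"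
    and le: "F 1 0 \<le> n" "F 2 0 \<le> n" "F 3 0 \<le> n" "F 4 0 \<le> n" "F 5 0 \<le> n" and nn: "n * n \<le> N"
  shows "frange N dual_fml e"
proof -
  let ?nx = "F 1 0" and ?nu = "F 2 0" and ?mx = "F 3 0" and ?mu = "F 4 0" and ?L = "F 5 0"
  have 1: "?mx + ?mu + ?mx * ?nx + ((k * ?mu + i) * ?nu + j) < N" if "k < ?nx" "i < ?mu" "j < ?nu" for k i j
    using mult_add_less[OF mult_add_less[OF that(1,2)] that(3)] T nN by linarith
  have 2: "?mx + ?mu + ?mx * ?nx + ?nx * ?mu * ?nu + ((l * ?nu + j) * ?nx + k) < N" if "l < ?L" "j < ?nu" "k < ?nx" for l k j
    using mult_add_less[OF mult_add_less[OF that(1,2)] that(3)] T nN by linarith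
  have "?L * ?mu \<le> N" "?L * ?nu \<le> N" using le mult_le_mono nn order_trans by meson+
  then have 3: "\<And>l i. l < ?L \<Longrightarrow> i < ?mu \<Longrightarrow> l * ?mu + i < N" "\<And>l j. l < ?L \<Longrightarrow> j < ?nu \<Longrightarrow> l * ?nu + j < N"
    using mult_add_less order_less_le_trans by blast+
  have 4: "?mx + i < N" if "i < ?mu" for i using that T nN by linarith
  have 5: "l < N" if "l < ?L" for l using that le nN by linarith
  show ?thesis
    using assms nN 1 2 3 4 5 by (simp add: dual_fml_def Let_def len0 len F)
qed

end

section \<open>Completeness of certificates\<close>

definition num :: "rat \<Rightarrow> nat" where "num r = nat \<bar>fst (quotient_of r)\<bar>"
definition den :: "rat \<Rightarrow> nat" where "den r = nat (snd (quotient_of r))"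
definition neg :: "rat \<Rightarrow> bool" where "neg r \<longleftrightarrow> fst (quotient_of r) < 0"

lemma enc_rat_num_den: "enc_rat r = neg r # enc_nat (num r) @ enc_nat (den r)"
  by (simp add: enc_rat_def enc_int_def num_def den_def neg_def split: prod.split)

lemma den_pos: "1 \<le> den r"
  using quotient_of_denom_pos'[of r] by (simp add: den_def)

lemma coprime_num_den: "coprime (num r) (den r)"
proof -
  obtain p q where "quotient_of r = (p, q)" by fastforce
  then show ?thesis
    using quotient_of_coprime[of r p q] quotient_of_denom_pos[of r p q] coprime_nat_abs_left_iff[of p "nat q"]
    by (simp add: num_def den_def)
qed

lemma neg_num: "neg r \<Longrightarrow> 1 \<le> num r"
  by (auto simp: neg_def num_def)

lemma rat_num_den: "r = (if neg r then - of_nat (num r) else of_nat (num r)) / of_nat (den r)"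
proof -
  obtain p q where "quotient_of r = (p, q)" by fastforce
  then show ?thesis
    using quotient_of_div[of r p q] quotient_of_denom_pos[of r p q] by (auto simp: num_def den_def neg_def)
qed

lemma length_enc_rat: "length (enc_rat r) =
    length (binary_digits (num r)) + length (binary_digits (num r)) +
    (length (binary_digits (den r)) + length (binary_digits (den r))) + 3"
  by (simp add: enc_rat_num_den length_enc_nat)

lemma less_length_digits: "v < 2 ^ length (binary_digits v)"
  using bval_less[of "binary_digits v"] by (simp add: bval_binary_digits)

lemma token_complete:
  assumes F0: "F 0 = inp w" and pw: "\<And>i. i \<le> F 11 (F 9 0) \<Longrightarrow> F 14 i = 2 ^ i"
    and o: "occ w (F 11 t) (enc_rat r)" and step: "F 11 (t + 1) = F 11 t + length (enc_rat r)"
    and nd: "F 15 t = num r" "F 16 t = den r"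
    and l: "F 12 t = length (binary_digits (num r))" "F 13 t = length (binary_digits (den r))"
    and le: "F 12 t \<le> F 11 (F 9 0)" "F 13 t \<le> F 11 (F 9 0)"
    and bez: "F 23 t * num r = F 24 t * den r + 1 \<or> F 23 t * num r + 1 = F 24 t * den r"
    and D: "den r dvd F 8 0"
    and vp: "F 17 t = (if neg r then 0 else num r * (F 8 0 div den r))"
    and vn: "F 18 t = (if neg r then num r * (F 8 0 div den r) else 0)"
  shows "token F t"
proof -
  have o': "inp w (F 11 t) = of_bool (neg r)" "occ w (F 11 t + 1) (enc_nat (num r))"
    "occ w (F 11 t + (F 12 t + F 12 t) + 2) (enc_nat (den r))"
    using o unfolding enc_rat_num_den l by (simp_all add: occ_Cons occ_append length_enc_nat mult_2)
  have c: "nat_code (F 0) (F 14) (F 11 t + 1) (F 12 t) (F 15 t)"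
    "nat_code (F 0) (F 14) (F 11 t + (F 12 t + F 12 t) + 2) (F 13 t) (F 16 t)"
    unfolding F0 nd using nat_code_occ[of "F 12 t" "F 14" w] nat_code_occ[of "F 13 t" "F 14" w] pw le o' l by auto
  have v: "num r * (F 8 0 div den r) * den r = num r * F 8 0" using D by (simp add: mult.assoc)
  have g: "F 0 (F 11 t) = of_bool (neg r)" using o'(1) F0 by simp
  have p: "F 11 (t + 1) = F 11 t + (F 12 t + F 12 t) + (F 13 t + F 13 t) + 3"
    using step l by (simp add: length_enc_rat)
  have s: "F 0 (F 11 t) = 0 \<and> F 18 t = 0 \<and> F 17 t * F 16 t = F 15 t * F 8 0 \<or>
      F 0 (F 11 t) = 1 \<and> 1 \<le> F 15 t \<and> F 17 t = 0 \<and> F 18 t * F 16 t = F 15 t * F 8 0"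
    using g vp vn v nd neg_num[of r] by (cases "neg r") simp_all
  show ?thesis
    unfolding token_def Let_def using c p s bez le den_pos[of r] unfolding nd by blast
qed

lemma val_eq:
  assumes D: "den r dvd F 8 0" "1 \<le> F 8 0"
    and vp: "F 17 t = (if neg r then 0 else num r * (F 8 0 div den r))"
    and vn: "F 18 t = (if neg r then num r * (F 8 0 div den r) else 0)"
  shows "val F t = r"
proof -
  have q: "rat_of_nat (num r * (F 8 0 div den r)) / of_nat (F 8 0) = of_nat (num r) / of_nat (den r)"
  proof -
    have "num r * (F 8 0 div den r) * den r = num r * F 8 0" using D(1) by (simp add: mult.assoc)
    then have "rat_of_nat (num r * (F 8 0 div den r)) * of_nat (den r) = of_nat (num r) * of_nat (F 8 0)"
      by (metis of_nat_mult)
    then show ?thesis using D(2) den_pos[of r] by (simp add: field_simps)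
  qed
  show ?thesis
  proof (cases "neg r")
    case True
    then have "val F t = - (of_nat (num r) / of_nat (den r))" using q vp vn by (simp add: val_def)
    then show ?thesis using rat_num_den[of r] True by simp
  next
    case False
    then have "val F t = of_nat (num r) / of_nat (den r)" using q vp vn by (simp add: val_def)
    then show ?thesis using rat_num_den[of r] False by simp
  qed
qed

lemma primal_complete:
  assumes D: "1 \<le> F 8 0" and X: "\<And>k. k < F 1 0 \<Longrightarrow> F 19 k \<le> F 6 0"
    and A: "\<And>i. i < F 3 0 \<Longrightarrow> (\<Sum>k<F 1 0. val F (F 3 0 + F 4 0 + (i * F 1 0 + k)) * of_nat (F 19 k)) \<le> val F i"
  shows "primal F"
proof -
  let ?nx = "F 1 0" and ?X = "F 19"
  have "(\<Sum>k<?nx. F 17 (F 3 0 + F 4 0 + (i * ?nx + k)) * ?X k) + F 18 i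
      \<le> (\<Sum>k<?nx. F 18 (F 3 0 + F 4 0 + (i * ?nx + k)) * ?X k) + F 17 i" (is "?p + _ \<le> ?m + _") if i: "i < F 3 0" for i
  proof -
    have "(rat_of_nat ?p - of_nat ?m) / of_nat (F 8 0) \<le> (of_nat (F 17 i) - of_nat (F 18 i)) / of_nat (F 8 0)"
      using A[OF i] unfolding val_sum unfolding val_def .
    then have "rat_of_nat ?p - of_nat ?m \<le> of_nat (F 17 i) - of_nat (F 18 i)"
      using D by (simp add: divide_le_cancel)
    then have "rat_of_nat (?p + F 18 i) \<le> of_nat (?m + F 17 i)" unfolding of_nat_add by linarith
    then show ?thesis using of_nat_le_iff by blast
  qed
  then show ?thesis unfolding primal_def Let_def using X by blast
qed

text \<open>This is \<open>small_dual\<close> for matrices given as differences of naturals. Entries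
  bounded by \<open>C\<close> on both sides have differences of absolute value at most
  \<open>C\<close>, so the bound \<open>K\<close> is unchanged.\<close>

lemma dual_nat:
  fixes pM nM :: "nat \<Rightarrow> nat \<Rightarrow> nat" and pb nb ph nh :: "nat \<Rightarrow> nat" and R mu nu C :: nat
  assumes primal: "\<And>u :: nat \<Rightarrow> rat. \<lbrakk>\<forall>j<nu. 0 \<le> u j \<and> u j \<le> of_nat R;
      \<forall>i<mu. (\<Sum>j<nu. (of_nat (pM i j) - of_nat (nM i j)) * u j) \<le> of_nat (pb i) - of_nat (nb i)\<rbrakk>
      \<Longrightarrow> (\<Sum>j<nu. (of_nat (ph j) - of_nat (nh j)) * u j) \<le> 0"
    and C: "\<And>i j. pM i j \<le> C" "\<And>i j. nM i j \<le> C" "\<And>i. pb i \<le> C" "\<And>i. nb i \<le> C" "\<And>j. ph j \<le> C" "\<And>j. nh j \<le> C"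
      "R \<le> C" "1 \<le> C"
  defines "K \<equiv> (2 * (mu + 2 * nu + 2) * C + 1) ^ (nu + 1)"
  shows "\<exists>s y z. 1 \<le> s \<and> s \<le> K \<and> (\<forall>i<mu. y i \<le> K) \<and> (\<forall>j<nu. z j \<le> K) \<and>
    (\<Sum>i<mu. y i * pb i) + R * (\<Sum>j<nu. z j) \<le> (\<Sum>i<mu. y i * nb i) \<and>
    (\<forall>j<nu. s * ph j + (\<Sum>i<mu. y i * nM i j) \<le> s * nh j + (\<Sum>i<mu. y i * pM i j) + z j)"
proof -
  have ab: "\<bar>int p - int m\<bar> \<le> int C" if "p \<le> C" "m \<le> C" for p m using that by linarith
  obtain s y z where *: "1 \<le> s" "s \<le> K" "\<forall>i<mu. y i \<le> K" "\<forall>j<nu. z j \<le> K"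
    and h: "\<forall>j<nu. int s * (int (ph j) - int (nh j)) \<le> (\<Sum>i<mu. int (y i) * (int (pM i j) - int (nM i j))) + int (z j)"
    and b: "(\<Sum>i<mu. int (y i) * (int (pb i) - int (nb i))) + int R * (\<Sum>j<nu. int (z j)) \<le> 0"
    using small_dual[of nu R mu "\<lambda>i j. int (pM i j) - int (nM i j)" "\<lambda>i. int (pb i) - int (nb i)"
        "\<lambda>j. int (ph j) - int (nh j)" C, folded K_def] primal C ab by auto
  have "int ((\<Sum>i<mu. y i * pb i) + R * (\<Sum>j<nu. z j)) \<le> int (\<Sum>i<mu. y i * nb i)"
    using b unfolding of_nat_add of_nat_mult of_nat_sum right_diff_distrib sum_subtractf by linarith
  then have b': "(\<Sum>i<mu. y i * pb i) + R * (\<Sum>j<nu. z j) \<le> (\<Sum>i<mu. y i * nb i)"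
    using of_nat_le_iff by blast
  have h': "s * ph j + (\<Sum>i<mu. y i * nM i j) \<le> s * nh j + (\<Sum>i<mu. y i * pM i j) + z j" if j: "j < nu" for j
  proof -
    have "int s * (int (ph j) - int (nh j)) \<le> (\<Sum>i<mu. int (y i) * (int (pM i j) - int (nM i j))) + int (z j)"
      using h j by blast
    then have "int (s * ph j + (\<Sum>i<mu. y i * nM i j)) \<le> int (s * nh j + (\<Sum>i<mu. y i * pM i j) + z j)"
      unfolding of_nat_add of_nat_mult of_nat_sum right_diff_distrib sum_subtractf by linarith
    then show ?thesis using of_nat_le_iff by blast
  qed
  show ?thesis using * b' h' by blast
qed

lemma choice3: "(\<And>l. l < n \<Longrightarrow> \<exists>s y z. P l s y z) \<Longrightarrow> \<exists>s y z. \<forall>l<(n::nat). P l (s l) (y l) (z l)"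
  by metis

text \<open>The implication for real \<open>u\<close> is used at rational points only. Multiplying
  it by \<open>D\<close> makes the data integral, and the entries of the \<open>x\<close>-dependent
  matrix are then bounded by \<open>nx\<close> times the bounds of its two factors.\<close>

lemma dual_complete:
  assumes D: "1 \<le> F 8 0"
    and impl: "\<And>(u :: nat \<Rightarrow> real) l. \<lbrakk>\<forall>j<F 2 0. 0 \<le> u j \<and> u j \<le> real (F 6 0);
      \<forall>i<F 4 0. (\<Sum>j<F 2 0. real_of_rat (\<Sum>k<F 1 0. val F (F 3 0 + F 4 0 + F 3 0 * F 1 0 + ((k * F 4 0 + i) * F 2 0 + j)) *
          of_nat (F 19 k)) * u j) \<le> real_of_rat (val F (F 3 0 + i)); l < F 5 0\<rbrakk> \<Longrightarrow>
      (\<Sum>j<F 2 0. real_of_rat (\<Sum>k<F 1 0. val F (F 3 0 + F 4 0 + F 3 0 * F 1 0 + F 1 0 * F 4 0 * F 2 0 + ((l * F 2 0 + j) * F 1 0 + k)) *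
          of_nat (F 19 k)) * u j) \<le> 0"
    and B: "\<And>t. F 17 t \<le> B" "\<And>t. F 18 t \<le> B" "\<And>k. F 19 k \<le> X" "F 1 0 * (B * X) \<le> C" "F 6 0 \<le> C" "B \<le> C" "1 \<le> C"
  defines "K \<equiv> (2 * (F 4 0 + 2 * F 2 0 + 2) * C + 1) ^ (F 2 0 + 1)"
  shows "\<exists>s y z. \<forall>l<F 5 0. 1 \<le> s l \<and> s l \<le> K \<and> (\<forall>i<F 4 0. y l i \<le> K) \<and> (\<forall>j<F 2 0. z l j \<le> K) \<and>
    (let nx = F 1 0; nu = F 2 0; mx = F 3 0; mu = F 4 0; R = F 6 0; VP = F 17; VN = F 18; X = F 19;
      b = mx + mu + mx * nx; h = mx + mu + mx * nx + nx * mu * nu in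
       (\<Sum>i<mu. y l i * VP (mx + i)) + R * (\<Sum>j<nu. z l j) \<le> (\<Sum>i<mu. y l i * VN (mx + i)) \<and>
       (\<forall>j<nu. s l * (\<Sum>k<nx. VP (h + ((l * nu + j) * nx + k)) * X k) +
            (\<Sum>i<mu. y l i * (\<Sum>k<nx. VN (b + ((k * mu + i) * nu + j)) * X k))
          \<le> s l * (\<Sum>k<nx. VN (h + ((l * nu + j) * nx + k)) * X k) +
            (\<Sum>i<mu. y l i * (\<Sum>k<nx. VP (b + ((k * mu + i) * nu + j)) * X k)) + z l j))"
proof -
  let ?nx = "F 1 0" and ?nu = "F 2 0" and ?mx = "F 3 0" and ?mu = "F 4 0" and ?X = "F 19"
  let ?b = "?mx + ?mu + ?mx * ?nx"
  let ?h = "?b + ?nx * ?mu * ?nu"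
  let ?fM = "\<lambda>i j k. ?b + ((k * ?mu + i) * ?nu + j)"
  let ?fh = "\<lambda>l j k. ?h + ((l * ?nu + j) * ?nx + k)"
  let ?S = "\<lambda>v f. \<Sum>k<?nx. F v (f k) * ?X k"
  have Dp: "0 < real (F 8 0)" using D by simp
  have bS: "?S v f \<le> C" if "\<And>t. F v t \<le> B" for v f
  proof -
    have "?S v f \<le> (\<Sum>k<?nx. B * X)" using that B(3) by (intro sum_mono mult_le_mono) auto
    then show ?thesis using B(4) by simp
  qed
  have Vsum: "real_of_rat (\<Sum>k<?nx. val F (f k) * of_nat (?X k)) = (real (?S 17 f) - real (?S 18 f)) / real (F 8 0)" for f
    unfolding val_sum of_rat_divide of_rat_diff of_rat_of_nat_eq ..
  have "\<exists>s y z. 1 \<le> s \<and> s \<le> K \<and> (\<forall>i<?mu. y i \<le> K) \<and> (\<forall>j<?nu. z j \<le> K) \<and>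
      (\<Sum>i<?mu. y i * F 17 (?mx + i)) + F 6 0 * (\<Sum>j<?nu. z j) \<le> (\<Sum>i<?mu. y i * F 18 (?mx + i)) \<and>
      (\<forall>j<?nu. s * ?S 17 (?fh l j) + (\<Sum>i<?mu. y i * ?S 18 (?fM i j))
        \<le> s * ?S 18 (?fh l j) + (\<Sum>i<?mu. y i * ?S 17 (?fM i j)) + z j)" if l: "l < F 5 0" for l
    unfolding K_def
  proof (rule dual_nat)
    fix u :: "nat \<Rightarrow> rat"
    assume u: "\<forall>j<?nu. 0 \<le> u j \<and> u j \<le> of_nat (F 6 0)"
      and M: "\<forall>i<?mu. (\<Sum>j<?nu. (of_nat (?S 17 (?fM i j)) - of_nat (?S 18 (?fM i j))) * u j) \<le> of_nat (F 17 (?mx + i)) - of_nat (F 18 (?mx + i))"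
    have pull: "(\<Sum>j<?nu. (real (p j) - real (q j)) / real (F 8 0) * real_of_rat (u j)) =
        real_of_rat (\<Sum>j<?nu. (of_nat (p j) - of_nat (q j)) * u j) / real (F 8 0)" for p q
      by (simp add: of_rat_sum of_rat_mult of_rat_diff sum_divide_distrib)
    have "(\<Sum>j<?nu. real_of_rat (\<Sum>k<?nx. val F (?fh l j k) * of_nat (?X k)) * real_of_rat (u j)) \<le> 0"
    proof (rule impl[OF _ _ l]; intro allI impI)
      fix j assume "j < ?nu"
      then show "0 \<le> real_of_rat (u j) \<and> real_of_rat (u j) \<le> real (F 6 0)"
        using u by (metis of_rat_less_eq of_rat_of_nat_eq zero_le_of_rat_iff)
    next
      fix i assume i: "i < ?mu"
      have "real_of_rat (\<Sum>j<?nu. (of_nat (?S 17 (?fM i j)) - of_nat (?S 18 (?fM i j))) * u j)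
          \<le> real_of_rat (of_nat (F 17 (?mx + i)) - of_nat (F 18 (?mx + i)))"
        unfolding of_rat_less_eq using M i by blast
      then have "real_of_rat (\<Sum>j<?nu. (of_nat (?S 17 (?fM i j)) - of_nat (?S 18 (?fM i j))) * u j) / real (F 8 0)
          \<le> real_of_rat (of_nat (F 17 (?mx + i)) - of_nat (F 18 (?mx + i))) / real (F 8 0)"
        by (rule divide_right_mono) simp
      then show "(\<Sum>j<?nu. real_of_rat (\<Sum>k<?nx. val F (?fM i j k) * of_nat (?X k)) * real_of_rat (u j)) \<le> real_of_rat (val F (?mx + i))"
        unfolding Vsum pull unfolding val_def of_rat_divide of_rat_of_nat_eq .
    qed
    then have "real_of_rat (\<Sum>j<?nu. (of_nat (?S 17 (?fh l j)) - of_nat (?S 18 (?fh l j))) * u j) / real (F 8 0) \<le> 0"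
      unfolding Vsum pull .
    then have "real_of_rat (\<Sum>j<?nu. (of_nat (?S 17 (?fh l j)) - of_nat (?S 18 (?fh l j))) * u j) \<le> 0"
      using Dp by (simp only: divide_le_0_iff) linarith
    then show "(\<Sum>j<?nu. (of_nat (?S 17 (?fh l j)) - of_nat (?S 18 (?fh l j))) * u j) \<le> 0"
      unfolding of_rat_le_0_iff .
  qed (use B bS in \<open>auto intro: order_trans\<close>)
  then show ?thesis
    unfolding Let_def by (rule choice3)
qed

lemma get_map: "i < N \<Longrightarrow> get (map f [0..<N]) i = f i"
  by (simp add: get_def)

text \<open>The bound 3 covers the default value that \<open>get\<close> returns beyond the
  array.\<close>

lemma get_map_le: "(\<And>i. f i \<le> B) \<Longrightarrow> 3 \<le> B \<Longrightarrow> get (map f [0..<N]) i \<le> (B::nat)"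
  by (simp add: get_def)

lemma length_concat_upt: "length (concat (map f [0..<t])) = (\<Sum>s<t. length (f s))"
  by (induction t) simp_all

lemma less_power_digits: "length (binary_digits v) \<le> n \<Longrightarrow> v < 2 ^ n"
  using less_length_digits[of v] power_increasing[of "length (binary_digits v)" n "2::nat"]
  by (meson one_le_numeral order_less_le_trans)

lemma fexp_pos: "1 \<le> fexp f"
proof (induction f)
  case (FLe s t)
  then show ?case using texp_pos[of s] by simp
next
  case (FAll k s f)
  then show ?case by simp
qed simp_all

lemma choice2: "(\<And>t. \<exists>u v. P t u v) \<Longrightarrow> \<exists>U V. \<forall>t. P t (U t) (V t)"
  by metis

text \<open>The base has at most \<open>n * n + 4 * n + 3\<close> bits, and the exponent is at most
  \<open>n + 1\<close>. The product of the two is below \<open>(n + 4) ^ 3\<close>, which is the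
  reason for choosing this cube as bit length.\<close>

lemma dual_bound:
  fixes n mu nu :: nat
  assumes "mu + 2 * nu + 2 \<le> 2 * n" "nu \<le> n"
  shows "(2 * (mu + 2 * nu + 2) * 2 ^ (n * n + 3 * n) + 1) ^ (nu + 1) < (2::nat) ^ (n + 4) ^ 3"
proof -
  let ?C = "2 ^ (n * n + 3 * n) :: nat"
  have n: "1 \<le> n" using assms(1) by linarith
  have "2 * (mu + 2 * nu + 2) * ?C + 1 \<le> 2 * (2 * n) * ?C + 1 * ?C"
    using assms(1) by (intro add_mono mult_le_mono) auto
  also have "\<dots> = (4 * n + 1) * ?C" by (simp add: algebra_simps)
  also have "4 * n + 1 \<le> 8 * (2 ^ n :: nat)" using less_exp[of n] by linarith
  also have "8 * 2 ^ n * ?C = 2 ^ (n * n + 4 * n + 3)"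
  proof -
    have "n * n + 4 * n + 3 = 3 + n + (n * n + 3 * n)" by simp
    then show ?thesis by (simp only: power_add) simp
  qed
  finally have "(2 * (mu + 2 * nu + 2) * ?C + 1) ^ (nu + 1) \<le> (2 ^ (n * n + 4 * n + 3)) ^ (nu + 1)"
    by (intro power_mono) auto
  also have "\<dots> = 2 ^ ((n * n + 4 * n + 3) * (nu + 1))" by (simp only: power_mult)
  also have "\<dots> \<le> 2 ^ ((n * n + 4 * n + 3) * (n + 1))" using assms(2) by (intro power_increasing mult_le_mono) auto
  also have "\<dots> < 2 ^ (n + 4) ^ 3"
    by (intro power_strict_increasing) (simp_all add: power3_eq_cube algebra_simps)
  finally show ?thesis .
qed

text \<open>With \<open>n\<close> the length of the input, arrays of length \<open>(n + 4)^2\<close>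
  suffice because double indices stay below \<open>n * n\<close>, and \<open>(n + 4) ^ 3\<close>
  bits suffice because the dual multipliers, the largest numbers, obey
  \<open>dual_bound\<close>.\<close>

lemma cert_complete:
  assumes "w \<in> Bounded_Static"
  defines "n \<equiv> length w"
  shows "\<exists>e. e 0 = map of_bool w @ [2] \<and> (\<forall>k>24. e k = []) \<and> (\<forall>k. length (e k) \<le> (n + 4)^2) \<and>
    (\<forall>k. \<forall>v\<in>set (e k). v < 2 ^ (n + 4) ^ 3) \<and> cert (\<lambda>k. get (e k)) \<and> frange ((n + 4)^2) cert_fml e"
proof -
  obtain I where I: "w = enc_instance I" "wf_instance I" "bounded_static I"
    using assms by (auto simp: Bounded_Static_def)
  define nx nu mx mu L R where dims: "nx = bs_nx I" "nu = bs_nu I" "mx = bs_mx I" "mu = bs_mu I" "L = bs_L I" "R = bs_R I"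
  obtain r where r: "I = mkI nx nu mx mu L R r" using mkI_surj[OF I(2)] unfolding dims by blast
  define T where "T = ntok nx nu mx mu L"
  define b where "b = mx + mu + mx * nx"
  define h where "h = b + nx * mu * nu"
  let ?c = "\<lambda>t. concat (map (\<lambda>t. enc_rat (r t)) [0..<t])"
  have w: "w = enc_dim nx @ enc_dim nu @ enc_dim mx @ enc_dim mu @ enc_dim L @ enc_nat R @ ?c T"
    unfolding I(1) r enc_mkI T_def ..
  obtain x where x: "\<forall>k<nx. x k \<le> R"
    and xA: "\<forall>i<mx. (\<Sum>k<nx. r (mx + mu + (i * nx + k)) * of_nat (x k)) \<le> r i"
    and xU: "\<forall>u. (\<forall>j<nu. 0 \<le> u j \<and> u j \<le> real R) \<longrightarrow>
          (\<forall>i<mu. (\<Sum>j<nu. real_of_rat (\<Sum>k<nx. r (b + ((k * mu + i) * nu + j)) * of_nat (x k)) * u j)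
             \<le> real_of_rat (r (mx + i))) \<longrightarrow>
          (\<forall>l<L. (\<Sum>j<nu. real_of_rat (\<Sum>k<nx. r (h + ((l * nu + j) * nx + k)) * of_nat (x k)) * u j) \<le> 0)"
    using I(3) unfolding r bounded_mkI b_def h_def by blast
  define len where "len t = length (enc_rat (r t))" for t
  define RL where "RL = length (binary_digits R)"
  define p5 where "p5 = nx + 1 + (nu + 1) + (mx + 1) + (mu + 1) + (L + 1)"
  define p0 where "p0 = p5 + (RL + RL) + 1"
  \<comment> \<open>Capping at \<open>T\<close> keeps \<open>P\<close> constant behind the last
    token, so that \<open>P t \<le> n\<close> holds for every \<open>t\<close>.\<close>
  define P where "P t = p0 + (\<Sum>s<min t T. len s)" for t
  have ld: "length (enc_dim k) = k + 1" for k by (simp add: enc_dim_def)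
  have n: "n = P T"
    unfolding n_def by (subst w)
      (simp add: ld length_enc_nat length_concat_upt P_def p0_def p5_def RL_def len_def del: length_concat)
  have Pn: "P t \<le> n" for t
    unfolding n P_def by (intro add_left_mono sum_mono2) auto
  have Pstep: "P (t + 1) = P t + len t" if "t < T" for t
    using that by (simp add: P_def min_def)
  have occ0: "occ w 0 (enc_dim nx @ enc_dim nu @ enc_dim mx @ enc_dim mu @ enc_dim L @ enc_nat R @ ?c T)"
    using occ_self[of w] w by simp
  have occ_dims: "occ w 0 (enc_dim nx)" "occ w (nx + 1) (enc_dim nu)" "occ w (nx + 1 + (nu + 1)) (enc_dim mx)"
    "occ w (nx + 1 + (nu + 1) + (mx + 1)) (enc_dim mu)"
    "occ w (nx + 1 + (nu + 1) + (mx + 1) + (mu + 1)) (enc_dim L)" and occ_R: "occ w p5 (enc_nat R)" and occ_c: "occ w p0 (?c T)"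
    using occ0 by (simp_all add: occ_append ld length_enc_nat add.assoc p0_def p5_def RL_def mult_2)
  have occ_t: "occ w (P t) (enc_rat (r t))" if t: "t < T" for t
  proof -
    have "[0..<T] = [0..<t] @ t # [Suc t..<T]"
      using t upt_add_eq_append[of 0 t "T - t"] upt_conv_Cons[OF t] by simp
    then have "?c T = ?c t @ enc_rat (r t) @ concat (map (\<lambda>t. enc_rat (r t)) [Suc t..<T])" by simp
    then have "occ w (p0 + length (?c t)) (enc_rat (r t))" using occ_c by (simp add: occ_append del: length_concat)
    moreover have "p0 + length (?c t) = P t"
      unfolding length_concat_upt P_def using t by (simp add: len_def min_def)
    ultimately show ?thesis by simp
  qed

  define LA where "LA t = (if t < T then length (binary_digits (num (r t))) else 0)" for t
  define LB where "LB t = (if t < T then length (binary_digits (den (r t))) else 0)" for t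
  have lent: "P t + (LA t + LA t) + (LB t + LB t) + 3 \<le> n" if t: "t < T" for t
  proof -
    have "P t + len t \<le> n" using Pstep[OF t] Pn[of "t + 1"] by simp
    then show ?thesis using t by (simp add: len_def length_enc_rat LA_def LB_def)
  qed
  have LAn: "LA t \<le> n" "LB t \<le> n" for t
    using lent[of t] by (cases "t < T"; simp add: LA_def LB_def)+
  have p0n: "p0 \<le> n" unfolding n by (simp add: P_def)
  have p5n: "p5 \<le> n" "RL \<le> n" "nx \<le> n" "nu \<le> n" "mx \<le> n" "mu \<le> n" "L \<le> n" "mu + 2 * nu + 2 \<le> 2 * n" "5 \<le> n"
    using p0n by (simp_all add: p0_def p5_def)
  \<comment> \<open>Every rational occupies at least one bit of the input.\<close>
  have Tn: "T \<le> n"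
  proof -
    have "T = (\<Sum>s<T. 1)" by simp
    also have "\<dots> \<le> (\<Sum>s<T. len s)" by (intro sum_mono) (simp add: len_def length_enc_rat)
    finally show ?thesis unfolding n by (simp add: P_def)
  qed
  \<comment> \<open>\<open>B\<close> bounds a numerator, at most \<open>2 ^ n\<close>, times the
    common denominator, at most \<open>2 ^ (n * n)\<close>. Passing to \<open>C\<close> adds a
    factor \<open>2 ^ n\<close> for the entries of \<open>x\<close> and another one for the
    \<open>nx\<close> summands.\<close>
  define B where "B = (2::nat) ^ (n * n + n)"
  define C where "C = (2::nat) ^ (n * n + 3 * n)"
  define G where "G = (n + 4) ^ 3"
  define N where "N = (n + 4)^2"
  have nB: "2 ^ n \<le> B" "n < 2 ^ n" "n \<le> B" "3 \<le> (2::nat) ^ n"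
  proof -
    show "2 ^ n \<le> B" "n < 2 ^ n" unfolding B_def by (auto intro: power_increasing)
    then show "n \<le> B" by linarith
    have "(2::nat) ^ 2 \<le> 2 ^ n" using p5n(9) by (intro power_increasing) auto
    then show "3 \<le> (2::nat) ^ n" by simp
  qed
  have BC: "B \<le> C" unfolding B_def C_def by (intro power_increasing) auto
  have BG: "B < 2 ^ G" unfolding B_def G_def by (intro power_strict_increasing) (simp_all add: power3_eq_cube algebra_simps)
  have Rn: "R \<le> 2 ^ n"
    using less_power_digits[of R n] p5n(2) unfolding RL_def by simp
  have nd: "num (r t) < 2 ^ n" "den (r t) \<le> 2 ^ n" if t: "t < T" for t
    using less_power_digits[of "num (r t)" n] less_power_digits[of "den (r t)" n] LAn[of t] t
    unfolding LA_def LB_def by simp_all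
  \<comment> \<open>The plain product of the denominators is good enough: at most \<open>n\<close>
    factors of at most \<open>n\<close> bits.\<close>
  define D where "D = (\<Prod>t<T. den (r t))"
  have dD: "den (r t) dvd D" if "t < T" for t
    unfolding D_def using that by (intro dvd_prodI) auto
  have D1: "1 \<le> D" unfolding D_def using den_pos by (intro prod_ge_1) auto
  have Dn: "D \<le> 2 ^ (n * n)"
  proof -
    have "D \<le> (\<Prod>t<T. 2 ^ n)" unfolding D_def using nd(2) by (intro prod_mono) auto
    also have "\<dots> = 2 ^ (n * T)" by (simp add: power_mult)
    also have "\<dots> \<le> 2 ^ (n * n)" using Tn by (intro power_increasing) auto
    finally show ?thesis .
  qed
  have DB: "D \<le> B" unfolding B_def by (rule order_trans[OF Dn]) (intro power_increasing, auto)
  have vB: "num (r t) * (D div den (r t)) \<le> B" if "t < T" for t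
  proof -
    have "num (r t) * (D div den (r t)) \<le> 2 ^ n * 2 ^ (n * n)"
      using nd(1)[OF that] order_trans[OF div_le_dividend[of D "den (r t)"] Dn] by (intro mult_le_mono) auto
    then show ?thesis by (simp add: B_def power_add mult.commute)
  qed
  \<comment> \<open>The arrays get the value 0 beyond their meaningful range, so that size bounds
    hold for all indices and not merely for those of tokens.\<close>
  define NU where "NU t = (if t < T then num (r t) else 0)" for t
  define DE where "DE t = (if t < T then den (r t) else 0)" for t
  define VP where "VP t = (if t < T \<and> \<not> neg (r t) then num (r t) * (D div den (r t)) else 0)" for t
  define VN where "VN t = (if t < T \<and> neg (r t) then num (r t) * (D div den (r t)) else 0)" for t
  define X where "X k = (if k < nx then x k else 0)" for k
  define PW where "PW i = (if i \<le> n then 2 ^ i else (0::nat))" for i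
  have "\<exists>U V. \<forall>t. U t \<le> den (r t) \<and> V t \<le> num (r t) + 1 \<and>
      (U t * num (r t) = V t * den (r t) + 1 \<or> U t * num (r t) + 1 = V t * den (r t))"
    by (rule choice2) (rule bezout_bounded[OF coprime_num_den den_pos])
  then obtain U0 V0 where UV0: "\<And>t. U0 t \<le> den (r t) \<and> V0 t \<le> num (r t) + 1 \<and>
      (U0 t * num (r t) = V0 t * den (r t) + 1 \<or> U0 t * num (r t) + 1 = V0 t * den (r t))" by blast
  define U where "U t = (if t < T then U0 t else 0)" for t
  define V where "V t = (if t < T then V0 t else 0)" for t
  \<comment> \<open>The dual multipliers exist only once the other data have been fixed. Zeros hold
    their places 20 to 22 in this preliminary list; \<open>dual_complete\<close> is applied to it
    and the places are filled afterwards.\<close>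
  define f0 where "f0 = [\<lambda>_. 0, \<lambda>_. nx, \<lambda>_. nu, \<lambda>_. mx, \<lambda>_. mu, \<lambda>_. L, \<lambda>_. R, \<lambda>_. RL, \<lambda>_. D, \<lambda>_. T, \<lambda>_. p5,
    P, LA, LB, PW, NU, DE, VP, VN, X, \<lambda>_. 0, \<lambda>_. 0, \<lambda>_. 0, U, V]"
  define F0 where "F0 k = get (map (f0 ! k) [0..<N])" for k
  have nN: "n + 1 < N" "n * n \<le> N" "n < N" "0 < N" by (simp_all add: N_def power2_eq_square algebra_simps)
  have arr: "F0 11 = get (map P [0..<N])" "F0 12 = get (map LA [0..<N])" "F0 13 = get (map LB [0..<N])"
    "F0 14 = get (map PW [0..<N])" "F0 15 = get (map NU [0..<N])" "F0 16 = get (map DE [0..<N])"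
    "F0 17 = get (map VP [0..<N])" "F0 18 = get (map VN [0..<N])" "F0 19 = get (map X [0..<N])"
    "F0 23 = get (map U [0..<N])" "F0 24 = get (map V [0..<N])"
    by (simp_all add: F0_def f0_def)
  have sca: "F0 1 0 = nx" "F0 2 0 = nu" "F0 3 0 = mx" "F0 4 0 = mu" "F0 5 0 = L" "F0 6 0 = R" "F0 7 0 = RL" "F0 8 0 = D"
    "F0 9 0 = T" "F0 10 0 = p5"
    using nN(4) by (simp_all add: F0_def f0_def get_map)
  have arrB: "VP t \<le> B" "VN t \<le> B" "X t \<le> 2 ^ n" for t
    using vB[of t] x Rn by (auto simp: VP_def VN_def X_def intro: order_trans)
  have tv: "F0 17 t = (if neg (r t) then 0 else num (r t) * (F0 8 0 div den (r t)))"
    "F0 18 t = (if neg (r t) then num (r t) * (F0 8 0 div den (r t)) else 0)" if "t < T" for t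
    using that Tn nN(3) by (simp_all add: arr sca get_map VP_def VN_def)
  have val: "val F0 t = r t" if t: "t < T" for t
    by (rule val_eq[of "r t" F0 t]) (use t tv[OF t] dD D1 sca in auto)
  have xk: "F0 19 k = x k" if "k < nx" for k using that p5n(3) nN(3) by (simp add: arr get_map X_def)
  have iA: "mx + mu + (i * nx + k) < T" if "i < mx" "k < nx" for i k
    using mult_add_less[OF that] unfolding T_def by linarith
  have iB: "b + ((k * mu + i) * nu + j) < T" if "k < nx" "i < mu" "j < nu" for k i j
    using mult_add_less[OF mult_add_less[OF that(1,2)] that(3)] unfolding T_def b_def by linarith
  have iH: "h + ((l * nu + j) * nx + k) < T" if "l < L" "j < nu" "k < nx" for l k j
    using mult_add_less[OF mult_add_less[OF that(1,2)] that(3)] unfolding T_def h_def b_def by linarith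
  have ib: "mx + i < T" if "i < mu" for i using that unfolding T_def by linarith
  have ia: "i < T" if "i < mx" for i using that unfolding T_def by linarith
  have eA: "(\<Sum>k<nx. val F0 (mx + mu + (i * nx + k)) * of_nat (F0 19 k)) = (\<Sum>k<nx. r (mx + mu + (i * nx + k)) * of_nat (x k))"
    if "i < mx" for i using that iA val xk by (intro sum.cong) auto
  have eB: "(\<Sum>k<nx. val F0 (b + ((k * mu + i) * nu + j)) * of_nat (F0 19 k)) = (\<Sum>k<nx. r (b + ((k * mu + i) * nu + j)) * of_nat (x k))"
    if "i < mu" "j < nu" for i j using that iB val xk by (intro sum.cong) auto
  have eH: "(\<Sum>k<nx. val F0 (h + ((l * nu + j) * nx + k)) * of_nat (F0 19 k)) = (\<Sum>k<nx. r (h + ((l * nu + j) * nx + k)) * of_nat (x k))"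
    if "l < L" "j < nu" for l j using that iH val xk by (intro sum.cong) auto
  define K where "K = (2 * (mu + 2 * nu + 2) * C + 1) ^ (nu + 1)"
  have KG: "K < 2 ^ G" using dual_bound[OF p5n(8,4)] unfolding K_def C_def G_def .
  obtain s y z where syz: "\<forall>l<L. 1 \<le> s l \<and> s l \<le> K \<and> (\<forall>i<mu. y l i \<le> K) \<and> (\<forall>j<nu. z l j \<le> K) \<and>
       (\<Sum>i<mu. y l i * F0 17 (mx + i)) + R * (\<Sum>j<nu. z l j) \<le> (\<Sum>i<mu. y l i * F0 18 (mx + i)) \<and>
       (\<forall>j<nu. s l * (\<Sum>k<nx. F0 17 (h + ((l * nu + j) * nx + k)) * F0 19 k) +
            (\<Sum>i<mu. y l i * (\<Sum>k<nx. F0 18 (b + ((k * mu + i) * nu + j)) * F0 19 k))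
          \<le> s l * (\<Sum>k<nx. F0 18 (h + ((l * nu + j) * nx + k)) * F0 19 k) +
            (\<Sum>i<mu. y l i * (\<Sum>k<nx. F0 17 (b + ((k * mu + i) * nu + j)) * F0 19 k)) + z l j)"
  proof -
    have "\<exists>s y z. \<forall>l<L. 1 \<le> s l \<and> s l \<le> K \<and> (\<forall>i<mu. y l i \<le> K) \<and> (\<forall>j<nu. z l j \<le> K) \<and>
       (\<Sum>i<mu. y l i * F0 17 (mx + i)) + R * (\<Sum>j<nu. z l j) \<le> (\<Sum>i<mu. y l i * F0 18 (mx + i)) \<and>
       (\<forall>j<nu. s l * (\<Sum>k<nx. F0 17 (h + ((l * nu + j) * nx + k)) * F0 19 k) +
            (\<Sum>i<mu. y l i * (\<Sum>k<nx. F0 18 (b + ((k * mu + i) * nu + j)) * F0 19 k))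
          \<le> s l * (\<Sum>k<nx. F0 18 (h + ((l * nu + j) * nx + k)) * F0 19 k) +
            (\<Sum>i<mu. y l i * (\<Sum>k<nx. F0 17 (b + ((k * mu + i) * nu + j)) * F0 19 k)) + z l j)"
    proof (rule dual_complete[of F0 B "2 ^ n" C, unfolded sca Let_def, folded b_def, folded h_def K_def])
      fix u :: "nat \<Rightarrow> real" and l
      assume u: "\<forall>j<nu. 0 \<le> u j \<and> u j \<le> real R"
        and Mu: "\<forall>i<mu. (\<Sum>j<nu. real_of_rat (\<Sum>k<nx. val F0 (b + ((k * mu + i) * nu + j)) * of_nat (F0 19 k)) * u j)
             \<le> real_of_rat (val F0 (mx + i))" and l: "l < L"
      have "(\<Sum>j<nu. real_of_rat (\<Sum>k<nx. r (b + ((k * mu + i) * nu + j)) * of_nat (x k)) * u j) \<le> real_of_rat (r (mx + i))"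
        if i: "i < mu" for i
      proof -
        have "(\<Sum>j<nu. real_of_rat (\<Sum>k<nx. r (b + ((k * mu + i) * nu + j)) * of_nat (x k)) * u j) =
            (\<Sum>j<nu. real_of_rat (\<Sum>k<nx. val F0 (b + ((k * mu + i) * nu + j)) * of_nat (F0 19 k)) * u j)"
          using eB i by (intro sum.cong) auto
        then show ?thesis using Mu i val[OF ib[OF i]] by auto
      qed
      then have "(\<Sum>j<nu. real_of_rat (\<Sum>k<nx. r (h + ((l * nu + j) * nx + k)) * of_nat (x k)) * u j) \<le> 0"
        using xU u l by blast
      moreover have "(\<Sum>j<nu. real_of_rat (\<Sum>k<nx. val F0 (h + ((l * nu + j) * nx + k)) * of_nat (F0 19 k)) * u j) =
          (\<Sum>j<nu. real_of_rat (\<Sum>k<nx. r (h + ((l * nu + j) * nx + k)) * of_nat (x k)) * u j)"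
        using eH l by (intro sum.cong) auto
      ultimately show "(\<Sum>j<nu. real_of_rat (\<Sum>k<nx. val F0 (h + ((l * nu + j) * nx + k)) * of_nat (F0 19 k)) * u j) \<le> 0"
        by simp
    next
      show "F0 17 t \<le> B" "F0 18 t \<le> B" "F0 19 t \<le> 2 ^ n" for t
        unfolding arr using arrB nB by (auto intro!: get_map_le)
      have "nx * (B * 2 ^ n) \<le> 2 ^ n * (B * 2 ^ n)" using order_trans[OF p5n(3) less_imp_le[OF nB(2)]] by (rule mult_le_mono1)
      also have "\<dots> = C"
      proof -
        have "n * n + 3 * n = n + (n * n + n + n)" by simp
        then show ?thesis unfolding B_def C_def by (simp only: power_add)
      qed
      finally show "nx * (B * 2 ^ n) \<le> C" .
    qed (use BC D1 Rn nB in \<open>auto simp: C_def\<close>)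
    then show ?thesis using that by blast
  qed

  \<comment> \<open>The families of multipliers, one for each \<open>l\<close>, are flattened row by
    row.\<close>
  define Y where "Y i = (if i < L * mu then y (i div mu) (i mod mu) else 0)" for i
  define Z where "Z i = (if i < L * nu then z (i div nu) (i mod nu) else 0)" for i
  define S where "S l = (if l < L then s l else 0)" for l
  define f where "f = [\<lambda>_. 0, \<lambda>_. nx, \<lambda>_. nu, \<lambda>_. mx, \<lambda>_. mu, \<lambda>_. L, \<lambda>_. R, \<lambda>_. RL, \<lambda>_. D, \<lambda>_. T, \<lambda>_. p5,
    P, LA, LB, PW, NU, DE, VP, VN, X, Y, Z, S, U, V]"
  define e where "e k = (if k = 0 then map of_bool w @ [2] else if k \<le> 24 then map (f ! k) [0..<N] else [])" for k
  define F where "F k = get (e k)" for k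
  have Fi: "F 0 = inp w" by (simp add: F_def e_def)
  have F0: "F 1 = F0 1" "F 2 = F0 2" "F 3 = F0 3" "F 4 = F0 4" "F 5 = F0 5" "F 6 = F0 6" "F 7 = F0 7" "F 8 = F0 8"
    "F 9 = F0 9" "F 10 = F0 10" "F 11 = F0 11" "F 12 = F0 12" "F 13 = F0 13" "F 14 = F0 14" "F 15 = F0 15"
    "F 16 = F0 16" "F 17 = F0 17" "F 18 = F0 18" "F 19 = F0 19" "F 23 = F0 23" "F 24 = F0 24"
    by (simp_all add: F_def e_def F0_def f_def f0_def)
  have arr': "F 20 = get (map Y [0..<N])" "F 21 = get (map Z [0..<N])" "F 22 = get (map S [0..<N])"
    by (simp_all add: F_def e_def f_def)
  have valF: "val F = val F0" by (rule ext) (simp only: val_def F0)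
  have T': "F 9 0 = T" by (simp only: F0 sca)
  have PT: "F 11 (F 9 0) = n" unfolding F0 sca arr using Tn nN(3) by (simp add: get_map n[symmetric])
  have pw: "F 14 i = 2 ^ i" if "i \<le> n" for i
    unfolding F0 arr using that nN by (simp add: get_map PW_def)
  have token: "token F t" if t: "t < T" for t
  proof (rule token_complete[where r = "r t" and w = w])
    have tN: "t < N" "t + 1 < N" using t Tn nN by linarith+
    show "F 0 = inp w" by (rule Fi)
    show "F 14 i = 2 ^ i" if "i \<le> F 11 (F 9 0)" for i using pw that unfolding PT by blast
    show "occ w (F 11 t) (enc_rat (r t))" using occ_t[OF t] tN by (simp add: F0 arr get_map)
    show "F 11 (t + 1) = F 11 t + length (enc_rat (r t))"
      unfolding F0 arr get_map[OF tN(1)] get_map[OF tN(2)] Pstep[OF t] len_def ..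
    show "F 15 t = num (r t)" "F 16 t = den (r t)" "F 12 t = length (binary_digits (num (r t)))"
      "F 13 t = length (binary_digits (den (r t)))"
      using t tN(1) by (simp_all add: F0 arr get_map NU_def DE_def LA_def LB_def)
    show "F 12 t \<le> F 11 (F 9 0)" "F 13 t \<le> F 11 (F 9 0)"
      using LAn tN(1) unfolding PT by (simp_all add: F0 arr get_map)
    show "F 23 t * num (r t) = F 24 t * den (r t) + 1 \<or> F 23 t * num (r t) + 1 = F 24 t * den (r t)"
      using UV0[of t] t tN(1) by (simp add: F0 arr get_map U_def V_def)
    show "den (r t) dvd F 8 0" using dD[OF t] by (simp add: F0 sca)
    show "F 17 t = (if neg (r t) then 0 else num (r t) * (F 8 0 div den (r t)))"
      "F 18 t = (if neg (r t) then num (r t) * (F 8 0 div den (r t)) else 0)"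
      using tv[OF t] unfolding F0 .
  qed
  have header: "header F"
  proof -
    have P0: "F 11 0 = p0" unfolding F0 arr using nN by (simp add: get_map P_def)
    have nR: "nat_code (inp w) (F 14) p5 RL R"
      using nat_code_occ[of RL "F 14" w p5 R] pw p5n(2) occ_R RL_def by auto
    have i2: "inp w n = 2" by (simp add: inp_simps n_def)
    have pwS: "F 14 (i + 1) = F 14 i + F 14 i" if "i < n" for i using pw[of i] pw[of "i + 1"] that by simp
    have pw0: "F 14 0 = 1" using pw[of 0] by simp
    show ?thesis
      unfolding header_def Let_def Fi PT P0 unfolding F0(1-10) sca dim_code_occ
      using occ_dims nR i2 pwS pw0 D1 p5n(2) p5_def p0_def T_def by blast
  qed
  have primal: "primal F"
  proof (rule primal_complete)
    show "1 \<le> F 8 0" using D1 by (simp only: F0 sca)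
    show "F 19 k \<le> F 6 0" if "k < F 1 0" for k using that x xk unfolding F0 sca by simp
    show "(\<Sum>k<F 1 0. val F (F 3 0 + F 4 0 + (i * F 1 0 + k)) * of_nat (F 19 k)) \<le> val F i" if "i < F 3 0" for i
    proof -
      have i: "i < mx" using that by (simp only: F0 sca)
      show ?thesis unfolding valF F0 sca eA[OF i] val[OF ia[OF i]] using xA i by blast
    qed
  qed
  have Yi: "F 20 (l * mu + i) = y l i" if "l < L" "i < mu" for l i
  proof -
    have "l * mu + i < L * mu" using mult_add_less[OF that] .
    moreover have "L * mu \<le> n * n" using p5n by (intro mult_le_mono) auto
    ultimately show ?thesis unfolding arr' using that nN(2) by (simp add: get_map Y_def)
  qed
  have Zi: "F 21 (l * nu + j) = z l j" if "l < L" "j < nu" for l j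
  proof -
    have "l * nu + j < L * nu" using mult_add_less[OF that] .
    moreover have "L * nu \<le> n * n" using p5n by (intro mult_le_mono) auto
    ultimately show ?thesis unfolding arr' using that nN(2) by (simp add: get_map Z_def)
  qed
  have Sl: "F 22 l = s l" if "l < L" for l
    unfolding arr' using that p5n nN by (simp add: get_map S_def)
  have dual: "dual F"
    unfolding dual_def Let_def F0 sca b_def[symmetric] h_def[symmetric]
  proof (intro allI impI)
    fix l assume l: "l < L"
    have Ys: "(\<Sum>i<mu. F 20 (l * mu + i) * g i) = (\<Sum>i<mu. y l i * g i)" for g
      using Yi[OF l] by (intro sum.cong) auto
    have Zs: "(\<Sum>j<nu. F 21 (l * nu + j)) = (\<Sum>j<nu. z l j)"
      using Zi[OF l] by (intro sum.cong) auto
    show "1 \<le> F 22 l \<and>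
       (\<Sum>i<mu. F 20 (l * mu + i) * F0 17 (mx + i)) + R * (\<Sum>j<nu. F 21 (l * nu + j)) \<le> (\<Sum>i<mu. F 20 (l * mu + i) * F0 18 (mx + i)) \<and>
       (\<forall>j<nu. F 22 l * (\<Sum>k<nx. F0 17 (h + ((l * nu + j) * nx + k)) * F0 19 k) +
            (\<Sum>i<mu. F 20 (l * mu + i) * (\<Sum>k<nx. F0 18 (b + ((k * mu + i) * nu + j)) * F0 19 k))
          \<le> F 22 l * (\<Sum>k<nx. F0 18 (h + ((l * nu + j) * nx + k)) * F0 19 k) +
            (\<Sum>i<mu. F 20 (l * mu + i) * (\<Sum>k<nx. F0 17 (b + ((k * mu + i) * nu + j)) * F0 19 k)) + F 21 (l * nu + j))"
      unfolding Ys Zs Sl[OF l] using syz l Zi[OF l] by auto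
  qed
  have cert: "cert (\<lambda>k. get (e k))"
    unfolding F_def[symmetric] cert_def using header token primal dual by (simp add: T')

  have len0: "length (e 0) = Suc n" by (simp add: e_def n_def)
  have len: "length (e k) = N" if "1 \<le> k" "k \<le> 24" for k using that by (simp add: e_def)
  note fr = len0 len F_def nN(1)
  have "frange N header_fml e"
    by (rule frange_header[where e = e and n = n and N = N and F = F, OF fr]) (use p5n Tn PT p0n in \<open>simp_all add: F0 sca p5_def p0_def del: One_nat_def\<close>)
  moreover have "frange N token_fml (e(31 := t # e 31))" if t: "t < T" for t
    by (rule frange_token[where e = e and n = n and N = N and F = F, OF fr]) (use lent[OF t] t Tn nN PT in \<open>simp_all add: F0 sca arr get_map\<close>)
  moreover have "frange N primal_fml e"
    by (rule frange_primal[where e = e and n = n and N = N and F = F, OF fr]) (use p5n Tn T_def in \<open>simp_all only: F0 sca\<close>)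
  moreover have "frange N dual_fml e"
    by (rule frange_dual[where e = e and n = n and N = N and F = F, OF fr]) (use p5n Tn T_def nN in \<open>simp_all only: F0 sca\<close>)
  moreover have "get (e 9) 0 = T" using T' unfolding F_def .
  ultimately have frange: "frange N cert_fml e"
    using Tn nN by (simp add: cert_fml_def len)
  have bnd: "\<forall>g\<in>set f. \<forall>i. g i < 2 ^ G"
  proof -
    have le: "v < 2 ^ G" if "v \<le> B" for v :: nat using that BG by simp
    have le2: "v < 2 ^ G" if "v \<le> 2 ^ n" for v :: nat using that nB by (intro le) simp
    have "v < 2 ^ G" if "v \<le> n" for v :: nat using that nB by (intro le) simp
    moreover have "n < G"
    proof -
      have "(2::nat) ^ n < 2 ^ G" using nB(1) BG by (rule le_less_trans)
      then show ?thesis by simp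
    qed
    moreover have "PW i < 2 ^ G" "NU i < 2 ^ G" "DE i < 2 ^ G" "U i < 2 ^ G" "V i < 2 ^ G" for i
      using nd[of i] UV0[of i] \<open>n < G\<close>
      by (auto simp: PW_def NU_def DE_def U_def V_def intro!: le2)
    moreover have "Y i < 2 ^ G" for i
    proof (cases "i < L * mu")
      case True
      then have "i div mu < L" by (simp add: less_mult_imp_div_less)
      moreover have "i mod mu < mu" using True by (cases "mu = 0") auto
      ultimately have "Y i \<le> K" using syz True by (simp add: Y_def)
      then show ?thesis using KG by simp
    qed (simp add: Y_def)
    moreover have "Z i < 2 ^ G" for i
    proof (cases "i < L * nu")
      case True
      then have "i div nu < L" by (simp add: less_mult_imp_div_less)
      moreover have "i mod nu < nu" using True by (cases "nu = 0") auto
      ultimately have "Z i \<le> K" using syz True by (simp add: Z_def)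
      then show ?thesis using KG by simp
    qed (simp add: Z_def)
    moreover have "S i < 2 ^ G" for i
      using syz KG by (cases "i < L") (auto simp: S_def intro: le_less_trans)
    ultimately show ?thesis
      unfolding f_def using p5n Tn Pn LAn le[OF DB] le2[OF Rn] le arrB le2 by simp
  qed
  have "\<forall>k. \<forall>v\<in>set (e k). v < 2 ^ G"
  proof (intro allI ballI)
    fix k v assume v: "v \<in> set (e k)"
    consider "k = 0" | "1 \<le> k" "k \<le> 24" | "24 < k" by linarith
    then show "v < 2 ^ G"
    proof cases
      case 1
      then have "v \<le> B" using v nB by (auto simp: e_def)
      then show ?thesis using BG by simp
    next
      case 2
      then have "f ! k \<in> set f" by (intro nth_mem) (simp add: f_def)
      then show ?thesis using v 2 bnd by (auto simp: e_def)
    qed (use v in \<open>simp add: e_def\<close>)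
  qed
  moreover have "\<forall>k. length (e k) \<le> N" using nN by (simp add: e_def n_def)
  moreover have "e 0 = map of_bool w @ [2]" "\<forall>k>24. e k = []" by (simp_all add: e_def)
  ultimately show ?thesis using cert frange unfolding N_def G_def by blast
qed

theorem theorem6:
  shows "Bounded_Static \<in> NP"
proof (rule NP_of_formula[where m = 24 and f = cert_fml and q = "[:4, 1:] ^ 3 * of_nat (fexp cert_fml)"])
  fix w e assume "e 0 = map of_bool w @ [2]" "fsat cert_fml e"
  then show "w \<in> Bounded_Static"
    using cert_sound[of "\<lambda>k. get (e k)" w] by (simp add: fsat_cert)
next
  fix w assume "w \<in> Bounded_Static"
  then obtain e where e: "e 0 = map of_bool w @ [2]" "\<forall>k>24. e k = []" "\<forall>k. length (e k) \<le> (length w + 4)^2"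
    "\<forall>k. \<forall>v\<in>set (e k). v < 2 ^ (length w + 4) ^ 3" "cert (\<lambda>k. get (e k))" "frange ((length w + 4)^2) cert_fml e"
    using cert_complete[of w] by blast
  \<comment> \<open>Array entries have at most \<open>(n + 4) ^ 3\<close> bits, and evaluating a
    term multiplies the bit length by at most its \<open>texp\<close>. The factor
    \<open>fexp cert_fml\<close> therefore accommodates all intermediate values.\<close>
  let ?n = "length w" let ?Y = "(?n + 4) ^ 3 * fexp cert_fml"
  have q: "poly ([:4, 1:] ^ 3 * of_nat (fexp cert_fml)) ?n = ?Y" by (simp add: add.commute of_nat_poly)
  have G: "1 \<le> (?n + 4) ^ 3" "(?n + 4)^2 \<le> (?n + 4) ^ 3" by (auto intro: power_increasing)
  have N: "(?n + 4)^2 \<le> 2 ^ (?n + 4) ^ 3" using G(2) less_exp[of "(?n + 4) ^ 3"] by linarith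
  have GY: "(?n + 4) ^ 3 \<le> ?Y" using fexp_pos[of cert_fml] by simp
  have "fok ?Y cert_fml e"
    by (rule fok_of_frange[OF G(1) N]) (use e order_trans[OF G(2) GY] in \<open>auto simp: fsat_cert\<close>)
  moreover have "length (e k) \<le> ?Y" for k using e(3) G(2) GY order_trans by meson
  moreover have "v < 2 ^ ?Y" if "v \<in> set (e k)" for v k
    using e(4) that power_increasing[OF GY, of "2::nat"] order_less_le_trans one_le_numeral by blast
  ultimately show "\<exists>e. e 0 = map of_bool w @ [2] \<and> (\<forall>k>24. e k = []) \<and>
      (\<forall>k. length (e k) \<le> poly ([:4, 1:] ^ 3 * of_nat (fexp cert_fml)) ?n \<and>
        (\<forall>v\<in>set (e k). v < 2 ^ poly ([:4, 1:] ^ 3 * of_nat (fexp cert_fml)) ?n)) \<and>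
      fok (poly ([:4, 1:] ^ 3 * of_nat (fexp cert_fml)) ?n) cert_fml e"
    unfolding q using e(1,2) by blast
next
  fix n
  have "2 * 1 \<le> (n + 4) ^ 3 * fexp cert_fml"
    using fexp_pos[of cert_fml] self_le_power[of "n + 4" 3] by (intro mult_le_mono) auto
  then show "2 \<le> poly ([:4, 1:] ^ 3 * of_nat (fexp cert_fml)) n" by (simp add: add.commute mult.commute of_nat_poly)
qed

end
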